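(* Let $\mathbb F=\langle a,b\rangle$ be the free group of rank $2$. There exists an ergodic essentially free probability-measure-preserving action $\mathbb F\curvearrowright^T(X,\mu)$ such that: (1) $h_{\Sigma,\mu}(T)=f_\mu(T)=h^{\mathrm{Rok}}(T)=0$ for every sofic approximation $\Sigma$ to $\mathbb F$; (2) $\mathbb F\curvearrowright^T(X,\mu)$ admits a $2$-to-$1$ factor map onto a Bernoulli shift over $\mathbb F$; (3) moreover, the action is algebraic (that is, $X$ is a compact metrizable group, $\mu$ is its Haar probability measure and $\mathbb F$ acts by continuous group automorphisms) and the factor map in (2) is a continuous group homomorphism.
   Context: All probability spaces are standard; null sets are ignored. An action of $\Gamma$ is written $T=(T^g)_{g\in\Gamma}$. It is essentially free if a.e. point has trivial stabilizer. A factor map from $\Gamma\curvearrowright(X,\mu)$ to $\Gamma\curvearrowright(Y,\nu)$ is a measurable a.e.-equivariant map $\Phi:X\to Y$ with $\Phi_*\mu=\nu$; it is $2$-to-$1$ if a.e. fiber has exactly two points. The Bernoulli shift over $\Gamma$ with base a nontrivial (not a point mass) probability space $(K,\kappa)$ is the action of $\Gamma$ on $(K^\Gamma,\kappa^\Gamma)$ by $(gx)_h=x_{g^{-1}h}$. Sofic approximation: a sequence $\Sigma=\{\sigma_i:\Gamma\to\mathrm{Sym}(V_i)\}$ of maps, $V_i$ finite sets, $|V_i|\to\infty$, such that for all $g,h\in\Gamma$, $|V_i|^{-1}\#\{p\in V_i:\sigma_i(g)\sigma_i(h)p=\sigma_i(gh)p\}\to1$, and for all $g\ne e$, $|V_i|^{-1}\#\{p\in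 V_i:\sigma_i(g)p=p\}\to0$. Measure sofic entropy: suppose $\Gamma$ acts by homeomorphisms $T^g$ on a compact metrizable space $X$ preserving a Borel probability measure $\mu$. Let $\rho$ be a continuous generating pseudometric on $X$ (generating: for $x\neq y$ there is $g$ with $\rho(T^gx,T^gy)>0$). For a finite set $V$ and $x,y\in X^V$ let $\rho_\infty(x,y)=\max_v\rho(x_v,y_v)$ and $\rho_2(x,y)=(|V|^{-1}\sum_v\rho(x_v,y_v)^2)^{1/2}$. For $F\subset\Gamma$ finite, $\delta>0$, a weak* open neighborhood $O$ of $\mu$ in $\mathrm{Prob}(X)$, and $\sigma:\Gamma\to\mathrm{Sym}(V)$, let $\mathrm{Map}(T,\rho,O,F,\delta,\sigma)$ be the set of $x\in X^V$ with $\rho_2(T^fx,x\circ\sigma(f))<\delta$ for all $f\in F$ (where $(T^fx)_v=T^fx_v$ and $(x\circ\sigma(f))_v=x_{\sigma(f)v}$) and $|V|^{-1}\sum_v\delta_{x_v}\in O$. Let $N_\epsilon(S,\rho_\infty)$ be the maximum cardinality of a subset of $S$ whose distinct points are at $\rho_\infty$-distance $\ge\epsilon$. Then $h_{\Sigma,\mu}(T)=\sup_{\epsilon>0}\inf_O\inf_F\inf_{\delta>0}\limsup_i|V_i|^{-1}\log N_\epsilon(\mathrm{Map}(T,\rho,O,F,\delta,\sigma_i),\rho_\infty)$, with $\log0=-\infty$. This is independent of $\rho$ and of the compact topological model chosen for a given pmp action. A countable measurable partition $\mathcal P$ is generating if the smallest $\Gamma$-invariant sigma-algebra containing it is the full Borel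 sigma-algebra modulo null sets. Shannon entropy: $H_\mu(\mathcal P)=-\sum_{P\in\mathcal P}\mu(P)\log\mu(P)$. Rokhlin entropy of an ergodic action: $h^{\mathrm{Rok}}(T)=\inf H_\mu(\mathcal P)$ over generating partitions $\mathcal P$. $f$-invariant: for $\Gamma$ free with free generating set $S$ (here $S=\{a,b\}$) and $\mathcal P$ a generating partition of finite Shannon entropy, $f_\mu(T)=\inf_{W}F_\mu(T,\mathcal P^W)$ over nonempty finite $W\subset\Gamma$, where $\mathcal P^W=\bigvee_{w\in W}(T^w)^{-1}\mathcal P$ and $F_\mu(T,\mathcal P)=H_\mu(\mathcal P)+\sum_{s\in S}(H_\mu(\mathcal P\vee T^s\mathcal P)-2H_\mu(\mathcal P))$; this does not depend on the choice of $\mathcal P$. *)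

theory Defs
  imports
    "HOL-Probability.Probability"
    "HOL-Algebra.Group_Action"
    "HOL-Algebra.Product_Groups"
    "HOL-Combinatorics.Permutations"
begin

section \<open>Free groups\<close>

text \<open>The letter \<open>(s, True)\<close> stands for the generator \<open>s\<close> and \<open>(s, False)\<close> for its inverse;
  the elements of the free group are the reduced words.\<close>

definition inv_letter :: "'a \<times> bool \<Rightarrow> 'a \<times> bool" where
  "inv_letter l = (fst l, \<not> snd l)"

fun reduced_word :: "('a \<times> bool) list \<Rightarrow> bool" where
  "reduced_word [] \<longleftrightarrow> True"
| "reduced_word [l] \<longleftrightarrow> True"
| "reduced_word (l # m # w) \<longleftrightarrow> m \<noteq> inv_letter l \<and> reduced_word (m # w)"

text \<open>Left multiplication of a reduced word by a single letter, with cancellation.\<close>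

fun push :: "'a \<times> bool \<Rightarrow> ('a \<times> bool) list \<Rightarrow> ('a \<times> bool) list" where
  "push l [] = [l]"
| "push l (m # w) = (if m = inv_letter l then w else l # m # w)"

definition free_group :: "'a set \<Rightarrow> ('a \<times> bool) list monoid" where
  "free_group S =
     \<lparr>carrier = {w. reduced_word w \<and> fst ` set w \<subseteq> S}, mult = (\<lambda>u v. foldr push u v), one = []\<rparr>"

definition free_gens :: "'a set \<Rightarrow> ('a \<times> bool) list set" where
  "free_gens S = (\<lambda>s. [(s, True)]) ` S"

datatype ab = gen_a | gen_b

abbreviation F2 :: "(ab \<times> bool) list monoid" where
  "F2 \<equiv> free_group {gen_a, gen_b}"

lemma inv_letter_inv_letter [simp]: "inv_letter (inv_letter l) = l"
  and inv_letter_neq [simp]: "inv_letter l \<noteq> l" "l \<noteq> inv_letter l"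
  and fst_inv_letter [simp]: "fst (inv_letter l) = fst l"
  by (cases l; simp add: inv_letter_def)+

lemma reduced_tl: "reduced_word (l # w) \<Longrightarrow> reduced_word w"
  by (cases w) auto

lemma reduced_push: "reduced_word w \<Longrightarrow> reduced_word (push l w)"
  by (cases w) (auto dest: reduced_tl)

lemma push_inverse: "reduced_word w \<Longrightarrow> push (inv_letter l) (push l w) = w"
proof (cases w)
  case (Cons m v)
  assume "reduced_word w"
  then show ?thesis using Cons by (cases v) auto
qed auto

lemma push_inverse': "reduced_word w \<Longrightarrow> push l (push (inv_letter l) w) = w"
  using push_inverse[of w "inv_letter l"] by simp

lemma set_push: "fst ` set (push l w) \<subseteq> insert (fst l) (fst ` set w)"
  by (cases w) auto

lemma reduced_foldr_push: "reduced_word w \<Longrightarrow> reduced_word (foldr push u w)"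
  by (induction u) (auto intro: reduced_push)

lemma set_foldr_push: "fst ` set (foldr push u w) \<subseteq> fst ` set u \<union> fst ` set w"
proof (induction u)
  case (Cons l u)
  have "fst ` set (foldr push (l # u) w) \<subseteq> insert (fst l) (fst ` set (foldr push u w))"
    using set_push[of l "foldr push u w"] by simp
  also have "\<dots> \<subseteq> insert (fst l) (fst ` set u \<union> fst ` set w)"
    using Cons.IH by blast
  finally show ?case by simp
qed auto

lemma foldr_push_push:
  "reduced_word w \<Longrightarrow> foldr push (push l v) w = push l (foldr push v w)"
  by (cases v) (auto simp: push_inverse' reduced_foldr_push)

lemma foldr_push_assoc:
  "reduced_word w \<Longrightarrow> foldr push (foldr push u v) w = foldr push u (foldr push v w)"
  by (induction u) (auto simp: foldr_push_push)

lemma foldr_push_Nil: "reduced_word u \<Longrightarrow> foldr push u [] = u"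
proof (induction u)
  case (Cons l u)
  then show ?case by (cases u) auto
qed auto

lemma foldr_push_inverse:
  "reduced_word w \<Longrightarrow> foldr push (map inv_letter (rev u)) (foldr push u w) = w"
  by (induction u arbitrary: w) (auto simp: push_inverse reduced_foldr_push)

lemma group_free_group: "group (free_group S)"
proof (rule groupI)
  fix u v assume "u \<in> carrier (free_group S)" "v \<in> carrier (free_group S)"
  then show "u \<otimes>\<^bsub>free_group S\<^esub> v \<in> carrier (free_group S)"
    using subset_trans[OF set_foldr_push[of u v]] reduced_foldr_push[of v u]
    by (simp add: free_group_def)
next
  fix u assume u: "u \<in> carrier (free_group S)"
  define v where "v = foldr push (map inv_letter (rev u)) []"
  have "fst ` set v \<subseteq> S"
    using subset_trans[OF set_foldr_push[of "map inv_letter (rev u)" "[]"]] u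
    by (simp add: v_def free_group_def image_image)
  then have "v \<in> carrier (free_group S)"
    by (auto simp: free_group_def v_def intro: reduced_foldr_push)
  moreover have "v \<otimes>\<^bsub>free_group S\<^esub> u = \<one>\<^bsub>free_group S\<^esub>"
  proof -
    have "foldr push v u = foldr push (map inv_letter (rev u)) (foldr push u [])"
      using u unfolding v_def by (simp add: foldr_push_assoc foldr_push_Nil free_group_def)
    then show ?thesis by (simp add: foldr_push_inverse free_group_def)
  qed
  ultimately show "\<exists>v\<in>carrier (free_group S). v \<otimes>\<^bsub>free_group S\<^esub> u = \<one>\<^bsub>free_group S\<^esub>"
    by blast
qed (auto simp: free_group_def foldr_push_assoc)

lemma free_gens_subset: "free_gens S \<subseteq> carrier (free_group S)"
  by (auto simp: free_gens_def free_group_def)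

lemma inv_free_gen:
  assumes "s \<in> S"
  shows "inv\<^bsub>free_group S\<^esub> [(s, True)] = [(s, False)]"
proof (rule group.inv_equality[OF group_free_group])
qed (use assms in \<open>auto simp: free_group_def inv_letter_def\<close>)

lemma free_group_hom_unique:
  assumes H: "group H" and h: "h \<in> hom (free_group S) H" and k: "k \<in> hom (free_group S) H"
    and eq: "\<And>x. x \<in> free_gens S \<Longrightarrow> h x = k x" and w: "w \<in> carrier (free_group S)"
  shows "h w = k w"
proof -
  interpret h: group_hom "free_group S" H h
    using H h group_free_group by (simp add: group_hom_def group_hom_axioms_def)
  interpret k: group_hom "free_group S" H k
    using H k group_free_group by (simp add: group_hom_def group_hom_axioms_def)
  have letter: "h [l] = k [l]" if l: "fst l \<in> S" for l
  proof -
    obtain s b where sb: "l = (s, b)" by (cases l)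
    have pos: "[(s, True)] \<in> free_gens S" using l sb by (auto simp: free_gens_def)
    then have "[(s, True)] \<in> carrier (free_group S)" using free_gens_subset by blast
    then have "h [(s, False)] = k [(s, False)]"
      using h.hom_inv k.hom_inv eq[OF pos] inv_free_gen[of s S] l sb by (metis fst_conv)
    then show ?thesis using eq[OF pos] sb by (cases b) auto
  qed
  show ?thesis using w
  proof (induction w)
    case Nil
    then show ?case using h.hom_one k.hom_one by (simp add: free_group_def)
  next
    case (Cons l w)
    have w: "w \<in> carrier (free_group S)" and l: "fst l \<in> S" "[l] \<in> carrier (free_group S)"
      using Cons.prems by (auto simp: free_group_def dest: reduced_tl)
    have "l # w = [l] \<otimes>\<^bsub>free_group S\<^esub> w"
      using Cons.prems by (cases w) (auto simp: free_group_def)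
    then show ?case using h.hom_mult[OF l(2) w] k.hom_mult[OF l(2) w] letter[OF l(1)] Cons.IH[OF w]
      by metis
  qed
qed

lemma free_group_hom_exists:
  fixes f :: "'a \<Rightarrow> 'h"
  assumes "group H" and f: "\<And>s. s \<in> S \<Longrightarrow> f s \<in> carrier H"
  shows "\<exists>h\<in>hom (free_group S) H. \<forall>s\<in>S. h [(s, True)] = f s"
proof -
  interpret H: group H by fact
  define e where "e l = (if snd l then f (fst l) else inv\<^bsub>H\<^esub> (f (fst l)))" for l :: "'a \<times> bool"
  define h where "h w = foldr (\<lambda>l x. e l \<otimes>\<^bsub>H\<^esub> x) w \<one>\<^bsub>H\<^esub>" for w
  have e: "e l \<in> carrier H" if "fst l \<in> S" for l
    using f[OF that] by (auto simp: e_def)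
  have h: "h w \<in> carrier H" if "fst ` set w \<subseteq> S" for w
    using that by (induction w) (auto simp: h_def intro!: H.m_closed e)
  have e_inv: "e l \<otimes>\<^bsub>H\<^esub> (e (inv_letter l) \<otimes>\<^bsub>H\<^esub> x) = x"
    if "fst l \<in> S" "x \<in> carrier H" for l x
  proof -
    have "e l \<otimes>\<^bsub>H\<^esub> e (inv_letter l) = \<one>\<^bsub>H\<^esub>"
      using f[OF that(1)] by (simp add: e_def inv_letter_def)
    then show ?thesis
      using H.m_assoc[of "e l" "e (inv_letter l)" x] e[of l] e[of "inv_letter l"] that by simp
  qed
  have h_push: "h (push l w) = e l \<otimes>\<^bsub>H\<^esub> h w" if "fst l \<in> S" "fst ` set w \<subseteq> S" for l w
  proof (cases w)
    case (Cons m v)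
    then show ?thesis using that e_inv[of l "h v"] h[of v] by (auto simp: h_def)
  qed (simp add: h_def)
  have h_mult: "h (foldr push u v) = h u \<otimes>\<^bsub>H\<^esub> h v"
    if "fst ` set u \<subseteq> S" "fst ` set v \<subseteq> S" for u v
    using that(1)
  proof (induction u)
    case Nil
    then show ?case using h[OF that(2)] by (simp add: h_def)
  next
    case (Cons l u)
    have "fst ` set (foldr push u v) \<subseteq> S"
      using subset_trans[OF set_foldr_push[of u v]] Cons.prems that(2) by simp
    then have "h (foldr push (l # u) v) = e l \<otimes>\<^bsub>H\<^esub> (h u \<otimes>\<^bsub>H\<^esub> h v)"
      using h_push[of l "foldr push u v"] Cons by simp
    also have "\<dots> = h (l # u) \<otimes>\<^bsub>H\<^esub> h v"
      using Cons.prems h[of u] h[OF that(2)] e[of l] by (simp add: h_def H.m_assoc)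
    finally show ?case .
  qed
  have "h \<in> hom (free_group S) H"
    by (auto simp: hom_def free_group_def intro!: h h_mult)
  moreover have "\<forall>s\<in>S. h [(s, True)] = f s"
    using f by (auto simp: h_def e_def)
  ultimately show ?thesis by blast
qed


section \<open>Compact metrizable groups and Haar measure\<close>

definition borel_of :: "'x topology \<Rightarrow> 'x measure" where
  "borel_of \<tau> = sigma (topspace \<tau>) {U. openin \<tau> U}"

definition compact_metrizable_group :: "('x, 'm) monoid_scheme \<Rightarrow> 'x topology \<Rightarrow> bool" where
  "compact_metrizable_group X \<tau> \<longleftrightarrow>
     group X \<and> topspace \<tau> = carrier X \<and> compact_space \<tau> \<and> metrizable_space \<tau> \<and>
     continuous_map (prod_topology \<tau> \<tau>) \<tau> (\<lambda>(x, y). x \<otimes>\<^bsub>X\<^esub> y) \<and>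
     continuous_map \<tau> \<tau> (\<lambda>x. inv\<^bsub>X\<^esub> x)"

text \<open>Finite Borel measures on a compact metrizable space are regular, so that left invariance
  characterizes the Haar probability measure.\<close>

definition haar_prob :: "('x, 'm) monoid_scheme \<Rightarrow> 'x topology \<Rightarrow> 'x measure \<Rightarrow> bool" where
  "haar_prob X \<tau> \<mu> \<longleftrightarrow>
     prob_space \<mu> \<and> sets \<mu> = sets (borel_of \<tau>) \<and>
     (\<forall>g\<in>carrier X. \<forall>A\<in>sets \<mu>. emeasure \<mu> ((\<lambda>x. g \<otimes>\<^bsub>X\<^esub> x) ` A) = emeasure \<mu> A)"


section \<open>Probability-measure-preserving actions\<close>

definition pmp_action ::
  "('g, 'm) monoid_scheme \<Rightarrow> 'x measure \<Rightarrow> ('g \<Rightarrow> 'x \<Rightarrow> 'x) \<Rightarrow> bool" where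
  "pmp_action G M T \<longleftrightarrow>
     prob_space M \<and> group_action G (space M) T \<and>
     (\<forall>g\<in>carrier G. T g \<in> measurable M M \<and> distr M M (T g) = M)"

definition ergodic_action ::
  "('g, 'm) monoid_scheme \<Rightarrow> 'x measure \<Rightarrow> ('g \<Rightarrow> 'x \<Rightarrow> 'x) \<Rightarrow> bool" where
  "ergodic_action G M T \<longleftrightarrow>
     (\<forall>A\<in>sets M. (\<forall>g\<in>carrier G. AE x in M. T g x \<in> A \<longleftrightarrow> x \<in> A) \<longrightarrow>
        measure M A = 0 \<or> measure M A = 1)"

definition essentially_free ::
  "('g, 'm) monoid_scheme \<Rightarrow> 'x measure \<Rightarrow> ('g \<Rightarrow> 'x \<Rightarrow> 'x) \<Rightarrow> bool" where
  "essentially_free G M T \<longleftrightarrow> (AE x in M. \<forall>g\<in>carrier G. T g x = x \<longrightarrow> g = \<one>\<^bsub>G\<^esub>)"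

definition algebraic_action ::
  "('g, 'm) monoid_scheme \<Rightarrow> ('x, 'n) monoid_scheme \<Rightarrow> 'x topology \<Rightarrow> 'x measure \<Rightarrow>
     ('g \<Rightarrow> 'x \<Rightarrow> 'x) \<Rightarrow> bool" where
  "algebraic_action G X \<tau> \<mu> T \<longleftrightarrow>
     compact_metrizable_group X \<tau> \<and> haar_prob X \<tau> \<mu> \<and> group_action G (carrier X) T \<and>
     (\<forall>g\<in>carrier G. T g \<in> iso X X \<and> homeomorphic_map \<tau> \<tau> (T g))"

definition factor_map ::
  "('g, 'm) monoid_scheme \<Rightarrow> 'x measure \<Rightarrow> ('g \<Rightarrow> 'x \<Rightarrow> 'x) \<Rightarrow>
     'y measure \<Rightarrow> ('g \<Rightarrow> 'y \<Rightarrow> 'y) \<Rightarrow> ('x \<Rightarrow> 'y) \<Rightarrow> bool" where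
  "factor_map G M T N S \<Phi> \<longleftrightarrow>
     \<Phi> \<in> measurable M N \<and> distr M N \<Phi> = N \<and>
     (\<forall>g\<in>carrier G. AE x in M. \<Phi> (T g x) = S g (\<Phi> x))"

definition two_to_one :: "'x measure \<Rightarrow> 'y measure \<Rightarrow> ('x \<Rightarrow> 'y) \<Rightarrow> bool" where
  "two_to_one M N \<Phi> \<longleftrightarrow> (AE y in N. card {x \<in> space M. \<Phi> x = y} = 2)"

definition nontrivial_base :: "'k measure \<Rightarrow> bool" where
  "nontrivial_base \<kappa> \<longleftrightarrow> prob_space \<kappa> \<and> \<not> (\<exists>k\<in>space \<kappa>. AE x in \<kappa>. x = k)"

definition bernoulli_measure :: "('g, 'm) monoid_scheme \<Rightarrow> 'k measure \<Rightarrow> ('g \<Rightarrow> 'k) measure" where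
  "bernoulli_measure G \<kappa> = PiM (carrier G) (\<lambda>_. \<kappa>)"

definition bernoulli_shift ::
  "('g, 'm) monoid_scheme \<Rightarrow> 'k measure \<Rightarrow> 'g \<Rightarrow> ('g \<Rightarrow> 'k) \<Rightarrow> ('g \<Rightarrow> 'k)" where
  "bernoulli_shift G \<kappa> g =
     (\<lambda>x\<in>space (bernoulli_measure G \<kappa>). \<lambda>h\<in>carrier G. x (inv\<^bsub>G\<^esub> g \<otimes>\<^bsub>G\<^esub> h))"


section \<open>Sofic entropy\<close>

text \<open>The finite sets are taken inside \<open>nat\<close>, which loses nothing up to relabelling.\<close>

definition sofic_approximation ::
  "('g, 'm) monoid_scheme \<Rightarrow> (nat \<Rightarrow> nat set) \<Rightarrow> (nat \<Rightarrow> 'g \<Rightarrow> nat \<Rightarrow> nat) \<Rightarrow> bool" where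
  "sofic_approximation G V \<sigma> \<longleftrightarrow>
     (\<forall>i. finite (V i)) \<and> filterlim (\<lambda>i. card (V i)) at_top sequentially \<and>
     (\<forall>i. \<forall>g\<in>carrier G. \<sigma> i g permutes V i) \<and>
     (\<forall>g\<in>carrier G. \<forall>h\<in>carrier G.
        (\<lambda>i. real (card {p \<in> V i. \<sigma> i g (\<sigma> i h p) = \<sigma> i (g \<otimes>\<^bsub>G\<^esub> h) p}) / real (card (V i)))
          \<longlonglongrightarrow> 1) \<and>
     (\<forall>g\<in>carrier G. g \<noteq> \<one>\<^bsub>G\<^esub> \<longrightarrow>
        (\<lambda>i. real (card {p \<in> V i. \<sigma> i g p = p}) / real (card (V i))) \<longlonglongrightarrow> 0)"

definition generating_pseudometric ::
  "('g, 'm) monoid_scheme \<Rightarrow> 'x topology \<Rightarrow> ('g \<Rightarrow> 'x \<Rightarrow> 'x) \<Rightarrow> ('x \<Rightarrow> 'x \<Rightarrow> real) \<Rightarrow> bool" where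
  "generating_pseudometric G \<tau> T \<rho> \<longleftrightarrow>
     (\<forall>x\<in>topspace \<tau>. \<rho> x x = 0) \<and>
     (\<forall>x\<in>topspace \<tau>. \<forall>y\<in>topspace \<tau>. 0 \<le> \<rho> x y \<and> \<rho> x y = \<rho> y x) \<and>
     (\<forall>x\<in>topspace \<tau>. \<forall>y\<in>topspace \<tau>. \<forall>z\<in>topspace \<tau>. \<rho> x z \<le> \<rho> x y + \<rho> y z) \<and>
     continuous_map (prod_topology \<tau> \<tau>) euclideanreal (\<lambda>(x, y). \<rho> x y) \<and>
     (\<forall>x\<in>topspace \<tau>. \<forall>y\<in>topspace \<tau>. x \<noteq> y \<longrightarrow> (\<exists>g\<in>carrier G. \<rho> (T g x) (T g y) > 0))"

definition rho_inf :: "('x \<Rightarrow> 'x \<Rightarrow> real) \<Rightarrow> 'v set \<Rightarrow> ('v \<Rightarrow> 'x) \<Rightarrow> ('v \<Rightarrow> 'x) \<Rightarrow> real" where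
  "rho_inf \<rho> V x y = (MAX v\<in>V. \<rho> (x v) (y v))"

definition rho_2 :: "('x \<Rightarrow> 'x \<Rightarrow> real) \<Rightarrow> 'v set \<Rightarrow> ('v \<Rightarrow> 'x) \<Rightarrow> ('v \<Rightarrow> 'x) \<Rightarrow> real" where
  "rho_2 \<rho> V x y = sqrt ((\<Sum>v\<in>V. (\<rho> (x v) (y v))\<^sup>2) / real (card V))"

definition prob_measures :: "'x topology \<Rightarrow> 'x measure set" where
  "prob_measures \<tau> = {\<nu>. prob_space \<nu> \<and> sets \<nu> = sets (borel_of \<tau>)}"

definition weak_star :: "'x topology \<Rightarrow> 'x measure topology" where
  "weak_star \<tau> = topology_generated_by
     {{\<nu> \<in> prob_measures \<tau>. integral\<^sup>L \<nu> f \<in> U} |f U. continuous_map \<tau> euclideanreal f \<and> open U}"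

text \<open>\<open>|V|\<^sup>-\<^sup>1 \<Sum>\<^sub>v \<delta>\<^bsub>x v\<^esub>\<close>, as the image of the uniform measure on \<open>V\<close>.\<close>

definition empirical_measure :: "'x topology \<Rightarrow> 'v set \<Rightarrow> ('v \<Rightarrow> 'x) \<Rightarrow> 'x measure" where
  "empirical_measure \<tau> V x = distr (uniform_count_measure V) (borel_of \<tau>) x"

definition sofic_maps ::
  "'x topology \<Rightarrow> ('g \<Rightarrow> 'x \<Rightarrow> 'x) \<Rightarrow> ('x \<Rightarrow> 'x \<Rightarrow> real) \<Rightarrow> 'x measure set \<Rightarrow> 'g set \<Rightarrow> real \<Rightarrow>
     'v set \<Rightarrow> ('g \<Rightarrow> 'v \<Rightarrow> 'v) \<Rightarrow> ('v \<Rightarrow> 'x) set" where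
  "sofic_maps \<tau> T \<rho> U F \<delta> V \<sigma> =
     {x \<in> V \<rightarrow>\<^sub>E topspace \<tau>.
        (\<forall>f\<in>F. rho_2 \<rho> V (\<lambda>v. T f (x v)) (\<lambda>v. x (\<sigma> f v)) < \<delta>) \<and> empirical_measure \<tau> V x \<in> U}"

definition separation_number :: "real \<Rightarrow> 'y set \<Rightarrow> ('y \<Rightarrow> 'y \<Rightarrow> real) \<Rightarrow> enat" where
  "separation_number \<epsilon> S d =
     (SUP A\<in>{A. A \<subseteq> S \<and> finite A \<and> (\<forall>x\<in>A. \<forall>y\<in>A. x \<noteq> y \<longrightarrow> \<epsilon> \<le> d x y)}. enat (card A))"

definition log_enat :: "enat \<Rightarrow> ereal" where
  "log_enat n = (case n of enat k \<Rightarrow> if k = 0 then -\<infinity> else ereal (ln (real k)) | \<infinity> \<Rightarrow> \<infinity>)"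

text \<open>The value does not depend on the continuous generating pseudometric \<open>\<rho>\<close>.\<close>

definition sofic_entropy ::
  "('g, 'm) monoid_scheme \<Rightarrow> (nat \<Rightarrow> nat set) \<Rightarrow> (nat \<Rightarrow> 'g \<Rightarrow> nat \<Rightarrow> nat) \<Rightarrow>
     'x topology \<Rightarrow> 'x measure \<Rightarrow> ('g \<Rightarrow> 'x \<Rightarrow> 'x) \<Rightarrow> ('x \<Rightarrow> 'x \<Rightarrow> real) \<Rightarrow> ereal" where
  "sofic_entropy G V \<sigma> \<tau> \<mu> T \<rho> =
     (SUP \<epsilon>\<in>{0<..}. INF U\<in>{U. openin (weak_star \<tau>) U \<and> \<mu> \<in> U}.
        INF F\<in>{F. finite F \<and> F \<subseteq> carrier G}. INF \<delta>\<in>{0<..}.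
          limsup (\<lambda>i. log_enat (separation_number \<epsilon> (sofic_maps \<tau> T \<rho> U F \<delta> (V i) (\<sigma> i))
                                   (rho_inf \<rho> (V i))) / ereal (real (card (V i)))))"


section \<open>Partitions, Rokhlin entropy and the f-invariant\<close>

definition measurable_partition :: "'x measure \<Rightarrow> 'x set set \<Rightarrow> bool" where
  "measurable_partition M P \<longleftrightarrow> partition_on (space M) P \<and> countable P \<and> P \<subseteq> sets M"

definition shannon_entropy :: "'x measure \<Rightarrow> 'x set set \<Rightarrow> ennreal" where
  "shannon_entropy M P = (\<Sum>\<^sub>\<infinity>A\<in>P. ennreal (- measure M A * ln (measure M A)))"

definition invariant_sigma_algebra ::
  "('g, 'm) monoid_scheme \<Rightarrow> 'x measure \<Rightarrow> ('g \<Rightarrow> 'x \<Rightarrow> 'x) \<Rightarrow> 'x set set \<Rightarrow> 'x set set" where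
  "invariant_sigma_algebra G M T P =
     \<Inter>{\<A>. sigma_algebra (space M) \<A> \<and> P \<subseteq> \<A> \<and>
         (\<forall>g\<in>carrier G. \<forall>A\<in>\<A>. T g -` A \<inter> space M \<in> \<A>)}"

definition generating_partition ::
  "('g, 'm) monoid_scheme \<Rightarrow> 'x measure \<Rightarrow> ('g \<Rightarrow> 'x \<Rightarrow> 'x) \<Rightarrow> 'x set set \<Rightarrow> bool" where
  "generating_partition G M T P \<longleftrightarrow>
     measurable_partition M P \<and>
     (\<forall>B\<in>sets M. \<exists>A\<in>invariant_sigma_algebra G M T P. AE x in M. x \<in> A \<longleftrightarrow> x \<in> B)"

definition rokhlin_entropy ::
  "('g, 'm) monoid_scheme \<Rightarrow> 'x measure \<Rightarrow> ('g \<Rightarrow> 'x \<Rightarrow> 'x) \<Rightarrow> ennreal" where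
  "rokhlin_entropy G M T = (INF P\<in>{P. generating_partition G M T P}. shannon_entropy M P)"

definition join :: "'x set set \<Rightarrow> 'x set set \<Rightarrow> 'x set set" where
  "join P Q = {A \<inter> B |A B. A \<in> P \<and> B \<in> Q} - {{}}"

text \<open>\<open>\<Or>\<^bsub>w\<in>W\<^esub> (T\<^sup>w)\<^sup>-\<^sup>1 P\<close>: its atoms are determined by a choice of an atom \<open>A w\<close> of \<open>P\<close> for
  each \<open>w\<close>.\<close>

definition refined_partition ::
  "'x measure \<Rightarrow> ('g \<Rightarrow> 'x \<Rightarrow> 'x) \<Rightarrow> 'x set set \<Rightarrow> 'g set \<Rightarrow> 'x set set" where
  "refined_partition M T P W = {{x \<in> space M. \<forall>w\<in>W. T w x \<in> A w} |A. A \<in> W \<rightarrow> P} - {{}}"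

text \<open>For partitions of finite Shannon entropy, the only ones to which this is applied, all terms
  are finite.\<close>

definition F_functional ::
  "'g set \<Rightarrow> 'x measure \<Rightarrow> ('g \<Rightarrow> 'x \<Rightarrow> 'x) \<Rightarrow> 'x set set \<Rightarrow> ereal" where
  "F_functional S M T P =
     enn2ereal (shannon_entropy M P) +
     (\<Sum>s\<in>S. enn2ereal (shannon_entropy M (join P ((`) (T s) ` P)))
             - 2 * enn2ereal (shannon_entropy M P))"

text \<open>For a free group \<open>G\<close> with free generating set \<open>S\<close>, the value is the same for all generating
  partitions \<open>P\<close> of finite Shannon entropy.\<close>

definition f_invariant ::
  "('g, 'm) monoid_scheme \<Rightarrow> 'g set \<Rightarrow> 'x measure \<Rightarrow> ('g \<Rightarrow> 'x \<Rightarrow> 'x) \<Rightarrow> 'x set set \<Rightarrow> ereal" where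
  "f_invariant G S M T P =
     (INF W\<in>{W. finite W \<and> W \<noteq> {} \<and> W \<subseteq> carrier G}. F_functional S M T (refined_partition M T P W))"

end

theory Submission
  imports Defs "HOL-Library.Nat_Bijection" "HOL-Real_Asymp.Real_Asymp"
begin

text \<open>The action is the generalized Bernoulli shift of the free group on \<open>(\<int>/2)\<^sup>J\<close>, where \<open>J\<close> is the set of cosets
  of the subgroup generated by \<open>b\<close>, and the factor map sends \<open>x\<close> to \<open>h \<mapsto> x(h) + x(ha)\<close>. The Schreier
  graph on \<open>J\<close> is a tree with a loop added at the trivial coset, so that a preimage is determined by
  its value at one point, and the fibres have two elements. The root coordinate is invariant under
  \<open>b\<close>: recording it on a small set that meets almost every \<open>b\<close>-orbit gives generating partitions of
  small entropy, and in a sofic approximation it is almost constant along the long \<open>b\<close>-cycles, which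
  leaves few models. Conversely, independent signs on long segments of the \<open>b\<close>-cycles are models, by a
  second moment estimate. For the f-invariant, counting edges and vertices in the tree with a loop
  gives \<open>F = 0\<close> for the root partition and \<open>F \<ge> 0\<close> for its refinements; any other generating partition
  is compared with it through splittings, which do not increase \<open>F\<close>, and approximation in the
  Rokhlin metric.\<close>

subsection \<open>Entropy of labels\<close>

text \<open>The stabilizer of the root coset is infinite, so one bit is shared by an infinite
  \<open>b\<close>-orbit; in the Schreier graph its loop pays for the single vertex by which a
  finite tree outnumbers its edges. The fibres of the factor map are governed by another tree on the
  same cosets, with an edge from the coset of \<open>h\<close> to that of \<open>h a\<close> for
  every group element \<open>h\<close>. Three obstacles shape the proof. The f-invariant is demanded
  for every generating partition of finite entropy, so its independence of the partition is part of
  the work; partitions are replaced by labels, whose joins and translates are plain functions, and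
  infinite ones are truncated. A sofic approximation is only almost an action: identities hold off
  sets of small density, and the segment length \<open>n\<close> is fixed before the index
  \<open>i\<close> grows, since segment ends of density up to \<open>1 / n\<close> may persist.
  Finally, zero rather than minus infinity requires models for every approximation, equidistributed
  on a given window and almost equivariant at once. The image of Haar measure is found by
  invariance: a surjective homomorphism carries it to an invariant probability measure.\<close>

text \<open>A countable partition is encoded by a function to \<open>nat\<close> with these fibres, and its entropy is the mean
  of the information function.\<close>

definition atom_prob :: "'x measure \<Rightarrow> ('x \<Rightarrow> nat) \<Rightarrow> 'x \<Rightarrow> real" where
  "atom_prob M X \<omega> = measure M {\<omega>' \<in> space M. X \<omega>' = X \<omega>}"

definition ent :: "'x measure \<Rightarrow> ('x \<Rightarrow> nat) \<Rightarrow> real" where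
  "ent M X = (\<integral>\<omega>. - ln (atom_prob M X \<omega>) \<partial>M)"

definition fin_ent :: "'x measure \<Rightarrow> ('x \<Rightarrow> nat) \<Rightarrow> bool" where
  "fin_ent M X \<longleftrightarrow> X \<in> measurable M (count_space UNIV) \<and> integrable M (\<lambda>\<omega>. - ln (atom_prob M X \<omega>))"

text \<open>The factorization is required at every point and not almost everywhere, so that it
  survives composition with any self-map of the space (\<open>coarser_comp\<close>).\<close>

definition coarser :: "'x measure \<Rightarrow> ('x \<Rightarrow> nat) \<Rightarrow> ('x \<Rightarrow> nat) \<Rightarrow> bool" where
  "coarser M X Y \<longleftrightarrow> (\<forall>\<omega>\<in>space M. \<forall>\<omega>'\<in>space M. Y \<omega> = Y \<omega>' \<longrightarrow> X \<omega> = X \<omega>')"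

definition pair :: "('x \<Rightarrow> nat) \<Rightarrow> ('x \<Rightarrow> nat) \<Rightarrow> 'x \<Rightarrow> nat" where
  "pair X Y = (\<lambda>\<omega>. prod_encode (X \<omega>, Y \<omega>))"

lemma coarser_refl [simp]: "coarser M X X"
  by (simp add: coarser_def)

lemma coarser_trans: "coarser M X Y \<Longrightarrow> coarser M Y Z \<Longrightarrow> coarser M X Z"
  unfolding coarser_def by metis

lemma coarser_pair1 [simp]: "coarser M X (pair X Y)"
  and coarser_pair2 [simp]: "coarser M Y (pair X Y)"
  by (auto simp: coarser_def pair_def)

lemma coarser_pairI: "coarser M X Z \<Longrightarrow> coarser M Y Z \<Longrightarrow> coarser M (pair X Y) Z"
  unfolding coarser_def pair_def by metis

lemma coarser_comp:
  assumes "coarser M X Y" "\<And>\<omega>. \<omega> \<in> space M \<Longrightarrow> f \<omega> \<in> space M"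
  shows "coarser M (\<lambda>\<omega>. X (f \<omega>)) (\<lambda>\<omega>. Y (f \<omega>))"
  using assms unfolding coarser_def by blast

lemma measurable_pair_label [measurable]:
  assumes [measurable]: "X \<in> measurable M (count_space UNIV)" "Y \<in> measurable M (count_space UNIV)"
  shows "pair X Y \<in> measurable M (count_space UNIV)"
  unfolding pair_def by measurable

context prob_space
begin

lemma label_sets [measurable]:
  "X \<in> measurable M (count_space (UNIV :: nat set)) \<Longrightarrow> {\<omega> \<in> space M. X \<omega> = i} \<in> sets M"
  by measurable

lemma atom_prob_le_1: "atom_prob M X \<omega> \<le> 1"
  by (simp add: atom_prob_def)

lemma atom_prob_nonneg: "0 \<le> atom_prob M X \<omega>"
  by (simp add: atom_prob_def)

text \<open>On a null atom the convention \<open>ln 0 = 0\<close> gives the value zero; otherwise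
  the probability lies in (0, 1].\<close>

lemma info_nonneg: "0 \<le> - ln (atom_prob M X \<omega>)"
  using atom_prob_le_1[of X \<omega>] atom_prob_nonneg[of X \<omega>] by (cases "atom_prob M X \<omega> = 0") auto

lemma atom_prob_measurable [measurable]:
  assumes [measurable]: "X \<in> measurable M (count_space UNIV)"
  shows "atom_prob M X \<in> borel_measurable M"
proof -
  have 1: "(\<lambda>v. measure M {\<omega>' \<in> space M. X \<omega>' = v}) \<in> borel_measurable (count_space UNIV)"
    by (rule borel_measurable_count_space)
  have 2: "atom_prob M X = (\<lambda>\<omega>. (\<lambda>v. measure M {\<omega>' \<in> space M. X \<omega>' = v}) (X \<omega>))"
    by (rule ext) (rule atom_prob_def)
  show ?thesis unfolding 2 by (rule measurable_compose[OF assms 1])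
qed

lemma atom_prob_mono:
  assumes "coarser M X Y" "\<omega> \<in> space M" and [measurable]: "X \<in> measurable M (count_space UNIV)"
  shows "atom_prob M Y \<omega> \<le> atom_prob M X \<omega>"
  unfolding atom_prob_def
proof (rule finite_measure_mono)
  show "{\<omega>' \<in> space M. Y \<omega>' = Y \<omega>} \<subseteq> {\<omega>' \<in> space M. X \<omega>' = X \<omega>}"
    using assms(1,2) unfolding coarser_def by blast
qed measurable

lemma atom_prob_pos:
  assumes [measurable]: "X \<in> measurable M (count_space UNIV)"
  shows "AE \<omega> in M. 0 < atom_prob M X \<omega>"
proof -
  have "AE \<omega> in M. X \<omega> = v \<longrightarrow> 0 < measure M {\<omega>' \<in> space M. X \<omega>' = v}" for v
  proof (cases "measure M {\<omega>' \<in> space M. X \<omega>' = v} = 0")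
    case True
    then have "AE \<omega> in M. \<not> (X \<omega> = v)"
      by (subst AE_iff_measurable[OF _ refl]) (auto simp: emeasure_eq_measure)
    then show ?thesis by eventually_elim auto
  qed (auto simp: less_le)
  then have "AE \<omega> in M. \<forall>v. X \<omega> = v \<longrightarrow> 0 < measure M {\<omega>' \<in> space M. X \<omega>' = v}"
    unfolding AE_all_countable by blast
  then show ?thesis by eventually_elim (auto simp: atom_prob_def)
qed

lemma nn_integral_label:
  assumes [measurable]: "X \<in> measurable M (count_space (UNIV :: nat set))"
  shows "(\<integral>\<^sup>+\<omega>. f (X \<omega>) \<partial>M) =
    (\<integral>\<^sup>+i. f i * emeasure M {\<omega> \<in> space M. X \<omega> = i} \<partial>count_space UNIV)"
proof -
  have "(\<integral>\<^sup>+\<omega>. f (X \<omega>) \<partial>M) = (\<integral>\<^sup>+\<omega>. (\<Sum>i. f i * indicator {\<omega> \<in> space M. X \<omega> = i} \<omega>) \<partial>M)"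
  proof (rule nn_integral_cong)
    fix \<omega> assume w: "\<omega> \<in> space M"
    have "(\<Sum>i. f i * indicator {\<omega> \<in> space M. X \<omega> = i} \<omega>) = (\<Sum>i\<in>{X \<omega>}. f i * indicator {\<omega> \<in> space M. X \<omega> = i} \<omega>)"
      by (rule suminf_finite) auto
    then show "f (X \<omega>) = (\<Sum>i. f i * indicator {\<omega> \<in> space M. X \<omega> = i} \<omega>)"
      using w by simp
  qed
  also have "\<dots> = (\<Sum>i. \<integral>\<^sup>+\<omega>. f i * indicator {\<omega> \<in> space M. X \<omega> = i} \<omega> \<partial>M)"
    by (rule nn_integral_suminf) measurable
  also have "\<dots> = (\<Sum>i. f i * emeasure M {\<omega> \<in> space M. X \<omega> = i})"
    by (intro suminf_cong nn_integral_cmult_indicator) measurable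
  finally show ?thesis by (simp add: nn_integral_count_space_nat)
qed

lemma marginal:
  assumes [measurable]: "X \<in> measurable M (count_space (UNIV :: nat set))" "A \<in> sets M"
  shows "(\<integral>\<^sup>+i. emeasure M {\<omega> \<in> A. X \<omega> = i} \<partial>count_space UNIV) = emeasure M A"
proof -
  have A: "A \<subseteq> space M" using assms(2) sets.sets_into_space by blast
  have "{\<omega> \<in> A. X \<omega> = i} = A \<inter> {\<omega> \<in> space M. X \<omega> = i}" for i
    using A by auto
  then have m: "{\<omega> \<in> A. X \<omega> = i} \<in> sets M" for i by simp
  have "(\<Sum>i. emeasure M {\<omega> \<in> A. X \<omega> = i}) = emeasure M (\<Union>i. {\<omega> \<in> A. X \<omega> = i})"
    by (rule suminf_emeasure) (use m in \<open>auto simp: disjoint_family_on_def\<close>)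
  also have "(\<Union>i. {\<omega> \<in> A. X \<omega> = i}) = A" by auto
  finally show ?thesis by (simp add: nn_integral_count_space_nat)
qed

lemma prod_encode_eqI: "prod_decode w = p \<Longrightarrow> prod_encode p = w"
  by (metis prod_decode_inverse)

text \<open>The ratio is the density of the coupling in which \<open>U\<close> and \<open>V\<close>
  are conditionally independent given \<open>Z\<close>, relative to their true joint law. Integrated
  against the true law it gives the mass of that coupling on the atoms of positive measure, hence at
  most one.\<close>

lemma ratio_integral:
  assumes [measurable]: "U \<in> measurable M (count_space UNIV)" "V \<in> measurable M (count_space UNIV)"
    "Z \<in> measurable M (count_space UNIV)"
    and ZU: "coarser M Z U" and ZV: "coarser M Z V"
  shows "(\<integral>\<^sup>+\<omega>. ennreal (atom_prob M U \<omega> * atom_prob M V \<omega> /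
      (atom_prob M (pair U V) \<omega> * atom_prob M Z \<omega>)) \<partial>M) \<le> 1"
proof -
  \<comment> \<open>\<open>Z\<close> is a function of \<open>U\<close>, yet it is listed in front so
    that the sum over the atoms of \<open>W\<close> becomes an iterated sum over the values of
    \<open>Z\<close>, \<open>V\<close> and \<open>U\<close>, in which the inner sums are
    marginals.\<close>
  define W where "W = pair Z (pair V U)"
  have W[measurable]: "W \<in> measurable M (count_space UNIV)" unfolding W_def by measurable
  define a where "a u z = measure M {\<omega> \<in> space M. U \<omega> = u \<and> Z \<omega> = z}" for u z
  define b where "b v z = measure M {\<omega> \<in> space M. V \<omega> = v \<and> Z \<omega> = z}" for v z
  define c where "c z = measure M {\<omega> \<in> space M. Z \<omega> = z}" for z
  define p where "p w = measure M {\<omega> \<in> space M. W \<omega> = w}" for w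
  define e where "e = (\<lambda>(z, v, u). prod_encode (z, prod_encode (v, u)))"
  have bij: "bij e"
    by (rule o_bij[where g="\<lambda>w. case prod_decode w of (z, t) \<Rightarrow> (z, prod_decode t)"])
       (auto simp: e_def fun_eq_iff prod_encode_eqI split: prod.splits)
  define zz vv uu where "zz w = fst (prod_decode w)" and "vv w = fst (prod_decode (snd (prod_decode w)))"
    and "uu w = snd (prod_decode (snd (prod_decode w)))" for w
  define f where "f w = a (uu w) (zz w) * b (vv w) (zz w) / (p w * c (zz w))" for w
  note f_simps = f_def zz_def vv_def uu_def
  have "(\<integral>\<^sup>+\<omega>. ennreal (atom_prob M U \<omega> * atom_prob M V \<omega> /
      (atom_prob M (pair U V) \<omega> * atom_prob M Z \<omega>)) \<partial>M) = (\<integral>\<^sup>+\<omega>. ennreal (f (W \<omega>)) \<partial>M)"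
  proof (rule nn_integral_cong)
    fix \<omega> assume w: "\<omega> \<in> space M"
    have U: "{\<omega>' \<in> space M. U \<omega>' = U \<omega>} = {\<omega>' \<in> space M. U \<omega>' = U \<omega> \<and> Z \<omega>' = Z \<omega>}"
      using w ZU unfolding coarser_def by blast
    have V: "{\<omega>' \<in> space M. V \<omega>' = V \<omega>} = {\<omega>' \<in> space M. V \<omega>' = V \<omega> \<and> Z \<omega>' = Z \<omega>}"
      using w ZV unfolding coarser_def by blast
    have UV: "{\<omega>' \<in> space M. pair U V \<omega>' = pair U V \<omega>} = {\<omega>' \<in> space M. W \<omega>' = W \<omega>}"
    proof -
      have "pair U V \<omega>' = pair U V \<omega> \<longleftrightarrow> W \<omega>' = W \<omega>" if "\<omega>' \<in> space M" for \<omega>'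
      proof -
        have "U \<omega>' = U \<omega> \<Longrightarrow> Z \<omega>' = Z \<omega>" using ZU w that unfolding coarser_def by blast
        then show ?thesis by (auto simp: W_def pair_def)
      qed
      then show ?thesis by blast
    qed
    have 1: "atom_prob M U \<omega> = a (U \<omega>) (Z \<omega>)" "atom_prob M V \<omega> = b (V \<omega>) (Z \<omega>)"
      unfolding atom_prob_def a_def b_def U[symmetric] V[symmetric] by (rule refl)+
    have 2: "atom_prob M (pair U V) \<omega> = p (W \<omega>)" "atom_prob M Z \<omega> = c (Z \<omega>)"
      by (simp_all only: atom_prob_def p_def c_def UV)
    show "ennreal (atom_prob M U \<omega> * atom_prob M V \<omega> /
      (atom_prob M (pair U V) \<omega> * atom_prob M Z \<omega>)) = ennreal (f (W \<omega>))"
      unfolding 1 2 f_simps by (simp add: W_def pair_def)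
  qed
  also have "\<dots> = (\<integral>\<^sup>+w. ennreal (f w) * emeasure M {\<omega> \<in> space M. W \<omega> = w} \<partial>count_space UNIV)"
    by (rule nn_integral_label) measurable
  also have "\<dots> = (\<integral>\<^sup>+t. ennreal (f (e t)) * emeasure M {\<omega> \<in> space M. W \<omega> = e t} \<partial>count_space UNIV)"
    using bij by (subst nn_integral_bij_count_space[of e UNIV UNIV, symmetric]) (auto simp: bij_def bij_betw_def)
  also have "\<dots> \<le> (\<integral>\<^sup>+t. (case t of (z, v, u) \<Rightarrow> ennreal (a u z) * (ennreal (b v z) * ennreal (1 / c z))) \<partial>count_space UNIV)"
  proof (rule nn_integral_mono)
    fix t :: "nat \<times> nat \<times> nat"
    obtain z v u where t: "t = (z, v, u)" by (cases t)
    have nn: "0 \<le> a u z" "0 \<le> b v z" "0 \<le> c z" "0 \<le> p (e t)"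
      by (auto simp: a_def b_def c_def p_def)
    have "ennreal (f (e t)) * emeasure M {\<omega> \<in> space M. W \<omega> = e t} = ennreal (f (e t) * p (e t))"
      using nn by (subst ennreal_mult) (auto simp: f_simps t e_def p_def emeasure_eq_measure)
    \<comment> \<open>Null atoms of \<open>W\<close> contribute zero on the left; elsewhere the two
      sides agree.\<close>
    also have "\<dots> \<le> ennreal (a u z * (b v z * (1 / c z)))"
    proof (rule ennreal_leI)
      show "f (e t) * p (e t) \<le> a u z * (b v z * (1 / c z))"
        using nn by (cases "p (e t) = 0") (auto simp: f_simps t e_def)
    qed
    also have "\<dots> = ennreal (a u z) * (ennreal (b v z) * ennreal (1 / c z))"
      using nn by (simp add: ennreal_mult[symmetric])
    finally show "ennreal (f (e t)) * emeasure M {\<omega> \<in> space M. W \<omega> = e t} \<le>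
        (case t of (z, v, u) \<Rightarrow> ennreal (a u z) * (ennreal (b v z) * ennreal (1 / c z)))"
      by (simp add: t)
  qed
  also have "\<dots> = (\<integral>\<^sup>+z. \<integral>\<^sup>+v. \<integral>\<^sup>+u. ennreal (a u z) * (ennreal (b v z) * ennreal (1 / c z))
      \<partial>count_space UNIV \<partial>count_space UNIV \<partial>count_space UNIV)"
    by (simp add: nn_integral_fst_count_space[symmetric])
  also have "\<dots> = (\<integral>\<^sup>+z. ennreal (c z) * (ennreal (c z) * ennreal (1 / c z)) \<partial>count_space UNIV)"
  proof (rule nn_integral_cong)
    fix z
    have am: "(\<integral>\<^sup>+u. ennreal (a u z) \<partial>count_space UNIV) = ennreal (c z)"
    proof -
      have "ennreal (a u z) = emeasure M {\<omega> \<in> {\<omega> \<in> space M. Z \<omega> = z}. U \<omega> = u}" for u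
        by (auto simp: a_def emeasure_eq_measure intro!: arg_cong[where f="measure M"])
      then show ?thesis
        using marginal[of U "{\<omega> \<in> space M. Z \<omega> = z}"] by (simp add: c_def emeasure_eq_measure)
    qed
    have bm: "(\<integral>\<^sup>+v. ennreal (b v z) \<partial>count_space UNIV) = ennreal (c z)"
    proof -
      have "ennreal (b v z) = emeasure M {\<omega> \<in> {\<omega> \<in> space M. Z \<omega> = z}. V \<omega> = v}" for v
        by (auto simp: b_def emeasure_eq_measure intro!: arg_cong[where f="measure M"])
      then show ?thesis
        using marginal[of V "{\<omega> \<in> space M. Z \<omega> = z}"] by (simp add: c_def emeasure_eq_measure)
    qed
    show "(\<integral>\<^sup>+v. \<integral>\<^sup>+u. ennreal (a u z) * (ennreal (b v z) * ennreal (1 / c z)) \<partial>count_space UNIV \<partial>count_space UNIV)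
        = ennreal (c z) * (ennreal (c z) * ennreal (1 / c z))"
      by (simp add: nn_integral_multc nn_integral_cmult am bm)
  qed
  also have "\<dots> \<le> (\<integral>\<^sup>+z. ennreal (c z) \<partial>count_space UNIV)"
  proof (rule nn_integral_mono)
    fix z
    show "ennreal (c z) * (ennreal (c z) * ennreal (1 / c z)) \<le> ennreal (c z)"
    proof (cases "c z = 0")
      case False
      then have "0 < c z" by (auto simp: c_def less_le)
      then show ?thesis by (simp add: ennreal_mult[symmetric])
    qed simp
  qed
  also have "\<dots> = 1"
    using marginal[of Z "space M"] by (simp add: c_def emeasure_eq_measure prob_space)
  finally show ?thesis .
qed

lemma fin_ent_label: "fin_ent M X \<Longrightarrow> X \<in> measurable M (count_space UNIV)"
  by (simp add: fin_ent_def)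

lemma ent_mono:
  assumes "coarser M X Y" and X[measurable]: "X \<in> measurable M (count_space UNIV)" and Y: "fin_ent M Y"
  shows "fin_ent M X" "ent M X \<le> ent M Y"
proof -
  note [measurable] = fin_ent_label[OF Y]
  have le: "AE \<omega> in M. - ln (atom_prob M X \<omega>) \<le> - ln (atom_prob M Y \<omega>)"
    using AE_space atom_prob_pos[of Y, OF fin_ent_label[OF Y]]
  proof eventually_elim
    case (elim \<omega>)
    then show ?case using atom_prob_mono[OF assms(1) elim(1) X] by simp
  qed
  have Yi: "integrable M (\<lambda>\<omega>. - ln (atom_prob M Y \<omega>))" using Y by (simp add: fin_ent_def)
  have Xi: "integrable M (\<lambda>\<omega>. - ln (atom_prob M X \<omega>))"
  proof (rule Bochner_Integration.integrable_bound[OF Yi])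
    show "AE \<omega> in M. norm (- ln (atom_prob M X \<omega>)) \<le> norm (- ln (atom_prob M Y \<omega>))"
      using le
    proof eventually_elim
      case (elim \<omega>)
      then show ?case using info_nonneg[of X \<omega>] info_nonneg[of Y \<omega>] by simp
    qed
  qed measurable
  then show "fin_ent M X" by (simp add: fin_ent_def)
  show "ent M X \<le> ent M Y" unfolding ent_def using le by (rule integral_mono_AE[OF Xi Yi])
qed

lemma ent_cong:
  assumes "coarser M X Y" "coarser M Y X" "X \<in> measurable M (count_space UNIV)" "fin_ent M Y"
  shows "ent M X = ent M Y"
proof -
  have "fin_ent M X" using ent_mono assms by blast
  then show ?thesis using ent_mono[OF assms(1,3,4)] ent_mono(2)[OF assms(2) fin_ent_label[OF assms(4)]]
    by simp
qed

lemma ent_nonneg: "0 \<le> ent M X"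
  unfolding ent_def by (intro Bochner_Integration.integral_nonneg info_nonneg)

text \<open>The inequality \<open>ln r \<le> r - 1\<close> is applied to the ratio \<open>r\<close>
  of \<open>ratio_integral\<close>, whose integral is at most one. The same pointwise bound makes
  the information of the pair integrable, which is how finiteness of its entropy is
  obtained.\<close>

lemma ent_submod:
  assumes U: "fin_ent M U" and V: "fin_ent M V" and [measurable]: "Z \<in> measurable M (count_space UNIV)"
    and ZU: "coarser M Z U" and ZV: "coarser M Z V"
  shows "fin_ent M (pair U V)" "ent M (pair U V) + ent M Z \<le> ent M U + ent M V"
proof -
  note [measurable] = fin_ent_label[OF U] fin_ent_label[OF V]
  let ?r = "\<lambda>\<omega>. atom_prob M U \<omega> * atom_prob M V \<omega> / (atom_prob M (pair U V) \<omega> * atom_prob M Z \<omega>)"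
  note r1 = ratio_integral[OF fin_ent_label[OF U] fin_ent_label[OF V] assms(3) ZU ZV]
  have r0: "0 \<le> ?r \<omega>" for \<omega> by (simp add: atom_prob_nonneg)
  have ri: "integrable M ?r"
    by (rule integrableI_nonneg) (use r0 r1 in \<open>auto simp: order.strict_trans1\<close>)
  have rint: "(\<integral>\<omega>. ?r \<omega> \<partial>M) \<le> 1"
  proof -
    have "ennreal (\<integral>\<omega>. ?r \<omega> \<partial>M) \<le> ennreal 1"
      using r1 nn_integral_eq_integral[OF ri] r0 by simp
    then show ?thesis by (subst (asm) ennreal_le_iff) auto
  qed
  have Ui: "integrable M (\<lambda>\<omega>. - ln (atom_prob M U \<omega>))" and Vi: "integrable M (\<lambda>\<omega>. - ln (atom_prob M V \<omega>))"
    using U V by (auto simp: fin_ent_def)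
  have Z: "fin_ent M Z" using ent_mono(1)[OF ZU _ U] by simp
  then have Zi: "integrable M (\<lambda>\<omega>. - ln (atom_prob M Z \<omega>))" by (auto simp: fin_ent_def)
  have le: "AE \<omega> in M. - ln (atom_prob M (pair U V) \<omega>) + - ln (atom_prob M Z \<omega>) \<le>
      - ln (atom_prob M U \<omega>) + - ln (atom_prob M V \<omega>) + (?r \<omega> - 1)"
    using atom_prob_pos[OF fin_ent_label[OF U]] atom_prob_pos[OF fin_ent_label[OF V]]
      atom_prob_pos[OF fin_ent_label[OF Z]] atom_prob_pos[of "pair U V", OF measurable_pair_label[OF fin_ent_label[OF U] fin_ent_label[OF V]]]
  proof eventually_elim
    case (elim \<omega>)
    then have pos: "0 < ?r \<omega>" by simp
    have "ln (?r \<omega>) = ln (atom_prob M U \<omega>) + ln (atom_prob M V \<omega>) - (ln (atom_prob M (pair U V) \<omega>) + ln (atom_prob M Z \<omega>))"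
      using elim by (subst ln_div) (simp_all add: ln_mult)
    then show ?case using ln_le_minus_one[OF pos] by linarith
  qed
  have UVi: "integrable M (\<lambda>\<omega>. - ln (atom_prob M (pair U V) \<omega>))"
  proof (rule Bochner_Integration.integrable_bound)
    show "integrable M (\<lambda>\<omega>. - ln (atom_prob M U \<omega>) + - ln (atom_prob M V \<omega>) + ?r \<omega>)"
      by (intro Bochner_Integration.integrable_add Ui Vi ri)
    show "AE \<omega> in M. norm (- ln (atom_prob M (pair U V) \<omega>)) \<le>
        norm (- ln (atom_prob M U \<omega>) + - ln (atom_prob M V \<omega>) + ?r \<omega>)"
      using le
    proof eventually_elim
      case (elim \<omega>)
      then show ?case using info_nonneg[of "pair U V" \<omega>] info_nonneg[of Z \<omega>] by simp
    qed
  qed measurable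
  then show "fin_ent M (pair U V)" by (simp add: fin_ent_def)
  have "ent M (pair U V) + ent M Z = (\<integral>\<omega>. - ln (atom_prob M (pair U V) \<omega>) + - ln (atom_prob M Z \<omega>) \<partial>M)"
    unfolding ent_def by (rule Bochner_Integration.integral_add[OF UVi Zi, symmetric])
  also have "\<dots> \<le> (\<integral>\<omega>. - ln (atom_prob M U \<omega>) + - ln (atom_prob M V \<omega>) + (?r \<omega> - 1) \<partial>M)"
    by (intro integral_mono_AE le Bochner_Integration.integrable_add Bochner_Integration.integrable_diff UVi Zi Ui Vi ri) simp
  also have "\<dots> = ent M U + ent M V + ((\<integral>\<omega>. ?r \<omega> \<partial>M) - 1)"
  proof -
    have "integrable M (\<lambda>\<omega>. - ln (atom_prob M U \<omega>) + - ln (atom_prob M V \<omega>))"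
      by (intro Bochner_Integration.integrable_add Ui Vi)
    moreover have "integrable M (\<lambda>\<omega>. ?r \<omega> - 1)" by (intro Bochner_Integration.integrable_diff ri) simp
    moreover have "(\<integral>\<omega>. ?r \<omega> - 1 \<partial>M) = (\<integral>\<omega>. ?r \<omega> \<partial>M) - 1"
      using ri by (subst Bochner_Integration.integral_diff) (auto simp: prob_space)
    ultimately show ?thesis unfolding ent_def
      using Bochner_Integration.integral_add[of M "\<lambda>\<omega>. - ln (atom_prob M U \<omega>) + - ln (atom_prob M V \<omega>)" "\<lambda>\<omega>. ?r \<omega> - 1"]
        Bochner_Integration.integral_add[OF Ui Vi] by linarith
  qed
  finally show "ent M (pair U V) + ent M Z \<le> ent M U + ent M V" using rint by linarith
qed

lemma ent_const: "fin_ent M (\<lambda>_. k)" "ent M (\<lambda>_. k) = 0"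
  by (auto simp: fin_ent_def ent_def atom_prob_def prob_space)

lemma ent_pair_le:
  assumes "fin_ent M U" "fin_ent M V"
  shows "fin_ent M (pair U V)" "ent M (pair U V) \<le> ent M U + ent M V"
  using ent_submod[OF assms, of "\<lambda>_. 0"] by (auto simp: coarser_def ent_const)

lemma ent_comp:
  assumes T[measurable]: "T \<in> measurable M M" and d: "distr M M T = M" and X: "fin_ent M X"
  shows "fin_ent M (\<lambda>\<omega>. X (T \<omega>))" "ent M (\<lambda>\<omega>. X (T \<omega>)) = ent M X"
proof -
  note [measurable] = fin_ent_label[OF X]
  have p: "atom_prob M (\<lambda>\<omega>. X (T \<omega>)) \<omega> = atom_prob M X (T \<omega>)" for \<omega>
  proof -
    have "measure M {\<omega>' \<in> space M. X \<omega>' = X (T \<omega>)} = measure (distr M M T) {\<omega>' \<in> space M. X \<omega>' = X (T \<omega>)}"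
      by (simp add: d)
    also have "\<dots> = measure M (T -` {\<omega>' \<in> space M. X \<omega>' = X (T \<omega>)} \<inter> space M)"
      by (rule measure_distr) measurable
    also have "T -` {\<omega>' \<in> space M. X \<omega>' = X (T \<omega>)} \<inter> space M = {\<omega>' \<in> space M. X (T \<omega>') = X (T \<omega>)}"
      using measurable_space[OF T] by auto
    finally show ?thesis by (simp add: atom_prob_def)
  qed
  have I: "integrable (distr M M T) (\<lambda>\<omega>. - ln (atom_prob M X \<omega>))"
    using X by (simp add: d fin_ent_def)
  show "fin_ent M (\<lambda>\<omega>. X (T \<omega>))"
    using I by (subst (asm) integrable_distr_eq) (auto simp: fin_ent_def p)
  have "ent M X = (\<integral>\<omega>. - ln (atom_prob M X \<omega>) \<partial>(distr M M T))" by (simp add: d ent_def)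
  also have "\<dots> = (\<integral>\<omega>. - ln (atom_prob M X (T \<omega>)) \<partial>M)"
    by (rule integral_distr) measurable
  finally show "ent M (\<lambda>\<omega>. X (T \<omega>)) = ent M X" by (simp add: ent_def p)
qed

lemma nn_integral_info:
  assumes [measurable]: "X \<in> measurable M (count_space UNIV)"
  shows "(\<integral>\<^sup>+\<omega>. ennreal (- ln (atom_prob M X \<omega>)) \<partial>M) =
    (\<Sum>i. ennreal (- measure M {\<omega> \<in> space M. X \<omega> = i} * ln (measure M {\<omega> \<in> space M. X \<omega> = i})))"
proof -
  let ?p = "\<lambda>i. measure M {\<omega> \<in> space M. X \<omega> = i}"
  have "(\<integral>\<^sup>+\<omega>. ennreal (- ln (atom_prob M X \<omega>)) \<partial>M) = (\<integral>\<^sup>+\<omega>. (\<lambda>i. ennreal (- ln (?p i))) (X \<omega>) \<partial>M)"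
    by (simp add: atom_prob_def)
  also have "\<dots> = (\<integral>\<^sup>+i. ennreal (- ln (?p i)) * emeasure M {\<omega> \<in> space M. X \<omega> = i} \<partial>count_space UNIV)"
    by (rule nn_integral_label) measurable
  also have "\<dots> = (\<Sum>i. ennreal (- ln (?p i)) * emeasure M {\<omega> \<in> space M. X \<omega> = i})"
    by (rule nn_integral_count_space_nat)
  also have "\<dots> = (\<Sum>i. ennreal (- ?p i * ln (?p i)))"
  proof (rule suminf_cong)
    fix i
    have "0 \<le> - ln (?p i)" by (cases "?p i = 0") (auto intro: ln_le_zero_iff[THEN iffD2] simp: less_le)
    then show "ennreal (- ln (?p i)) * emeasure M {\<omega> \<in> space M. X \<omega> = i} = ennreal (- ?p i * ln (?p i))"
      by (simp add: emeasure_eq_measure ennreal_mult[symmetric] mult.commute)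
  qed
  finally show ?thesis .
qed

lemma eta_nonneg: "0 \<le> - measure M A * ln (measure M A)"
proof (cases "measure M A = 0")
  case False
  then have "0 < measure M A" by (simp add: less_le)
  then show ?thesis by (simp add: mult_nonneg_nonpos)
qed simp

text \<open>The series over the values is the form in which single atoms can be estimated, as in
  \<open>ent_correction_le\<close> and \<open>block_entropy\<close>.\<close>

lemma ent_eq_suminf:
  assumes [measurable]: "X \<in> measurable M (count_space UNIV)"
  shows "fin_ent M X \<longleftrightarrow> summable (\<lambda>i. - measure M {\<omega> \<in> space M. X \<omega> = i} * ln (measure M {\<omega> \<in> space M. X \<omega> = i}))"
    (is "_ \<longleftrightarrow> summable ?e")
    and "fin_ent M X \<Longrightarrow> ent M X = (\<Sum>i. - measure M {\<omega> \<in> space M. X \<omega> = i} * ln (measure M {\<omega> \<in> space M. X \<omega> = i}))"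
proof -
  have fin: "fin_ent M X \<longleftrightarrow> (\<integral>\<^sup>+\<omega>. ennreal (- ln (atom_prob M X \<omega>)) \<partial>M) < \<infinity>"
    unfolding fin_ent_def using info_nonneg[of X]
    by (auto simp: integrable_iff_bounded)
  have nn: "0 \<le> ?e i" for i by (rule eta_nonneg)
  show s: "fin_ent M X \<longleftrightarrow> summable ?e"
  proof
    assume "fin_ent M X"
    then have "(\<Sum>i. ennreal (?e i)) \<noteq> \<top>" unfolding fin nn_integral_info[OF assms] by simp
    then show "summable ?e" by (intro summable_suminf_not_top nn) simp
  next
    assume "summable ?e"
    then have "(\<Sum>i. ennreal (?e i)) = ennreal (\<Sum>i. ?e i)" by (rule suminf_ennreal2[OF nn])
    then show "fin_ent M X" unfolding fin nn_integral_info[OF assms] by simp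
  qed
  assume f: "fin_ent M X"
  then have "ennreal (ent M X) = (\<integral>\<^sup>+\<omega>. ennreal (- ln (atom_prob M X \<omega>)) \<partial>M)"
    unfolding ent_def using info_nonneg[of X] by (subst nn_integral_eq_integral) (auto simp: fin_ent_def)
  also have "\<dots> = ennreal (\<Sum>i. ?e i)"
    unfolding nn_integral_info[OF assms] using f s by (intro suminf_ennreal2[OF nn]) simp
  finally show "ent M X = (\<Sum>i. ?e i)"
    using ent_nonneg[of X] suminf_nonneg[of ?e] f s nn by (subst (asm) ennreal_inj) auto
qed

end

subsection \<open>The functional F and splittings\<close>

lemma coarser_pairL: "coarser M X Y \<Longrightarrow> coarser M X (pair Y Z)"
  and coarser_pairR: "coarser M X Z \<Longrightarrow> coarser M X (pair Y Z)"
  using coarser_trans coarser_pair1 coarser_pair2 by metis+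

section \<open>Reduced words over the two generators\<close>

lemma F2_group: "group F2"
  by (rule group_free_group)

lemma F2_carrier: "w \<in> carrier F2 \<longleftrightarrow> reduced_word w"
proof -
  have "fst ` set w \<subseteq> {gen_a, gen_b}" by (rule subsetI) (metis ab.exhaust insertCI)
  then show ?thesis by (simp add: free_group_def)
qed

lemma F2_mult: "u \<otimes>\<^bsub>F2\<^esub> v = foldr push u v"
  by (simp add: free_group_def)

lemma F2_one: "\<one>\<^bsub>F2\<^esub> = []"
  by (simp add: free_group_def)

lemma reduced_snoc: "reduced_word (u @ [l]) \<Longrightarrow> reduced_word u"
proof (induction u)
  case (Cons m u)
  then show ?case by (cases u) auto
qed simp

lemma foldr_push_snoc: "reduced_word (u @ [l]) \<Longrightarrow> foldr push u [l] = u @ [l]"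
proof (induction u)
  case (Cons m u)
  then show ?case by (cases u) auto
qed simp

locale F2_pmp =
  fixes M :: "'x measure" and T :: "(ab \<times> bool) list \<Rightarrow> 'x \<Rightarrow> 'x"
  assumes pmp: "pmp_action F2 M T"
begin

sublocale prob_space M using pmp by (simp add: pmp_action_def)

lemma T_measurable: "g \<in> carrier F2 \<Longrightarrow> T g \<in> measurable M M"
  and T_distr: "g \<in> carrier F2 \<Longrightarrow> distr M M (T g) = M"
  using pmp by (auto simp: pmp_action_def)

lemma T_mult: "g \<in> carrier F2 \<Longrightarrow> h \<in> carrier F2 \<Longrightarrow> x \<in> space M \<Longrightarrow> T (g \<otimes>\<^bsub>F2\<^esub> h) x = T g (T h x)"
  using pmp group_action.composition_rule[of F2 "space M" T x g h] by (simp add: pmp_action_def)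

lemma T_one: "x \<in> space M \<Longrightarrow> T [] x = x"
  using pmp group_action.id_eq_one[of F2 "space M" T] by (simp add: pmp_action_def F2_one) (metis restrict_apply')

lemma T_space: "g \<in> carrier F2 \<Longrightarrow> x \<in> space M \<Longrightarrow> T g x \<in> space M"
  using T_measurable measurable_space by metis

lemma Nil_carrier [simp]: "[] \<in> carrier F2" by (simp add: F2_carrier)

lemma coarser_T:
  "coarser M X Y \<Longrightarrow> g \<in> carrier F2 \<Longrightarrow> coarser M (\<lambda>\<omega>. X (T g \<omega>)) (\<lambda>\<omega>. Y (T g \<omega>))"
  by (rule coarser_comp) (auto intro: T_space)

lemma label_T: "X \<in> measurable M (count_space (UNIV :: nat set)) \<Longrightarrow> g \<in> carrier F2 \<Longrightarrow>
    (\<lambda>\<omega>. X (T g \<omega>)) \<in> measurable M (count_space UNIV)"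
  using measurable_compose[OF T_measurable] by blast

definition J :: "(ab \<times> bool) list \<Rightarrow> ('x \<Rightarrow> nat) \<Rightarrow> real" where
  "J g X = ent M (pair X (\<lambda>\<omega>. X (T g \<omega>)))"

text \<open>\<open>F_functional\<close> transported to labels. The translate is taken by
  \<open>T s\<close> itself, whereas the image partition under \<open>T s\<close> carries the label
  of the inverse; \<open>J_letter_inverse\<close> reconciles the two.\<close>

definition F_label :: "('x \<Rightarrow> nat) \<Rightarrow> real" where
  "F_label X = ent M X + ((J [(gen_a, True)] X - 2 * ent M X) + (J [(gen_b, True)] X - 2 * ent M X))"

lemma letter_carrier [simp]: "[l] \<in> carrier F2"
  by (simp add: F2_carrier)

lemma fin_T:
  assumes "fin_ent M X" "g \<in> carrier F2"
  shows "fin_ent M (\<lambda>\<omega>. X (T g \<omega>))" "ent M (\<lambda>\<omega>. X (T g \<omega>)) = ent M X"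
  using ent_comp[OF T_measurable[OF assms(2)] T_distr[OF assms(2)] assms(1)] by auto

lemma fin_JT: "fin_ent M X \<Longrightarrow> g \<in> carrier F2 \<Longrightarrow> fin_ent M (pair X (\<lambda>\<omega>. X (T g \<omega>)))"
  by (intro ent_pair_le fin_T)

text \<open>Composition with \<open>T [l]\<close> turns the pair for the inverse letter into the
  pair for \<open>l\<close> with its components exchanged, and it preserves entropy.\<close>

lemma J_letter_inverse:
  assumes "fin_ent M X"
  shows "J [inv_letter l] X = J [l] X"
proof -
  let ?Y = "pair X (\<lambda>\<omega>. X (T [inv_letter l] \<omega>))" and ?Z = "pair X (\<lambda>\<omega>. X (T [l] \<omega>))"
  have *: "T [inv_letter l] (T [l] \<omega>) = \<omega>" if "\<omega> \<in> space M" for \<omega>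
    using T_mult[of "[inv_letter l]" "[l]" \<omega>] that by (simp add: F2_mult T_one)
  have "ent M ?Y = ent M (\<lambda>\<omega>. ?Y (T [l] \<omega>))"
    by (intro fin_T(2)[symmetric] fin_JT assms letter_carrier)
  also have "\<dots> = ent M ?Z"
  proof (rule ent_cong)
    show "(\<lambda>\<omega>. ?Y (T [l] \<omega>)) \<in> measurable M (count_space UNIV)"
      by (intro label_T fin_ent_label fin_JT assms letter_carrier)
  qed (use * in \<open>auto simp: coarser_def pair_def intro: fin_JT[OF assms letter_carrier, unfolded pair_def]\<close>)
  finally show ?thesis by (simp add: J_def)
qed

text \<open>Submodularity is applied three times: \<open>X'\<close> is adjoined at the identity,
  then at \<open>g\<close>, and the two results are joined over the original pair. Each end of the
  edge costs at most the increment of entropy.\<close>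

lemma J_le_other:
  assumes X: "fin_ent M X" and X': "fin_ent M X'" and c: "coarser M X X'" and g: "g \<in> carrier F2"
  shows "J g X' \<le> J g X + 2 * (ent M X' - ent M X)"
proof -
  let ?t = "\<lambda>Y \<omega>. Y (T g \<omega>)"
  note fins = fin_T[OF X g] fin_T[OF X' g] fin_ent_label[OF X] fin_ent_label[OF X']
  have Xg: "fin_ent M (pair X (?t X))" by (rule fin_JT[OF X g])
  have 1: "fin_ent M (pair X' (pair X (?t X)))"
    "ent M (pair X' (pair X (?t X))) + ent M X \<le> ent M X' + ent M (pair X (?t X))"
    by (rule ent_submod[OF X' Xg fins(5) c]; simp)+
  have 2: "fin_ent M (pair (pair X (?t X)) (?t X'))"
    "ent M (pair (pair X (?t X)) (?t X')) + ent M (?t X) \<le> ent M (pair X (?t X)) + ent M (?t X')"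
    by (rule ent_submod[OF Xg fins(3) fin_ent_label[OF fins(1)] _ coarser_T[OF c g]]; simp)+
  have 3: "ent M (pair (pair X' (pair X (?t X))) (pair (pair X (?t X)) (?t X'))) + ent M (pair X (?t X))
     \<le> ent M (pair X' (pair X (?t X))) + ent M (pair (pair X (?t X)) (?t X'))"
    "fin_ent M (pair (pair X' (pair X (?t X))) (pair (pair X (?t X)) (?t X')))"
    by (rule ent_submod[OF 1(1) 2(1) fin_ent_label[OF Xg]]; simp)+
  have "ent M (pair X' (?t X')) \<le> ent M (pair (pair X' (pair X (?t X))) (pair (pair X (?t X)) (?t X')))"
    by (rule ent_mono(2)[OF _ _ 3(2)])
       (auto intro!: coarser_pairI intro: coarser_pairL coarser_pairR coarser_refl
         measurable_pair_label fin_ent_label fins)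
  then show ?thesis using 1 2 3 fins unfolding J_def by simp
qed

text \<open>Here \<open>X'\<close> is already visible from the edge, so that only its translate at
  the far end is paid for.\<close>

lemma J_le_same:
  assumes X: "fin_ent M X" and X': "fin_ent M X'" and c: "coarser M X X'" and g: "g \<in> carrier F2"
    and s: "coarser M X' (pair X (\<lambda>\<omega>. X (T g \<omega>)))"
  shows "J g X' \<le> J g X + (ent M X' - ent M X)"
proof -
  let ?t = "\<lambda>Y \<omega>. Y (T g \<omega>)"
  note fins = fin_T[OF X g] fin_T[OF X' g] fin_ent_label[OF X] fin_ent_label[OF X']
  have Xg: "fin_ent M (pair X (?t X))" by (rule fin_JT[OF X g])
  have 2: "fin_ent M (pair (pair X (?t X)) (?t X'))"
    "ent M (pair (pair X (?t X)) (?t X')) + ent M (?t X) \<le> ent M (pair X (?t X)) + ent M (?t X')"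
    by (rule ent_submod[OF Xg fins(3) fin_ent_label[OF fins(1)] _ coarser_T[OF c g]]; simp)+
  have "ent M (pair X' (?t X')) \<le> ent M (pair (pair X (?t X)) (?t X'))"
    by (rule ent_mono(2)[OF _ _ 2(1)])
       (auto intro!: coarser_pairI coarser_trans[OF s] intro: measurable_pair_label fin_ent_label fins coarser_pairL coarser_pairR coarser_refl)
  then show ?thesis using 2 fins unfolding J_def by simp
qed

text \<open>Collecting terms, entropy enters \<open>F_label\<close> with coefficient
  \<open>-3\<close>. An increment \<open>d\<close> of entropy raises the joint term of the split
  letter by at most \<open>d\<close> (\<open>J_le_same\<close>) and that of the other generator by
  at most \<open>2 * d\<close> (\<open>J_le_other\<close>), so the total change is at most
  zero.\<close>

lemma F_label_split_le:
  assumes X: "fin_ent M X" and X': "X' \<in> measurable M (count_space UNIV)" and c: "coarser M X X'"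
    and s: "coarser M X' (pair X (\<lambda>\<omega>. X (T [l] \<omega>)))"
  shows "fin_ent M X'" "F_label X' \<le> F_label X"
proof -
  show f: "fin_ent M X'" using ent_mono(1)[OF s X' fin_JT[OF X letter_carrier]] .
  have J: "J [l] X' \<le> J [l] X + (ent M X' - ent M X)"
    by (rule J_le_same[OF X f c letter_carrier s])
  obtain g b where l: "l = (g, b)" by (cases l)
  have "J [(g, True)] X' \<le> J [(g, True)] X + (ent M X' - ent M X)"
    using J J_letter_inverse[OF X, of "(g, True)"] J_letter_inverse[OF f, of "(g, True)"] l
    by (cases b) (auto simp: inv_letter_def)
  moreover have "J [(h, True)] X' \<le> J [(h, True)] X + 2 * (ent M X' - ent M X)" for h
    by (rule J_le_other[OF X f c letter_carrier])
  then have "J [(gen_a, True)] X' \<le> J [(gen_a, True)] X + 2 * (ent M X' - ent M X)"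
    "J [(gen_b, True)] X' \<le> J [(gen_b, True)] X + 2 * (ent M X' - ent M X)" by this+
  ultimately show "F_label X' \<le> F_label X"
    unfolding F_label_def by (cases g; simp only:; argo)
qed

lemma F_label_cong:
  assumes "coarser M X Y" "coarser M Y X" "X \<in> measurable M (count_space UNIV)" "fin_ent M Y"
  shows "F_label X = F_label Y"
proof -
  have "J g X = J g Y" if g: "g \<in> carrier F2" for g unfolding J_def
    by (rule ent_cong)
       (use assms g in \<open>auto intro!: coarser_pairI measurable_pair_label label_T fin_JT
         intro: coarser_pairL coarser_pairR coarser_T\<close>)
  then show ?thesis using ent_cong[OF assms] unfolding F_label_def by simp
qed

text \<open>The two increments are the conditional entropies of each label given the other. The
  factor 3 is the coefficient of entropy in \<open>F_label\<close>, up to sign, and 4 counts the two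
  ends of the two generator edges.\<close>

lemma F_label_continuous:
  assumes U: "fin_ent M U" and V: "fin_ent M V"
  shows "F_label V \<le> F_label U + 3 * (ent M (pair U V) - ent M V) + 4 * (ent M (pair U V) - ent M U)"
proof -
  have UV: "fin_ent M (pair U V)" by (rule ent_pair_le[OF U V])
  have "J g V \<le> J g U + 2 * (ent M (pair U V) - ent M U)" if g: "g \<in> carrier F2" for g
  proof -
    have "J g V \<le> J g (pair U V)" unfolding J_def
      by (rule ent_mono(2)[OF _ _ fin_JT[OF UV g]])
         (auto intro!: coarser_pairI measurable_pair_label label_T fin_ent_label[OF V] g
           intro: coarser_pairL coarser_pairR[OF coarser_T[OF coarser_pair2 g]])
    also have "\<dots> \<le> J g U + 2 * (ent M (pair U V) - ent M U)"
      by (rule J_le_other[OF U UV _ g]) simp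
    finally show ?thesis .
  qed
  from this[of "[(gen_a, True)]"] this[of "[(gen_b, True)]"]
  have "J [(gen_a, True)] V \<le> J [(gen_a, True)] U + 2 * (ent M (pair U V) - ent M U)"
    "J [(gen_b, True)] V \<le> J [(gen_b, True)] U + 2 * (ent M (pair U V) - ent M U)" by auto
  moreover have "ent M U \<le> ent M (pair U V)"
    using ent_mono(2)[OF coarser_pair1 fin_ent_label[OF U] UV] .
  ultimately show ?thesis unfolding F_label_def by argo
qed

text \<open>The refinement of \<open>X\<close> over a window, given as a list of words so that the
  tuple of values is again encoded in \<open>nat\<close>.\<close>

definition fam :: "('x \<Rightarrow> nat) \<Rightarrow> (ab \<times> bool) list list \<Rightarrow> 'x \<Rightarrow> nat" where
  "fam X ws = (\<lambda>\<omega>. list_encode (map (\<lambda>w. X (T w \<omega>)) ws))"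

lemma fam_Cons: "fam X (w # ws) = (\<lambda>\<omega>. Suc (pair (\<lambda>\<omega>. X (T w \<omega>)) (fam X ws) \<omega>))"
  by (simp add: fam_def pair_def)

lemma coarser_Suc: "coarser M (\<lambda>\<omega>. Suc (X \<omega>)) Y \<longleftrightarrow> coarser M X Y"
  "coarser M Y (\<lambda>\<omega>. Suc (X \<omega>)) \<longleftrightarrow> coarser M Y X"
  by (simp_all add: coarser_def)

lemma label_fam:
  "X \<in> measurable M (count_space UNIV) \<Longrightarrow> set ws \<subseteq> carrier F2 \<Longrightarrow> fam X ws \<in> measurable M (count_space UNIV)"
proof (induction ws)
  case (Cons w ws)
  then have [measurable]: "pair (\<lambda>\<omega>. X (T w \<omega>)) (fam X ws) \<in> measurable M (count_space UNIV)"
    by (intro measurable_pair_label label_T) auto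
  show ?case unfolding fam_Cons by measurable
qed (simp add: fam_def)

lemma fin_fam: "fin_ent M X \<Longrightarrow> set ws \<subseteq> carrier F2 \<Longrightarrow> fin_ent M (fam X ws)"
proof (induction ws)
  case (Cons w ws)
  then have f: "fin_ent M (pair (\<lambda>\<omega>. X (T w \<omega>)) (fam X ws))"
    by (intro ent_pair_le fin_T) auto
  show ?case
    by (rule ent_mono(1)[OF _ label_fam[OF fin_ent_label[OF Cons.prems(1)] Cons.prems(2)] f]) (simp add: fam_Cons coarser_Suc)
qed (simp add: fam_def ent_const)

lemma coarser_fam_iff: "coarser M (fam X ws) Y \<longleftrightarrow> (\<forall>w\<in>set ws. coarser M (\<lambda>\<omega>. X (T w \<omega>)) Y)"
proof (induction ws)
  case (Cons w ws)
  have "coarser M (pair A B) Y \<longleftrightarrow> coarser M A Y \<and> coarser M B Y" for A B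
    by (auto intro: coarser_pairI coarser_trans[OF coarser_pair1] coarser_trans[OF coarser_pair2])
  then show ?case using Cons by (simp add: fam_Cons coarser_Suc)
qed (simp add: fam_def coarser_def)

lemma coarser_famI: "w \<in> set ws \<Longrightarrow> coarser M (\<lambda>\<omega>. X (T w \<omega>)) (fam X ws)"
  using coarser_fam_iff[of X ws "fam X ws"] by simp

lemma coarser_fam_subset: "set vs \<subseteq> set ws \<Longrightarrow> coarser M (fam X vs) (fam X ws)"
  using coarser_famI by (auto simp: coarser_fam_iff)

lemma coarser_id_iff: "coarser M (\<lambda>\<omega>. X (T [] \<omega>)) Y \<longleftrightarrow> coarser M X Y"
  unfolding coarser_def using T_one by simp

lemma fam_T_coarser:
  assumes "set ws \<subseteq> carrier F2" "v \<in> carrier F2"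
  shows "coarser M (\<lambda>\<omega>. fam X ws (T v \<omega>)) (fam X (map (\<lambda>w. w \<otimes>\<^bsub>F2\<^esub> v) ws))"
proof -
  have "fam X ws (T v \<omega>) = fam X (map (\<lambda>w. w \<otimes>\<^bsub>F2\<^esub> v) ws) \<omega>" if "\<omega> \<in> space M" for \<omega>
    unfolding fam_def map_map comp_def
    by (intro arg_cong[where f=list_encode] map_cong) (use assms T_mult that in auto)
  then show ?thesis by (simp add: coarser_def)
qed

lemma mult_carrier: "u \<in> carrier F2 \<Longrightarrow> v \<in> carrier F2 \<Longrightarrow> u \<otimes>\<^bsub>F2\<^esub> v \<in> carrier F2"
  using group.subgroup_self[OF F2_group] subgroup.m_closed by metis

text \<open>Windows multiply: the words \<open>w v\<close> with \<open>w\<close> from the window of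
  \<open>X\<close> over \<open>P\<close> and \<open>v\<close> from \<open>vs\<close>
  suffice.\<close>

lemma coarser_fam_fam:
  assumes c: "coarser M X (fam P ws)" and ws: "set ws \<subseteq> carrier F2" "set vs \<subseteq> carrier F2"
  shows "\<exists>us. set us \<subseteq> carrier F2 \<and> coarser M (fam X vs) (fam P us)"
proof (intro exI conjI)
  let ?us = "concat (map (\<lambda>v. map (\<lambda>w. w \<otimes>\<^bsub>F2\<^esub> v) ws) vs)"
  show "set ?us \<subseteq> carrier F2" using ws mult_carrier by auto
  show "coarser M (fam X vs) (fam P ?us)"
    unfolding coarser_fam_iff
  proof
    fix v assume v: "v \<in> set vs"
    then have vc: "v \<in> carrier F2" using ws by auto
    show "coarser M (\<lambda>\<omega>. X (T v \<omega>)) (fam P ?us)"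
      by (rule coarser_trans[OF coarser_T[OF c vc] coarser_trans[OF fam_T_coarser[OF ws(1) vc] coarser_fam_subset]])
         (use v in auto)
  qed
qed

text \<open>Adjoining \<open>Z \<circ> T\<^sup>w\<close> for \<open>w = w't\<close> once \<open>Z \<circ> T\<^sup>w\<^sup>'\<close> is present is a splitting along \<open>t\<close>.\<close>

lemma F_label_adjoin_word:
  assumes "reduced_word w" and Z: "Z \<in> measurable M (count_space UNIV)" and \<beta>: "fin_ent M \<beta>"
    and c: "coarser M Z \<beta>"
  shows "\<exists>ws. w \<in> set ws \<and> set ws \<subseteq> carrier F2 \<and> fin_ent M (pair \<beta> (fam Z ws)) \<and> F_label (pair \<beta> (fam Z ws)) \<le> F_label \<beta>"
  using assms(1)
\<comment> \<open>The last letter of a word acts before the others, hence words are peeled from the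
  right; prefixes of reduced words are reduced.\<close>
proof (induction w rule: rev_induct)
  case Nil
  have l: "fam Z [[]] \<in> measurable M (count_space UNIV)" by (rule label_fam[OF Z]) simp
  have cc: "coarser M (fam Z [[]]) \<beta>" using c by (simp add: coarser_fam_iff coarser_id_iff)
  have m: "pair \<beta> (fam Z [[]]) \<in> measurable M (count_space UNIV)"
    by (rule measurable_pair_label[OF fin_ent_label[OF \<beta>] l])
  have c2: "coarser M (pair \<beta> (fam Z [[]])) \<beta>" by (rule coarser_pairI[OF coarser_refl cc])
  have "F_label (pair \<beta> (fam Z [[]])) = F_label \<beta>" "fin_ent M (pair \<beta> (fam Z [[]]))"
    by (rule F_label_cong[OF c2 coarser_pair1 m \<beta>], rule ent_mono(1)[OF c2 m \<beta>])
  then show ?case by (intro exI[of _ "[[]]"]) auto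
next
  case (snoc t w)
  obtain ws where ws: "w \<in> set ws" "set ws \<subseteq> carrier F2" "fin_ent M (pair \<beta> (fam Z ws))" "F_label (pair \<beta> (fam Z ws)) \<le> F_label \<beta>"
    using snoc.IH reduced_snoc[OF snoc.prems] by blast
  let ?w = "w @ [t]" and ?X = "pair \<beta> (fam Z ws)"
  let ?X' = "pair \<beta> (fam Z (?w # ws))"
  have wc: "?w \<in> carrier F2" "w \<in> carrier F2" using snoc.prems ws by (auto simp: F2_carrier)
  have m: "?X' \<in> measurable M (count_space UNIV)"
    by (intro measurable_pair_label fin_ent_label[OF \<beta>] label_fam[OF Z]) (use ws wc in auto)
  have c1: "coarser M ?X ?X'"
    by (intro coarser_pairI coarser_pair1 coarser_trans[OF coarser_fam_subset coarser_pair2]) auto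
  have "coarser M (\<lambda>\<omega>. Z (T ?w \<omega>)) (\<lambda>\<omega>. ?X (T [t] \<omega>))"
  proof -
    have "Z (T ?w \<omega>) = Z (T w (T [t] \<omega>))" if "\<omega> \<in> space M" for \<omega>
      using T_mult[OF wc(2) letter_carrier that, of t] foldr_push_snoc[OF snoc.prems] by (simp add: F2_mult)
    then have "coarser M (\<lambda>\<omega>. Z (T ?w \<omega>)) (\<lambda>\<omega>. (\<lambda>\<omega>. Z (T w \<omega>)) (T [t] \<omega>))"
      by (simp add: coarser_def)
    also have "coarser M (\<lambda>\<omega>. (\<lambda>\<omega>. Z (T w \<omega>)) (T [t] \<omega>)) (\<lambda>\<omega>. ?X (T [t] \<omega>))"
      by (rule coarser_T[OF coarser_trans[OF coarser_famI[OF ws(1)] coarser_pair2] letter_carrier])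
    finally (coarser_trans) show ?thesis .
  qed
  then have c2: "coarser M ?X' (pair ?X (\<lambda>\<omega>. ?X (T [t] \<omega>)))"
    unfolding fam_Cons
    by (intro coarser_pairI, unfold coarser_Suc)
       (auto intro!: coarser_pairI intro: coarser_pairL coarser_pairR coarser_refl)
  have "fin_ent M ?X'" "F_label ?X' \<le> F_label ?X" by (rule F_label_split_le[OF ws(3) m c1 c2])+
  then show ?case using ws wc by (intro exI[of _ "?w # ws"]) auto
qed

text \<open>The words are adjoined in succession, the refinement already obtained taking the place
  of \<open>\<beta>\<close>.\<close>

lemma F_label_adjoin_words:
  assumes "set vs \<subseteq> carrier F2" and Z: "Z \<in> measurable M (count_space UNIV)" and \<beta>: "fin_ent M \<beta>"
    and c: "coarser M Z \<beta>"
  shows "\<exists>ws. set vs \<subseteq> set ws \<and> set ws \<subseteq> carrier F2 \<and> fin_ent M (pair \<beta> (fam Z ws)) \<and> F_label (pair \<beta> (fam Z ws)) \<le> F_label \<beta>"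
  using assms(1)
proof (induction vs)
  case Nil
  show ?case using F_label_adjoin_word[OF _ Z \<beta> c, of "[]"] by auto
next
  case (Cons v vs)
  obtain ws where ws: "set vs \<subseteq> set ws" "set ws \<subseteq> carrier F2" "fin_ent M (pair \<beta> (fam Z ws))" "F_label (pair \<beta> (fam Z ws)) \<le> F_label \<beta>"
    using Cons by auto
  obtain us where us: "v \<in> set us" "set us \<subseteq> carrier F2" "fin_ent M (pair (pair \<beta> (fam Z ws)) (fam Z us))"
    "F_label (pair (pair \<beta> (fam Z ws)) (fam Z us)) \<le> F_label (pair \<beta> (fam Z ws))"
    using F_label_adjoin_word[OF _ Z ws(3) coarser_trans[OF c coarser_pair1], of v] Cons.prems by (auto simp: F2_carrier)
  let ?Y = "pair \<beta> (fam Z (ws @ us))" and ?X = "pair (pair \<beta> (fam Z ws)) (fam Z us)"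
  have 1: "coarser M ?Y ?X"
  proof (intro coarser_pairI)
    show "coarser M \<beta> ?X" by (rule coarser_trans[OF coarser_pair1 coarser_pair1])
    show "coarser M (fam Z (ws @ us)) ?X" unfolding coarser_fam_iff
      using coarser_trans[OF coarser_famI coarser_trans[OF coarser_pair2 coarser_pair1]] coarser_trans[OF coarser_famI coarser_pair2]
      by (auto simp del: coarser_pair1 coarser_pair2)
  qed
  have 2: "coarser M ?X ?Y"
    by (intro coarser_pairI coarser_pair1 coarser_trans[OF coarser_fam_subset coarser_pair2]) auto
  have m: "?Y \<in> measurable M (count_space UNIV)"
    by (intro measurable_pair_label fin_ent_label[OF \<beta>] label_fam[OF Z]) (use ws us in auto)
  have "F_label ?Y = F_label ?X" "fin_ent M ?Y" by (rule F_label_cong[OF 1 2 m us(3)], rule ent_mono(1)[OF 1 m us(3)])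
  then show ?case using ws us by (intro exI[of _ "ws @ us"]) auto
qed

end

subsection \<open>Approximation of generators\<close>

text \<open>Both ends of the unit interval occur: the atoms of error have mass near 0, and the atom
  of agreement has mass near 1.\<close>

lemma small_eta:
  assumes "0 < (\<delta> :: real)"
  shows "\<exists>\<kappa>>0. \<forall>t. 0 \<le> t \<and> t \<le> \<kappa> \<longrightarrow> - t * ln t < \<delta>" "\<exists>\<kappa>>0. \<forall>t. 1 - \<kappa> \<le> t \<and> t \<le> 1 \<longrightarrow> - t * ln t < \<delta>"
proof -
  have "((\<lambda>t::real. - t * ln t) \<longlongrightarrow> 0) (at_right 0)" by real_asymp
  then have "eventually (\<lambda>t::real. - t * ln t < \<delta>) (at_right 0)"
    using assms by (rule order_tendstoD)
  then obtain b where b: "b > 0" "\<And>t. 0 < t \<Longrightarrow> t < b \<Longrightarrow> - t * ln t < \<delta>"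
    unfolding eventually_at_right_field by auto
  show "\<exists>\<kappa>>0. \<forall>t. 0 \<le> t \<and> t \<le> \<kappa> \<longrightarrow> - t * ln t < \<delta>"
  proof (intro exI[of _ "b/2"] conjI allI impI)
    fix t assume "0 \<le> t \<and> t \<le> b / 2"
    then show "- t * ln t < \<delta>" using b assms by (cases "t = 0") auto
  qed (use b in auto)
  have "isCont (\<lambda>t::real. - t * ln t) 1" by (intro continuous_intros) auto
  then have "((\<lambda>t::real. - t * ln t) \<longlongrightarrow> 0) (nhds 1)"
    using tendsto_at_iff_tendsto_nhds[of "\<lambda>t::real. - t * ln t" 1] by (simp add: isCont_def)
  then have "eventually (\<lambda>t::real. - t * ln t < \<delta>) (nhds 1)"
    using assms by (rule order_tendstoD)
  then obtain d where d: "d > 0" "\<And>t. dist t 1 < d \<Longrightarrow> - t * ln t < \<delta>"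
    unfolding eventually_nhds_metric by auto
  show "\<exists>\<kappa>>0. \<forall>t. 1 - \<kappa> \<le> t \<and> t \<le> 1 \<longrightarrow> - t * ln t < \<delta>"
    by (rule exI[of _ "d/2"]) (use d in \<open>auto simp: dist_real_def\<close>)
qed

lemma measurable_label2:
  assumes "X \<in> measurable M (count_space (UNIV :: nat set))" "Y \<in> measurable M (count_space (UNIV :: nat set))"
  shows "(\<lambda>\<omega>. f (X \<omega>) (Y \<omega>)) \<in> measurable M (count_space UNIV)"
proof -
  have "(\<lambda>v. f (fst (prod_decode v)) (snd (prod_decode v))) \<in> measurable (count_space UNIV) (count_space UNIV)"
    by simp
  from measurable_compose[OF measurable_pair_label[OF assms] this] show ?thesis
    by (simp add: pair_def)
qed

lemma sets_label2:
  assumes "X \<in> measurable M (count_space (UNIV :: nat set))" "Y \<in> measurable M (count_space (UNIV :: nat set))"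
  shows "{\<omega> \<in> space M. R (X \<omega>) (Y \<omega>)} \<in> sets M"
proof -
  have "(\<lambda>\<omega>. R (X \<omega>) (Y \<omega>)) -` {True} \<inter> space M \<in> sets M"
    by (rule measurable_sets[OF measurable_label2[OF assms]]) simp
  also have "(\<lambda>\<omega>. R (X \<omega>) (Y \<omega>)) -` {True} \<inter> space M = {\<omega> \<in> space M. R (X \<omega>) (Y \<omega>)}" by auto
  finally show ?thesis .
qed

lemma sets_label_neq:
  "X \<in> measurable M (count_space (UNIV :: nat set)) \<Longrightarrow> Y \<in> measurable M (count_space UNIV) \<Longrightarrow>
    {\<omega> \<in> space M. X \<omega> \<noteq> Y \<omega>} \<in> sets M"
  by (rule sets_label2)

lemma sets_label_ge:
  "X \<in> measurable M (count_space (UNIV :: nat set)) \<Longrightarrow> {\<omega> \<in> space M. N \<le> X \<omega>} \<in> sets M"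
  by (rule sets_label2[where R="\<lambda>x _. N \<le> x"])

definition trunc :: "nat \<Rightarrow> ('x \<Rightarrow> nat) \<Rightarrow> 'x \<Rightarrow> nat" where
  "trunc N Q \<omega> = (if Q \<omega> \<le> N then Q \<omega> else 0)"

text \<open>The message that repairs \<open>R\<close> to \<open>Q\<close>: 0 where nothing is to be
  done, otherwise the true value shifted by one. Its entropy bounds the conditional entropy of
  \<open>Q\<close> given \<open>R\<close>.\<close>

definition correction :: "('x \<Rightarrow> nat) \<Rightarrow> ('x \<Rightarrow> nat) \<Rightarrow> 'x \<Rightarrow> nat" where
  "correction Q R \<omega> = (if Q \<omega> = R \<omega> then 0 else Suc (Q \<omega>))"

lemma measurable_trunc [measurable]:
  assumes [measurable]: "Q \<in> measurable M (count_space UNIV)"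
  shows "trunc N Q \<in> measurable M (count_space UNIV)"
  unfolding trunc_def[abs_def] by (rule measurable_label2[OF assms assms])

lemma measurable_correction [measurable]:
  assumes [measurable]: "Q \<in> measurable M (count_space UNIV)" "R \<in> measurable M (count_space UNIV)"
  shows "correction Q R \<in> measurable M (count_space UNIV)"
  unfolding correction_def[abs_def] by (rule measurable_label2[OF assms])

lemma coarser_correction: "coarser M Q (pair R (correction Q R))"
  unfolding coarser_def pair_def correction_def by (auto split: if_splits)

lemma correction_coarser: "coarser M (correction Q R) (pair Q R)"
  unfolding coarser_def pair_def correction_def by auto

lemma trunc_coarser: "coarser M (trunc N Q) Q"
  unfolding coarser_def trunc_def by auto

text \<open>Every \<open>\<epsilon>\<close>-approximation of \<open>Q\<close> with values in \<open>{0..N}\<close> is \<open>\<delta>\<close>-close to \<open>Q\<close> in the Rokhlin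
  metric.\<close>

definition approximable :: "'x measure \<Rightarrow> ('x \<Rightarrow> nat) \<Rightarrow> real \<Rightarrow> nat \<Rightarrow> real \<Rightarrow> bool" where
  "approximable M Q \<delta> N \<epsilon> \<longleftrightarrow> (\<forall>R. R \<in> measurable M (count_space UNIV) \<and> (\<forall>\<omega>. R \<omega> \<le> N) \<and>
      measure M {\<omega> \<in> space M. trunc N Q \<omega> \<noteq> R \<omega>} \<le> \<epsilon> \<longrightarrow>
      fin_ent M (correction Q R) \<and> ent M (correction Q R) \<le> \<delta> \<and>
      fin_ent M (correction R (trunc N Q)) \<and> ent M (correction R (trunc N Q)) \<le> \<delta>)"

lemma approximableD:
  assumes "approximable M Q \<delta> N \<epsilon>" "R \<in> measurable M (count_space UNIV)" "\<And>\<omega>. R \<omega> \<le> N"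
    "measure M {\<omega> \<in> space M. trunc N Q \<omega> \<noteq> R \<omega>} \<le> \<epsilon>"
  shows "fin_ent M (correction Q R)" "ent M (correction Q R) \<le> \<delta>"
    "fin_ent M (correction R (trunc N Q))" "ent M (correction R (trunc N Q)) \<le> \<delta>"
  using assms unfolding approximable_def by blast+

context prob_space
begin

lemma label_tail:
  assumes [measurable]: "Q \<in> measurable M (count_space (UNIV :: nat set))"
  shows "(\<lambda>N. measure M {\<omega> \<in> space M. N \<le> Q \<omega>}) \<longlonglongrightarrow> 0"
proof -
  have "(\<lambda>N. measure M {\<omega> \<in> space M. N \<le> Q \<omega>}) \<longlonglongrightarrow> measure M (\<Inter>N. {\<omega> \<in> space M. N \<le> Q \<omega>})"
    by (rule finite_Lim_measure_decseq) (auto simp: decseq_def intro: sets_label_ge assms)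
  moreover have "(\<Inter>N. {\<omega> \<in> space M. N \<le> Q \<omega>}) = {}" using not_less_eq_eq by auto
  ultimately show "(\<lambda>N. measure M {\<omega> \<in> space M. N \<le> Q \<omega>}) \<longlonglongrightarrow> 0" by simp
qed

text \<open>The distribution of a correction has three parts: the atom 0 of nearly full mass,
  \<open>N + 1\<close> atoms of mass at most \<open>\<epsilon>\<close>, and a tail dominated by that
  of \<open>Q\<close>. \<open>N\<close> is chosen for the tail and \<open>\<epsilon>\<close>
  afterwards, so that each part contributes at most \<open>\<delta> / 4\<close>.\<close>

lemma ent_correction_le:
  assumes Q: "fin_ent M Q" and \<delta>: "0 < \<delta>"
  shows "\<exists>N0. \<forall>N\<ge>N0. \<exists>\<epsilon>>0. approximable M Q \<delta> N \<epsilon>"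
proof -
  note [measurable] = fin_ent_label[OF Q]
  define eta where "eta = (\<lambda>t::real. - t * ln t)"
  define q where "q i = measure M {\<omega> \<in> space M. Q \<omega> = i}" for i
  have sq: "summable (\<lambda>i. eta (q i))"
    using Q unfolding ent_eq_suminf(1)[OF fin_ent_label[OF Q]] eta_def q_def .
  have "\<delta> / 4 > 0" using \<delta> by simp
  from small_eta(2)[OF this] obtain \<kappa> where \<kappa>: "\<kappa> > 0" "\<And>t. 1 - \<kappa> \<le> t \<Longrightarrow> t \<le> 1 \<Longrightarrow> eta t < \<delta> / 4"
    unfolding eta_def by auto
  have "(\<lambda>N. \<Sum>i. eta (q (i + N))) \<longlonglongrightarrow> 0" by (rule suminf_exist_split2[OF sq])
  then have ev1: "eventually (\<lambda>N. (\<Sum>i. eta (q (i + N))) < \<delta> / 4) sequentially"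
    using \<delta> by (intro order_tendstoD) auto
  have "(\<lambda>N. measure M {\<omega> \<in> space M. N \<le> Q \<omega>}) \<longlonglongrightarrow> 0" by (rule label_tail) measurable
  then have ev2: "eventually (\<lambda>N. measure M {\<omega> \<in> space M. N \<le> Q \<omega>} < \<kappa> / 2) sequentially"
    using \<kappa> by (intro order_tendstoD) auto
  obtain N0 where N0: "\<And>N. N \<ge> N0 \<Longrightarrow> (\<Sum>i. eta (q (i + N))) < \<delta> / 4"
    "\<And>N. N \<ge> N0 \<Longrightarrow> measure M {\<omega> \<in> space M. N \<le> Q \<omega>} < \<kappa> / 2"
    using eventually_conj[OF ev1 ev2] unfolding eventually_sequentially by blast
  show ?thesis
  proof (intro exI[of _ N0] allI impI)
    fix N assume N: "N0 \<le> N"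
    \<comment> \<open>The values \<open>1\<close> to \<open>N + 1\<close> of a correction share the
      budget \<open>\<delta> / 4\<close>.\<close>
    have "\<delta> / (4 * (real N + 1)) > 0" using \<delta> by simp
    from small_eta(1)[OF this] obtain \<kappa>' where \<kappa>': "\<kappa>' > 0"
      "\<And>t. 0 \<le> t \<Longrightarrow> t \<le> \<kappa>' \<Longrightarrow> eta t < \<delta> / (4 * (real N + 1))"
      unfolding eta_def by auto
    define \<epsilon> where "\<epsilon> = min \<kappa>' (\<kappa> / 2)"
    have \<epsilon>: "\<epsilon> > 0" "\<epsilon> \<le> \<kappa>'" "\<epsilon> \<le> \<kappa> / 2" using \<kappa> \<kappa>' by (auto simp: \<epsilon>_def)
    have goal: "fin_ent M g \<and> ent M g \<le> \<delta>"
      if g[measurable]: "g \<in> measurable M (count_space UNIV)"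
        and p0: "1 - \<kappa> \<le> measure M {\<omega> \<in> space M. g \<omega> = 0}"
        and p1: "\<And>i. i \<le> N \<Longrightarrow> measure M {\<omega> \<in> space M. g \<omega> = Suc i} \<le> \<epsilon>"
        and p2: "\<And>i. i > N \<Longrightarrow> eta (measure M {\<omega> \<in> space M. g \<omega> = Suc i}) \<le> eta (q i)"
      for g
    proof -
      define p where "p i = measure M {\<omega> \<in> space M. g \<omega> = i}" for i
      have nn: "0 \<le> eta (p i)" for i unfolding eta_def p_def by (rule eta_nonneg)
      have tail: "eta (p (i + (N + 2))) \<le> eta (q (i + (N + 1)))" for i
        using p2[of "i + (N + 1)"] by (simp add: p_def)
      have sqt: "summable (\<lambda>i. eta (q (i + (N + 1))))" using sq by (subst summable_iff_shift)
      have spt: "summable (\<lambda>i. eta (p (i + (N + 2))))"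
        by (rule summable_comparison_test'[OF sqt, of 0]) (use nn tail in auto)
      then have sp: "summable (\<lambda>i. eta (p i))" by (subst (asm) summable_iff_shift)
      then have fg: "fin_ent M g" unfolding ent_eq_suminf(1)[OF g] eta_def p_def .
      have "ent M g = (\<Sum>i. eta (p i))"
        using ent_eq_suminf(2)[OF g fg] by (simp add: eta_def p_def)
      also have "\<dots> = (\<Sum>i. eta (p (i + (N + 2)))) + (\<Sum>i<N+2. eta (p i))"
        by (rule suminf_split_initial_segment[OF sp])
      also have "(\<Sum>i. eta (p (i + (N + 2)))) \<le> (\<Sum>i. eta (q (i + (N + 1))))"
        by (rule suminf_le[OF tail spt sqt])
      also have "\<dots> \<le> \<delta> / 4" using N0(1)[of "N + 1"] N by simp
      also have "(\<Sum>i<N+2. eta (p i)) = eta (p 0) + (\<Sum>i<N+1. eta (p (Suc i)))"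
        using sum.lessThan_Suc_shift[of "\<lambda>i. eta (p i)" "N+1"] by simp
      also have "eta (p 0) \<le> \<delta> / 4" using \<kappa>(2)[of "p 0"] p0 by (simp add: p_def)
      also have "(\<Sum>i<N+1. eta (p (Suc i))) \<le> (\<Sum>i<N+1. \<delta> / (4 * (real N + 1)))"
      proof (rule sum_mono)
        fix i assume "i \<in> {..<N + 1}"
        then have "p (Suc i) \<le> \<kappa>'" "0 \<le> p (Suc i)" using p1[of i] \<epsilon> by (auto simp: p_def)
        then show "eta (p (Suc i)) \<le> \<delta> / (4 * (real N + 1))" using \<kappa>'(2)[of "p (Suc i)"] by simp
      qed
      also have "\<dots> = \<delta> / 4" by (simp add: field_simps)
      finally show ?thesis using fg \<delta> by simp
    qed
    show "\<exists>\<epsilon>>0. approximable M Q \<delta> N \<epsilon>"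
      unfolding approximable_def
    proof (intro exI[of _ \<epsilon>] conjI \<epsilon>(1) allI impI)
      fix R assume R: "R \<in> measurable M (count_space UNIV) \<and> (\<forall>\<omega>. R \<omega> \<le> N) \<and>
        measure M {\<omega> \<in> space M. trunc N Q \<omega> \<noteq> R \<omega>} \<le> \<epsilon>"
      then have [measurable]: "R \<in> measurable M (count_space UNIV)" and RN: "R \<omega> \<le> N"
        and err: "measure M {\<omega> \<in> space M. trunc N Q \<omega> \<noteq> R \<omega>} \<le> \<epsilon>" for \<omega> by auto
      have eN: "{\<omega> \<in> space M. trunc N Q \<omega> \<noteq> R \<omega>} \<in> sets M"
        by (intro sets_label_neq) measurable
      have zero: "1 - \<kappa> \<le> measure M {\<omega> \<in> space M. g \<omega> = (0::nat)}"
        if [measurable]: "g \<in> measurable M (count_space UNIV)" and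
          "\<And>\<omega>. \<omega> \<in> space M \<Longrightarrow> g \<omega> \<noteq> 0 \<Longrightarrow> trunc N Q \<omega> \<noteq> R \<omega> \<or> N \<le> Q \<omega>" for g
      proof -
        have "measure M {\<omega> \<in> space M. g \<omega> \<noteq> 0} \<le> measure M ({\<omega> \<in> space M. trunc N Q \<omega> \<noteq> R \<omega>} \<union> {\<omega> \<in> space M. N \<le> Q \<omega>})"
          by (rule finite_measure_mono, use that(2) in blast)
             (intro sets.Un sets_label_neq sets_label_ge; measurable)
        also have "\<dots> \<le> measure M {\<omega> \<in> space M. trunc N Q \<omega> \<noteq> R \<omega>} + measure M {\<omega> \<in> space M. N \<le> Q \<omega>}"
          by (rule measure_Un_le) (intro sets_label_neq sets_label_ge; measurable)+
        also have "\<dots> \<le> \<kappa>" using err \<epsilon> N0(2)[OF N] by simp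
        finally have "measure M {\<omega> \<in> space M. g \<omega> \<noteq> 0} \<le> \<kappa>" .
        moreover have "measure M {\<omega> \<in> space M. g \<omega> = 0} = 1 - measure M {\<omega> \<in> space M. g \<omega> \<noteq> 0}"
          using prob_neg[of "\<lambda>\<omega>. g \<omega> \<noteq> 0"] by simp
        ultimately show ?thesis by simp
      qed
      have "fin_ent M (correction Q R) \<and> ent M (correction Q R) \<le> \<delta>"
      proof (rule goal)
        show "1 - \<kappa> \<le> measure M {\<omega> \<in> space M. correction Q R \<omega> = 0}"
          by (rule zero) (measurable, auto simp: correction_def trunc_def split: if_splits)
        fix i
        {
          assume "i \<le> N"
          then have "{\<omega> \<in> space M. correction Q R \<omega> = Suc i} \<subseteq> {\<omega> \<in> space M. trunc N Q \<omega> \<noteq> R \<omega>}"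
            by (auto simp: correction_def trunc_def split: if_splits)
          then show "measure M {\<omega> \<in> space M. correction Q R \<omega> = Suc i} \<le> \<epsilon>"
            by (rule order_trans[OF finite_measure_mono[OF _ eN] err])
        }
        assume i: "i > N"
        \<comment> \<open>\<open>R\<close> never takes a value above \<open>N\<close>, so there the
          repair message repeats \<open>Q\<close> and its atoms are those of
          \<open>Q\<close>.\<close>
        have "{\<omega> \<in> space M. correction Q R \<omega> = Suc i} = {\<omega> \<in> space M. Q \<omega> = i}"
        proof -
          have "correction Q R \<omega> = Suc i \<longleftrightarrow> Q \<omega> = i" for \<omega>
            using RN[of \<omega>] i by (auto simp: correction_def)
          then show ?thesis by blast
        qed
        then show "eta (measure M {\<omega> \<in> space M. correction Q R \<omega> = Suc i}) \<le> eta (q i)"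
          by (simp add: q_def)
      qed measurable
      moreover have "fin_ent M (correction R (trunc N Q)) \<and> ent M (correction R (trunc N Q)) \<le> \<delta>"
      proof (rule goal)
        show "1 - \<kappa> \<le> measure M {\<omega> \<in> space M. correction R (trunc N Q) \<omega> = 0}"
          by (rule zero) (measurable, auto simp: correction_def split: if_splits)
        fix i
        have "{\<omega> \<in> space M. correction R (trunc N Q) \<omega> = Suc i} \<subseteq> {\<omega> \<in> space M. trunc N Q \<omega> \<noteq> R \<omega>}"
          by (auto simp: correction_def split: if_splits)
        then show "measure M {\<omega> \<in> space M. correction R (trunc N Q) \<omega> = Suc i} \<le> \<epsilon>"
          by (rule order_trans[OF finite_measure_mono[OF _ eN] err])
        assume i: "i > N"
        have z: "{\<omega> \<in> space M. correction R (trunc N Q) \<omega> = Suc i} = {}"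
        proof -
          have "correction R (trunc N Q) \<omega> \<noteq> Suc i" for \<omega>
            using RN[of \<omega>] i by (auto simp: correction_def)
          then show ?thesis by blast
        qed
        have "0 \<le> eta (q i)" unfolding eta_def q_def by (rule eta_nonneg)
        then show "eta (measure M {\<omega> \<in> space M. correction R (trunc N Q) \<omega> = Suc i}) \<le> eta (q i)"
          unfolding z by (simp add: eta_def)
      qed measurable
      ultimately show "fin_ent M (correction Q R)" "ent M (correction Q R) \<le> \<delta>"
        "fin_ent M (correction R (trunc N Q))" "ent M (correction R (trunc N Q)) \<le> \<delta>" by auto
    qed
  qed
qed

end

context F2_pmp
begin

text \<open>Generation in metric form: events read off finite windows are dense in the measure
  algebra.\<close>

definition dense_label :: "('x \<Rightarrow> nat) \<Rightarrow> bool" where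
  "dense_label X \<longleftrightarrow> (\<forall>B\<in>sets M. \<forall>\<epsilon>>0. \<exists>ws S. set ws \<subseteq> carrier F2 \<and> S \<in> sets M \<and>
     coarser M (indicator S) (fam X ws) \<and> measure M {\<omega> \<in> space M. \<omega> \<in> B \<longleftrightarrow> \<omega> \<notin> S} < \<epsilon>)"

text \<open>One value is added at a time: the event that \<open>Q\<close> equals
  \<open>Suc N\<close> is approximated within half of the allowed error, and the new value overrides
  the old approximant on it.\<close>

lemma dense_approx:
  assumes P: "dense_label P" and Q[measurable]: "Q \<in> measurable M (count_space UNIV)"
  shows "0 < \<epsilon> \<Longrightarrow> \<exists>ws R. set ws \<subseteq> carrier F2 \<and> R \<in> measurable M (count_space UNIV) \<and> (\<forall>\<omega>. R \<omega> \<le> N) \<and>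
    coarser M R (fam P ws) \<and> measure M {\<omega> \<in> space M. trunc N Q \<omega> \<noteq> R \<omega>} \<le> \<epsilon>"
proof (induction N arbitrary: \<epsilon>)
  case 0
  have "trunc 0 Q \<omega> = 0" for \<omega> by (simp add: trunc_def)
  then show ?case using 0 by (intro exI[of _ "[]"] exI[of _ "\<lambda>_. 0"]) (simp add: coarser_def)
next
  case (Suc N)
  obtain ws R where R: "set ws \<subseteq> carrier F2" "R \<in> measurable M (count_space UNIV)" "\<And>\<omega>. R \<omega> \<le> N"
    "coarser M R (fam P ws)" "measure M {\<omega> \<in> space M. trunc N Q \<omega> \<noteq> R \<omega>} \<le> \<epsilon> / 2"
    using Suc.IH[of "\<epsilon> / 2"] Suc.prems by auto
  obtain vs S where S: "set vs \<subseteq> carrier F2" "S \<in> sets M" "coarser M (indicator S) (fam P vs)"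
    "measure M {\<omega> \<in> space M. \<omega> \<in> {\<omega> \<in> space M. Q \<omega> = Suc N} \<longleftrightarrow> \<omega> \<notin> S} < \<epsilon> / 2"
    using P[unfolded dense_label_def, rule_format, of "{\<omega> \<in> space M. Q \<omega> = Suc N}" "\<epsilon> / 2"] Suc.prems by auto
  note [measurable] = R(2) S(2)
  define R' where "R' \<omega> = (if \<omega> \<in> S then Suc N else R \<omega>)" for \<omega>
  have m[measurable]: "R' \<in> measurable M (count_space UNIV)" unfolding R'_def[abs_def] by measurable
  have e1: "{\<omega> \<in> space M. trunc N Q \<omega> \<noteq> R \<omega>} \<in> sets M"
    by (intro sets_label_neq) measurable
  have e2: "{\<omega> \<in> space M. \<omega> \<in> {\<omega> \<in> space M. Q \<omega> = Suc N} \<longleftrightarrow> \<omega> \<notin> S} \<in> sets M"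
    by measurable
  have "measure M {\<omega> \<in> space M. trunc (Suc N) Q \<omega> \<noteq> R' \<omega>} \<le>
     measure M ({\<omega> \<in> space M. trunc N Q \<omega> \<noteq> R \<omega>} \<union> {\<omega> \<in> space M. \<omega> \<in> {\<omega> \<in> space M. Q \<omega> = Suc N} \<longleftrightarrow> \<omega> \<notin> S})"
    by (rule finite_measure_mono[OF _ sets.Un[OF e1 e2]]) (auto simp: trunc_def R'_def split: if_splits)
  also have "\<dots> \<le> measure M {\<omega> \<in> space M. trunc N Q \<omega> \<noteq> R \<omega>} + measure M {\<omega> \<in> space M. \<omega> \<in> {\<omega> \<in> space M. Q \<omega> = Suc N} \<longleftrightarrow> \<omega> \<notin> S}"
    by (rule measure_Un_le[OF e1 e2])
  also have "\<dots> \<le> \<epsilon>" using R S by simp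
  finally have e: "measure M {\<omega> \<in> space M. trunc (Suc N) Q \<omega> \<noteq> R' \<omega>} \<le> \<epsilon>" .
  have c: "coarser M R (fam P (ws @ vs))" "coarser M (indicator S) (fam P (ws @ vs))"
    using coarser_trans[OF R(4) coarser_fam_subset] coarser_trans[OF S(3) coarser_fam_subset] by auto
  have "coarser M R' (fam P (ws @ vs))"
    unfolding coarser_def
  proof (intro ballI impI)
    fix \<omega> \<omega>' assume "\<omega> \<in> space M" "\<omega>' \<in> space M" "fam P (ws @ vs) \<omega> = fam P (ws @ vs) \<omega>'"
    then have "R \<omega> = R \<omega>'" "(indicator S \<omega> :: nat) = indicator S \<omega>'" using c unfolding coarser_def by blast+
    then show "R' \<omega> = R' \<omega>'" by (auto simp: R'_def indicator_def split: if_splits)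
  qed
  moreover have "R' \<omega> \<le> Suc N" for \<omega> using R(3)[of \<omega>] by (simp add: R'_def)
  moreover have "set (ws @ vs) \<subseteq> carrier F2" using R(1) S(1) by simp
  ultimately show ?case using e m by blast
qed

text \<open>Union bound over the words; by invariance every translate has the same error.\<close>

lemma fam_diff_le:
  assumes [measurable]: "X \<in> measurable M (count_space UNIV)" "Y \<in> measurable M (count_space UNIV)"
    and "set ws \<subseteq> carrier F2"
  shows "measure M {\<omega> \<in> space M. fam X ws \<omega> \<noteq> fam Y ws \<omega>} \<le>
    real (length ws) * measure M {\<omega> \<in> space M. X \<omega> \<noteq> Y \<omega>}"
  using assms(3)
proof (induction ws)
  case (Cons w ws)
  then have w: "w \<in> carrier F2" and ws: "set ws \<subseteq> carrier F2" by auto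
  note [measurable] = label_fam[OF assms(1) ws] label_fam[OF assms(2) ws] T_measurable[OF w]
  have "measure M {\<omega> \<in> space M. X (T w \<omega>) \<noteq> Y (T w \<omega>)} = measure (distr M M (T w)) {\<omega> \<in> space M. X \<omega> \<noteq> Y \<omega>}"
    by (subst measure_distr) (auto intro!: arg_cong[where f="measure M"] sets_label_neq assms T_measurable w simp: T_space[OF w])
  then have t: "measure M {\<omega> \<in> space M. X (T w \<omega>) \<noteq> Y (T w \<omega>)} = measure M {\<omega> \<in> space M. X \<omega> \<noteq> Y \<omega>}"
    by (simp add: T_distr[OF w])
  have "measure M {\<omega> \<in> space M. fam X (w # ws) \<omega> \<noteq> fam Y (w # ws) \<omega>} \<le>
     measure M ({\<omega> \<in> space M. X (T w \<omega>) \<noteq> Y (T w \<omega>)} \<union> {\<omega> \<in> space M. fam X ws \<omega> \<noteq> fam Y ws \<omega>})"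
    by (rule finite_measure_mono)
       (auto simp: fam_def intro!: sets.Un sets_label_neq label_T[OF _ w] assms(1,2) label_fam[OF _ ws, unfolded fam_def])
  also have "\<dots> \<le> measure M {\<omega> \<in> space M. X (T w \<omega>) \<noteq> Y (T w \<omega>)} + measure M {\<omega> \<in> space M. fam X ws \<omega> \<noteq> fam Y ws \<omega>}"
    by (rule measure_Un_le) (auto intro!: sets_label_neq label_T[OF _ w] assms(1,2) label_fam[OF _ ws])
  finally show ?case using Cons.IH[OF ws] t by (simp add: algebra_simps)
qed (simp add: fam_def)

text \<open>The rule by which \<open>X\<close> is computed from \<open>Y\<close> is made explicit
  with the same bound, so that it can later be applied to an approximation of
  \<open>Y\<close>.\<close>

lemma coarser_function:
  assumes "coarser M X Y" "\<And>\<omega>. X \<omega> \<le> N"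
  obtains g where "\<And>v. g v \<le> N" "\<And>\<omega>. \<omega> \<in> space M \<Longrightarrow> X \<omega> = g (Y \<omega>)"
proof
  define g where "g v = (if \<exists>\<omega>\<in>space M. Y \<omega> = v then X (SOME \<omega>. \<omega> \<in> space M \<and> Y \<omega> = v) else 0)" for v
  show "g v \<le> N" for v using assms(2) by (simp add: g_def)
  fix \<omega> assume w: "\<omega> \<in> space M"
  define \<omega>' where "\<omega>' = (SOME \<omega>'. \<omega>' \<in> space M \<and> Y \<omega>' = Y \<omega>)"
  have "\<omega>' \<in> space M \<and> Y \<omega>' = Y \<omega>" unfolding \<omega>'_def by (rule someI[of _ \<omega>]) (use w in simp)
  then have "X \<omega>' = X \<omega>" using assms(1) w unfolding coarser_def by blast
  then show "X \<omega> = g (Y \<omega>)" using w unfolding g_def \<omega>'_def by auto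
qed

text \<open>The approximant \<open>Q'\<close> is close to \<open>Q\<close> in entropy, and \<open>P\<close> and \<open>Q'\<close> are determined by finitely
  many translates of each other, so that finitely many splittings lead from \<open>Q'\<close> to a refinement
  of \<open>P\<close>.\<close>

lemma F_label_generator_le:
  assumes P: "fin_ent M P" "dense_label P" and Q: "fin_ent M Q" "dense_label Q" and \<epsilon>: "0 < \<epsilon>"
  shows "\<exists>ws. ws \<noteq> [] \<and> set ws \<subseteq> carrier F2 \<and> F_label (fam P ws) \<le> F_label Q + \<epsilon>"
proof -
  note [measurable] = fin_ent_label[OF P(1)] fin_ent_label[OF Q(1)]
  \<comment> \<open>\<open>F_label_continuous\<close> is used with the increments
    \<open>h1 \<le> \<delta>\<close> and \<open>h2 \<le> 2 * \<delta>\<close>, which costs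
    \<open>3 * \<delta> + 4 * 2 * \<delta>\<close>.\<close>
  define \<delta> where "\<delta> = \<epsilon> / 11"
  have \<delta>: "\<delta> > 0" using \<epsilon> by (simp add: \<delta>_def)
  obtain N \<epsilon>P where \<epsilon>P: "\<epsilon>P > 0" and corrP: "approximable M P \<delta> N \<epsilon>P"
    using ent_correction_le[OF P(1) \<delta>] by blast
  obtain ws0 R0 where R0: "set ws0 \<subseteq> carrier F2" "R0 \<in> measurable M (count_space UNIV)" "\<And>\<omega>. R0 \<omega> \<le> N"
    "coarser M R0 (fam Q ws0)" "measure M {\<omega> \<in> space M. trunc N P \<omega> \<noteq> R0 \<omega>} \<le> \<epsilon>P / 2"
    using dense_approx[OF Q(2) fin_ent_label[OF P(1)], of "\<epsilon>P / 2" N] \<epsilon>P by auto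
  obtain g where g: "\<And>v. g v \<le> N" "\<And>\<omega>. \<omega> \<in> space M \<Longrightarrow> R0 \<omega> = g (fam Q ws0 \<omega>)"
    by (rule coarser_function[OF R0(4,3)]) blast
  \<comment> \<open>\<open>S\<close> will differ from \<open>Q\<close> with probability at most
    \<open>2 * \<eta>\<close>; over the window \<open>ws0\<close> this costs at most
    \<open>\<epsilon>P / 2\<close>.\<close>
  define \<eta> where "\<eta> = \<epsilon>P / (4 * (real (length ws0) + 1))"
  have \<eta>: "\<eta> > 0" using \<epsilon>P by (simp add: \<eta>_def)
  obtain N1 where N1: "\<And>N. N \<ge> N1 \<Longrightarrow> \<exists>\<epsilon>>0. approximable M Q \<delta> N \<epsilon>"
    using ent_correction_le[OF Q(1) \<delta>] by blast
  have "eventually (\<lambda>N. measure M {\<omega> \<in> space M. N \<le> Q \<omega>} < \<eta>) sequentially"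
    by (rule order_tendstoD(2)[OF label_tail[OF fin_ent_label[OF Q(1)]] \<eta>])
  then obtain N2 where N2: "\<And>N. N \<ge> N2 \<Longrightarrow> measure M {\<omega> \<in> space M. N \<le> Q \<omega>} < \<eta>"
    unfolding eventually_sequentially by blast
  define L where "L = max N1 N2"
  obtain \<epsilon>Q where \<epsilon>Q: "\<epsilon>Q > 0" and corrQ: "approximable M Q \<delta> L \<epsilon>Q"
    using N1[of L] unfolding L_def by auto
  obtain ws1 S where S: "set ws1 \<subseteq> carrier F2" "S \<in> measurable M (count_space UNIV)" "\<And>\<omega>. S \<omega> \<le> L"
    "coarser M S (fam P ws1)" "measure M {\<omega> \<in> space M. trunc L Q \<omega> \<noteq> S \<omega>} \<le> min \<epsilon>Q \<eta>"
    using dense_approx[OF P(2) fin_ent_label[OF Q(1)], of "min \<epsilon>Q \<eta>" L] \<epsilon>Q \<eta> by auto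
  note [measurable] = S(2) R0(2) label_fam[OF S(2) R0(1)] label_fam[OF fin_ent_label[OF Q(1)] R0(1)]
  have cQ: "fin_ent M (correction Q S)" "ent M (correction Q S) \<le> \<delta>"
    "fin_ent M (correction S (trunc L Q))" "ent M (correction S (trunc L Q)) \<le> \<delta>"
    using approximableD[OF corrQ S(2,3)] S(5) by simp_all
  have QS: "measure M {\<omega> \<in> space M. Q \<omega> \<noteq> S \<omega>} \<le> 2 * \<eta>"
  proof -
    have "measure M {\<omega> \<in> space M. Q \<omega> \<noteq> S \<omega>} \<le> measure M ({\<omega> \<in> space M. trunc L Q \<omega> \<noteq> S \<omega>} \<union> {\<omega> \<in> space M. L \<le> Q \<omega>})"
      by (rule finite_measure_mono, force simp: trunc_def) (intro sets.Un sets_label_neq sets_label_ge; measurable)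
    also have "\<dots> \<le> measure M {\<omega> \<in> space M. trunc L Q \<omega> \<noteq> S \<omega>} + measure M {\<omega> \<in> space M. L \<le> Q \<omega>}"
      by (rule measure_Un_le) (intro sets_label_neq sets_label_ge; measurable)+
    also have "\<dots> \<le> 2 * \<eta>" using S(5) N2[of L] by (simp add: L_def)
    finally show ?thesis .
  qed
  \<comment> \<open>The rule that approximates \<open>P\<close> from \<open>Q\<close> is applied to
    the approximant \<open>S\<close>, which is itself determined by translates of
    \<open>P\<close>.\<close>
  define R where "R \<omega> = g (fam S ws0 \<omega>)" for \<omega>
  have R[measurable]: "R \<in> measurable M (count_space UNIV)" unfolding R_def[abs_def] by measurable
  have RS: "coarser M R (fam S ws0)" by (auto simp: coarser_def R_def)
  have "measure M {\<omega> \<in> space M. trunc N P \<omega> \<noteq> R \<omega>} \<le>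
      measure M ({\<omega> \<in> space M. trunc N P \<omega> \<noteq> R0 \<omega>} \<union> {\<omega> \<in> space M. fam Q ws0 \<omega> \<noteq> fam S ws0 \<omega>})"
    by (rule finite_measure_mono, force simp: R_def g(2)) (intro sets.Un sets_label_neq; measurable)
  also have "\<dots> \<le> measure M {\<omega> \<in> space M. trunc N P \<omega> \<noteq> R0 \<omega>} + measure M {\<omega> \<in> space M. fam Q ws0 \<omega> \<noteq> fam S ws0 \<omega>}"
    by (rule measure_Un_le) (intro sets_label_neq; measurable)+
  also have "\<dots> \<le> \<epsilon>P / 2 + real (length ws0) * (2 * \<eta>)"
    using R0(5) order_trans[OF fam_diff_le[OF fin_ent_label[OF Q(1)] S(2) R0(1)] mult_left_mono[OF QS, of "real (length ws0)"]]
    by simp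
  also have "\<dots> \<le> \<epsilon>P" using \<epsilon>P unfolding \<eta>_def by (simp add: field_simps)
  finally have "measure M {\<omega> \<in> space M. trunc N P \<omega> \<noteq> R \<omega>} \<le> \<epsilon>P" .
  then have cP: "fin_ent M (correction P R)" "ent M (correction P R) \<le> \<delta>"
    using approximableD(1,2)[OF corrP R] g(1) by (simp_all add: R_def)
  \<comment> \<open>The correction makes \<open>P\<close> recoverable from finitely many translates
    of \<open>Q'\<close>, while \<open>Q'\<close> stays determined by finitely many translates of
    \<open>P\<close>; its small entropy keeps \<open>Q'\<close> close to \<open>Q\<close>.\<close>
  define Q' where "Q' = pair S (correction P R)"
  have tQ: "fin_ent M (trunc L Q)" by (rule ent_mono(1)[OF trunc_coarser _ Q(1)]) measurable
  have Sfin: "fin_ent M S"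
    by (rule ent_mono(1)[OF coarser_correction S(2) ent_pair_le(1)[OF tQ cQ(3)]])
  have Q'fin: "fin_ent M Q'" unfolding Q'_def by (rule ent_pair_le(1)[OF Sfin cP(1)])
  note Q'l = fin_ent_label[OF Q'fin]
  have "ent M (pair Q Q') \<le> ent M (pair Q' (correction Q S))"
  proof (rule ent_mono(2)[OF coarser_pairI])
    show "coarser M Q (pair Q' (correction Q S))"
      by (rule coarser_trans[OF coarser_correction[of M Q S]])
         (rule coarser_pairI[OF coarser_pairL coarser_pair2], simp add: Q'_def)
  qed (use ent_pair_le(1)[OF Q'fin cQ(1)] Q'l in \<open>auto intro: measurable_pair_label fin_ent_label[OF Q(1)]\<close>)
  also have "\<dots> \<le> ent M Q' + \<delta>" using ent_pair_le(2)[OF Q'fin cQ(1)] cQ(2) by linarith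
  finally have h1: "ent M (pair Q Q') - ent M Q' \<le> \<delta>" by simp
  let ?c = "pair (correction S (trunc L Q)) (correction P R)"
  have cfin: "fin_ent M ?c" by (rule ent_pair_le(1)[OF cQ(3) cP(1)])
  have "ent M (pair Q Q') \<le> ent M (pair Q ?c)"
  proof (rule ent_mono(2)[OF coarser_pairI])
    have "coarser M S (pair Q ?c)"
      by (rule coarser_trans[OF coarser_correction[of M S "trunc L Q"]])
         (auto intro!: coarser_pairI intro: coarser_pairL[OF trunc_coarser] coarser_pairR[OF coarser_pair1])
    then show "coarser M Q' (pair Q ?c)" unfolding Q'_def by (auto intro!: coarser_pairI coarser_pairR[OF coarser_pair2])
  qed (use ent_pair_le(1)[OF Q(1) cfin] Q'l in \<open>auto intro: measurable_pair_label fin_ent_label[OF Q(1)]\<close>)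
  also have "\<dots> \<le> ent M Q + 2 * \<delta>"
    using ent_pair_le(2)[OF Q(1) cfin] ent_pair_le(2)[OF cQ(3) cP(1)] cP cQ by linarith
  finally have h2: "ent M (pair Q Q') - ent M Q \<le> 2 * \<delta>" by simp
  have FQ': "F_label Q' \<le> F_label Q + \<epsilon>"
    using F_label_continuous[OF Q(1) Q'fin] h1 h2 by (simp add: \<delta>_def)
  obtain us1 where us1: "set us1 \<subseteq> carrier F2" "coarser M (fam S ws0) (fam P us1)"
    using coarser_fam_fam[OF S(4,1) R0(1)] by auto
  define us where "us = [] # ws1 @ us1"
  have usc: "set us \<subseteq> carrier F2" using S(1) us1(1) by (simp add: us_def)
  have Pus: "coarser M P (fam P us)"
    using coarser_famI[of "[]" us P] by (simp add: us_def coarser_id_iff)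
  have Q'us: "coarser M Q' (fam P us)" unfolding Q'_def
  proof (rule coarser_pairI)
    show "coarser M S (fam P us)"
      by (rule coarser_trans[OF S(4) coarser_fam_subset]) (auto simp: us_def)
    have "coarser M R (fam P us)"
      by (rule coarser_trans[OF RS coarser_trans[OF us1(2) coarser_fam_subset]]) (auto simp: us_def)
    then show "coarser M (correction P R) (fam P us)"
      by (rule coarser_trans[OF correction_coarser coarser_pairI[OF Pus]])
  qed
  have PQ': "coarser M P (fam Q' ([] # ws0))"
  proof (rule coarser_trans[OF coarser_correction[of M P R] coarser_pairI])
    have Q'n: "coarser M Q' (fam Q' ([] # ws0))"
      using coarser_famI[of "[]" "[] # ws0" Q'] by (simp add: coarser_id_iff)
    show "coarser M (correction P R) (fam Q' ([] # ws0))"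
      by (rule coarser_trans[OF _ Q'n]) (simp add: Q'_def)
    have SQ': "coarser M (fam S ws0) (fam Q' ws0)"
      unfolding coarser_fam_iff
    proof
      fix w assume w: "w \<in> set ws0"
      then have "w \<in> carrier F2" using R0(1) by auto
      then have "coarser M (\<lambda>\<omega>. S (T w \<omega>)) (\<lambda>\<omega>. Q' (T w \<omega>))"
        by (intro coarser_T) (simp_all add: Q'_def)
      then show "coarser M (\<lambda>\<omega>. S (T w \<omega>)) (fam Q' ws0)" by (rule coarser_trans[OF _ coarser_famI[OF w]])
    qed
    show "coarser M R (fam Q' ([] # ws0))"
      by (rule coarser_trans[OF RS coarser_trans[OF SQ' coarser_fam_subset]]) auto
  qed
  \<comment> \<open>Splittings of \<open>Q'\<close> lead to a refinement that determines
    \<open>P\<close>.\<close>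
  obtain ws2 where ws2: "set ([] # ws0) \<subseteq> set ws2" "set ws2 \<subseteq> carrier F2"
    "fin_ent M (pair Q' (fam Q' ws2))" "F_label (pair Q' (fam Q' ws2)) \<le> F_label Q'"
    using F_label_adjoin_words[of "[] # ws0", OF _ Q'l Q'fin coarser_refl] R0(1) by auto
  let ?\<beta> = "pair Q' (fam Q' ws2)"
  have P\<beta>: "coarser M P ?\<beta>"
    by (rule coarser_pairR[OF coarser_trans[OF PQ' coarser_fam_subset[OF ws2(1)]]])
  obtain us2 where us2: "set us2 \<subseteq> carrier F2" "coarser M (fam Q' ws2) (fam P us2)"
    using coarser_fam_fam[OF Q'us usc ws2(2)] by auto
  \<comment> \<open>Splittings along translates of \<open>P\<close> continue until \<open>us\<close>
    recovers \<open>Q'\<close> and \<open>us2\<close> its adjoined translates; the result is then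
    equivalent to a refinement of \<open>P\<close> alone.\<close>
  obtain ws3 where ws3: "set (us @ us2) \<subseteq> set ws3" "set ws3 \<subseteq> carrier F2"
    "fin_ent M (pair ?\<beta> (fam P ws3))" "F_label (pair ?\<beta> (fam P ws3)) \<le> F_label ?\<beta>"
    using F_label_adjoin_words[of "us @ us2", OF _ fin_ent_label[OF P(1)] ws2(3) P\<beta>] usc us2(1) by auto
  have "F_label (fam P ws3) = F_label (pair ?\<beta> (fam P ws3))"
  proof (rule F_label_cong[OF coarser_pair2 _ label_fam[OF fin_ent_label[OF P(1)] ws3(2)] ws3(3)])
    show "coarser M (pair ?\<beta> (fam P ws3)) (fam P ws3)"
      by (intro coarser_pairI coarser_refl coarser_trans[OF Q'us coarser_fam_subset] coarser_trans[OF us2(2) coarser_fam_subset])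
         (use ws3(1) in auto)
  qed
  then show ?thesis using ws3 ws2 FQ' by (intro exI[of _ ws3]) (auto simp: us_def)
qed

end

subsection \<open>Partitions and labels\<close>

definition labels :: "'x measure \<Rightarrow> 'x set set \<Rightarrow> ('x \<Rightarrow> nat) \<Rightarrow> bool" where
  "labels M P X \<longleftrightarrow> X \<in> measurable M (count_space UNIV) \<and>
     (\<forall>\<omega>\<in>space M. \<forall>\<omega>'\<in>space M. X \<omega> = X \<omega>' \<longleftrightarrow> (\<exists>A\<in>P. \<omega> \<in> A \<and> \<omega>' \<in> A))"

lemma coarser_cong:
  assumes "\<And>\<omega>. \<omega> \<in> space M \<Longrightarrow> X \<omega> = X' \<omega>" "\<And>\<omega>. \<omega> \<in> space M \<Longrightarrow> Y \<omega> = Y' \<omega>" "coarser M X Y"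
  shows "coarser M X' Y'"
  unfolding coarser_def
proof (intro ballI impI)
  fix \<omega> \<omega>' assume w: "\<omega> \<in> space M" "\<omega>' \<in> space M" "Y' \<omega> = Y' \<omega>'"
  then have "X \<omega> = X \<omega>'" using assms(2,3) unfolding coarser_def by metis
  then show "X' \<omega> = X' \<omega>'" using assms(1) w by metis
qed

lemma labelsD:
  assumes "labels M P X" "\<omega> \<in> space M" "\<omega>' \<in> space M"
  shows "X \<omega> = X \<omega>' \<longleftrightarrow> (\<exists>A\<in>P. \<omega> \<in> A \<and> \<omega>' \<in> A)"
  using assms unfolding labels_def by blast

lemma labels_measurable: "labels M P X \<Longrightarrow> X \<in> measurable M (count_space UNIV)"
  by (simp add: labels_def)

lemma labels_atom:
  assumes P: "partition_on (space M) P" and X: "labels M P X" and A: "A \<in> P" "\<omega> \<in> A"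
  shows "A = {\<omega>' \<in> space M. X \<omega>' = X \<omega>}"
proof -
  have sub: "B \<in> P \<Longrightarrow> B \<subseteq> space M" for B using partition_onD1[OF P] by auto
  have w: "\<omega> \<in> space M" using sub[OF A(1)] A(2) by blast
  show ?thesis
  proof (intro Set.set_eqI iffI)
    fix \<omega>' assume "\<omega>' \<in> A"
    then show "\<omega>' \<in> {\<omega>' \<in> space M. X \<omega>' = X \<omega>}"
      using labelsD[OF X _ w, of \<omega>'] A sub by blast
  next
    fix \<omega>' assume "\<omega>' \<in> {\<omega>' \<in> space M. X \<omega>' = X \<omega>}"
    then obtain B where B: "B \<in> P" "\<omega>' \<in> B" "\<omega> \<in> B" using labelsD[OF X _ w, of \<omega>'] by blast
    then have "B = A" using partition_onD2[OF P] A by (auto dest: disjointD)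
    then show "\<omega>' \<in> A" using B by simp
  qed
qed

definition atom_label :: "('x \<Rightarrow> nat) \<Rightarrow> 'x set \<Rightarrow> nat" where
  "atom_label X A = X (SOME \<omega>. \<omega> \<in> A)"

lemma atom_label:
  assumes P: "partition_on (space M) P" and X: "labels M P X" and A: "A \<in> P"
  shows "A = {\<omega> \<in> space M. X \<omega> = atom_label X A}"
proof -
  have "A \<noteq> {}" using partition_onD3[OF P] A by auto
  then have "(SOME \<omega>. \<omega> \<in> A) \<in> A" by (simp add: some_in_eq)
  from labels_atom[OF P X A this] show ?thesis by (simp add: atom_label_def)
qed

lemma inj_on_atom_label:
  assumes "partition_on (space M) P" "labels M P X"
  shows "inj_on (atom_label X) P"
proof (rule inj_onI)
  fix A B assume "A \<in> P" "B \<in> P" "atom_label X A = atom_label X B"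
  then show "A = B" using atom_label[OF assms, of A] atom_label[OF assms, of B] by simp
qed

lemma measurable_partition_labels:
  assumes P: "partition_on (space M) P" and X: "labels M P X"
  shows "measurable_partition M P"
proof -
  note [measurable] = labels_measurable[OF X]
  have "countable P" using inj_on_atom_label[OF P X] by (rule countableI)
  moreover have "A \<in> sets M" if "A \<in> P" for A
    by (subst atom_label[OF P X that]) measurable
  ultimately show ?thesis using P by (auto simp: measurable_partition_def)
qed

lemma labels_exists:
  assumes "measurable_partition M P"
  shows "\<exists>X. labels M P X"
proof -
  have P: "partition_on (space M) P" "countable P" "P \<subseteq> sets M"
    using assms by (auto simp: measurable_partition_def)
  define atom where "atom \<omega> = (THE A. A \<in> P \<and> \<omega> \<in> A)" for \<omega>
  have atom: "atom \<omega> = A" if "A \<in> P" "\<omega> \<in> A" for A \<omega>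
    unfolding atom_def using partition_onD2[OF P(1)] that by (intro the_equality) (auto dest: disjointD)
  have ex: "\<exists>A\<in>P. \<omega> \<in> A" if "\<omega> \<in> space M" for \<omega>
    using partition_onD1[OF P(1)] that by auto
  define X where "X \<omega> = to_nat_on P (atom \<omega>)" for \<omega>
  have eq: "X \<omega> = X \<omega>' \<longleftrightarrow> (\<exists>A\<in>P. \<omega> \<in> A \<and> \<omega>' \<in> A)" if w: "\<omega> \<in> space M" "\<omega>' \<in> space M" for \<omega> \<omega>'
  proof -
    obtain A B where AB: "A \<in> P" "\<omega> \<in> A" "B \<in> P" "\<omega>' \<in> B" using ex w by metis
    then have "X \<omega> = X \<omega>' \<longleftrightarrow> A = B" using P(2) by (simp add: X_def atom to_nat_on_inj)
    moreover have "A = B" if "C \<in> P" "\<omega> \<in> C" "\<omega>' \<in> C" for C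
      using atom AB that by metis
    ultimately show ?thesis using AB by metis
  qed
  have "X -` {i} \<inter> space M \<in> sets M" for i
  proof (cases "\<exists>\<omega>\<in>space M. X \<omega> = i")
    case True
    then obtain \<omega> A where w: "\<omega> \<in> space M" "X \<omega> = i" "A \<in> P" "\<omega> \<in> A" using ex by metis
    have "X -` {i} \<inter> space M = A"
    proof (intro Set.set_eqI iffI)
      fix \<omega>' assume "\<omega>' \<in> X -` {i} \<inter> space M"
      then have "X \<omega> = X \<omega>'" "\<omega>' \<in> space M" using w by auto
      then obtain B where "B \<in> P" "\<omega> \<in> B" "\<omega>' \<in> B" using eq w by metis
      then show "\<omega>' \<in> A" using atom w by metis
    next
      fix \<omega>' assume a: "\<omega>' \<in> A"
      then have "\<omega>' \<in> space M" using w(3) partition_onD1[OF P(1)] by auto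
      then show "\<omega>' \<in> X -` {i} \<inter> space M" using eq[of \<omega> \<omega>'] a w by auto
    qed
    then show ?thesis using w P(3) by auto
  next
    case False
    then have "X -` {i} \<inter> space M = {}" by auto
    then show ?thesis by simp
  qed
  then have "X \<in> measurable M (count_space UNIV)"
    by (subst measurable_count_space_eq_countable) auto
  then show ?thesis using eq unfolding labels_def by blast
qed

lemma infsum_nat_ennreal: "infsum f (UNIV :: nat set) = (\<Sum>i. (f i :: ennreal))"
proof -
  have "(f has_sum infsum f UNIV) UNIV"
    by (intro has_sum_infsum nonneg_summable_on_complete) simp
  then show ?thesis by (intro sums_unique has_sum_imp_sums)
qed

lemma join_partition:
  assumes P: "partition_on S P" and Q: "partition_on S Q"
  shows "partition_on S (join P Q)"
proof (rule partition_onI)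
  have S: "\<Union>P = S" "\<Union>Q = S" using partition_onD1[OF P] partition_onD1[OF Q] by auto
  show "\<Union>(join P Q) = S"
  proof (intro subset_antisym subsetI)
    fix x assume "x \<in> S"
    then obtain A B where "A \<in> P" "B \<in> Q" "x \<in> A \<inter> B" using S by blast
    then show "x \<in> \<Union>(join P Q)" unfolding join_def by blast
  qed (use S in \<open>auto simp: join_def\<close>)
  show "disjnt p q" if pq: "p \<in> join P Q" "q \<in> join P Q" "p \<noteq> q" for p q
  proof -
    obtain A B C D where AB: "p = A \<inter> B" "q = C \<inter> D" "A \<in> P" "B \<in> Q" "C \<in> P" "D \<in> Q"
      using pq unfolding join_def by blast
    then have "A \<noteq> C \<or> B \<noteq> D" using pq(3) by blast
    then have "A \<inter> C = {} \<or> B \<inter> D = {}"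
      using disjointD[OF partition_onD2[OF P] AB(3,5)] disjointD[OF partition_onD2[OF Q] AB(4,6)] by blast
    then show ?thesis unfolding disjnt_def AB(1,2) by blast
  qed
qed (auto simp: join_def)

lemma labels_join:
  assumes P: "partition_on (space M) P" "labels M P X" and Q: "partition_on (space M) Q" "labels M Q Y"
  shows "labels M (join P Q) (pair X Y)"
  unfolding labels_def
proof (intro conjI ballI)
  show "pair X Y \<in> measurable M (count_space UNIV)"
    by (rule measurable_pair_label[OF labels_measurable[OF P(2)] labels_measurable[OF Q(2)]])
  fix \<omega> \<omega>' assume w: "\<omega> \<in> space M" "\<omega>' \<in> space M"
  have "pair X Y \<omega> = pair X Y \<omega>' \<longleftrightarrow> (\<exists>A\<in>P. \<omega> \<in> A \<and> \<omega>' \<in> A) \<and> (\<exists>A\<in>Q. \<omega> \<in> A \<and> \<omega>' \<in> A)"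
    using labelsD[OF P(2) w] labelsD[OF Q(2) w] by (simp add: pair_def)
  also have "\<dots> \<longleftrightarrow> (\<exists>A\<in>join P Q. \<omega> \<in> A \<and> \<omega>' \<in> A)"
  proof
    assume "(\<exists>A\<in>P. \<omega> \<in> A \<and> \<omega>' \<in> A) \<and> (\<exists>A\<in>Q. \<omega> \<in> A \<and> \<omega>' \<in> A)"
    then obtain A B where AB: "A \<in> P" "\<omega> \<in> A" "\<omega>' \<in> A" "B \<in> Q" "\<omega> \<in> B" "\<omega>' \<in> B" by auto
    then have "A \<inter> B \<in> join P Q" by (auto simp: join_def)
    moreover have "\<omega> \<in> A \<inter> B \<and> \<omega>' \<in> A \<inter> B" using AB by simp
    ultimately show "\<exists>A\<in>join P Q. \<omega> \<in> A \<and> \<omega>' \<in> A" by (rule bexI[rotated])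
  next
    assume "\<exists>A\<in>join P Q. \<omega> \<in> A \<and> \<omega>' \<in> A"
    then obtain A B where "A \<in> P" "\<omega> \<in> A \<inter> B" "\<omega>' \<in> A \<inter> B" "B \<in> Q"
      unfolding join_def by blast
    then show "(\<exists>A\<in>P. \<omega> \<in> A \<and> \<omega>' \<in> A) \<and> (\<exists>A\<in>Q. \<omega> \<in> A \<and> \<omega>' \<in> A)" by blast
  qed
  finally show "pair X Y \<omega> = pair X Y \<omega>' \<longleftrightarrow> (\<exists>A\<in>join P Q. \<omega> \<in> A \<and> \<omega>' \<in> A)" .
qed

context prob_space
begin

lemma shannon_entropy_labels:
  assumes P: "partition_on (space M) P" and X: "labels M P X"
  shows "shannon_entropy M P = (\<integral>\<^sup>+\<omega>. ennreal (- ln (atom_prob M X \<omega>)) \<partial>M)"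
proof -
  let ?e = "\<lambda>i. ennreal (- measure M {\<omega> \<in> space M. X \<omega> = i} * ln (measure M {\<omega> \<in> space M. X \<omega> = i}))"
  have "shannon_entropy M P = infsum (?e \<circ> atom_label X) P"
    unfolding shannon_entropy_def comp_def
  proof (rule infsum_cong)
    fix A assume "A \<in> P"
    then have "measure M A = measure M {\<omega> \<in> space M. X \<omega> = atom_label X A}"
      by (rule arg_cong[OF atom_label[OF P X]])
    then show "ennreal (- measure M A * ln (measure M A)) = ?e (atom_label X A)" by presburger
  qed
  also have "\<dots> = infsum ?e (atom_label X ` P)"
    by (rule infsum_reindex[symmetric, OF inj_on_atom_label[OF P X]])
  also have "\<dots> = infsum ?e UNIV"
  \<comment> \<open>Numbers that label no atom contribute \<open>0 * ln 0 = 0\<close>.\<close>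
  proof (rule infsum_cong_neutral)
    fix i assume i: "i \<in> UNIV - atom_label X ` P"
    have "{\<omega> \<in> space M. X \<omega> = i} = {}"
    proof (rule ccontr)
      assume "{\<omega> \<in> space M. X \<omega> = i} \<noteq> {}"
      then obtain \<omega> where w: "\<omega> \<in> space M" "X \<omega> = i" by auto
      then obtain A where "A \<in> P" "\<omega> \<in> A" using partition_onD1[OF P] by auto
      then have "\<omega> \<in> {\<omega> \<in> space M. X \<omega> = atom_label X A}" using atom_label[OF P X, of A] by simp
      then show False using i \<open>A \<in> P\<close> w by auto
    qed
    then show "?e i = 0" by (simp only: measure_empty) simp
  qed auto
  also have "\<dots> = (\<integral>\<^sup>+\<omega>. ennreal (- ln (atom_prob M X \<omega>)) \<partial>M)"
    by (simp add: infsum_nat_ennreal nn_integral_info[OF labels_measurable[OF X]])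
  finally show ?thesis .
qed

lemma shannon_entropy_finite_iff:
  assumes "partition_on (space M) P" and X: "labels M P X"
  shows "shannon_entropy M P < \<infinity> \<longleftrightarrow> fin_ent M X"
  using shannon_entropy_labels[OF assms] labels_measurable[OF X] info_nonneg[of X]
  unfolding fin_ent_def by (auto simp: integrable_iff_bounded)

lemma shannon_entropy_eq_ent:
  assumes "partition_on (space M) P" "labels M P X" "fin_ent M X"
  shows "shannon_entropy M P = ennreal (ent M X)"
  unfolding shannon_entropy_labels[OF assms(1,2)] ent_def
  using assms(3) info_nonneg[of X] by (subst nn_integral_eq_integral) (auto simp: fin_ent_def)

end

context F2_pmp
begin

lemma inv_carrier: "g \<in> carrier F2 \<Longrightarrow> inv\<^bsub>F2\<^esub> g \<in> carrier F2"
  by (rule group.inv_closed[OF F2_group])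

lemma T_inv:
  assumes "g \<in> carrier F2" "\<omega> \<in> space M"
  shows "T (inv\<^bsub>F2\<^esub> g) (T g \<omega>) = \<omega>" "T g (T (inv\<^bsub>F2\<^esub> g) \<omega>) = \<omega>"
  using T_mult[OF inv_carrier[OF assms(1)] assms(1) assms(2)] T_mult[OF assms(1) inv_carrier[OF assms(1)] assms(2)]
    group.l_inv[OF F2_group assms(1)] group.r_inv[OF F2_group assms(1)] T_one[OF assms(2)] by (simp_all add: F2_one)

text \<open>A point lies in the image of an atom under \<open>T g\<close> exactly if its inverse
  translate lies in the atom, whence the inverse in the label.\<close>

lemma translate_partition:
  assumes P: "partition_on (space M) P" and X: "labels M P X" and g: "g \<in> carrier F2"
  shows "partition_on (space M) ((`) (T g) ` P)"
    "labels M ((`) (T g) ` P) (\<lambda>\<omega>. X (T (inv\<^bsub>F2\<^esub> g) \<omega>))"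
proof -
  have sub: "A \<in> P \<Longrightarrow> A \<subseteq> space M" for A using partition_onD1[OF P] by auto
  have img: "\<omega> \<in> T g ` A \<longleftrightarrow> T (inv\<^bsub>F2\<^esub> g) \<omega> \<in> A" if "\<omega> \<in> space M" "A \<in> P" for \<omega> A
  proof
    assume "\<omega> \<in> T g ` A"
    then show "T (inv\<^bsub>F2\<^esub> g) \<omega> \<in> A" using T_inv(1)[OF g] sub[OF that(2)] by auto
  next
    assume "T (inv\<^bsub>F2\<^esub> g) \<omega> \<in> A"
    then show "\<omega> \<in> T g ` A" using T_inv(2)[OF g that(1)] by (metis imageI)
  qed
  have imgs: "T g ` A \<subseteq> space M" if "A \<in> P" for A using sub[OF that] T_space[OF g] by auto
  show "partition_on (space M) ((`) (T g) ` P)"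
  proof (rule partition_onI)
    show "\<Union> ((`) (T g) ` P) = space M"
    proof (intro subset_antisym subsetI)
      fix \<omega> assume w: "\<omega> \<in> space M"
      then have "T (inv\<^bsub>F2\<^esub> g) \<omega> \<in> \<Union>P" using T_space[OF inv_carrier[OF g] w] partition_onD1[OF P] by simp
      then show "\<omega> \<in> \<Union> ((`) (T g) ` P)" using img[OF w] by auto
    qed (use imgs in auto)
    show "disjnt p q" if pq: "p \<in> (`) (T g) ` P" "q \<in> (`) (T g) ` P" "p \<noteq> q" for p q
    proof -
      obtain A B where AB: "p = T g ` A" "q = T g ` B" "A \<in> P" "B \<in> P" using pq by auto
      then have "A \<inter> B = {}" using partition_onD2[OF P] pq(3) by (auto dest: disjointD)
      then show ?thesis using img AB imgs unfolding disjnt_def by blast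
    qed
    show "{} \<notin> (`) (T g) ` P" using partition_onD3[OF P] by auto
  qed
  show "labels M ((`) (T g) ` P) (\<lambda>\<omega>. X (T (inv\<^bsub>F2\<^esub> g) \<omega>))"
    unfolding labels_def
  proof (intro conjI ballI)
    show "(\<lambda>\<omega>. X (T (inv\<^bsub>F2\<^esub> g) \<omega>)) \<in> measurable M (count_space UNIV)"
      by (rule label_T[OF labels_measurable[OF X] inv_carrier[OF g]])
    fix \<omega> \<omega>' assume w: "\<omega> \<in> space M" "\<omega>' \<in> space M"
    have "X (T (inv\<^bsub>F2\<^esub> g) \<omega>) = X (T (inv\<^bsub>F2\<^esub> g) \<omega>') \<longleftrightarrow>
        (\<exists>A\<in>P. T (inv\<^bsub>F2\<^esub> g) \<omega> \<in> A \<and> T (inv\<^bsub>F2\<^esub> g) \<omega>' \<in> A)"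
      by (rule labelsD[OF X T_space[OF inv_carrier[OF g] w(1)] T_space[OF inv_carrier[OF g] w(2)]])
    also have "\<dots> \<longleftrightarrow> (\<exists>A\<in>(`) (T g) ` P. \<omega> \<in> A \<and> \<omega>' \<in> A)"
      using img[OF w(1)] img[OF w(2)] by blast
    finally show "X (T (inv\<^bsub>F2\<^esub> g) \<omega>) = X (T (inv\<^bsub>F2\<^esub> g) \<omega>') \<longleftrightarrow> (\<exists>A\<in>(`) (T g) ` P. \<omega> \<in> A \<and> \<omega>' \<in> A)" .
  qed
qed

lemma refined_partition_labels:
  assumes P: "partition_on (space M) P" and X: "labels M P X" and ws: "set ws \<subseteq> carrier F2"
  shows "partition_on (space M) (refined_partition M T P (set ws))"
    "labels M (refined_partition M T P (set ws)) (fam X ws)"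
proof -
  let ?R = "refined_partition M T P (set ws)"
  have choice: "\<exists>A\<in>set ws \<rightarrow> P. \<forall>w\<in>set ws. T w \<omega> \<in> A w" if w: "\<omega> \<in> space M" for \<omega>
  proof -
    have "\<forall>w\<in>set ws. \<exists>A\<in>P. T w \<omega> \<in> A"
      using T_space[OF _ w] ws partition_onD1[OF P] by blast
    then show ?thesis by (metis Pi_I)
  qed
  show "partition_on (space M) ?R"
  proof (rule partition_onI)
    show "\<Union>?R = space M"
    proof (intro subset_antisym subsetI)
      fix \<omega> assume w: "\<omega> \<in> space M"
      then obtain A where A: "A \<in> set ws \<rightarrow> P" "\<forall>w\<in>set ws. T w \<omega> \<in> A w" using choice by blast
      then have "{x \<in> space M. \<forall>w\<in>set ws. T w x \<in> A w} \<in> ?R" using w by (auto simp: refined_partition_def)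
      then show "\<omega> \<in> \<Union>?R" using w A by blast
    qed (auto simp: refined_partition_def)
    show "disjnt p q" if pq: "p \<in> ?R" "q \<in> ?R" "p \<noteq> q" for p q
    proof (rule ccontr)
      assume "\<not> disjnt p q"
      then obtain \<omega> where w: "\<omega> \<in> p" "\<omega> \<in> q" by (auto simp: disjnt_def)
      obtain A B where AB: "A \<in> set ws \<rightarrow> P" "p = {x \<in> space M. \<forall>w\<in>set ws. T w x \<in> A w}"
        "B \<in> set ws \<rightarrow> P" "q = {x \<in> space M. \<forall>w\<in>set ws. T w x \<in> B w}"
        using pq by (auto simp: refined_partition_def)
      have "A w = B w" if "w \<in> set ws" for w
        using partition_onD2[OF P] w AB that by (auto dest!: disjointD[of P "A w" "B w"])
      then show False using AB pq(3) by auto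
    qed
  qed (auto simp: refined_partition_def)
  show "labels M ?R (fam X ws)"
    unfolding labels_def
  proof (intro conjI ballI label_fam labels_measurable[OF X] ws)
    fix \<omega> \<omega>' assume w: "\<omega> \<in> space M" "\<omega>' \<in> space M"
    have "fam X ws \<omega> = fam X ws \<omega>' \<longleftrightarrow> (\<forall>w\<in>set ws. X (T w \<omega>) = X (T w \<omega>'))"
      by (simp add: fam_def list_encode_eq)
    also have "\<dots> \<longleftrightarrow> (\<forall>w\<in>set ws. \<exists>A\<in>P. T w \<omega> \<in> A \<and> T w \<omega>' \<in> A)"
      using labelsD[OF X T_space[OF _ w(1)] T_space[OF _ w(2)]] ws by (intro ball_cong) auto
    also have "\<dots> \<longleftrightarrow> (\<exists>A\<in>?R. \<omega> \<in> A \<and> \<omega>' \<in> A)"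
    proof
      assume "\<forall>w\<in>set ws. \<exists>A\<in>P. T w \<omega> \<in> A \<and> T w \<omega>' \<in> A"
      then obtain A where "\<forall>w\<in>set ws. A w \<in> P \<and> T w \<omega> \<in> A w \<and> T w \<omega>' \<in> A w" by metis
      then show "\<exists>A\<in>?R. \<omega> \<in> A \<and> \<omega>' \<in> A"
        using w by (intro bexI[of _ "{x \<in> space M. \<forall>w\<in>set ws. T w x \<in> A w}"]) (auto simp: refined_partition_def)
    qed (auto simp: refined_partition_def)
    finally show "fam X ws \<omega> = fam X ws \<omega>' \<longleftrightarrow> (\<exists>A\<in>?R. \<omega> \<in> A \<and> \<omega>' \<in> A)" .
  qed
qed

text \<open>The join with the image under a generator has the label of the inverse letter;
  \<open>J_letter_inverse\<close> replaces it by the letter itself. Finiteness of the entropies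
  makes the extended real expression an ordinary sum.\<close>

lemma F_functional_eq:
  assumes P: "partition_on (space M) P" and X: "labels M P X" and f: "fin_ent M X"
  shows "F_functional (free_gens {gen_a, gen_b}) M T P = ereal (F_label X)"
proof -
  have e: "enn2ereal (shannon_entropy M P) = ereal (ent M X)"
    using shannon_entropy_eq_ent[OF P X f] ent_nonneg[of X] by (simp add: enn2ereal_ennreal)
  have j: "enn2ereal (shannon_entropy M (join P ((`) (T [(s, True)]) ` P))) = ereal (J [(s, True)] X)" for s
  proof -
    have i: "inv\<^bsub>F2\<^esub> [(s, True)] = [(s, False)]" by (rule inv_free_gen) (cases s; simp)
    note tp = translate_partition[OF P X letter_carrier, of "(s, True)", unfolded i]
    have fj: "fin_ent M (pair X (\<lambda>\<omega>. X (T [(s, False)] \<omega>)))" by (rule fin_JT[OF f letter_carrier])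
    have "shannon_entropy M (join P ((`) (T [(s, True)]) ` P)) = ennreal (J [(s, False)] X)"
      unfolding J_def
      by (rule shannon_entropy_eq_ent[OF join_partition[OF P tp(1)] labels_join[OF P X tp] fj])
    moreover have "J [(s, False)] X = J [(s, True)] X"
      using J_letter_inverse[OF f, of "(s, True)"] by (simp add: inv_letter_def)
    moreover have "0 \<le> J [(s, True)] X" unfolding J_def by (rule ent_nonneg)
    ultimately show ?thesis by (simp add: enn2ereal_ennreal)
  qed
  have "free_gens {gen_a, gen_b} = {[(gen_a, True)], [(gen_b, True)]}" by (auto simp: free_gens_def)
  then show ?thesis unfolding F_functional_def F_label_def by (simp add: e j)
qed

text \<open>For finite unions the windows are concatenated; a countable union is approximated by a
  finite one, by continuity from below.\<close>

lemma dense_label_sigma_algebra: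
  assumes X: "X \<in> measurable M (count_space UNIV)"
  defines "\<D> \<equiv> {B \<in> sets M. \<forall>\<epsilon>>0. \<exists>ws S. set ws \<subseteq> carrier F2 \<and> S \<in> sets M \<and>
     coarser M (indicator S) (fam X ws) \<and> measure M {\<omega> \<in> space M. \<omega> \<in> B \<longleftrightarrow> \<omega> \<notin> S} < \<epsilon>}"
  shows "sigma_algebra (space M) \<D>"
proof -
  have D: "\<exists>ws S. set ws \<subseteq> carrier F2 \<and> S \<in> sets M \<and>
     coarser M (indicator S) (fam X ws) \<and> measure M {\<omega> \<in> space M. \<omega> \<in> B \<longleftrightarrow> \<omega> \<notin> S} < \<epsilon>"
    if "B \<in> \<D>" "0 < \<epsilon>" for B \<epsilon>
    using that unfolding \<D>_def by blast
  have Un: "A \<union> B \<in> \<D>" if A: "A \<in> \<D>" and B: "B \<in> \<D>" for A B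
    unfolding \<D>_def
  proof (intro CollectI conjI allI impI)
    show "A \<union> B \<in> sets M" using A B by (auto simp: \<D>_def)
    fix \<epsilon> :: real assume e: "0 < \<epsilon>"
    obtain ws S where S: "set ws \<subseteq> carrier F2" "S \<in> sets M" "coarser M (indicator S) (fam X ws)"
      "measure M {\<omega> \<in> space M. \<omega> \<in> A \<longleftrightarrow> \<omega> \<notin> S} < \<epsilon> / 2"
      using D[OF A half_gt_zero[OF e]] by blast
    obtain vs R where R: "set vs \<subseteq> carrier F2" "R \<in> sets M" "coarser M (indicator R) (fam X vs)"
      "measure M {\<omega> \<in> space M. \<omega> \<in> B \<longleftrightarrow> \<omega> \<notin> R} < \<epsilon> / 2"
      using D[OF B half_gt_zero[OF e]] by blast
    have AB[measurable]: "A \<in> sets M" "B \<in> sets M" using A B by (auto simp: \<D>_def)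
    note [measurable] = S(2) R(2)
    have "measure M {\<omega> \<in> space M. \<omega> \<in> A \<union> B \<longleftrightarrow> \<omega> \<notin> S \<union> R} \<le>
        measure M ({\<omega> \<in> space M. \<omega> \<in> A \<longleftrightarrow> \<omega> \<notin> S} \<union> {\<omega> \<in> space M. \<omega> \<in> B \<longleftrightarrow> \<omega> \<notin> R})"
      by (rule finite_measure_mono, blast) measurable
    also have "\<dots> \<le> measure M {\<omega> \<in> space M. \<omega> \<in> A \<longleftrightarrow> \<omega> \<notin> S} + measure M {\<omega> \<in> space M. \<omega> \<in> B \<longleftrightarrow> \<omega> \<notin> R}"
      by (rule measure_Un_le) measurable
    finally have m: "measure M {\<omega> \<in> space M. \<omega> \<in> A \<union> B \<longleftrightarrow> \<omega> \<notin> S \<union> R} < \<epsilon>" using S R by linarith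
    have c: "coarser M (indicator S :: _ \<Rightarrow> nat) (fam X (ws @ vs))" "coarser M (indicator R :: _ \<Rightarrow> nat) (fam X (ws @ vs))"
      using coarser_trans[OF S(3) coarser_fam_subset] coarser_trans[OF R(3) coarser_fam_subset] by auto
    have "coarser M (indicator (S \<union> R)) (fam X (ws @ vs))"
      unfolding coarser_def
    proof (intro ballI impI)
      fix \<omega> \<omega>' assume "\<omega> \<in> space M" "\<omega>' \<in> space M" "fam X (ws @ vs) \<omega> = fam X (ws @ vs) \<omega>'"
      then have "(indicator R \<omega> :: nat) = indicator R \<omega>'" "(indicator S \<omega> :: nat) = indicator S \<omega>'"
        using c unfolding coarser_def by blast+
      then show "(indicator (S \<union> R) \<omega> :: nat) = indicator (S \<union> R) \<omega>'" by (auto simp: indicator_def split: if_splits)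
    qed
    then show "\<exists>ws S. set ws \<subseteq> carrier F2 \<and> S \<in> sets M \<and>
        coarser M (indicator S) (fam X ws) \<and> measure M {\<omega> \<in> space M. \<omega> \<in> A \<union> B \<longleftrightarrow> \<omega> \<notin> S} < \<epsilon>"
      using m S R by (intro exI[of _ "ws @ vs"] exI[of _ "S \<union> R"]) auto
  qed
  have empty: "{} \<in> \<D>"
    unfolding \<D>_def by (auto intro!: exI[of _ "[]"] exI[of _ "{}"] simp: coarser_def)
  show ?thesis
    unfolding sigma_algebra_iff2
  proof (intro conjI ballI allI impI)
    show "\<D> \<subseteq> Pow (space M)" using sets.sets_into_space by (auto simp: \<D>_def)
    show "{} \<in> \<D>" by (rule empty)
    fix B assume B: "B \<in> \<D>"
    show "space M - B \<in> \<D>"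
      unfolding \<D>_def
    proof (intro CollectI conjI allI impI)
      show "space M - B \<in> sets M" using B by (auto simp: \<D>_def)
      fix \<epsilon> :: real assume e: "0 < \<epsilon>"
      obtain ws S where S: "set ws \<subseteq> carrier F2" "S \<in> sets M" "coarser M (indicator S) (fam X ws)"
        "measure M {\<omega> \<in> space M. \<omega> \<in> B \<longleftrightarrow> \<omega> \<notin> S} < \<epsilon>"
        using D[OF B e] by blast
      have "coarser M (indicator (space M - S)) (fam X ws)"
        unfolding coarser_def
      proof (intro ballI impI)
        fix \<omega> \<omega>' assume "\<omega> \<in> space M" "\<omega>' \<in> space M" "fam X ws \<omega> = fam X ws \<omega>'"
        then have "(indicator S \<omega> :: nat) = indicator S \<omega>'" using S(3) unfolding coarser_def by blast
        then show "(indicator (space M - S) \<omega> :: nat) = indicator (space M - S) \<omega>'"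
          using \<open>\<omega> \<in> space M\<close> \<open>\<omega>' \<in> space M\<close> by (cases "\<omega> \<in> S"; cases "\<omega>' \<in> S") auto
      qed
      moreover have "{\<omega> \<in> space M. \<omega> \<in> space M - B \<longleftrightarrow> \<omega> \<notin> space M - S} = {\<omega> \<in> space M. \<omega> \<in> B \<longleftrightarrow> \<omega> \<notin> S}" by auto
      ultimately show "\<exists>ws S. set ws \<subseteq> carrier F2 \<and> S \<in> sets M \<and>
        coarser M (indicator S) (fam X ws) \<and> measure M {\<omega> \<in> space M. \<omega> \<in> space M - B \<longleftrightarrow> \<omega> \<notin> S} < \<epsilon>"
        using S by (intro exI[of _ ws] exI[of _ "space M - S"]) auto
    qed
  next
    fix A :: "nat \<Rightarrow> _" assume A: "range A \<subseteq> \<D>"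
    have fin: "(\<Union>i<n. A i) \<in> \<D>" for n
      by (induction n) (use A empty Un in \<open>auto simp: lessThan_Suc\<close>)
    have Am: "A i \<in> sets M" for i using A by (auto simp: \<D>_def)
    show "(\<Union>i. A i) \<in> \<D>"
      unfolding \<D>_def
    proof (intro CollectI conjI allI impI)
      show m[measurable]: "(\<Union>i. A i) \<in> sets M" using Am by auto
      fix \<epsilon> :: real assume e: "0 < \<epsilon>"
      have "(\<lambda>n. measure M (\<Union>i<n. A i)) \<longlonglongrightarrow> measure M (\<Union>n. \<Union>i<n. A i)"
        by (rule finite_Lim_measure_incseq) (use Am in \<open>auto simp: incseq_def intro: less_le_trans\<close>)
      moreover have U: "(\<Union>n. \<Union>i<n. A i) = (\<Union>i. A i)" by auto
      ultimately have "eventually (\<lambda>n. measure M (\<Union>i. A i) - \<epsilon> / 2 < measure M (\<Union>i<n. A i)) sequentially"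
        using e by (intro order_tendstoD(1)) auto
      then obtain n where n: "measure M (\<Union>i. A i) - \<epsilon> / 2 < measure M (\<Union>i<n. A i)"
        unfolding eventually_sequentially by blast
      let ?A = "\<Union>i<n. A i"
      have Anm[measurable]: "?A \<in> sets M" using Am by auto
      obtain ws S where S: "set ws \<subseteq> carrier F2" "S \<in> sets M" "coarser M (indicator S) (fam X ws)"
        "measure M {\<omega> \<in> space M. \<omega> \<in> ?A \<longleftrightarrow> \<omega> \<notin> S} < \<epsilon> / 2"
        using D[OF fin half_gt_zero[OF e]] by blast
      note [measurable] = S(2)
      have "measure M {\<omega> \<in> space M. \<omega> \<in> (\<Union>i. A i) \<longleftrightarrow> \<omega> \<notin> S} \<le>
          measure M ({\<omega> \<in> space M. \<omega> \<in> ?A \<longleftrightarrow> \<omega> \<notin> S} \<union> ((\<Union>i. A i) - ?A))"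
        by (rule finite_measure_mono, blast) measurable
      also have "\<dots> \<le> measure M {\<omega> \<in> space M. \<omega> \<in> ?A \<longleftrightarrow> \<omega> \<notin> S} + measure M ((\<Union>i. A i) - ?A)"
        by (rule measure_Un_le) measurable
      also have "measure M ((\<Union>i. A i) - ?A) = measure M (\<Union>i. A i) - measure M ?A"
        by (rule finite_measure_Diff) auto
      finally have "measure M {\<omega> \<in> space M. \<omega> \<in> (\<Union>i. A i) \<longleftrightarrow> \<omega> \<notin> S} < \<epsilon>" using S n by linarith
      then show "\<exists>ws S. set ws \<subseteq> carrier F2 \<and> S \<in> sets M \<and>
        coarser M (indicator S) (fam X ws) \<and> measure M {\<omega> \<in> space M. \<omega> \<in> (\<Union>i. A i) \<longleftrightarrow> \<omega> \<notin> S} < \<epsilon>"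
        using S by blast
    qed
  qed
qed

text \<open>The approximable sets form a sigma-algebra containing the atoms of \<open>P\<close>, and
  preimages under \<open>T g\<close> are approximated on windows multiplied by \<open>g\<close> on
  the right. The class therefore contains the whole invariant sigma-algebra, and passing to almost
  everywhere equal sets does not change the error.\<close>

lemma dense_label_generating:
  assumes gen: "generating_partition F2 M T P" and X: "labels M P X"
  shows "dense_label X"
proof -
  have P: "partition_on (space M) P" "P \<subseteq> sets M"
    using gen by (auto simp: generating_partition_def measurable_partition_def)
  note lX = labels_measurable[OF X]
  define \<D> where "\<D> = {B \<in> sets M. \<forall>\<epsilon>>0. \<exists>ws S. set ws \<subseteq> carrier F2 \<and> S \<in> sets M \<and>
     coarser M (indicator S) (fam X ws) \<and> measure M {\<omega> \<in> space M. \<omega> \<in> B \<longleftrightarrow> \<omega> \<notin> S} < \<epsilon>}"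
  have sa: "sigma_algebra (space M) \<D>"
    unfolding \<D>_def by (rule dense_label_sigma_algebra[OF lX])
  have "P \<subseteq> \<D>"
  proof
    fix A assume A: "A \<in> P"
    have memA: "\<omega> \<in> A \<longleftrightarrow> X \<omega> = atom_label X A" if "\<omega> \<in> space M" for \<omega>
      using that arg_cong[OF atom_label[OF P(1) X A], of "\<lambda>A. \<omega> \<in> A"] by simp
    have "coarser M (indicator A) (fam X [[]])"
      unfolding coarser_def
    proof (intro ballI impI)
      fix \<omega> \<omega>' assume w: "\<omega> \<in> space M" "\<omega>' \<in> space M" "fam X [[]] \<omega> = fam X [[]] \<omega>'"
      then have "X \<omega> = X \<omega>'" by (simp add: fam_def T_one)
      then have "\<omega> \<in> A \<longleftrightarrow> \<omega>' \<in> A"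
        using memA[OF w(1)] memA[OF w(2)] by simp
      then show "(indicator A \<omega> :: nat) = indicator A \<omega>'" by (auto simp: indicator_def)
    qed
    moreover have "{\<omega> \<in> space M. \<omega> \<in> A \<longleftrightarrow> \<omega> \<notin> A} = {}" by auto
    ultimately show "A \<in> \<D>" unfolding \<D>_def using A P(2)
      by (auto intro!: exI[of _ "[[]]"] exI[of _ A])
  qed
  moreover have "T g -` A \<inter> space M \<in> \<D>" if g: "g \<in> carrier F2" and A: "A \<in> \<D>" for g A
    unfolding \<D>_def
  proof (intro CollectI conjI allI impI)
    have Am: "A \<in> sets M" using A by (simp add: \<D>_def)
    then show "T g -` A \<inter> space M \<in> sets M" by (rule measurable_sets[OF T_measurable[OF g]])
    fix \<epsilon> :: real assume "0 < \<epsilon>"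
    then obtain ws S where S: "set ws \<subseteq> carrier F2" "S \<in> sets M" "coarser M (indicator S) (fam X ws)"
      "measure M {\<omega> \<in> space M. \<omega> \<in> A \<longleftrightarrow> \<omega> \<notin> S} < \<epsilon>"
      using A unfolding \<D>_def by blast
    let ?S = "T g -` S \<inter> space M" and ?ws = "map (\<lambda>w. w \<otimes>\<^bsub>F2\<^esub> g) ws"
    have cS: "coarser M (\<lambda>\<omega>. indicator S (T g \<omega>)) (fam X ?ws)"
      by (rule coarser_trans[OF coarser_T[OF S(3) g] fam_T_coarser[OF S(1) g]])
    have "coarser M (indicator ?S) (fam X ?ws)"
      by (rule coarser_cong[OF _ _ cS]) (auto simp: indicator_def)
    moreover have "?S \<in> sets M" by (rule measurable_sets[OF T_measurable[OF g] S(2)])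
    moreover have "set ?ws \<subseteq> carrier F2" using S(1) mult_carrier g by auto
    moreover have "measure M {\<omega> \<in> space M. \<omega> \<in> T g -` A \<inter> space M \<longleftrightarrow> \<omega> \<notin> ?S} = measure M {\<omega> \<in> space M. \<omega> \<in> A \<longleftrightarrow> \<omega> \<notin> S}"
    proof -
      have "measure M {\<omega> \<in> space M. \<omega> \<in> A \<longleftrightarrow> \<omega> \<notin> S} = measure (distr M M (T g)) {\<omega> \<in> space M. \<omega> \<in> A \<longleftrightarrow> \<omega> \<notin> S}"
        by (simp add: T_distr[OF g])
      also have "\<dots> = measure M (T g -` {\<omega> \<in> space M. \<omega> \<in> A \<longleftrightarrow> \<omega> \<notin> S} \<inter> space M)"
        by (rule measure_distr[OF T_measurable[OF g]]) (use Am S(2) in measurable)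
      also have "T g -` {\<omega> \<in> space M. \<omega> \<in> A \<longleftrightarrow> \<omega> \<notin> S} \<inter> space M = {\<omega> \<in> space M. \<omega> \<in> T g -` A \<inter> space M \<longleftrightarrow> \<omega> \<notin> ?S}"
        using T_space[OF g] by auto
      finally show ?thesis by simp
    qed
    ultimately show "\<exists>ws S. set ws \<subseteq> carrier F2 \<and> S \<in> sets M \<and>
        coarser M (indicator S) (fam X ws) \<and> measure M {\<omega> \<in> space M. \<omega> \<in> T g -` A \<inter> space M \<longleftrightarrow> \<omega> \<notin> S} < \<epsilon>"
      using S(4) by (intro exI[of _ ?ws] exI[of _ ?S] conjI) (assumption | simp only:)+
  qed
  ultimately have sub: "invariant_sigma_algebra F2 M T P \<subseteq> \<D>"
    unfolding invariant_sigma_algebra_def using sa by blast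
  show ?thesis
    unfolding dense_label_def
  proof (intro ballI allI impI)
    fix B and \<epsilon> :: real assume B: "B \<in> sets M" and e: "0 < \<epsilon>"
    then obtain A where A: "A \<in> invariant_sigma_algebra F2 M T P" "AE x in M. x \<in> A \<longleftrightarrow> x \<in> B"
      using gen by (auto simp: generating_partition_def)
    then have AD: "A \<in> \<D>" using sub by auto
    then obtain ws S where S: "set ws \<subseteq> carrier F2" "S \<in> sets M" "coarser M (indicator S) (fam X ws)"
      "measure M {\<omega> \<in> space M. \<omega> \<in> A \<longleftrightarrow> \<omega> \<notin> S} < \<epsilon>"
      using e unfolding \<D>_def by blast
    have [measurable]: "A \<in> sets M" "B \<in> sets M" "S \<in> sets M" using AD S B by (auto simp: \<D>_def)
    have "measure M {\<omega> \<in> space M. \<omega> \<in> B \<longleftrightarrow> \<omega> \<notin> S} = measure M {\<omega> \<in> space M. \<omega> \<in> A \<longleftrightarrow> \<omega> \<notin> S}"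
      by (rule finite_measure_eq_AE) (use A(2) in \<open>auto elim!: eventually_mono\<close>)
    then show "\<exists>ws S. set ws \<subseteq> carrier F2 \<and> S \<in> sets M \<and>
        coarser M (indicator S) (fam X ws) \<and> measure M {\<omega> \<in> space M. \<omega> \<in> B \<longleftrightarrow> \<omega> \<notin> S} < \<epsilon>"
      using S by (intro exI[of _ ws] exI[of _ S]) simp
  qed
qed

text \<open>A single word \<open>w\<close> of the window suffices: translation by its inverse gives
  back \<open>X\<close>.\<close>

lemma dense_label_fam:
  assumes d: "dense_label X" and ws: "set ws \<subseteq> carrier F2" "ws \<noteq> []"
  shows "dense_label (fam X ws)"
  unfolding dense_label_def
proof (intro ballI allI impI)
  fix B and \<epsilon> :: real assume B: "B \<in> sets M" and e: "0 < \<epsilon>"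
  then obtain vs S where S: "set vs \<subseteq> carrier F2" "S \<in> sets M" "coarser M (indicator S) (fam X vs)"
      "measure M {\<omega> \<in> space M. \<omega> \<in> B \<longleftrightarrow> \<omega> \<notin> S} < \<epsilon>"
    using d unfolding dense_label_def by blast
  obtain w where w: "w \<in> set ws" using ws by (cases ws) auto
  then have wc: "w \<in> carrier F2" using ws by auto
  have cX: "coarser M (\<lambda>\<omega>. X (T w (T (inv\<^bsub>F2\<^esub> w) \<omega>))) (\<lambda>\<omega>. fam X ws (T (inv\<^bsub>F2\<^esub> w) \<omega>))"
    using coarser_T[OF coarser_famI[OF w] inv_carrier[OF wc], of X] .
  have "coarser M X (fam (fam X ws) [inv\<^bsub>F2\<^esub> w])"
    by (rule coarser_trans[OF coarser_cong[OF _ _ cX] coarser_famI[of "inv\<^bsub>F2\<^esub> w"]]) (simp_all add: T_inv(2)[OF wc])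
  from coarser_fam_fam[OF this _ S(1)] obtain us where "set us \<subseteq> carrier F2" "coarser M (fam X vs) (fam (fam X ws) us)"
    using inv_carrier[OF wc] by auto
  then show "\<exists>vs S. set vs \<subseteq> carrier F2 \<and> S \<in> sets M \<and>
      coarser M (indicator S) (fam (fam X ws) vs) \<and> measure M {\<omega> \<in> space M. \<omega> \<in> B \<longleftrightarrow> \<omega> \<notin> S} < \<epsilon>"
    using S coarser_trans by blast
qed

text \<open>Both inequalities come from \<open>F_label_generator_le\<close>. Every refinement of
  \<open>P\<close> is dense, so up to an arbitrary error some refinement of \<open>\<alpha>\<close>,
  with nonnegative value, lies below it; conversely some refinement of \<open>P\<close> lies below
  \<open>F_label \<alpha> + e\<close>.\<close>

lemma f_invariant_eq_0:
  assumes \<alpha>: "fin_ent M \<alpha>" "dense_label \<alpha>" "F_label \<alpha> \<le> 0"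
    and nonneg: "\<And>ws. ws \<noteq> [] \<Longrightarrow> set ws \<subseteq> carrier F2 \<Longrightarrow> 0 \<le> F_label (fam \<alpha> ws)"
    and P: "generating_partition F2 M T P" "shannon_entropy M P < \<infinity>"
  shows "f_invariant F2 (free_gens {gen_a, gen_b}) M T P = 0"
proof -
  have mp: "measurable_partition M P" using P by (simp add: generating_partition_def)
  then have part: "partition_on (space M) P" by (simp add: measurable_partition_def)
  obtain X where X: "labels M P X" using labels_exists[OF mp] by blast
  have f: "fin_ent M X" using shannon_entropy_finite_iff[OF part X] P by simp
  have d: "dense_label X" by (rule dense_label_generating[OF P(1) X])
  have F: "F_functional (free_gens {gen_a, gen_b}) M T (refined_partition M T P (set ws)) = ereal (F_label (fam X ws))"
    if "set ws \<subseteq> carrier F2" for ws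
    by (rule F_functional_eq[OF refined_partition_labels[OF part X that] fin_fam[OF f that]])
  show ?thesis
    unfolding f_invariant_def
  proof (intro antisym)
    show "0 \<le> (INF W\<in>{W. finite W \<and> W \<noteq> {} \<and> W \<subseteq> carrier F2}.
        F_functional (free_gens {gen_a, gen_b}) M T (refined_partition M T P W))"
    proof (rule INF_greatest)
      fix W assume W: "W \<in> {W. finite W \<and> W \<noteq> {} \<and> W \<subseteq> carrier F2}"
      then obtain ws where ws: "W = set ws" using finite_list by auto
      then have ws': "ws \<noteq> []" "set ws \<subseteq> carrier F2" using W by auto
      have "0 \<le> F_label (fam X ws)"
      proof (rule field_le_epsilon)
        fix e :: real assume "0 < e"
        then obtain vs where "vs \<noteq> []" "set vs \<subseteq> carrier F2" "F_label (fam \<alpha> vs) \<le> F_label (fam X ws) + e"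
          using F_label_generator_le[OF \<alpha>(1,2) fin_fam[OF f ws'(2)] dense_label_fam[OF d ws'(2,1)]] by blast
        then show "0 \<le> F_label (fam X ws) + e" using nonneg[of vs] by simp
      qed
      then show "0 \<le> F_functional (free_gens {gen_a, gen_b}) M T (refined_partition M T P W)"
        using F[OF ws'(2)] by (simp add: ws)
    qed
    show "(INF W\<in>{W. finite W \<and> W \<noteq> {} \<and> W \<subseteq> carrier F2}.
        F_functional (free_gens {gen_a, gen_b}) M T (refined_partition M T P W)) \<le> 0"
    proof (rule ereal_le_epsilon2)
      fix e :: real assume "0 < e"
      then obtain ws where ws: "ws \<noteq> []" "set ws \<subseteq> carrier F2" "F_label (fam X ws) \<le> F_label \<alpha> + e"
        using F_label_generator_le[OF f d \<alpha>(1,2)] by blast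
      have "(INF W\<in>{W. finite W \<and> W \<noteq> {} \<and> W \<subseteq> carrier F2}.
        F_functional (free_gens {gen_a, gen_b}) M T (refined_partition M T P W)) \<le>
        F_functional (free_gens {gen_a, gen_b}) M T (refined_partition M T P (set ws))"
        by (rule INF_lower) (use ws in auto)
      also have "\<dots> \<le> ereal e" using F[OF ws(2)] ws(3) \<alpha>(3) by simp
      finally show "(INF W\<in>{W. finite W \<and> W \<noteq> {} \<and> W \<subseteq> carrier F2}.
        F_functional (free_gens {gen_a, gen_b}) M T (refined_partition M T P W)) \<le> 0 + ereal e" by simp
    qed
  qed
qed

end

subsection \<open>Fair coins\<close>

text \<open>The values are real numbers to fit the type of configurations in the theorem.\<close>

definition two :: "real measure" where
  "two = uniform_count_measure {0, 1}"

definition zero_one :: "'j set \<Rightarrow> ('j \<Rightarrow> real) set" where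
  "zero_one J = (\<Pi>\<^sub>E j\<in>J. {0, 1})"

definition coin :: "'j set \<Rightarrow> ('j \<Rightarrow> real) measure" where
  "coin J = PiM J (\<lambda>_. two)"

definition cyl :: "'j set \<Rightarrow> 'j set \<Rightarrow> ('j \<Rightarrow> real) \<Rightarrow> ('j \<Rightarrow> real) set" where
  "cyl J D q = {x \<in> zero_one J. \<forall>j\<in>D. x j = q j}"

lemma space_two [simp]: "space two = {0, 1}"
  and sets_two [simp]: "sets two = Pow {0, 1}"
  by (auto simp: two_def space_uniform_count_measure sets_uniform_count_measure)

lemma prob_two: "prob_space two"
  unfolding two_def by (rule prob_space_uniform_count_measure) auto

lemma measure_two: "i \<in> {0, 1} \<Longrightarrow> emeasure two {i} = ennreal (1 / 2)"
  unfolding two_def by (subst emeasure_uniform_count_measure) auto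

lemma space_coin [simp]: "space (coin J) = zero_one J"
  by (simp add: coin_def space_PiM zero_one_def)

lemma prob_coin: "prob_space (coin J)"
  unfolding coin_def by (rule prob_space_PiM) (rule prob_two)

lemma zero_one_D: "x \<in> zero_one J \<Longrightarrow> j \<in> J \<Longrightarrow> x j = 0 \<or> x j = 1"
  by (auto simp: zero_one_def PiE_iff)

lemma zero_one_eqI: "x \<in> zero_one J \<Longrightarrow> y \<in> zero_one J \<Longrightarrow> (\<And>j. j \<in> J \<Longrightarrow> x j = y j) \<Longrightarrow> x = y"
  unfolding zero_one_def by (rule PiE_ext)

lemma zero_one_restrictI: "(\<And>j. j \<in> J \<Longrightarrow> f j = 0 \<or> f j = 1) \<Longrightarrow> restrict f J \<in> zero_one J"
  by (auto simp: zero_one_def)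

lemma measurable_coin_iff:
  assumes "f \<in> space N \<rightarrow> zero_one J" "\<And>j. j \<in> J \<Longrightarrow> {x \<in> space N. f x j = 1} \<in> sets N"
  shows "f \<in> measurable N (coin J)"
proof -
  have "(\<lambda>x. f x j) \<in> measurable N two" if j: "j \<in> J" for j
  proof (rule measurableI)
    show "f x j \<in> space two" if "x \<in> space N" for x using assms(1) that j zero_one_D by fastforce
    fix A assume "A \<in> sets two"
    have "(\<lambda>x. f x j) -` A \<inter> space N = (if 1 \<in> A then {x \<in> space N. f x j = 1} else {}) \<union>
        (if 0 \<in> A then space N - {x \<in> space N. f x j = 1} else {})"
      using assms(1) j zero_one_D by (fastforce split: if_splits)
    then show "(\<lambda>x. f x j) -` A \<inter> space N \<in> sets N"
      using assms(2)[OF j] by auto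
  qed
  then show ?thesis
    unfolding coin_def by (intro measurable_PiM_single') (use assms(1) in \<open>auto simp: zero_one_def\<close>)
qed

lemma cyl_empty: "cyl J {} q = zero_one J"
  by (simp add: cyl_def)

lemma cyl_restrict: "cyl J D (restrict q D) = cyl J D q"
  by (auto simp: cyl_def)

lemma sets_coin_coordinate: "j \<in> J \<Longrightarrow> {x \<in> zero_one J. x j = c} \<in> sets (coin J)"
proof -
  assume j: "j \<in> J"
  then have "(\<lambda>x. x j) \<in> measurable (coin J) two" unfolding coin_def by (rule measurable_component_singleton)
  then have "(\<lambda>x. x j) -` ({c} \<inter> {0, 1}) \<inter> space (coin J) \<in> sets (coin J)"
    by (rule measurable_sets) simp
  also have "(\<lambda>x. x j) -` ({c} \<inter> {0, 1}) \<inter> space (coin J) = {x \<in> zero_one J. x j = c}"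
    using zero_one_D[OF _ j] by auto
  finally show ?thesis .
qed

lemma sets_cyl: "finite D \<Longrightarrow> D \<subseteq> J \<Longrightarrow> cyl J D q \<in> sets (coin J)"
proof (induction D rule: finite_induct)
  case empty
  show ?case using sets.top[of "coin J"] by (simp add: cyl_empty)
next
  case (insert j D)
  have "cyl J (insert j D) q = cyl J D q \<inter> {x \<in> zero_one J. x j = q j}" by (auto simp: cyl_def)
  then show ?case using insert sets_coin_coordinate[of j J] by auto
qed

lemma emeasure_cyl:
  assumes D: "finite D" "D \<subseteq> J" and q: "\<And>j. j \<in> D \<Longrightarrow> q j \<in> {0, 1}"
  shows "emeasure (coin J) (cyl J D q) = ennreal ((1 / 2) ^ card D)"
proof -
  interpret product_prob_space "\<lambda>_. two" J
    by (simp add: product_prob_space_def product_sigma_finite_def product_prob_space_axioms_def prob_two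
        prob_space_imp_sigma_finite)
  have "cyl J D q = {x \<in> space (PiM J (\<lambda>_. two)). \<forall>i\<in>D. x i \<in> {q i}}"
    by (auto simp: cyl_def space_PiM zero_one_def)
  then have "emeasure (coin J) (cyl J D q) = (\<Prod>i\<in>D. emeasure two {q i})"
    unfolding coin_def using emeasure_PiM_Collect[OF D(2,1), of "\<lambda>i. {q i}"] q by simp
  also have "\<dots> = (\<Prod>i\<in>D. ennreal (1 / 2))"
    by (intro prod.cong refl measure_two q)
  also have "\<dots> = ennreal ((1 / 2) ^ card D)" unfolding prod_constant by (rule ennreal_power) simp
  finally show ?thesis .
qed

lemma measure_cyl:
  assumes "finite D" "D \<subseteq> J" "\<And>j. j \<in> D \<Longrightarrow> q j \<in> {0, 1}"
  shows "measure (coin J) (cyl J D q) = (1 / 2) ^ card D"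
  unfolding measure_def using emeasure_cyl[OF assms] by simp

text \<open>A rectangle over finitely many coordinates is a finite disjoint union of cylinders, and
  rectangles determine the product measure.\<close>

lemma coin_unique:
  assumes sets: "sets N = sets (coin J)" and N: "prob_space N"
    and eq: "\<And>D q. finite D \<Longrightarrow> D \<subseteq> J \<Longrightarrow> (\<And>j. j \<in> D \<Longrightarrow> q j \<in> {0, 1}) \<Longrightarrow>
      emeasure N (cyl J D q) = emeasure (coin J) (cyl J D q)"
  shows "N = coin J"
proof -
  have "N = PiM J (\<lambda>_. two)"
  proof (rule measure_eqI_PiM_infinite)
    show "sets N = sets (PiM J (\<lambda>_. two))" using sets by (simp add: coin_def)
    show "finite_measure N" by (rule prob_space.finite_measure[OF N])
    fix A :: "'a \<Rightarrow> real set" and D assume D: "finite D" "D \<subseteq> J" and A: "\<And>i. i \<in> D \<Longrightarrow> A i \<in> sets two"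
    have A': "i \<in> D \<Longrightarrow> A i \<subseteq> {0, 1}" for i using A by simp
    have fin: "finite (PiE D A)" by (intro finite_PiE D) (use A' finite_subset in blast)
    have U: "prod_emb J (\<lambda>_. two) D (PiE D A) = (\<Union>q\<in>PiE D A. cyl J D q)"
    proof (intro Set.set_eqI iffI)
      fix x assume "x \<in> prod_emb J (\<lambda>_. two) D (PiE D A)"
      then have "x \<in> zero_one J" "restrict x D \<in> PiE D A" by (auto simp: prod_emb_def zero_one_def)
      then show "x \<in> (\<Union>q\<in>PiE D A. cyl J D q)" by (intro UN_I[of "restrict x D"]) (auto simp: cyl_def)
    next
      fix x assume "x \<in> (\<Union>q\<in>PiE D A. cyl J D q)"
      then obtain q where q: "q \<in> PiE D A" "x \<in> zero_one J" "\<And>j. j \<in> D \<Longrightarrow> x j = q j" by (auto simp: cyl_def)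
      then have "restrict x D = q" by (auto simp: PiE_def extensional_def fun_eq_iff)
      then show "x \<in> prod_emb J (\<lambda>_. two) D (PiE D A)" using q by (simp add: prod_emb_def zero_one_def PiE_def)
    qed
    have disj: "disjoint_family_on (cyl J D) (PiE D A)"
    proof (unfold disjoint_family_on_def, intro ballI impI)
      fix q r assume qr: "q \<in> PiE D A" "r \<in> PiE D A" "q \<noteq> r"
      then obtain j where "j \<in> D" "q j \<noteq> r j" using PiE_ext by metis
      then show "cyl J D q \<inter> cyl J D r = {}" by (auto simp: cyl_def)
    qed
    have s: "cyl J D ` PiE D A \<subseteq> sets (coin J)" using sets_cyl[OF D] by auto
    have e: "emeasure N (cyl J D q) = emeasure (coin J) (cyl J D q)" if "q \<in> PiE D A" for q
      using eq[OF D, of q] that A' by (auto simp: PiE_iff)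
    have "emeasure N (\<Union>q\<in>PiE D A. cyl J D q) = (\<Sum>q\<in>PiE D A. emeasure N (cyl J D q))"
      by (rule sum_emeasure[symmetric, OF _ disj fin]) (use s sets in simp)
    also have "\<dots> = (\<Sum>q\<in>PiE D A. emeasure (coin J) (cyl J D q))" by (rule sum.cong[OF refl e])
    also have "\<dots> = emeasure (coin J) (\<Union>q\<in>PiE D A. cyl J D q)"
      by (rule sum_emeasure[OF s disj fin])
    finally show "emeasure N (prod_emb J (\<lambda>_. two) D (PiE D A)) = emeasure (PiM J (\<lambda>_. two)) (prod_emb J (\<lambda>_. two) D (PiE D A))"
      by (simp add: U coin_def)
  qed simp
  then show ?thesis by (simp add: coin_def)
qed

section \<open>The group of binary configurations and its Haar measure\<close>

definition xor2 :: "real \<Rightarrow> real \<Rightarrow> real" where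
  "xor2 x y = (if x = y then 0 else 1)"

definition Z2 :: "real monoid" where
  "Z2 = \<lparr>carrier = {0, 1}, mult = xor2, one = 0\<rparr>"

lemma Z2_simps [simp]: "carrier Z2 = {0, 1}" "x \<otimes>\<^bsub>Z2\<^esub> y = xor2 x y" "\<one>\<^bsub>Z2\<^esub> = 0"
  by (simp_all add: Z2_def)

lemma xor2_range: "xor2 x y = 0 \<or> xor2 x y = 1"
  by (simp add: xor2_def)

lemma xor2_cancel: "x = 0 \<or> x = 1 \<Longrightarrow> y = 0 \<or> y = 1 \<Longrightarrow> xor2 x (xor2 x y) = y"
  by (auto simp: xor2_def)

lemma group_Z2: "group Z2"
proof (rule groupI)
  show "\<exists>y\<in>carrier Z2. y \<otimes>\<^bsub>Z2\<^esub> x = \<one>\<^bsub>Z2\<^esub>" if "x \<in> carrier Z2" for x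
    using that by (auto simp: xor2_def)
qed (auto simp: xor2_def)

lemma inv_Z2: "x \<in> {0, 1} \<Longrightarrow> inv\<^bsub>Z2\<^esub> x = x"
  by (rule group.inv_equality[OF group_Z2]) (auto simp: xor2_def)

definition Z2_power :: "'j set \<Rightarrow> ('j \<Rightarrow> real) monoid" where
  "Z2_power J = product_group J (\<lambda>_. Z2)"

lemma Z2_power_simps [simp]: "carrier (Z2_power J) = zero_one J"
  "x \<otimes>\<^bsub>Z2_power J\<^esub> y = (\<lambda>j\<in>J. xor2 (x j) (y j))" "\<one>\<^bsub>Z2_power J\<^esub> = (\<lambda>j\<in>J. 0)"
  by (simp_all add: Z2_power_def zero_one_def)

lemma group_Z2_power: "group (Z2_power J)"
  unfolding Z2_power_def by (intro product_group group_Z2)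

lemma inv_Z2_power:
  assumes "x \<in> zero_one J" shows "inv\<^bsub>Z2_power J\<^esub> x = x"
proof -
  have "inv\<^bsub>Z2_power J\<^esub> x = (\<lambda>i\<in>J. inv\<^bsub>Z2\<^esub> x i)"
    unfolding Z2_power_def using assms by (subst inv_product_group) (auto simp: zero_one_def group_Z2)
  also have "\<dots> = x"
  proof (rule zero_one_eqI[OF zero_one_restrictI assms])
    have *: "inv\<^bsub>Z2\<^esub> x j = x j" if "j \<in> J" for j
      by (rule inv_Z2) (use zero_one_D[OF assms that] in simp)
    then show "(\<lambda>i\<in>J. inv\<^bsub>Z2\<^esub> x i) j = x j" if "j \<in> J" for j using that by simp
    show "inv\<^bsub>Z2\<^esub> x j = 0 \<or> inv\<^bsub>Z2\<^esub> x j = 1" if "j \<in> J" for j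
      using *[OF that] zero_one_D[OF assms that] by simp
  qed
  finally show ?thesis .
qed

lemma translate_zero_one: "(\<lambda>j\<in>J. xor2 (x j) (y j)) \<in> zero_one J"
  by (intro zero_one_restrictI xor2_range)

lemma translate_translate:
  assumes "x \<in> zero_one J" "y \<in> zero_one J"
  shows "(\<lambda>j\<in>J. xor2 (x j) ((\<lambda>j\<in>J. xor2 (x j) (y j)) j)) = y"
  by (rule zero_one_eqI[OF translate_zero_one assms(2)]) (use assms in \<open>simp add: xor2_cancel zero_one_D\<close>)

lemma translate_measurable:
  assumes x: "x \<in> zero_one J"
  shows "(\<lambda>y. \<lambda>j\<in>J. xor2 (x j) (y j)) \<in> measurable (coin J) (coin J)"
proof (rule measurable_coin_iff)
  fix j assume j: "j \<in> J"
  have "{y \<in> space (coin J). (\<lambda>j\<in>J. xor2 (x j) (y j)) j = 1} = {y \<in> zero_one J. y j = 1 - x j}"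
  proof -
    have "xor2 (x j) (y j) = 1 \<longleftrightarrow> y j = 1 - x j" if "y \<in> zero_one J" for y
      using zero_one_D[OF that j] zero_one_D[OF x j] by (auto simp: xor2_def)
    then show ?thesis using j by auto
  qed
  then show "{y \<in> space (coin J). (\<lambda>j\<in>J. xor2 (x j) (y j)) j = 1} \<in> sets (coin J)"
    using sets_coin_coordinate[OF j] by simp
qed (use translate_zero_one in auto)

text \<open>Translations of this group are involutions, so images are preimages.\<close>

lemma translate_image:
  assumes x: "x \<in> zero_one J" and A: "A \<subseteq> zero_one J"
  shows "(\<lambda>y. \<lambda>j\<in>J. xor2 (x j) (y j)) ` A = (\<lambda>y. \<lambda>j\<in>J. xor2 (x j) (y j)) -` A \<inter> zero_one J"
proof (intro Set.set_eqI iffI)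
  fix z assume "z \<in> (\<lambda>y. \<lambda>j\<in>J. xor2 (x j) (y j)) ` A"
  then show "z \<in> (\<lambda>y. \<lambda>j\<in>J. xor2 (x j) (y j)) -` A \<inter> zero_one J"
    using translate_translate[OF x] A translate_zero_one by force
next
  fix z assume "z \<in> (\<lambda>y. \<lambda>j\<in>J. xor2 (x j) (y j)) -` A \<inter> zero_one J"
  then have z: "(\<lambda>j\<in>J. xor2 (x j) (z j)) \<in> A" "z \<in> zero_one J" by auto
  show "z \<in> (\<lambda>y. \<lambda>j\<in>J. xor2 (x j) (y j)) ` A"
    by (rule rev_image_eqI[OF z(1)]) (simp only: translate_translate[OF x z(2)])
qed

lemma distr_translate:
  assumes x: "x \<in> zero_one J"
  shows "distr (coin J) (coin J) (\<lambda>y. \<lambda>j\<in>J. xor2 (x j) (y j)) = coin J"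
proof (rule coin_unique)
  show "prob_space (distr (coin J) (coin J) (\<lambda>y. \<lambda>j\<in>J. xor2 (x j) (y j)))"
    by (rule prob_space.prob_space_distr[OF prob_coin translate_measurable[OF x]])
  fix D q assume D: "finite D" "D \<subseteq> J" and q: "\<And>j. j \<in> D \<Longrightarrow> q j \<in> {0, 1 :: real}"
  have "(\<lambda>y. \<lambda>j\<in>J. xor2 (x j) (y j)) -` cyl J D q \<inter> space (coin J) = cyl J D (\<lambda>j. xor2 (x j) (q j))"
  proof (intro Set.set_eqI iffI)
    fix y assume y: "y \<in> (\<lambda>y. \<lambda>j\<in>J. xor2 (x j) (y j)) -` cyl J D q \<inter> space (coin J)"
    have "y j = xor2 (x j) (q j)" if "j \<in> D" for j
      using y that D xor2_cancel[of "x j" "y j"] zero_one_D[OF x] zero_one_D[of y J j] by (auto simp: cyl_def subset_iff)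
    then show "y \<in> cyl J D (\<lambda>j. xor2 (x j) (q j))" using y by (auto simp: cyl_def)
  next
    fix y assume y: "y \<in> cyl J D (\<lambda>j. xor2 (x j) (q j))"
    have "xor2 (x j) (y j) = q j" if "j \<in> D" for j
      using y that D xor2_cancel[of "x j" "q j"] zero_one_D[OF x] q by (auto simp: cyl_def subset_iff)
    then show "y \<in> (\<lambda>y. \<lambda>j\<in>J. xor2 (x j) (y j)) -` cyl J D q \<inter> space (coin J)"
      using y D translate_zero_one by (auto simp: cyl_def subset_iff)
  qed
  moreover have "emeasure (coin J) (cyl J D (\<lambda>j. xor2 (x j) (q j))) = emeasure (coin J) (cyl J D q)"
    by (subst (1 2) emeasure_cyl[OF D]) (use q xor2_range in auto)
  ultimately show "emeasure (distr (coin J) (coin J) (\<lambda>y. \<lambda>j\<in>J. xor2 (x j) (y j))) (cyl J D q) = emeasure (coin J) (cyl J D q)"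
    by (subst emeasure_distr[OF translate_measurable[OF x] sets_cyl[OF D]]) simp
qed simp

text \<open>Any two cylinders over the same \<open>D\<close> differ by a translation. Invariance
  gives all \<open>2 ^ card D\<close> of them the same mass, and they partition the space.\<close>

lemma haar_unique:
  assumes N: "prob_space N" and sets: "sets N = sets (coin J)"
    and inv: "\<And>x A. x \<in> zero_one J \<Longrightarrow> A \<in> sets N \<Longrightarrow>
      emeasure N ((\<lambda>y. \<lambda>j\<in>J. xor2 (x j) (y j)) -` A \<inter> zero_one J) = emeasure N A"
  shows "N = coin J"
proof (rule coin_unique[OF sets N])
  interpret prob_space N by fact
  fix D q assume D: "finite D" "D \<subseteq> J" and q: "\<And>j. j \<in> D \<Longrightarrow> q j \<in> {0, 1 :: real}"
  have sp: "space N = zero_one J" using sets_eq_imp_space_eq[OF sets] by simp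
  have eq: "emeasure N (cyl J D r) = emeasure N (cyl J D (\<lambda>_. 0))" if r: "\<And>j. j \<in> D \<Longrightarrow> r j \<in> {0, 1 :: real}" for r
  proof -
    define x where "x = (\<lambda>j\<in>J. if j \<in> D then r j else 0)"
    have x: "x \<in> zero_one J" unfolding x_def by (rule zero_one_restrictI) (use r in auto)
    have "(\<lambda>y. \<lambda>j\<in>J. xor2 (x j) (y j)) -` cyl J D (\<lambda>_. 0) \<inter> zero_one J = cyl J D r"
      using D translate_zero_one by (auto simp: cyl_def subset_iff x_def xor2_def)
    then show ?thesis using inv[OF x, of "cyl J D (\<lambda>_. 0)"] sets_cyl[OF D] sets by simp
  qed
  let ?Q = "\<Pi>\<^sub>E j\<in>D. {0, 1 :: real}"
  have fin: "finite ?Q" by (intro finite_PiE D) auto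
  have U: "(\<Union>r\<in>?Q. cyl J D r) = zero_one J"
  proof (intro Set.set_eqI iffI)
    fix x assume x: "x \<in> zero_one J"
    then show "x \<in> (\<Union>r\<in>?Q. cyl J D r)"
      using D zero_one_D[OF x] by (intro UN_I[of "restrict x D"]) (auto simp: cyl_def)
  qed (auto simp: cyl_def)
  have disj: "disjoint_family_on (cyl J D) ?Q"
  proof (unfold disjoint_family_on_def, intro ballI impI)
    fix q r assume qr: "q \<in> ?Q" "r \<in> ?Q" "q \<noteq> r"
    then obtain j where "j \<in> D" "q j \<noteq> r j" using PiE_ext by metis
    then show "cyl J D q \<inter> cyl J D r = {}" by (auto simp: cyl_def)
  qed
  have "1 = emeasure N (\<Union>r\<in>?Q. cyl J D r)" unfolding U using emeasure_space_1 sp by simp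
  also have "\<dots> = (\<Sum>r\<in>?Q. emeasure N (cyl J D r))"
    by (rule sum_emeasure[symmetric, OF _ disj fin]) (use sets_cyl[OF D] sets in auto)
  also have "\<dots> = (\<Sum>r\<in>?Q. emeasure N (cyl J D q))"
  proof (rule sum.cong[OF refl])
    fix r assume "r \<in> ?Q"
    then have "r j \<in> {0, 1}" if "j \<in> D" for j using that by (simp add: PiE_iff)
    from eq[of r, OF this] eq[of q, OF q] show "emeasure N (cyl J D r) = emeasure N (cyl J D q)" by presburger
  qed
  also have "\<dots> = ennreal (2 ^ card D * measure N (cyl J D q))"
    using D by (simp add: card_PiE emeasure_eq_measure ennreal_mult ennreal_power[symmetric] ennreal_of_nat_eq_real_of_nat)
  finally have "2 ^ card D * measure N (cyl J D q) = 1"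
    by (metis ennreal_eq_1 ennreal_1)
  then have "measure N (cyl J D q) = (1 / 2) ^ card D"
    by (simp add: field_simps power_one_over)
  then show "emeasure N (cyl J D q) = emeasure (coin J) (cyl J D q)"
    by (simp add: emeasure_eq_measure emeasure_cyl[OF D q])
qed

lemma permute_zero_one:
  assumes "p \<in> J \<rightarrow> J" "x \<in> zero_one J" shows "(\<lambda>j\<in>J. x (p j)) \<in> zero_one J"
proof (rule zero_one_restrictI)
  show "x (p j) = 0 \<or> x (p j) = 1" if "j \<in> J" for j
    by (rule zero_one_D[OF assms(2)]) (use assms(1) that in auto)
qed

lemma permute_measurable:
  assumes p: "p \<in> J \<rightarrow> J"
  shows "(\<lambda>x. \<lambda>j\<in>J. x (p j)) \<in> measurable (coin J) (coin J)"
proof (rule measurable_coin_iff)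
  fix j assume j: "j \<in> J"
  then have pj: "p j \<in> J" using p by auto
  show "{x \<in> space (coin J). (\<lambda>j\<in>J. x (p j)) j = 1} \<in> sets (coin J)"
    using sets_coin_coordinate[OF pj, of 1] j by simp
qed (use permute_zero_one[OF p] in auto)

lemma distr_permute:
  assumes p: "bij_betw p J J"
  shows "distr (coin J) (coin J) (\<lambda>x. \<lambda>j\<in>J. x (p j)) = coin J"
proof (rule coin_unique)
  have pJ: "p \<in> J \<rightarrow> J" and inj: "inj_on p J" using p by (auto simp: bij_betw_def)
  show "prob_space (distr (coin J) (coin J) (\<lambda>x. \<lambda>j\<in>J. x (p j)))"
    by (rule prob_space.prob_space_distr[OF prob_coin permute_measurable[OF pJ]])
  fix D q assume D: "finite D" "D \<subseteq> J" and q: "\<And>j. j \<in> D \<Longrightarrow> q j \<in> {0, 1 :: real}"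
  have pre: "(\<lambda>x. \<lambda>j\<in>J. x (p j)) -` cyl J D q \<inter> space (coin J) = cyl J (p ` D) (\<lambda>j. q (inv_into J p j))"
    using D permute_zero_one[OF pJ] inv_into_f_f[OF inj] by (auto simp: cyl_def subset_iff)
  have "finite (p ` D)" "p ` D \<subseteq> J" "card (p ` D) = card D"
    using D pJ inj by (auto intro: card_image inj_on_subset)
  moreover have "q (inv_into J p j) \<in> {0, 1}" if j: "j \<in> p ` D" for j
  proof -
    obtain i where "i \<in> D" "j = p i" using j by auto
    then show ?thesis using q[of i] inv_into_f_f[OF inj, of i] D(2) by auto
  qed
  ultimately show "emeasure (distr (coin J) (coin J) (\<lambda>x. \<lambda>j\<in>J. x (p j))) (cyl J D q) = emeasure (coin J) (cyl J D q)"
    by (subst emeasure_distr[OF permute_measurable[OF pJ] sets_cyl[OF D]])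
       (simp only: pre emeasure_cyl[OF D q] emeasure_cyl)
qed simp

section \<open>Events determined by finitely many coordinates\<close>

definition determined :: "'j set \<Rightarrow> 'j set \<Rightarrow> ('j \<Rightarrow> real) set \<Rightarrow> bool" where
  "determined J D S \<longleftrightarrow> S \<subseteq> zero_one J \<and> (\<forall>x\<in>S. \<forall>y\<in>zero_one J. (\<forall>j\<in>D. x j = y j) \<longrightarrow> y \<in> S)"

lemma determined_cyls:
  assumes "determined J D S" "finite D" "D \<subseteq> J"
  defines "Q \<equiv> (\<lambda>x. restrict x D) ` S"
  shows "finite Q" "S = (\<Union>q\<in>Q. cyl J D q)" "disjoint_family_on (cyl J D) Q" "Q \<subseteq> (\<Pi>\<^sub>E j\<in>D. {0, 1})"
proof -
  have S: "S \<subseteq> zero_one J" using assms(1) by (simp add: determined_def)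
  show sub: "Q \<subseteq> (\<Pi>\<^sub>E j\<in>D. {0, 1})"
    using S zero_one_D assms(3) unfolding Q_def by fastforce
  then show "finite Q" by (rule finite_subset) (intro finite_PiE assms(2); simp)
  show "S = (\<Union>q\<in>Q. cyl J D q)"
    using assms(1) S unfolding Q_def determined_def cyl_def by fastforce
  show "disjoint_family_on (cyl J D) Q"
  proof (unfold disjoint_family_on_def, intro ballI impI)
    fix q r assume qr: "q \<in> Q" "r \<in> Q" "q \<noteq> r"
    then obtain j where "j \<in> D" "q j \<noteq> r j" using sub PiE_ext by (metis subsetD)
    then show "cyl J D q \<inter> cyl J D r = {}" by (auto simp: cyl_def)
  qed
qed

lemma determined_sets:
  assumes "determined J D S" "finite D" "D \<subseteq> J"
  shows "S \<in> sets (coin J)"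
proof -
  have "(\<Union>q\<in>(\<lambda>x. restrict x D) ` S. cyl J D q) \<in> sets (coin J)"
    using determined_cyls(1)[OF assms] sets_cyl[OF assms(2,3)] by (intro sets.finite_UN) auto
  then show ?thesis using determined_cyls(2)[OF assms] by simp
qed

text \<open>Both events are finite disjoint unions of cylinders of equal mass, so their measures are
  counts. On disjoint windows the intersection of two cylinders is a cylinder over the union, and
  the counts multiply.\<close>

lemma determined_independent:
  assumes S: "determined J D S" "finite D" "D \<subseteq> J" and R: "determined J E R" "finite E" "E \<subseteq> J"
    and DE: "D \<inter> E = {}"
  shows "measure (coin J) (S \<inter> R) = measure (coin J) S * measure (coin J) R"
proof -
  interpret prob_space "coin J" by (rule prob_coin)
  obtain Q where Q: "finite Q" "S = (\<Union>q\<in>Q. cyl J D q)" "disjoint_family_on (cyl J D) Q"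
    "Q \<subseteq> (\<Pi>\<^sub>E j\<in>D. {0, 1})"
    using determined_cyls[OF S] by blast
  obtain P where P: "finite P" "R = (\<Union>q\<in>P. cyl J E q)" "disjoint_family_on (cyl J E) P"
    "P \<subseteq> (\<Pi>\<^sub>E j\<in>E. {0, 1})"
    using determined_cyls[OF R] by blast
  have Qv: "q j \<in> {0, 1}" if "q \<in> Q" "j \<in> D" for q j using subsetD[OF Q(4) that(1)] that(2) by (rule PiE_mem)
  have Pv: "r j \<in> {0, 1}" if "r \<in> P" "j \<in> E" for r j using subsetD[OF P(4) that(1)] that(2) by (rule PiE_mem)
  have "measure (coin J) (\<Union>q\<in>Q. cyl J D q) = (\<Sum>q\<in>Q. measure (coin J) (cyl J D q))"
    by (rule finite_measure_finite_Union[OF Q(1) _ Q(3)]) (use sets_cyl[OF S(2,3)] in blast)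
  also have "\<dots> = (\<Sum>q\<in>Q. (1 / 2) ^ card D)"
    by (rule sum.cong[OF refl measure_cyl[OF S(2,3) Qv]])
  finally have mS: "measure (coin J) S = real (card Q) * (1 / 2) ^ card D" using Q(2) by simp
  have "measure (coin J) (\<Union>q\<in>P. cyl J E q) = (\<Sum>q\<in>P. measure (coin J) (cyl J E q))"
    by (rule finite_measure_finite_Union[OF P(1) _ P(3)]) (use sets_cyl[OF R(2,3)] in blast)
  also have "\<dots> = (\<Sum>q\<in>P. (1 / 2) ^ card E)"
    by (rule sum.cong[OF refl measure_cyl[OF R(2,3) Pv]])
  finally have mR: "measure (coin J) R = real (card P) * (1 / 2) ^ card E" using P(2) by simp
  define m where "m qr = (\<lambda>j. if j \<in> D then fst qr j else snd qr j)" for qr :: "('a \<Rightarrow> real) \<times> ('a \<Rightarrow> real)"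
  have mc: "cyl J D q \<inter> cyl J E r = cyl J (D \<union> E) (m (q, r))" for q r
    using DE by (auto simp: cyl_def m_def)
  have U: "S \<inter> R = (\<Union>qr\<in>Q \<times> P. cyl J (D \<union> E) (m qr))"
  proof -
    have "S \<inter> R = (\<Union>q\<in>Q. \<Union>r\<in>P. cyl J D q \<inter> cyl J E r)" unfolding Q(2) P(2) by blast
    also have "\<dots> = (\<Union>qr\<in>Q \<times> P. cyl J (D \<union> E) (m qr))" unfolding mc by blast
    finally show ?thesis .
  qed
  have disj: "disjoint_family_on (\<lambda>qr. cyl J (D \<union> E) (m qr)) (Q \<times> P)"
    unfolding disjoint_family_on_def
  proof (intro ballI impI)
    fix u v assume u: "u \<in> Q \<times> P" and v: "v \<in> Q \<times> P" and "u \<noteq> v"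
    obtain q r q' r' where uv: "u = (q, r)" "v = (q', r')" by (cases u, cases v)
    have "cyl J D q \<inter> cyl J D q' = {} \<or> cyl J E r \<inter> cyl J E r' = {}"
      using Q(3) P(3) u v \<open>u \<noteq> v\<close> uv unfolding disjoint_family_on_def by blast
    then show "cyl J (D \<union> E) (m u) \<inter> cyl J (D \<union> E) (m v) = {}"
      unfolding uv mc[symmetric] by blast
  qed
  have DEJ: "finite (D \<union> E)" "D \<union> E \<subseteq> J" using S(2,3) R(2,3) by simp_all
  have "(\<lambda>qr. cyl J (D \<union> E) (m qr)) ` (Q \<times> P) \<subseteq> sets (coin J)"
    by (rule image_subsetI) (rule sets_cyl[OF DEJ])
  from finite_measure_finite_Union[OF finite_cartesian_product[OF Q(1) P(1)] this disj]
  have "measure (coin J) (S \<inter> R) = (\<Sum>qr\<in>Q \<times> P. measure (coin J) (cyl J (D \<union> E) (m qr)))"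
    by (simp only: U)
  also have "\<dots> = (\<Sum>qr\<in>Q \<times> P. (1 / 2) ^ card (D \<union> E))"
  proof (rule sum.cong[OF refl measure_cyl[OF DEJ]])
    fix qr j assume "qr \<in> Q \<times> P" "j \<in> D \<union> E"
    then show "m qr j \<in> {0, 1}" using Qv Pv unfolding m_def by (cases qr; cases "j \<in> D") (simp_all del: insert_iff)
  qed
  also have "\<dots> = measure (coin J) S * measure (coin J) R"
    using card_Un_disjoint[OF S(2) R(2) DE] by (simp add: mS mR card_cartesian_product power_add)
  finally show ?thesis .
qed

subsection \<open>Topology\<close>

definition coin_top :: "'j set \<Rightarrow> ('j \<Rightarrow> real) topology" where
  "coin_top J = product_topology (\<lambda>_. discrete_topology {0, 1}) J"

lemma topspace_coin_top [simp]: "topspace (coin_top J) = zero_one J"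
  by (simp add: coin_top_def zero_one_def)

lemma coin_top_basis:
  assumes "openin (coin_top J) U" "x \<in> U"
  obtains D where "finite D" "D \<subseteq> J" "cyl J D x \<subseteq> U"
proof -
  obtain V where V: "finite {i \<in> J. V i \<noteq> {0, 1 :: real}}" "x \<in> Pi\<^sub>E J V" "Pi\<^sub>E J V \<subseteq> U"
    using assms unfolding coin_top_def openin_product_topology_alt by (auto simp: openin_discrete_topology)
  show ?thesis
  proof
    show "cyl J {i \<in> J. V i \<noteq> {0, 1}} x \<subseteq> U"
    proof
      fix y assume y: "y \<in> cyl J {i \<in> J. V i \<noteq> {0, 1}} x"
      have "y \<in> Pi\<^sub>E J V"
      proof (rule PiE_I)
        fix j assume j: "j \<in> J"
        show "y j \<in> V j"
        proof (cases "V j = {0, 1}")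
          case True
          then show ?thesis using y zero_one_D[of y J j] j by (auto simp: cyl_def)
        next
          case False
          then have "y j = x j" using y j by (auto simp: cyl_def)
          then show ?thesis using V(2) j by auto
        qed
      qed (use y in \<open>auto simp: cyl_def zero_one_def\<close>)
      then show "y \<in> U" using V(3) by auto
    qed
  qed (use V(1) in auto)
qed

lemma continuous_coin_coordinate: "j \<in> J \<Longrightarrow> continuous_map (coin_top J) (discrete_topology {0, 1}) (\<lambda>x. x j)"
  unfolding coin_top_def by (rule continuous_map_product_projection)

lemma openin_coordinate: "j \<in> J \<Longrightarrow> openin (coin_top J) {x \<in> zero_one J. x j = c}"
proof -
  assume j: "j \<in> J"
  have "openin (coin_top J) {x \<in> topspace (coin_top J). x j \<in> {c} \<inter> {0, 1}}"
    by (rule openin_continuous_map_preimage[OF continuous_coin_coordinate[OF j]]) (auto simp: openin_discrete_topology)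
  also have "{x \<in> topspace (coin_top J). x j \<in> {c} \<inter> {0, 1}} = {x \<in> zero_one J. x j = c}"
    using zero_one_D[OF _ j] by auto
  finally show ?thesis .
qed

lemma openin_cyl: "finite D \<Longrightarrow> D \<subseteq> J \<Longrightarrow> openin (coin_top J) (cyl J D q)"
proof (induction D rule: finite_induct)
  case empty
  show ?case using openin_topspace[of "coin_top J"] by (simp add: cyl_empty)
next
  case (insert j D)
  have "cyl J (insert j D) q = cyl J D q \<inter> {x \<in> zero_one J. x j = q j}" by (auto simp: cyl_def)
  then show ?case using insert openin_coordinate[of j J] by auto
qed

lemma compact_coin_top: "compact_space (coin_top J)"
  unfolding coin_top_def compact_space_product_topology by (simp add: compact_space_discrete_topology)

lemma metrizable_coin_top: "countable J \<Longrightarrow> metrizable_space (coin_top J)"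
  unfolding coin_top_def metrizable_space_product_topology
  by (auto intro: countable_subset[of _ J])

text \<open>Countably many cylinders form a base of the topology, so open sets are countable unions
  of cylinders; conversely the coordinates are continuous.\<close>

lemma sets_borel_of_coin_top:
  assumes J: "countable J"
  shows "sets (borel_of (coin_top J)) = sets (coin J)"
proof (rule antisym)
  have b: "sets (borel_of (coin_top J)) = sigma_sets (zero_one J) {U. openin (coin_top J) U}"
    unfolding borel_of_def by (subst sets_measure_of) (auto dest!: openin_subset)
  define \<C> where "\<C> = (\<Union>D\<in>{D. finite D \<and> D \<subseteq> J}. cyl J D ` (\<Pi>\<^sub>E j\<in>D. {0, 1 :: real}))"
  have "countable \<C>" unfolding \<C>_def
    by (intro countable_UN countable_Collect_finite_subset J countable_image countable_finite finite_PiE) auto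
  have "U \<in> sets (coin J)" if U: "openin (coin_top J) U" for U
  proof -
    have "U = \<Union>{C \<in> \<C>. C \<subseteq> U}"
    proof (intro Set.set_eqI iffI)
      fix x assume x: "x \<in> U"
      then obtain D where D: "finite D" "D \<subseteq> J" "cyl J D x \<subseteq> U" using coin_top_basis[OF U] by blast
      have xO: "x \<in> zero_one J" using openin_subset[OF U] x by auto
      have "restrict x D \<in> (\<Pi>\<^sub>E j\<in>D. {0, 1})" using zero_one_D[OF xO] D(2) by auto
      then have "cyl J D (restrict x D) \<in> \<C>" unfolding \<C>_def using D(1,2) by blast
      then have "cyl J D x \<in> \<C>" by (simp only: cyl_restrict)
      moreover have "x \<in> cyl J D x" using xO by (simp add: cyl_def)
      ultimately show "x \<in> \<Union>{C \<in> \<C>. C \<subseteq> U}" using D by auto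
    qed auto
    moreover have "\<Union>{C \<in> \<C>. C \<subseteq> U} \<in> sets (coin J)"
    proof (rule sets.countable_Union)
      show "countable {C \<in> \<C>. C \<subseteq> U}" using \<open>countable \<C>\<close> by (rule countable_subset[rotated]) auto
      show "{C \<in> \<C>. C \<subseteq> U} \<subseteq> sets (coin J)" unfolding \<C>_def using sets_cyl by auto
    qed
    ultimately show ?thesis by simp
  qed
  then show "sets (borel_of (coin_top J)) \<subseteq> sets (coin J)"
    unfolding b using sets.sigma_sets_subset[of "{U. openin (coin_top J) U}" "coin J"] by auto
  have sp: "space (borel_of (coin_top J)) = zero_one J"
    unfolding borel_of_def by (subst space_measure_of) (auto dest!: openin_subset)
  have "(\<lambda>x. x) \<in> measurable (borel_of (coin_top J)) (coin J)"
  proof (rule measurable_coin_iff)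
    fix j assume "j \<in> J"
    then show "{x \<in> space (borel_of (coin_top J)). x j = 1} \<in> sets (borel_of (coin_top J))"
      unfolding sp b using openin_coordinate[of j J 1] by (intro sigma_sets.Basic) simp
  qed (simp add: sp)
  then show "sets (coin J) \<subseteq> sets (borel_of (coin_top J))"
  proof (intro subsetI)
    fix A assume m: "(\<lambda>x. x) \<in> measurable (borel_of (coin_top J)) (coin J)" and A: "A \<in> sets (coin J)"
    have "(\<lambda>x. x) -` A \<inter> space (borel_of (coin_top J)) = A"
      using sets.sets_into_space[OF A] by (auto simp: sp)
    then show "A \<in> sets (borel_of (coin_top J))" using measurable_sets[OF m A] by simp
  qed
qed

lemma continuous_into_coin_top:
  assumes "f ` topspace \<tau> \<subseteq> zero_one J" "\<And>j. j \<in> J \<Longrightarrow> continuous_map \<tau> (discrete_topology {0, 1}) (\<lambda>x. f x j)"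
  shows "continuous_map \<tau> (coin_top J) f"
  unfolding coin_top_def continuous_map_componentwise using assms by (auto simp: zero_one_def PiE_def)

lemma continuous_xor2:
  assumes f: "continuous_map \<tau> (discrete_topology {0, 1}) f" and g: "continuous_map \<tau> (discrete_topology {0, 1}) g"
  shows "continuous_map \<tau> (discrete_topology {0, 1}) (\<lambda>x. xor2 (f x) (g x))"
proof -
  have "continuous_map \<tau> (prod_topology (discrete_topology {0, 1}) (discrete_topology {0, 1})) (\<lambda>x. (f x, g x))"
    using f g by (simp add: continuous_map_pairwise comp_def)
  then have c: "continuous_map \<tau> (discrete_topology ({0, 1} \<times> {0, 1})) (\<lambda>x. (f x, g x))"
    by (subst prod_topology_discrete_topology)
  have "continuous_map (discrete_topology ({0, 1} \<times> {0, 1})) (discrete_topology {0, 1}) (\<lambda>(x, y). xor2 x y)"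
    using xor2_range by auto
  from continuous_map_compose[OF c this] show ?thesis by (simp add: comp_def)
qed

lemma compact_metrizable_group_Z2_power:
  assumes "countable J"
  shows "compact_metrizable_group (Z2_power J) (coin_top J)"
  unfolding compact_metrizable_group_def
proof (intro conjI)
  have fst: "continuous_map (prod_topology (coin_top J) (coin_top J)) (discrete_topology {0, 1}) (\<lambda>z. fst z j)"
    and snd: "continuous_map (prod_topology (coin_top J) (coin_top J)) (discrete_topology {0, 1}) (\<lambda>z. snd z j)"
    if "j \<in> J" for j
    using continuous_map_compose[OF continuous_map_fst continuous_coin_coordinate[OF that]]
      continuous_map_compose[OF continuous_map_snd continuous_coin_coordinate[OF that]] by (auto simp: comp_def)
  show "continuous_map (prod_topology (coin_top J) (coin_top J)) (coin_top J) (\<lambda>(x, y). x \<otimes>\<^bsub>Z2_power J\<^esub> y)"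
    unfolding split_beta
    by (rule continuous_into_coin_top) (auto simp: translate_zero_one intro!: continuous_xor2 fst snd)
  show "continuous_map (coin_top J) (coin_top J) (\<lambda>x. inv\<^bsub>Z2_power J\<^esub> x)"
    by (rule continuous_map_eq[of _ _ "\<lambda>x. x"]) (auto simp: inv_Z2_power)
qed (use assms in \<open>simp_all add: group_Z2_power compact_coin_top metrizable_coin_top\<close>)

lemma haar_coin:
  assumes "countable J"
  shows "haar_prob (Z2_power J) (coin_top J) (coin J)"
  unfolding haar_prob_def
proof (intro conjI ballI)
  fix x A assume x: "x \<in> carrier (Z2_power J)" and A: "A \<in> sets (coin J)"
  then have xO: "x \<in> zero_one J" by simp
  have AO: "A \<subseteq> zero_one J" using sets.sets_into_space[OF A] by simp
  have "emeasure (coin J) A = emeasure (distr (coin J) (coin J) (\<lambda>y. \<lambda>j\<in>J. xor2 (x j) (y j))) A"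
    by (simp add: distr_translate[OF xO])
  also have "\<dots> = emeasure (coin J) ((\<lambda>y. \<lambda>j\<in>J. xor2 (x j) (y j)) -` A \<inter> zero_one J)"
    by (subst emeasure_distr[OF translate_measurable[OF xO] A]) simp
  finally show "emeasure (coin J) ((\<lambda>y. x \<otimes>\<^bsub>Z2_power J\<^esub> y) ` A) = emeasure (coin J) A"
    using translate_image[OF xO AO] by simp
qed (use assms sets_borel_of_coin_top prob_coin in auto)

text \<open>Compactness in the form used below: windows chosen separately at every point reduce to
  finitely many centres, and the union of their windows is finite.\<close>

lemma coin_top_cover:
  assumes "\<And>x. x \<in> zero_one J \<Longrightarrow> finite (D x) \<and> D x \<subseteq> J"
  shows "\<exists>F. finite F \<and> F \<subseteq> zero_one J \<and> (\<forall>y\<in>zero_one J. \<exists>x\<in>F. y \<in> cyl J (D x) x)"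
proof -
  let ?U = "(\<lambda>x. cyl J (D x) x) ` zero_one J"
  have "\<forall>U\<in>?U. openin (coin_top J) U" using assms openin_cyl by blast
  moreover have "topspace (coin_top J) \<subseteq> \<Union>?U" by (auto simp: cyl_def)
  ultimately obtain \<F> where "finite \<F>" "\<F> \<subseteq> ?U" "topspace (coin_top J) \<subseteq> \<Union>\<F>"
    using compact_coin_top[of J] unfolding compact_space_alt by meson
  then obtain F where "F \<subseteq> zero_one J" "finite F" "\<F> = (\<lambda>x. cyl J (D x) x) ` F"
    using finite_subset_image[of \<F> "\<lambda>x. cyl J (D x) x" "zero_one J"] by blast
  then show ?thesis using \<open>topspace (coin_top J) \<subseteq> \<Union>\<F>\<close> by (intro exI[of _ F]) auto
qed

text \<open>Uniform continuity by compactness, with a finite window in the role of the modulus.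
  Halving the error allows two points to be compared through a common centre.\<close>

lemma uniformly_continuous_coin_top:
  assumes f: "continuous_map (coin_top J) euclideanreal f" and e: "0 < \<epsilon>"
  shows "\<exists>D. finite D \<and> D \<subseteq> J \<and> (\<forall>x\<in>zero_one J. \<forall>y\<in>zero_one J. (\<forall>j\<in>D. x j = y j) \<longrightarrow> \<bar>f x - f y\<bar> < \<epsilon>)"
proof -
  have "\<exists>D. finite D \<and> D \<subseteq> J \<and> (\<forall>y\<in>cyl J D x. \<bar>f x - f y\<bar> < \<epsilon> / 2)" if x: "x \<in> zero_one J" for x
  proof -
    have "openin (coin_top J) {y \<in> topspace (coin_top J). f y \<in> {t. \<bar>f x - t\<bar> < \<epsilon> / 2}}"
      by (rule openin_continuous_map_preimage[OF f])
         (auto intro!: open_Collect_less continuous_intros simp: open_openin[symmetric])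
    then obtain D where "finite D" "D \<subseteq> J" "cyl J D x \<subseteq> {y \<in> topspace (coin_top J). f y \<in> {t. \<bar>f x - t\<bar> < \<epsilon> / 2}}"
      using coin_top_basis[of J _ x] x e by force
    then show ?thesis by blast
  qed
  then obtain D where D: "\<And>x. x \<in> zero_one J \<Longrightarrow> finite (D x) \<and> D x \<subseteq> J"
    "\<And>x y. x \<in> zero_one J \<Longrightarrow> y \<in> cyl J (D x) x \<Longrightarrow> \<bar>f x - f y\<bar> < \<epsilon> / 2" by metis
  obtain F where F: "finite F" "F \<subseteq> zero_one J" "\<forall>y\<in>zero_one J. \<exists>x\<in>F. y \<in> cyl J (D x) x"
    using coin_top_cover[of J D] D(1) by blast
  show ?thesis
  proof (intro exI[of _ "\<Union>(D ` F)"] conjI ballI impI)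
    fix x y assume xy: "x \<in> zero_one J" "y \<in> zero_one J" "\<forall>j\<in>\<Union>(D ` F). x j = y j"
    obtain z where z: "z \<in> F" "x \<in> cyl J (D z) z" using F(3) xy(1) by blast
    then have "y \<in> cyl J (D z) z" using xy by (auto simp: cyl_def)
    then have "\<bar>f z - f x\<bar> < \<epsilon> / 2" "\<bar>f z - f y\<bar> < \<epsilon> / 2" using D(2) z F(2) by auto
    then show "\<bar>f x - f y\<bar> < \<epsilon>" by linarith
  qed (use D(1) F in auto)
qed

subsection \<open>Cosets\<close>

abbreviation gA :: "ab \<times> bool" where "gA \<equiv> (gen_a, True)"
abbreviation gB :: "ab \<times> bool" where "gB \<equiv> (gen_b, True)"

text \<open>The cosets of \<open>\<langle>b\<rangle>\<close> are represented by the reduced words that do not end in a power of \<open>b\<close>.\<close>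

definition cosets :: "(ab \<times> bool) list set" where
  "cosets = {w. reduced_word w \<and> (w = [] \<or> fst (last w) = gen_a)}"

text \<open>Left multiplication on coset representatives. It agrees with \<open>push\<close> except
  that both letters of \<open>gen_b\<close> fix the trivial coset: this is the loop of the Schreier
  graph.\<close>

definition act :: "ab \<times> bool \<Rightarrow> (ab \<times> bool) list \<Rightarrow> (ab \<times> bool) list" where
  "act l w = (if w = [] \<and> fst l = gen_b then [] else push l w)"

definition cact :: "(ab \<times> bool) list \<Rightarrow> (ab \<times> bool) list \<Rightarrow> (ab \<times> bool) list" where
  "cact g w = foldr act g w"

lemma not_gen_b: "s \<noteq> gen_b \<longleftrightarrow> s = gen_a" "s \<noteq> gen_a \<longleftrightarrow> s = gen_b"
  by (cases s; simp)+

lemma Nil_cosets [simp]: "[] \<in> cosets"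
  and gA_cosets [simp]: "[(gen_a, b)] \<in> cosets"
  by (simp_all add: cosets_def)

lemma cosets_carrier: "w \<in> cosets \<Longrightarrow> w \<in> carrier F2"
  by (simp add: cosets_def F2_carrier)

lemma cosets_tl: "l # w \<in> cosets \<Longrightarrow> w \<in> cosets"
  by (auto simp: cosets_def dest: reduced_tl split: if_splits)

lemma act_cosets: "w \<in> cosets \<Longrightarrow> act l w \<in> cosets"
proof (cases w)
  case Nil
  then show ?thesis by (auto simp: act_def cosets_def not_gen_b)
next
  case (Cons m v)
  assume "w \<in> cosets"
  then show ?thesis using Cons cosets_tl[of m v] by (auto simp: act_def cosets_def)
qed

lemma act_inverse: "w \<in> cosets \<Longrightarrow> act (inv_letter l) (act l w) = w"
proof (cases w)
  case (Cons m v)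
  assume w: "w \<in> cosets"
  show ?thesis
  proof (cases "m = inv_letter l")
    case True
    have "act l w = v" using True Cons by (simp add: act_def)
    moreover have "\<not> (v = [] \<and> fst l = gen_b)" using w Cons True by (auto simp: cosets_def)
    moreover have "push (inv_letter l) v = w" using w Cons True by (cases v) (auto simp: cosets_def)
    ultimately show ?thesis by (auto simp: act_def)
  qed (use Cons in \<open>auto simp: act_def\<close>)
qed (auto simp: act_def)

lemma act_inverse': "w \<in> cosets \<Longrightarrow> act l (act (inv_letter l) w) = w"
  using act_inverse[of w "inv_letter l"] by simp

lemma cact_simps [simp]: "cact [] w = w" "cact (l # g) w = act l (cact g w)"
  by (simp_all add: cact_def)

lemma cact_append: "cact (g @ h) w = cact g (cact h w)"
  by (simp add: cact_def)

lemma cact_cosets: "w \<in> cosets \<Longrightarrow> cact g w \<in> cosets"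
  by (induction g) (auto intro: act_cosets)

lemma cact_push: "w \<in> cosets \<Longrightarrow> cact (push l v) w = act l (cact v w)"
  by (cases v) (auto simp: act_inverse' cact_cosets)

lemma cact_mult: "w \<in> cosets \<Longrightarrow> cact (u \<otimes>\<^bsub>F2\<^esub> v) w = cact u (cact v w)"
proof -
  assume w: "w \<in> cosets"
  have "cact (foldr push u v) w = cact u (cact v w)"
    by (induction u) (simp_all add: cact_push[OF w])
  then show ?thesis by (simp add: F2_mult)
qed

lemma F2_inv: "g \<in> carrier F2 \<Longrightarrow> inv\<^bsub>F2\<^esub> g \<in> carrier F2"
  by (rule group.inv_closed[OF F2_group])

lemma F2_inv_inv [simp]: "g \<in> carrier F2 \<Longrightarrow> inv\<^bsub>F2\<^esub> (inv\<^bsub>F2\<^esub> g) = g"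
  by (rule group.inv_inv[OF F2_group])

lemma F2_inv_mult: "g \<in> carrier F2 \<Longrightarrow> h \<in> carrier F2 \<Longrightarrow>
    inv\<^bsub>F2\<^esub> (g \<otimes>\<^bsub>F2\<^esub> h) = inv\<^bsub>F2\<^esub> h \<otimes>\<^bsub>F2\<^esub> inv\<^bsub>F2\<^esub> g"
  by (rule group.inv_mult_group[OF F2_group])

lemma F2_inv_one [simp]: "inv\<^bsub>F2\<^esub> [] = []"
  using group.is_monoid[OF F2_group] monoid.inv_one[of F2] by (simp add: F2_one)

lemma F2_inv_letter: "inv\<^bsub>F2\<^esub> [l] = [inv_letter l]"
  by (rule group.inv_equality[OF F2_group]) (simp_all add: F2_mult F2_one F2_carrier)

lemma cact_inv:
  assumes "g \<in> carrier F2" "w \<in> cosets"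
  shows "cact g (cact (inv\<^bsub>F2\<^esub> g) w) = w" "cact (inv\<^bsub>F2\<^esub> g) (cact g w) = w"
  using cact_mult[OF assms(2), of g "inv\<^bsub>F2\<^esub> g"] cact_mult[OF assms(2), of "inv\<^bsub>F2\<^esub> g" g] assms(1)
    group.r_inv[OF F2_group] group.l_inv[OF F2_group] by (simp_all add: F2_one)

lemma bij_cact: "g \<in> carrier F2 \<Longrightarrow> bij_betw (cact g) cosets cosets"
  by (rule bij_betw_byWitness[where f'="cact (inv\<^bsub>F2\<^esub> g)"]) (auto simp: cact_inv cact_cosets)

lemma inj_cact: "g \<in> carrier F2 \<Longrightarrow> inj_on (cact g) cosets"
  using bij_cact by (auto simp: bij_betw_def)

lemma reduced_append:
  "reduced_word (u @ v) \<longleftrightarrow> reduced_word u \<and> reduced_word v \<and> (u = [] \<or> v = [] \<or> hd v \<noteq> inv_letter (last u))"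
proof (induction u)
  case (Cons l u)
  note IH = Cons.IH
  show ?case
  proof (cases u)
    case Nil
    then show ?thesis by (cases v) auto
  next
    case (Cons m w)
    then show ?thesis using IH by auto
  qed
qed simp

lemma cact_eq_append: "w \<noteq> [] \<Longrightarrow> reduced_word (u @ w) \<Longrightarrow> cact u w = u @ w"
proof (induction u)
  case (Cons l u)
  then have "cact u w = u @ w" by (auto dest: reduced_tl)
  moreover have "push l (u @ w) = l # u @ w" using Cons.prems by (cases "u @ w") auto
  ultimately show ?case using Cons.prems by (simp add: act_def)
qed simp

text \<open>Transitivity made explicit: the representative itself carries the root to its coset, so
  that every coordinate of a configuration is the root coordinate of a translate.\<close>

lemma cact_Nil_eq: "w \<in> cosets \<Longrightarrow> cact w [] = w"
proof (cases w rule: rev_cases)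
  case (snoc u l)
  assume w: "w \<in> cosets"
  have "act l [] = [l]" using w snoc by (auto simp: act_def cosets_def)
  then have "cact w [] = cact u [l]" using snoc by (simp add: cact_append)
  then show ?thesis using cact_eq_append[of "[l]" u] w snoc by (simp add: cosets_def)
qed simp

lemma length_act: "length (act l w) \<le> Suc (length w)"
  by (cases w) (auto simp: act_def)

lemma length_cact: "length (cact g w) \<le> length g + length w"
proof (induction g)
  case (Cons l g)
  then show ?case using length_act[of l "cact g w"] by simp
qed simp

lemma countable_words: "countable (A :: (ab \<times> bool) list set)"
proof -
  have "(UNIV :: ab set) = {gen_a, gen_b}" using not_gen_b by auto
  then have "finite (UNIV :: ab set)" by (metis finite.emptyI finite_insert)
  then have "finite (UNIV :: (ab \<times> bool) set)" by (simp add: finite_prod)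
  then have "countable (lists (UNIV :: (ab \<times> bool) set))" by (intro countable_lists countable_finite)
  then show ?thesis by (rule countable_subset[rotated]) auto
qed

subsection \<open>The action\<close>

text \<open>The outer restriction is demanded by \<open>BijGroup\<close>, whose elements are
  extensional on the space.\<close>

definition shift :: "(ab \<times> bool) list \<Rightarrow> ((ab \<times> bool) list \<Rightarrow> real) \<Rightarrow> (ab \<times> bool) list \<Rightarrow> real" where
  "shift g = (\<lambda>x\<in>zero_one cosets. \<lambda>j\<in>cosets. x (cact (inv\<^bsub>F2\<^esub> g) j))"

abbreviation mu :: "((ab \<times> bool) list \<Rightarrow> real) measure" where "mu \<equiv> coin cosets"

lemma shift_apply: "x \<in> zero_one cosets \<Longrightarrow> j \<in> cosets \<Longrightarrow> shift g x j = x (cact (inv\<^bsub>F2\<^esub> g) j)"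
  by (simp add: shift_def)

lemma shift_zero_one: "x \<in> zero_one cosets \<Longrightarrow> shift g x \<in> zero_one cosets"
  unfolding shift_def by (simp, rule permute_zero_one) (auto intro: cact_cosets)

lemma shift_mult:
  assumes g: "g \<in> carrier F2" and h: "h \<in> carrier F2" and x: "x \<in> zero_one cosets"
  shows "shift (g \<otimes>\<^bsub>F2\<^esub> h) x = shift g (shift h x)"
proof (rule zero_one_eqI[OF shift_zero_one[OF x] shift_zero_one[OF shift_zero_one[OF x]]])
  fix j assume j: "j \<in> cosets"
  show "shift (g \<otimes>\<^bsub>F2\<^esub> h) x j = shift g (shift h x) j"
    using shift_apply[OF x j, of "g \<otimes>\<^bsub>F2\<^esub> h"] shift_apply[OF shift_zero_one[OF x] j, of g h]
      shift_apply[OF x cact_cosets[OF j], of h "inv\<^bsub>F2\<^esub> g"] cact_mult[OF j] F2_inv_mult[OF g h] by simp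
qed

lemma shift_one: "x \<in> zero_one cosets \<Longrightarrow> shift [] x = x"
  by (rule zero_one_eqI[OF shift_zero_one]) (auto simp: shift_apply)

lemma shift_inv:
  assumes "g \<in> carrier F2" "x \<in> zero_one cosets"
  shows "shift (inv\<^bsub>F2\<^esub> g) (shift g x) = x" "shift g (shift (inv\<^bsub>F2\<^esub> g) x) = x"
  using shift_mult[OF F2_inv[OF assms(1)] assms] shift_mult[OF assms(1) F2_inv[OF assms(1)] assms(2)] assms
    group.r_inv[OF F2_group] group.l_inv[OF F2_group] by (simp_all add: F2_one shift_one)

lemma bij_shift: "g \<in> carrier F2 \<Longrightarrow> bij_betw (shift g) (zero_one cosets) (zero_one cosets)"
  by (rule bij_betw_byWitness[where f'="shift (inv\<^bsub>F2\<^esub> g)"]) (auto simp: shift_inv shift_zero_one)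

lemma group_action_shift: "group_action F2 (zero_one cosets) shift"
proof -
  have "shift \<in> hom F2 (BijGroup (zero_one cosets))"
  proof (rule homI)
    fix g assume g: "g \<in> carrier F2"
    then show gB: "shift g \<in> carrier (BijGroup (zero_one cosets))"
      using bij_shift by (simp add: BijGroup_def Bij_def shift_def)
    fix h assume h: "h \<in> carrier F2"
    have B: "shift u \<in> Bij (zero_one cosets)" if "u \<in> carrier F2" for u
      using bij_shift[OF that] by (simp add: Bij_def shift_def)
    have "shift (g \<otimes>\<^bsub>F2\<^esub> h) = compose (zero_one cosets) (shift g) (shift h)"
    proof
      fix x show "shift (g \<otimes>\<^bsub>F2\<^esub> h) x = compose (zero_one cosets) (shift g) (shift h) x"
        using shift_mult[OF g h, of x] by (cases "x \<in> zero_one cosets") (simp_all add: compose_def shift_def)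
    qed
    then show "shift (g \<otimes>\<^bsub>F2\<^esub> h) = shift g \<otimes>\<^bsub>BijGroup (zero_one cosets)\<^esub> shift h"
      using B[OF g] B[OF h] by (simp add: BijGroup_def)
  qed
  then show ?thesis
    by (simp add: group_action_def group_hom_def group_hom_axioms_def F2_group group_BijGroup)
qed

lemma shift_measurable: "shift g \<in> measurable mu mu"
proof -
  have "(\<lambda>x. \<lambda>j\<in>cosets. x (cact (inv\<^bsub>F2\<^esub> g) j)) \<in> measurable mu mu"
    by (rule permute_measurable) (auto intro: cact_cosets)
  then show ?thesis by (rule measurable_cong[THEN iffD2, rotated]) (simp add: shift_def)
qed

lemma distr_shift:
  assumes g: "g \<in> carrier F2"
  shows "distr mu mu (shift g) = mu"
proof -
  have "distr mu mu (shift g) = distr mu mu (\<lambda>x. \<lambda>j\<in>cosets. x (cact (inv\<^bsub>F2\<^esub> g) j))"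
    by (rule distr_cong) (simp_all add: shift_def)
  then show ?thesis using distr_permute[OF bij_cact[OF F2_inv[OF g]]] by simp
qed

lemma pmp_shift: "pmp_action F2 mu shift"
  unfolding pmp_action_def using prob_coin group_action_shift shift_measurable distr_shift by simp

interpretation shift: F2_pmp mu shift
  by unfold_locales (rule pmp_shift)

lemma algebraic_shift: "algebraic_action F2 (Z2_power cosets) (coin_top cosets) mu shift"
  unfolding algebraic_action_def
proof (intro conjI ballI)
  show "compact_metrizable_group (Z2_power cosets) (coin_top cosets)"
    by (rule compact_metrizable_group_Z2_power[OF countable_words])
  show "haar_prob (Z2_power cosets) (coin_top cosets) mu"
    by (rule haar_coin[OF countable_words])
  show "group_action F2 (carrier (Z2_power cosets)) shift"
    using group_action_shift by simp
  fix g assume g: "g \<in> carrier F2"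
  have "shift g \<in> hom (Z2_power cosets) (Z2_power cosets)"
  proof (rule homI)
    fix x y assume "x \<in> carrier (Z2_power cosets)" "y \<in> carrier (Z2_power cosets)"
    then have xy: "x \<in> zero_one cosets" "y \<in> zero_one cosets" by simp_all
    show "shift g (x \<otimes>\<^bsub>Z2_power cosets\<^esub> y) = shift g x \<otimes>\<^bsub>Z2_power cosets\<^esub> shift g y"
    proof (rule zero_one_eqI)
      fix j assume j: "j \<in> cosets"
      have "shift g (x \<otimes>\<^bsub>Z2_power cosets\<^esub> y) j = xor2 (x (cact (inv\<^bsub>F2\<^esub> g) j)) (y (cact (inv\<^bsub>F2\<^esub> g) j))"
        using shift_apply[OF translate_zero_one j] cact_cosets[OF j] by simp
      then show "shift g (x \<otimes>\<^bsub>Z2_power cosets\<^esub> y) j = (shift g x \<otimes>\<^bsub>Z2_power cosets\<^esub> shift g y) j"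
        using j xy by (simp add: shift_apply)
    qed (simp_all add: shift_zero_one translate_zero_one)
  qed (simp add: shift_zero_one)
  then show "shift g \<in> iso (Z2_power cosets) (Z2_power cosets)"
    using bij_shift[OF g] by (simp add: iso_def)
  have cont: "continuous_map (coin_top cosets) (coin_top cosets) (shift h)" for h
  proof (rule continuous_into_coin_top)
    fix j assume j: "j \<in> cosets"
    show "continuous_map (coin_top cosets) (discrete_topology {0, 1}) (\<lambda>x. shift h x j)"
      by (rule continuous_map_eq[OF continuous_coin_coordinate[OF cact_cosets[OF j]]])
         (simp add: shift_apply[OF _ j])
  qed (auto simp: shift_zero_one)
  show "homeomorphic_map (coin_top cosets) (coin_top cosets) (shift g)"
    unfolding homeomorphic_map_maps homeomorphic_maps_def
    using cont shift_inv[OF g] by (intro exI[of _ "shift (inv\<^bsub>F2\<^esub> g)"]) simp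
qed

subsection \<open>Essential freeness\<close>

text \<open>A measurable subgroup of infinite index is null, its translates having the same measure.\<close>

lemma null_subgroup:
  assumes H: "H \<in> sets (coin J)" and add: "\<And>x y. x \<in> H \<Longrightarrow> y \<in> H \<Longrightarrow> (\<lambda>j\<in>J. xor2 (x j) (y j)) \<in> H"
    and y: "\<And>k :: nat. y k \<in> zero_one J" "\<And>k l. k < l \<Longrightarrow> (\<lambda>j\<in>J. xor2 (y k j) (y l j)) \<notin> H"
  shows "measure (coin J) H = 0"
proof (rule ccontr)
  interpret prob_space "coin J" by (rule prob_coin)
  assume "measure (coin J) H \<noteq> 0"
  then have pos: "0 < measure (coin J) H" by (simp add: less_le)
  \<comment> \<open>The translates of \<open>H\<close> by the \<open>y k\<close>, written as
    preimages since translations are involutions; a common point of two of them would put the sum of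
    the two translating elements into \<open>H\<close>.\<close>
  define S where "S k = (\<lambda>z. \<lambda>j\<in>J. xor2 (y k j) (z j)) -` H \<inter> space (coin J)" for k
  have Sm: "S k \<in> sets (coin J)" for k
    unfolding S_def by (rule measurable_sets[OF translate_measurable[OF y(1)] H])
  have mS: "measure (coin J) (S k) = measure (coin J) H" for k
    unfolding S_def using measure_distr[OF translate_measurable[OF y(1)] H, of k] by (simp add: distr_translate[OF y(1)])
  have d: "S k \<inter> S l = {}" if "k < l" for k l
  proof (rule ccontr)
    assume "S k \<inter> S l \<noteq> {}"
    then obtain z where z: "z \<in> zero_one J" "(\<lambda>j\<in>J. xor2 (y k j) (z j)) \<in> H" "(\<lambda>j\<in>J. xor2 (y l j) (z j)) \<in> H"
      by (auto simp: S_def)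
    have "(\<lambda>j\<in>J. xor2 ((\<lambda>j\<in>J. xor2 (y k j) (z j)) j) ((\<lambda>j\<in>J. xor2 (y l j) (z j)) j)) = (\<lambda>j\<in>J. xor2 (y k j) (y l j))"
    proof (rule restrict_ext)
      fix j assume "j \<in> J"
      then show "xor2 ((\<lambda>j\<in>J. xor2 (y k j) (z j)) j) ((\<lambda>j\<in>J. xor2 (y l j) (z j)) j) = xor2 (y k j) (y l j)"
        using zero_one_D[OF y(1), of j k] zero_one_D[OF y(1), of j l] zero_one_D[OF z(1), of j] by (auto simp: xor2_def)
    qed
    then show False using add[OF z(2,3)] y(2)[OF that] by simp
  qed
  have disj: "disjoint_family_on S {..<n}" for n
    unfolding disjoint_family_on_def using d by (metis Int_commute linorder_neqE_nat)
  obtain n where n: "1 < real n * measure (coin J) H"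
    using reals_Archimedean3[OF pos] by blast
  have "real n * measure (coin J) H = (\<Sum>k<n. measure (coin J) (S k))" by (simp add: mS)
  also have "\<dots> = measure (coin J) (\<Union>k<n. S k)"
    by (rule finite_measure_finite_Union[symmetric, OF _ _ disj]) (use Sm in auto)
  also have "\<dots> \<le> 1" by (rule prob_le_1)
  finally show False using n by simp
qed

text \<open>The fixed configurations form a subgroup. Indicators of single cosets
  \<open>v k\<close>, which the inverse of \<open>g\<close> moves to longer words, represent
  infinitely many classes modulo it, so \<open>null_subgroup\<close> applies.\<close>

lemma fixed_points_null:
  assumes g: "g \<in> carrier F2" "g \<noteq> []"
  shows "{x \<in> zero_one cosets. shift g x = x} \<in> sets mu" "measure mu {x \<in> zero_one cosets. shift g x = x} = 0"
proof -
  let ?h = "inv\<^bsub>F2\<^esub> g" and ?H = "{x \<in> zero_one cosets. shift g x = x}"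
  have h: "?h \<in> carrier F2" "?h \<noteq> []"
    using F2_inv[OF g(1)] F2_inv_inv[OF g(1)] g(2) by auto
  have Heq: "?H = {x \<in> zero_one cosets. \<forall>j\<in>cosets. x (cact ?h j) = x j}"
  proof (intro Collect_cong conj_cong refl)
    fix x assume x: "x \<in> zero_one cosets"
    show "shift g x = x \<longleftrightarrow> (\<forall>j\<in>cosets. x (cact ?h j) = x j)"
      using shift_apply[OF x, of _ g] zero_one_eqI[OF shift_zero_one[OF x] x, of g] by metis
  qed
  have eqs: "{x \<in> zero_one cosets. x i = x j} \<in> sets mu" if ij: "i \<in> cosets" "j \<in> cosets" for i j
  proof -
    have "{x \<in> zero_one cosets. x i = x j} = ({x \<in> zero_one cosets. x i = 0} \<inter> {x \<in> zero_one cosets. x j = 0}) \<union>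
        ({x \<in> zero_one cosets. x i = 1} \<inter> {x \<in> zero_one cosets. x j = 1})"
      using zero_one_D[OF _ ij(1)] zero_one_D[OF _ ij(2)] by fastforce
    then show ?thesis using sets_coin_coordinate[OF ij(1)] sets_coin_coordinate[OF ij(2)] by auto
  qed
  have "?H = (\<Inter>j\<in>cosets. {x \<in> zero_one cosets. x (cact ?h j) = x j})"
    unfolding Heq using Nil_cosets by blast
  also have "\<dots> \<in> sets mu"
    by (rule sets.countable_INT'[OF countable_words]) (auto intro!: eqs cact_cosets intro: Nil_cosets)
  finally show m: "?H \<in> sets mu" .
  \<comment> \<open>This letter cancels neither against the last letter of \<open>?h\<close> nor
    against the final \<open>gA\<close> of \<open>v k\<close>; that final letter makes
    \<open>v k\<close> the representative of a coset.\<close>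
  define c where "c = (if last ?h = (gen_a, False) then gB else gA)"
  have c: "c \<noteq> inv_letter (last ?h)" "c \<noteq> (gen_a, False)"
    by (auto simp: c_def inv_letter_def prod_eq_iff)
  define v where "v k = replicate (Suc k) c @ [gA]" for k :: nat
  have rep: "reduced_word (replicate k c)" for k
    by (induction k rule: induct_nat_012) auto
  have vred: "reduced_word (v k)" for k
    unfolding v_def reduced_append using rep[of "Suc k"] c(2) by (cases c) (auto simp: inv_letter_def simp del: replicate_Suc)
  have vco: "v k \<in> cosets" for k using vred by (simp add: cosets_def v_def)
  have hv: "cact ?h (v k) = ?h @ v k" for k
    by (rule cact_eq_append) (use vred h c in \<open>auto simp: v_def reduced_append F2_carrier\<close>)
  define y where "y k = (\<lambda>j\<in>cosets. if j = v k then 1 else 0 :: real)" for k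
  show "measure mu ?H = 0"
  proof (rule null_subgroup[OF m])
    show "y k \<in> zero_one cosets" for k unfolding y_def by (rule zero_one_restrictI) auto
    show "(\<lambda>j\<in>cosets. xor2 (x j) (z j)) \<in> ?H" if "x \<in> ?H" "z \<in> ?H" for x z
      using that cact_cosets translate_zero_one unfolding Heq by auto
    show "(\<lambda>j\<in>cosets. xor2 (y k j) (y l j)) \<notin> ?H" if "k < l" for k l
    proof
      assume "(\<lambda>j\<in>cosets. xor2 (y k j) (y l j)) \<in> ?H"
      \<comment> \<open>Invariance is tested at \<open>v l\<close>, the longer of the two supports:
        the sum is 1 there and 0 at its image.\<close>
      then have "xor2 (y k (?h @ v l)) (y l (?h @ v l)) = xor2 (y k (v l)) (y l (v l))"
        unfolding Heq using vco[of l] cact_cosets[OF vco[of l], of ?h] by (auto simp: hv)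
      moreover have "length (v k) < length (v l)" "length (v l) < length (?h @ v l)"
        using that h by (auto simp: v_def)
      then have "v k \<noteq> v l" "?h @ v l \<noteq> v l" "?h @ v l \<noteq> v k" by (metis less_irrefl less_trans)+
      ultimately show False
        using vco[of l] cact_cosets[OF vco[of l], of ?h] by (auto simp: y_def hv xor2_def)
    qed
  qed
qed

lemma essentially_free_shift: "essentially_free F2 mu shift"
proof -
  have "AE x in mu. \<forall>g\<in>carrier F2. shift g x = x \<longrightarrow> g = \<one>\<^bsub>F2\<^esub>"
  proof (subst AE_ball_countable[OF countable_words], intro ballI)
    fix g assume g: "g \<in> carrier F2"
    show "AE x in mu. shift g x = x \<longrightarrow> g = \<one>\<^bsub>F2\<^esub>"
    proof (cases "g = []")
      case False
      note n = fixed_points_null[OF g False]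
      have "AE x in mu. \<not> shift g x = x"
        by (rule AE_I[where N="{x \<in> zero_one cosets. shift g x = x}"]) (use n in \<open>auto simp: shift.emeasure_eq_measure\<close>)
      then show ?thesis by eventually_elim simp
    qed (simp add: F2_one)
  qed
  then show ?thesis by (simp add: essentially_free_def)
qed

section \<open>Partitions into the fibres of a label\<close>

definition fibers :: "'x measure \<Rightarrow> ('x \<Rightarrow> nat) \<Rightarrow> 'x set set" where
  "fibers M X = (\<lambda>\<omega>. {\<omega>' \<in> space M. X \<omega>' = X \<omega>}) ` space M"

lemma fibers_partition: "partition_on (space M) (fibers M X)"
proof (rule partition_onI)
  show "disjnt p q" if pq: "p \<in> fibers M X" "q \<in> fibers M X" "p \<noteq> q" for p q
  proof -
    obtain u v where "p = {\<omega>' \<in> space M. X \<omega>' = X u}" "q = {\<omega>' \<in> space M. X \<omega>' = X v}"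
      using pq by (auto simp: fibers_def)
    then show ?thesis using pq(3) unfolding disjnt_def by force
  qed
qed (auto simp: fibers_def)

lemma fibers_labels: "X \<in> measurable M (count_space UNIV) \<Longrightarrow> labels M (fibers M X) X"
  unfolding labels_def fibers_def by (intro conjI ballI) auto

lemma fibers_measurable_partition:
  "X \<in> measurable M (count_space UNIV) \<Longrightarrow> measurable_partition M (fibers M X)"
  by (rule measurable_partition_labels[OF fibers_partition fibers_labels])

subsection \<open>Generating partitions\<close>

lemma invariant_sigma_algebra_sigma:
  assumes "measurable_partition mu P"
  shows "sigma_algebra (zero_one cosets) (invariant_sigma_algebra F2 mu shift P)"
    "P \<subseteq> invariant_sigma_algebra F2 mu shift P"
    "\<And>g A. g \<in> carrier F2 \<Longrightarrow> A \<in> invariant_sigma_algebra F2 mu shift P \<Longrightarrow>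
       shift g -` A \<inter> zero_one cosets \<in> invariant_sigma_algebra F2 mu shift P"
proof -
  let ?F = "{\<A>. sigma_algebra (space mu) \<A> \<and> P \<subseteq> \<A> \<and>
         (\<forall>g\<in>carrier F2. \<forall>A\<in>\<A>. shift g -` A \<inter> space mu \<in> \<A>)}"
  have I: "invariant_sigma_algebra F2 mu shift P = \<Inter>?F" by (simp add: invariant_sigma_algebra_def)
  have "P \<subseteq> Pow (zero_one cosets)"
    using assms sets.sets_into_space[of _ mu] by (auto simp: measurable_partition_def)
  then have Pow: "Pow (zero_one cosets) \<in> ?F" by (auto simp: sigma_algebra_Pow)
  show "sigma_algebra (zero_one cosets) (invariant_sigma_algebra F2 mu shift P)"
    unfolding sigma_algebra_iff2
  proof (intro conjI ballI allI impI)
    show "invariant_sigma_algebra F2 mu shift P \<subseteq> Pow (zero_one cosets)"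
      unfolding I using Pow by (rule Inter_lower)
    show "{} \<in> invariant_sigma_algebra F2 mu shift P"
      unfolding I by (auto simp: sigma_algebra_iff2)
    show "zero_one cosets - s \<in> invariant_sigma_algebra F2 mu shift P"
      if "s \<in> invariant_sigma_algebra F2 mu shift P" for s
      using that unfolding I by (auto simp: sigma_algebra_iff2)
    show "(\<Union>i. A i) \<in> invariant_sigma_algebra F2 mu shift P"
      if A: "range A \<subseteq> invariant_sigma_algebra F2 mu shift P" for A :: "nat \<Rightarrow> _"
      unfolding I
    proof
      fix \<A> assume a: "\<A> \<in> ?F"
      then have "range A \<subseteq> \<A>" using A unfolding I by blast
      then show "(\<Union>i. A i) \<in> \<A>" using a by (simp add: sigma_algebra_iff2)
    qed
  qed
  show "P \<subseteq> invariant_sigma_algebra F2 mu shift P" unfolding I by blast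
  show "shift g -` A \<inter> zero_one cosets \<in> invariant_sigma_algebra F2 mu shift P"
    if "g \<in> carrier F2" "A \<in> invariant_sigma_algebra F2 mu shift P" for g A
    using that unfolding I by simp
qed

lemma AE_shift:
  assumes g: "g \<in> carrier F2" and "AE x in mu. Q x"
  shows "AE x in mu. Q (shift g x)"
proof -
  have "AE x in distr mu mu (shift g). Q x" unfolding distr_shift[OF g] by (rule assms(2))
  then show ?thesis by (rule AE_distrD[OF shift_measurable])
qed

text \<open>Recovering the root coordinate almost everywhere is enough: its translates are all
  coordinates, and the sets almost equal to members of the invariant sigma-algebra form a
  sigma-algebra themselves.\<close>

lemma generating_shiftI:
  assumes P: "measurable_partition mu P" and A: "A \<in> invariant_sigma_algebra F2 mu shift P"
    and ae: "AE x in mu. x \<in> A \<longleftrightarrow> x [] = 1"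
  shows "generating_partition F2 mu shift P"
proof -
  let ?I = "invariant_sigma_algebra F2 mu shift P"
  note I = invariant_sigma_algebra_sigma[OF P]
  define \<B> where "\<B> = {B. B \<subseteq> zero_one cosets \<and> (\<exists>A\<in>?I. AE x in mu. x \<in> A \<longleftrightarrow> x \<in> B)}"
  have sB: "sigma_algebra (zero_one cosets) \<B>"
    unfolding sigma_algebra_iff2
  proof (intro conjI ballI allI impI)
    show "\<B> \<subseteq> Pow (zero_one cosets)" by (auto simp: \<B>_def)
    have "{} \<in> ?I" using I(1) by (simp add: sigma_algebra_iff2)
    then show "{} \<in> \<B>" by (auto simp: \<B>_def)
    fix B assume "B \<in> \<B>"
    then obtain C where C: "C \<in> ?I" "AE x in mu. x \<in> C \<longleftrightarrow> x \<in> B" by (auto simp: \<B>_def)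
    have "zero_one cosets - C \<in> ?I" using I(1) C(1) by (simp add: sigma_algebra_iff2)
    moreover have "AE x in mu. x \<in> zero_one cosets - C \<longleftrightarrow> x \<in> zero_one cosets - B" using C(2) by eventually_elim auto
    ultimately show "zero_one cosets - B \<in> \<B>" unfolding \<B>_def by blast
  next
    fix B :: "nat \<Rightarrow> _" assume "range B \<subseteq> \<B>"
    then have "B i \<in> \<B>" for i by blast
    then have BO: "B i \<subseteq> zero_one cosets" and "\<exists>A. A \<in> ?I \<and> (AE x in mu. x \<in> A \<longleftrightarrow> x \<in> B i)" for i
      unfolding \<B>_def by blast+
    then have "\<forall>i. \<exists>A. A \<in> ?I \<and> (AE x in mu. x \<in> A \<longleftrightarrow> x \<in> B i)" by blast
    from choice[OF this] obtain C where
      C: "\<And>i. C i \<in> ?I" "\<And>i. AE x in mu. x \<in> C i \<longleftrightarrow> x \<in> B i" by blast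
    have "AE x in mu. \<forall>i. x \<in> C i \<longleftrightarrow> x \<in> B i" using C(2) by (simp add: AE_all_countable)
    then have "AE x in mu. x \<in> (\<Union>i. C i) \<longleftrightarrow> x \<in> (\<Union>i. B i)" by eventually_elim auto
    moreover have "(\<Union>i. C i) \<in> ?I" using I(1) C(1) by (simp add: sigma_algebra_iff2 image_subset_iff)
    moreover have "(\<Union>i. B i) \<subseteq> zero_one cosets" using BO by blast
    ultimately show "(\<Union>i. B i) \<in> \<B>" unfolding \<B>_def by blast
  qed
  then interpret B: sigma_algebra "zero_one cosets" \<B> .
  have coord: "{x \<in> zero_one cosets. x j = 1} \<in> \<B>" if j: "j \<in> cosets" for j
  proof -
    have jc: "j \<in> carrier F2" by (rule cosets_carrier[OF j])
    let ?g = "inv\<^bsub>F2\<^esub> j"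
    have "AE x in mu. x \<in> shift ?g -` A \<inter> zero_one cosets \<longleftrightarrow> x \<in> {x \<in> zero_one cosets. x j = 1}"
      using AE_shift[OF F2_inv[OF jc] ae] AE_space
    proof eventually_elim
      case (elim x)
      then show ?case using shift_apply[of x "[]" ?g] jc cact_Nil_eq[OF j] by simp
    qed
    moreover have "shift ?g -` A \<inter> zero_one cosets \<in> ?I" by (rule I(3)[OF F2_inv[OF jc] A])
    ultimately show ?thesis unfolding \<B>_def by blast
  qed
  let ?N = "sigma (zero_one cosets) \<B>"
  have N: "space ?N = zero_one cosets" "sets ?N = \<B>" using B.space_closed B.sets_measure_of_eq by (auto simp: space_measure_of)
  have m: "(\<lambda>x. x) \<in> measurable ?N mu"
    by (rule measurable_coin_iff) (use N coord in auto)
  have "sets mu \<subseteq> \<B>"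
  proof
    fix S assume S: "S \<in> sets mu"
    have "(\<lambda>x. x) -` S \<inter> space ?N \<in> sets ?N" by (rule measurable_sets[OF m S])
    then show "S \<in> \<B>" using sets.sets_into_space[OF S] N by (simp add: Int_absorb2)
  qed
  then show ?thesis using P by (auto simp: generating_partition_def \<B>_def)
qed

definition root_label :: "((ab \<times> bool) list \<Rightarrow> real) \<Rightarrow> nat" where
  "root_label x = (if x [] = 1 then 1 else 0)"

lemma root_set: "{x \<in> zero_one cosets. x [] = 1} \<in> sets mu"
  by (rule sets_coin_coordinate) simp

lemma root_label_measurable: "root_label \<in> measurable mu (count_space UNIV)"
proof -
  have "(\<lambda>x. if x \<in> {x \<in> zero_one cosets. x [] = 1} then 1 else 0 :: nat) \<in> measurable mu (count_space UNIV)"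
  proof (rule measurable_If_set)
    have "{x \<in> zero_one cosets. x [] = 1} \<inter> space mu = {x \<in> zero_one cosets. x [] = 1}" by auto
    then show "{x \<in> zero_one cosets. x [] = 1} \<inter> space mu \<in> sets mu" using root_set by (simp only:)
  qed simp_all
  then show ?thesis by (rule measurable_cong[THEN iffD2, rotated]) (auto simp: root_label_def)
qed

lemma root_label_eq_iff:
  "x \<in> zero_one cosets \<Longrightarrow> y \<in> zero_one cosets \<Longrightarrow> root_label x = root_label y \<longleftrightarrow> x [] = y []"
  using zero_one_D[of x cosets "[]"] zero_one_D[of y cosets "[]"] by (auto simp: root_label_def)

lemma generating_root: "generating_partition F2 mu shift (fibers mu root_label)"
proof (rule generating_shiftI)
  show P: "measurable_partition mu (fibers mu root_label)"
    by (rule fibers_measurable_partition[OF root_label_measurable])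
  let ?x = "\<lambda>j\<in>cosets. 1 :: real"
  have x: "?x \<in> zero_one cosets" by (rule zero_one_restrictI) simp
  have "{y \<in> zero_one cosets. y [] = 1} = {y \<in> space mu. root_label y = root_label ?x}"
    using root_label_eq_iff[OF _ x] by auto
  then have "{y \<in> zero_one cosets. y [] = 1} \<in> fibers mu root_label" using x unfolding fibers_def by simp
  then show "{y \<in> zero_one cosets. y [] = 1} \<in> invariant_sigma_algebra F2 mu shift (fibers mu root_label)"
    using invariant_sigma_algebra_sigma(2)[OF P] by blast
qed (use AE_space in auto)

lemma dense_root: "shift.dense_label root_label"
  by (rule shift.dense_label_generating[OF generating_root fibers_labels[OF root_label_measurable]])

subsection \<open>Windows\<close>

text \<open>Labels equivalent to the restriction to a finite set of cosets. Their entropy is a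
  number of bits, which turns the functional F into a count.\<close>

definition window :: "(((ab \<times> bool) list \<Rightarrow> real) \<Rightarrow> nat) \<Rightarrow> (ab \<times> bool) list set \<Rightarrow> bool" where
  "window X D \<longleftrightarrow> X \<in> measurable mu (count_space UNIV) \<and> finite D \<and> D \<subseteq> cosets \<and>
     (\<forall>x\<in>zero_one cosets. \<forall>y\<in>zero_one cosets. X x = X y \<longleftrightarrow> (\<forall>j\<in>D. x j = y j))"

lemma window_root: "window root_label {[]}"
  unfolding window_def using root_label_measurable root_label_eq_iff by auto

lemma window_shift:
  assumes X: "window X D" and g: "g \<in> carrier F2"
  shows "window (\<lambda>x. X (shift g x)) (cact (inv\<^bsub>F2\<^esub> g) ` D)"
  unfolding window_def
proof (intro conjI ballI)
  show "(\<lambda>x. X (shift g x)) \<in> measurable mu (count_space UNIV)"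
    using X shift.label_T[OF _ g] by (auto simp: window_def)
  have D: "finite D" "D \<subseteq> cosets" using X by (auto simp: window_def)
  then show "finite (cact (inv\<^bsub>F2\<^esub> g) ` D)" "cact (inv\<^bsub>F2\<^esub> g) ` D \<subseteq> cosets" using cact_cosets by auto
  fix x y assume x: "x \<in> zero_one cosets" and y: "y \<in> zero_one cosets"
  have "X (shift g x) = X (shift g y) \<longleftrightarrow> (\<forall>j\<in>D. shift g x j = shift g y j)"
    using X shift_zero_one[OF x, of g] shift_zero_one[OF y, of g] unfolding window_def by blast
  also have "\<dots> \<longleftrightarrow> (\<forall>j\<in>D. x (cact (inv\<^bsub>F2\<^esub> g) j) = y (cact (inv\<^bsub>F2\<^esub> g) j))"
    by (intro ball_cong refl) (use D shift_apply[OF x] shift_apply[OF y] in auto)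
  finally show "X (shift g x) = X (shift g y) \<longleftrightarrow> (\<forall>j\<in>cact (inv\<^bsub>F2\<^esub> g) ` D. x j = y j)" by simp
qed

lemma window_pair: "window X D \<Longrightarrow> window Y E \<Longrightarrow> window (pair X Y) (D \<union> E)"
  unfolding window_def by (auto intro: measurable_pair_label simp: pair_def)

lemma window_fam:
  "set ws \<subseteq> carrier F2 \<Longrightarrow> window (shift.fam root_label ws) ((\<lambda>w. cact (inv\<^bsub>F2\<^esub> w) []) ` set ws)"
proof (induction ws)
  case Nil
  then show ?case by (simp add: shift.fam_def window_def)
next
  case (Cons w ws)
  have w: "window (\<lambda>x. root_label (shift w x)) {cact (inv\<^bsub>F2\<^esub> w) []}"
    using window_shift[OF window_root, of w] Cons.prems by simp
  have p: "window (pair (\<lambda>x. root_label (shift w x)) (shift.fam root_label ws))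
      ({cact (inv\<^bsub>F2\<^esub> w) []} \<union> (\<lambda>w. cact (inv\<^bsub>F2\<^esub> w) []) ` set ws)"
    by (rule window_pair[OF w Cons.IH]) (use Cons.prems in simp)
  have "shift.fam root_label (w # ws) \<in> measurable mu (count_space UNIV)"
    by (rule shift.label_fam[OF root_label_measurable Cons.prems])
  then show ?case using p unfolding window_def shift.fam_Cons by simp
qed

lemma window_ent:
  assumes "window X D"
  shows "fin_ent mu X" "ent mu X = real (card D) * ln 2"
proof -
  have D: "finite D" "D \<subseteq> cosets" and X: "X \<in> measurable mu (count_space UNIV)" using assms by (auto simp: window_def)
  have "atom_prob mu X x = (1 / 2) ^ card D" if x: "x \<in> zero_one cosets" for x
  proof -
    have "{y \<in> space mu. X y = X x} = cyl cosets D x"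
      using assms x unfolding window_def cyl_def by auto
    moreover have "measure mu (cyl cosets D x) = (1 / 2) ^ card D"
      by (rule measure_cyl[OF D]) (use zero_one_D[OF x] D in auto)
    ultimately show ?thesis by (simp add: atom_prob_def)
  qed
  then have e: "- ln (atom_prob mu X x) = real (card D) * ln 2" if "x \<in> space mu" for x
    using that by (simp add: ln_realpow ln_div)
  show "fin_ent mu X" unfolding fin_ent_def using X
    by (subst Bochner_Integration.integrable_cong[OF refl e]) simp_all
  have "ent mu X = (\<integral>x. real (card D) * ln 2 \<partial>mu)" unfolding ent_def
    by (rule Bochner_Integration.integral_cong[OF refl e])
  then show "ent mu X = real (card D) * ln 2" using shift.prob_space by simp
qed

text \<open>The joint label with a translate records the union of two windows of equal size, counted
  by inclusion and exclusion. The intersection counts the edges of the Schreier graph inside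
  \<open>D\<close> that carry the given generator.\<close>

lemma window_F_label:
  assumes X: "window X D"
  shows "shift.F_label X = ln 2 * (real (card D) - real (card (D \<inter> cact [(gen_a, False)] ` D)) - real (card (D \<inter> cact [(gen_b, False)] ` D)))"
proof -
  have D: "finite D" "D \<subseteq> cosets" using X by (auto simp: window_def)
  have J: "shift.J [(s, True)] X = (2 * real (card D) - real (card (D \<inter> cact [(s, False)] ` D))) * ln 2" for s
  proof -
    have i: "inv\<^bsub>F2\<^esub> [(s, True)] = [(s, False)]" by (simp add: F2_inv_letter inv_letter_def)
    have "card (cact [(s, False)] ` D) = card D"
      by (rule card_image) (rule inj_on_subset[OF inj_cact D(2)], simp add: F2_carrier)
    then have c: "card (D \<union> cact [(s, False)] ` D) + card (D \<inter> cact [(s, False)] ` D) = 2 * card D"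
      using card_Un_Int[OF D(1), of "cact [(s, False)] ` D"] D(1) by simp
    have "window (pair X (\<lambda>x. X (shift [(s, True)] x))) (D \<union> cact [(s, False)] ` D)"
      using window_pair[OF X window_shift[OF X shift.letter_carrier[of "(s, True)"]]] unfolding i .
    moreover have "real (card (D \<union> cact [(s, False)] ` D)) = 2 * real (card D) - real (card (D \<inter> cact [(s, False)] ` D))"
      using arg_cong[OF c, of real] by simp
    ultimately show ?thesis unfolding shift.J_def by (simp only: window_ent(2))
  qed
  show ?thesis unfolding shift.F_label_def J window_ent(2)[OF X] by (simp add: algebra_simps)
qed

text \<open>The Schreier graph on the cosets is a tree with one loop, at the trivial coset. Charging
  each edge inside \<open>D\<close> to its endpoint farther from the root, and the loop to the root, one finds
  at most \<open>card D\<close> edges.\<close>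

lemma cosets_edge_count:
  assumes D: "finite D" "D \<subseteq> cosets"
  shows "card (D \<inter> cact [(gen_a, False)] ` D) + card (D \<inter> cact [(gen_b, False)] ` D) \<le> card D"
proof -
  define E where "E l = {v \<in> D. act l v \<in> D}" for l
  \<comment> \<open>The longer endpoint of the edge from \<open>v\<close> along \<open>l\<close>; on
    the loop both endpoints are the root.\<close>
  define far where "far l v = (if act l v = l # v then act l v else v)" for l v
  have fin: "finite (E l)" for l using D by (simp add: E_def)
  have cE: "card (D \<inter> cact [l] ` D) = card (E l)" for l
  proof -
    have "D \<inter> cact [l] ` D = cact [l] ` E l" by (auto simp: E_def)
    moreover have "inj_on (cact [l]) (E l)"
      by (rule inj_on_subset[OF inj_cact]) (use D in \<open>auto simp: E_def F2_carrier\<close>)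
    ultimately show ?thesis by (metis card_image)
  qed
  have far_cases: "(far l v = [] \<and> v = [] \<and> fst l = gen_b) \<or> far l v = l # v \<or> (far l v = v \<and> (\<exists>t. v = inv_letter l # t))" for l v
    by (cases v) (auto simp: far_def act_def)
  have inj: "inj_on (far l) (E l)" for l
  proof (rule inj_onI)
    fix u v assume "u \<in> E l" "v \<in> E l" "far l u = far l v"
    then show "u = v" using far_cases[of l u] far_cases[of l v] by auto
  qed
  \<comment> \<open>The first letter of the far endpoint tells the generator of the edge, and the
    root is charged only by the loop of \<open>gen_b\<close>.\<close>
  have disj: "far (gen_a, False) ` E (gen_a, False) \<inter> far (gen_b, False) ` E (gen_b, False) = {}"
  proof (rule ccontr)
    assume "far (gen_a, False) ` E (gen_a, False) \<inter> far (gen_b, False) ` E (gen_b, False) \<noteq> {}"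
    then obtain u v where "far (gen_a, False) u = far (gen_b, False) v" by auto
    then show False
      using far_cases[of "(gen_a, False)" u] far_cases[of "(gen_b, False)" v] by (auto simp: inv_letter_def)
  qed
  have "card (E (gen_a, False)) + card (E (gen_b, False)) =
      card (far (gen_a, False) ` E (gen_a, False) \<union> far (gen_b, False) ` E (gen_b, False))"
    using fin by (simp add: card_Un_disjoint[OF _ _ disj] card_image[OF inj])
  also have "\<dots> \<le> card D"
    by (rule card_mono[OF D(1)]) (auto simp: far_def E_def)
  finally show ?thesis unfolding cE .
qed

text \<open>A single vertex carrying one loop.\<close>

lemma F_label_root: "shift.F_label root_label \<le> 0"
proof -
  have "{[]} \<inter> cact [(gen_b, False)] ` {[]} = {[]}" by (simp add: act_def)
  then show ?thesis unfolding window_F_label[OF window_root] by simp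
qed

lemma F_label_fam_root:
  assumes "set ws \<subseteq> carrier F2"
  shows "0 \<le> shift.F_label (shift.fam root_label ws)"
proof -
  note w = window_fam[OF assms]
  let ?D = "(\<lambda>w. cact (inv\<^bsub>F2\<^esub> w) []) ` set ws"
  have "card (?D \<inter> cact [(gen_a, False)] ` ?D) + card (?D \<inter> cact [(gen_b, False)] ` ?D) \<le> card ?D"
    by (rule cosets_edge_count) (use w in \<open>auto simp: window_def\<close>)
  then have "0 \<le> real (card ?D) - real (card (?D \<inter> cact [(gen_a, False)] ` ?D)) - real (card (?D \<inter> cact [(gen_b, False)] ` ?D))"
    by linarith
  then show ?thesis unfolding window_F_label[OF w] by simp
qed

lemma f_invariant_shift:
  assumes "generating_partition F2 mu shift P" "shannon_entropy mu P < \<infinity>"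
  shows "f_invariant F2 (free_gens {gen_a, gen_b}) mu shift P = 0"
  by (rule shift.f_invariant_eq_0[OF window_ent(1)[OF window_root] dense_root F_label_root F_label_fam_root assms])

lemma finite_entropy_generator: "\<exists>P. generating_partition F2 mu shift P \<and> shannon_entropy mu P < \<infinity>"
proof (intro exI conjI)
  show "generating_partition F2 mu shift (fibers mu root_label)" by (rule generating_root)
  show "shannon_entropy mu (fibers mu root_label) < \<infinity>"
    using shift.shannon_entropy_finite_iff[OF fibers_partition fibers_labels[OF root_label_measurable]]
      window_ent(1)[OF window_root] by simp
qed

subsection \<open>Ergodicity\<close>

text \<open>The signed length of the initial run of powers of \<open>a\<close> increases by one under \<open>a\<close>.\<close>

fun run :: "(ab \<times> bool) list \<Rightarrow> int" where
  "run [] = 0"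
| "run (l # w) = (if l = gA then 1 + run w else if l = inv_letter gA then run w - 1 else 0)"

lemma run_act: "run (act gA w) = run w + 1"
  by (cases w) (auto simp: act_def inv_letter_def)

lemma run_bound: "\<bar>run w\<bar> \<le> int (length w)"
  by (induction w) auto

text \<open>\<open>run\<close> grows by one with each factor \<open>gA\<close>, while its absolute
  value is bounded by the length both before and after.\<close>

lemma length_cact_power: "m \<le> length (cact (replicate m gA) w) + length w"
proof -
  have "run (cact (replicate m gA) w) = run w + int m"
    by (induction m) (simp_all add: run_act)
  then show ?thesis using run_bound[of w] run_bound[of "cact (replicate m gA) w"] by linarith
qed

lemma replicate_carrier: "replicate m l \<in> carrier F2"
proof -
  have "reduced_word (replicate m l)" by (induction m rule: induct_nat_012) auto
  then show ?thesis by (simp add: F2_carrier)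
qed

text \<open>A power of \<open>a\<close> whose exponent exceeds twice the length of every word in
  \<open>D\<close> moves the window off itself. Powers of \<open>b\<close> would not do, since they
  fix the root.\<close>

lemma mixing_window:
  assumes "finite D"
  obtains g where "g \<in> carrier F2" "D \<inter> cact (inv\<^bsub>F2\<^esub> g) ` D = {}"
proof
  define n where "n = Max (length ` D)"
  define h where "h = replicate (2 * n + 1) gA"
  have h: "h \<in> carrier F2" by (simp add: h_def replicate_carrier del: replicate.simps)
  show "inv\<^bsub>F2\<^esub> h \<in> carrier F2" by (rule F2_inv[OF h])
  show "D \<inter> cact (inv\<^bsub>F2\<^esub> (inv\<^bsub>F2\<^esub> h)) ` D = {}"
  proof (rule ccontr)
    assume "D \<inter> cact (inv\<^bsub>F2\<^esub> (inv\<^bsub>F2\<^esub> h)) ` D \<noteq> {}"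
    then obtain v where v: "v \<in> D" "cact h v \<in> D" using h by auto
    then have "length v \<le> n" "length (cact h v) \<le> n" using assms by (auto simp: n_def)
    moreover have "2 * n + 1 \<le> length (cact h v) + length v"
      unfolding h_def by (rule length_cact_power)
    ultimately show False by linarith
  qed
qed

lemma determined_shift:
  assumes "determined cosets D S" "D \<subseteq> cosets"
  shows "determined cosets (cact (inv\<^bsub>F2\<^esub> g) ` D) (shift g -` S \<inter> zero_one cosets)"
  unfolding determined_def
proof (intro conjI ballI impI)
  fix x y assume x: "x \<in> shift g -` S \<inter> zero_one cosets" and y: "y \<in> zero_one cosets" "\<forall>j\<in>cact (inv\<^bsub>F2\<^esub> g) ` D. x j = y j"
  have "\<forall>j\<in>D. shift g x j = shift g y j"
    using assms(2) x y by (auto simp: shift_apply subset_iff)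
  then have "shift g y \<in> S"
    using assms(1) x shift_zero_one[OF y(1), of g] unfolding determined_def by blast
  then show "y \<in> shift g -` S \<inter> zero_one cosets" using y by simp
qed auto

lemma (in prob_space) measure_diff_le:
  assumes "A \<in> sets M" "B \<in> sets M"
  shows "\<bar>measure M A - measure M B\<bar> \<le> measure M {\<omega> \<in> space M. \<omega> \<in> A \<longleftrightarrow> \<omega> \<notin> B}"
proof -
  let ?D = "{\<omega> \<in> space M. \<omega> \<in> A \<longleftrightarrow> \<omega> \<notin> B}"
  have D: "?D \<in> sets M" using assms by measurable
  have "measure M A \<le> measure M (B \<union> ?D)" "measure M B \<le> measure M (A \<union> ?D)"
    using assms D sets.sets_into_space[OF assms(1)] sets.sets_into_space[OF assms(2)]
    by (auto intro!: finite_measure_mono)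
  moreover have "measure M (B \<union> ?D) \<le> measure M B + measure M ?D" "measure M (A \<union> ?D) \<le> measure M A + measure M ?D"
    using assms D by (auto intro!: measure_Un_le)
  ultimately show ?thesis by linarith
qed

text \<open>An invariant event is approximated by an event \<open>S\<close> on a finite window. Some
  translate of this window is disjoint from it, so \<open>S\<close> is independent of its translate.
  Invariance then makes the measure equal to its square, up to \<open>\<epsilon> / 2\<close> for the
  intersection and \<open>\<epsilon> / 2\<close> for the product.\<close>

lemma ergodic_shift: "ergodic_action F2 mu shift"
  unfolding ergodic_action_def
proof (intro ballI impI)
  fix A assume A: "A \<in> sets mu" and inv: "\<forall>g\<in>carrier F2. AE x in mu. shift g x \<in> A \<longleftrightarrow> x \<in> A"
  let ?m = "measure mu A"
  have "\<bar>?m - ?m * ?m\<bar> \<le> 0"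
  proof (rule field_le_epsilon)
    fix \<epsilon> :: real assume e: "0 < \<epsilon>"
    obtain ws S where S: "set ws \<subseteq> carrier F2" "S \<in> sets mu" "coarser mu (indicator S) (shift.fam root_label ws)"
      "measure mu {\<omega> \<in> space mu. \<omega> \<in> A \<longleftrightarrow> \<omega> \<notin> S} < \<epsilon> / 4"
      using dense_root[unfolded shift.dense_label_def, rule_format, OF A, of "\<epsilon> / 4"] e by auto
    let ?D = "(\<lambda>w. cact (inv\<^bsub>F2\<^esub> w) []) ` set ws"
    have win: "window (shift.fam root_label ws) ?D" by (rule window_fam[OF S(1)])
    then have D: "finite ?D" "?D \<subseteq> cosets" by (auto simp: window_def)
    have SO: "S \<subseteq> zero_one cosets" using sets.sets_into_space[OF S(2)] by simp
    have det: "determined cosets ?D S" unfolding determined_def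
    proof (intro conjI SO ballI impI)
      fix x y assume x: "x \<in> S" and y: "y \<in> zero_one cosets" and eq: "\<forall>j\<in>?D. x j = y j"
      have xy: "x \<in> space mu" "y \<in> space mu" using x y SO by auto
      have "shift.fam root_label ws x = shift.fam root_label ws y"
        using win x y eq SO unfolding window_def by blast
      from S(3)[unfolded coarser_def, rule_format, OF xy this]
      have "(indicator S x :: nat) = indicator S y" .
      then show "y \<in> S" using x by (cases "y \<in> S") auto
    qed
    obtain g where g: "g \<in> carrier F2" "?D \<inter> cact (inv\<^bsub>F2\<^esub> g) ` ?D = {}"
      using mixing_window[OF D(1)] by blast
    let ?S = "shift g -` S \<inter> zero_one cosets" and ?dA = "{\<omega> \<in> space mu. \<omega> \<in> A \<longleftrightarrow> \<omega> \<notin> S}"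
    have Sg: "?S \<in> sets mu" using measurable_sets[OF shift_measurable S(2), of g] by simp
    have dA: "?dA \<in> sets mu" using A S(2) by measurable
    have pre: "measure mu (shift g -` B \<inter> zero_one cosets) = measure mu B" if "B \<in> sets mu" for B
      using measure_distr[OF shift_measurable that, of g] by (simp add: distr_shift[OF g(1)])
    have "measure mu (S \<inter> ?S) = measure mu S * measure mu ?S"
      by (rule determined_independent[OF det D determined_shift[OF det D(2)] _ _ g(2)]) (use D cact_cosets in auto)
    then have ind: "measure mu (S \<inter> ?S) = measure mu S * measure mu S" by (simp add: pre[OF S(2)])
    have d1: "\<bar>?m - measure mu S\<bar> \<le> \<epsilon> / 4"
      using shift.measure_diff_le[OF A S(2)] S(4) by linarith
    have "\<bar>?m - measure mu (S \<inter> ?S)\<bar> \<le> measure mu {\<omega> \<in> space mu. \<omega> \<in> A \<longleftrightarrow> \<omega> \<notin> S \<inter> ?S}"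
      by (rule shift.measure_diff_le[OF A sets.Int[OF S(2) Sg]])
    also have "\<dots> \<le> measure mu (?dA \<union> (shift g -` ?dA \<inter> zero_one cosets))"
    proof (rule shift.finite_measure_mono_AE)
      have "AE x in mu. shift g x \<in> A \<longleftrightarrow> x \<in> A" using inv g(1) by blast
      then show "AE x in mu. x \<in> {\<omega> \<in> space mu. \<omega> \<in> A \<longleftrightarrow> \<omega> \<notin> S \<inter> ?S} \<longrightarrow> x \<in> ?dA \<union> (shift g -` ?dA \<inter> zero_one cosets)"
        using AE_space by eventually_elim (auto simp: shift_zero_one)
      show "?dA \<union> (shift g -` ?dA \<inter> zero_one cosets) \<in> sets mu"
        using dA measurable_sets[OF shift_measurable dA, of g] by simp
    qed
    also have "\<dots> \<le> measure mu ?dA + measure mu (shift g -` ?dA \<inter> zero_one cosets)"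
      using dA measurable_sets[OF shift_measurable dA, of g] by (intro measure_Un_le) simp_all
    also have "\<dots> \<le> \<epsilon> / 4 + \<epsilon> / 4" using S(4) pre[OF dA] by linarith
    finally have d2: "\<bar>?m - measure mu S * measure mu S\<bar> \<le> \<epsilon> / 2" using ind by simp
    have "\<bar>measure mu S * measure mu S - ?m * ?m\<bar> = \<bar>measure mu S - ?m\<bar> * (measure mu S + ?m)"
    proof -
      have "measure mu S * measure mu S - ?m * ?m = (measure mu S - ?m) * (measure mu S + ?m)"
        by (simp add: algebra_simps)
      then show ?thesis by (simp add: abs_mult)
    qed
    also have "\<dots> \<le> \<epsilon> / 4 * 2"
    proof (rule mult_mono)
      show "\<bar>measure mu S - ?m\<bar> \<le> \<epsilon> / 4" using d1 by linarith
      show "measure mu S + ?m \<le> 2" using shift.prob_le_1[of S] shift.prob_le_1[of A] by linarith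
    qed (use e in simp_all)
    finally show "\<bar>?m - ?m * ?m\<bar> \<le> 0 + \<epsilon>" using d2 by linarith
  qed
  then have "?m * (1 - ?m) = 0" by (simp add: algebra_simps)
  then show "?m = 0 \<or> ?m = 1" by auto
qed

subsection \<open>Rokhlin entropy\<close>

text \<open>The root coordinate is \<open>b\<close>-invariant, so it suffices to record it on a small set that meets
  almost every \<open>b\<close>-orbit.\<close>

definition block :: "nat \<Rightarrow> nat \<Rightarrow> (ab \<times> bool) list set" where
  "block n k = (\<lambda>i. replicate (k * n + i) gB @ [gA]) ` {..<n}"

lemma block_word: "replicate m gB @ [gA] \<in> cosets"
proof -
  have "reduced_word (replicate m gB)" using replicate_carrier by (simp add: F2_carrier)
  then have "reduced_word (replicate m gB @ [gA])" unfolding reduced_append by (cases m) (auto simp: inv_letter_def)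
  then show ?thesis by (simp add: cosets_def)
qed

lemma block_cosets: "block n k \<subseteq> cosets" "finite (block n k)" "[] \<notin> block n k"
  using block_word by (auto simp: block_def)

lemma block_word_inj: "replicate m gB @ [gA] = replicate m' gB @ [gA] \<Longrightarrow> m = m'"
  by (metis append_same_eq length_replicate)

lemma card_block: "card (block n k) = n"
  unfolding block_def by (subst card_image) (auto intro!: inj_onI dest: block_word_inj)

lemma block_disjoint:
  assumes "k < l" shows "block n k \<inter> block n l = {}"
proof (rule ccontr)
  assume "block n k \<inter> block n l \<noteq> {}"
  then obtain i j where ij: "i < n" "j < n" "k * n + i = l * n + j"
    by (auto simp: block_def dest!: block_word_inj)
  have "k * n + n \<le> l * n" using assms by (metis Suc_leI add.commute mult_Suc mult_le_mono1)
  then show False using ij by linarith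
qed

text \<open>A power of \<open>b\<close> carries the initial block to block \<open>k\<close>. As it
  fixes the root, all blocks can serve as markers for the same root coordinate.\<close>

lemma cact_gB_block: "cact (replicate (k * n) gB) ` block n 0 = block n k"
proof -
  have "cact (replicate (k * n) gB) (replicate i gB @ [gA]) = replicate (k * n + i) gB @ [gA]" for i
    by (subst cact_eq_append)
       (use block_word[of "k * n + i"] in \<open>auto simp: cosets_def replicate_add\<close>)
  then show ?thesis unfolding block_def by (auto simp: image_image)
qed

lemma cact_gB_root: "cact (replicate m gB) [] = []"
  by (induction m) (simp_all add: act_def)

text \<open>Disjoint blocks are independent, so \<open>K\<close> of them all fail to be filled with
  ones with probability \<open>(1 - (1 / 2) ^ n) ^ K\<close>, which tends to zero.\<close>

lemma block_AE:
  assumes n: "0 < n"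
  shows "AE x in mu. \<exists>k. \<forall>j\<in>block n k. x j = 1"
proof -
  define B where "B k = cyl cosets (block n k) (\<lambda>_. 1)" for k
  define U where "U K = (\<Union>k<K. block n k)" for K
  define N where "N K = zero_one cosets - (\<Union>k<K. B k)" for K
  have Bs: "B k \<in> sets mu" for k unfolding B_def by (rule sets_cyl[OF block_cosets(2,1)])
  have mB: "measure mu (B k) = (1 / 2) ^ n" for k
    unfolding B_def by (subst measure_cyl[OF block_cosets(2,1)]) (simp_all add: card_block)
  have N: "determined cosets (U K) (N K)" for K
    unfolding determined_def N_def U_def B_def cyl_def by fastforce
  have c: "determined cosets (block n K) (zero_one cosets - B K)" for K
    unfolding determined_def B_def cyl_def by fastforce
  have mN: "measure mu (N K) = (1 - (1 / 2) ^ n) ^ K" for K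
  proof (induction K)
    case 0
    then show ?case using shift.prob_space by (simp add: N_def)
  next
    case (Suc K)
    have "N (Suc K) = N K \<inter> (zero_one cosets - B K)" by (auto simp: N_def lessThan_Suc)
    also have "measure mu \<dots> = measure mu (N K) * measure mu (zero_one cosets - B K)"
    proof (rule determined_independent[OF N _ _ c])
      show "U K \<inter> block n K = {}" using block_disjoint by (auto simp: U_def)
    qed (use block_cosets in \<open>auto simp: U_def\<close>)
    also have "measure mu (zero_one cosets - B K) = 1 - (1 / 2) ^ n"
      using shift.prob_compl[OF Bs, of K] mB by simp
    finally show ?case using Suc by simp
  qed
  have null: "measure mu (zero_one cosets - (\<Union>k. B k)) = 0"
  proof (rule ccontr)
    assume "measure mu (zero_one cosets - (\<Union>k. B k)) \<noteq> 0"
    then have pos: "0 < measure mu (zero_one cosets - (\<Union>k. B k))" by (simp add: less_le)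
    have "(\<lambda>K. (1 - (1 / 2 :: real) ^ n) ^ K) \<longlonglongrightarrow> 0"
      by (rule LIMSEQ_realpow_zero) (use n in \<open>auto simp: power_le_one_iff\<close>)
    then have "eventually (\<lambda>K. (1 - (1 / 2 :: real) ^ n) ^ K < measure mu (zero_one cosets - (\<Union>k. B k))) sequentially"
      using pos by (rule order_tendstoD)
    then obtain K where K: "(1 - (1 / 2 :: real) ^ n) ^ K < measure mu (zero_one cosets - (\<Union>k. B k))"
      unfolding eventually_sequentially by blast
    have "measure mu (zero_one cosets - (\<Union>k. B k)) \<le> measure mu (N K)"
    proof (rule shift.finite_measure_mono)
      show "N K \<in> sets mu" by (rule determined_sets[OF N]) (use block_cosets in \<open>auto simp: U_def\<close>)
    qed (auto simp: N_def)
    then show False using K mN by simp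
  qed
  have "zero_one cosets - (\<Union>k. B k) \<in> sets mu" using Bs sets.top[of mu] by (intro sets.Diff sets.countable_UN) auto
  with null have "AE x in mu. x \<notin> zero_one cosets - (\<Union>k. B k)"
    by (intro AE_not_in) (auto simp: null_sets_def shift.emeasure_eq_measure)
  then show ?thesis using AE_space by eventually_elim (auto simp: B_def cyl_def)
qed

text \<open>The block \<open>block n 0\<close> filled with ones is a marker, an event of measure
  \<open>(1 / 2) ^ n\<close>; the root coordinate is recorded only where the marker is
  present.\<close>

definition block_label :: "nat \<Rightarrow> ((ab \<times> bool) list \<Rightarrow> real) \<Rightarrow> nat" where
  "block_label n x = (if \<forall>j\<in>block n 0. x j = 1 then (if x [] = 1 then 2 else 1) else 0)"

lemma block_label_sets:
  "{x \<in> zero_one cosets. block_label n x = 2} = cyl cosets (insert [] (block n 0)) (\<lambda>_. 1)"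
  "{x \<in> zero_one cosets. block_label n x = 1} = cyl cosets (insert [] (block n 0)) (\<lambda>j. if j = [] then 0 else 1)"
  "{x \<in> zero_one cosets. block_label n x = 0} = zero_one cosets - cyl cosets (block n 0) (\<lambda>_. 1)"
proof -
  show "{x \<in> zero_one cosets. block_label n x = 2} = cyl cosets (insert [] (block n 0)) (\<lambda>_. 1)"
    by (auto simp: block_label_def cyl_def)
  have "(\<forall>j\<in>insert [] (block n 0). x j = (if j = [] then 0 else 1)) \<longleftrightarrow> x [] = 0 \<and> (\<forall>j\<in>block n 0. x j = 1)" for x :: "_ \<Rightarrow> real"
    using block_cosets(3)[of n 0] by auto
  moreover have "block_label n x = 1 \<longleftrightarrow> x [] = 0 \<and> (\<forall>j\<in>block n 0. x j = 1)" if "x \<in> zero_one cosets" for x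
    using zero_one_D[OF that Nil_cosets] by (auto simp: block_label_def)
  ultimately show "{x \<in> zero_one cosets. block_label n x = 1} = cyl cosets (insert [] (block n 0)) (\<lambda>j. if j = [] then 0 else 1)"
    unfolding cyl_def by blast
  show "{x \<in> zero_one cosets. block_label n x = 0} = zero_one cosets - cyl cosets (block n 0) (\<lambda>_. 1)"
    by (auto simp: block_label_def cyl_def)
qed

lemma block_label_measurable: "block_label n \<in> measurable mu (count_space UNIV)"
proof (subst measurable_count_space_eq_countable)
  show "countable (UNIV :: nat set)" by simp
  have "block_label n -` {i} \<inter> space mu \<in> sets mu" for i
  proof -
    have "block_label n -` {i} \<inter> space mu = {x \<in> zero_one cosets. block_label n x = i}" by auto
    moreover have "i = 0 \<or> i = 1 \<or> i = 2 \<or> {x \<in> zero_one cosets. block_label n x = i} = {}" by (auto simp: block_label_def)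
    moreover have "{x \<in> zero_one cosets. block_label n x = i} \<in> sets mu" if "i = 0 \<or> i = 1 \<or> i = 2"
      using that
    proof (elim disjE)
      have "zero_one cosets \<in> sets mu" using sets.top[of mu] by simp
      then show "{x \<in> zero_one cosets. block_label n x = i} \<in> sets mu" if "i = 0"
        unfolding that block_label_sets using block_cosets[of n 0] by (auto intro!: sets_cyl)
      show "{x \<in> zero_one cosets. block_label n x = i} \<in> sets mu" if "i = 1"
        unfolding that block_label_sets using block_cosets[of n 0] by (intro sets_cyl) auto
      show "{x \<in> zero_one cosets. block_label n x = i} \<in> sets mu" if "i = 2"
        unfolding that block_label_sets using block_cosets[of n 0] by (intro sets_cyl) auto
    qed
    ultimately show ?thesis by (metis sets.empty_sets)
  qed
  then show "block_label n \<in> space mu \<rightarrow> UNIV \<and> (\<forall>a\<in>UNIV. block_label n -` {a} \<inter> space mu \<in> sets mu)" by simp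
qed

text \<open>For almost every point some power of \<open>b\<close> brings a filled block to the
  position of the marker. The root coordinate, unchanged on the way, is read there, and
  \<open>generating_shiftI\<close> applies.\<close>

lemma generating_block:
  assumes n: "0 < n"
  shows "generating_partition F2 mu shift (fibers mu (block_label n))"
proof (rule generating_shiftI)
  let ?P = "fibers mu (block_label n)"
  show P: "measurable_partition mu ?P" by (rule fibers_measurable_partition[OF block_label_measurable])
  note I = invariant_sigma_algebra_sigma[OF P]
  let ?x = "\<lambda>j\<in>cosets. 1 :: real" and ?A = "{x \<in> zero_one cosets. block_label n x = 2}"
  have x: "?x \<in> zero_one cosets" by (rule zero_one_restrictI) simp
  have "block_label n ?x = 2" using block_cosets[of n 0] by (auto simp: block_label_def)
  then have "?A = {y \<in> space mu. block_label n y = block_label n ?x}" by simp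
  then have "?A \<in> ?P" using x unfolding fibers_def by simp
  then have A: "?A \<in> invariant_sigma_algebra F2 mu shift ?P" using I(2) by blast
  define g where "g k = inv\<^bsub>F2\<^esub> (replicate (k * n) gB)" for k
  have g: "g k \<in> carrier F2" for k unfolding g_def by (rule F2_inv[OF replicate_carrier])
  have gi: "inv\<^bsub>F2\<^esub> (g k) = replicate (k * n) gB" for k unfolding g_def using replicate_carrier by simp
  show "(\<Union>k. shift (g k) -` ?A \<inter> zero_one cosets) \<in> invariant_sigma_algebra F2 mu shift ?P"
    by (rule sigma_algebra.countable_nat_UN[OF I(1)]) (rule image_subsetI, rule I(3)[OF g A])
  have mem: "shift (g k) y \<in> ?A \<longleftrightarrow> (\<forall>j\<in>block n k. y j = 1) \<and> y [] = 1" if y: "y \<in> zero_one cosets" for y k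
  proof -
    have "shift (g k) y \<in> ?A \<longleftrightarrow> (\<forall>j\<in>block n 0. shift (g k) y j = 1) \<and> shift (g k) y [] = 1"
      using shift_zero_one[OF y] by (auto simp: block_label_def)
    also have "\<dots> \<longleftrightarrow> (\<forall>j\<in>block n 0. y (cact (replicate (k * n) gB) j) = 1) \<and> y [] = 1"
      using shift_apply[OF y, of _ "g k"] block_cosets(1)[of n 0] by (auto simp: gi cact_gB_root subset_iff)
    also have "(\<forall>j\<in>block n 0. y (cact (replicate (k * n) gB) j) = 1) \<longleftrightarrow> (\<forall>j\<in>cact (replicate (k * n) gB) ` block n 0. y j = 1)"
      by simp
    finally show ?thesis unfolding cact_gB_block .
  qed
  show "AE y in mu. y \<in> (\<Union>k. shift (g k) -` ?A \<inter> zero_one cosets) \<longleftrightarrow> y [] = 1"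
    using block_AE[OF n] AE_space
  proof eventually_elim
    case (elim y)
    then show ?case using mem[of y] by auto
  qed
qed

lemma block_entropy:
  "shannon_entropy mu (fibers mu (block_label n)) =
    ennreal (2 * (- ((1 / 2) ^ Suc n) * ln ((1 / 2) ^ Suc n)) + - (1 - (1 / 2) ^ n) * ln (1 - (1 / 2) ^ n))"
proof -
  let ?e = "\<lambda>i. - measure mu {x \<in> space mu. block_label n x = i} * ln (measure mu {x \<in> space mu. block_label n x = i})"
  have z: "?e i = 0" if "i \<notin> {..<3}" for i
  proof -
    have "{x \<in> space mu. block_label n x = i} = {}" using that by (auto simp: block_label_def split: if_splits)
    then show ?thesis by (simp only: measure_empty)
  qed
  have s: "summable ?e" by (rule summable_finite[of "{..<3}"]) (use z in auto)
  have f: "fin_ent mu (block_label n)" using s shift.ent_eq_suminf(1)[OF block_label_measurable] by simp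
  have c: "card (insert [] (block n 0)) = Suc n" using block_cosets[of n 0] card_block[of n 0] by simp
  have "ent mu (block_label n) = (\<Sum>i<3. ?e i)"
    unfolding shift.ent_eq_suminf(2)[OF block_label_measurable f] by (rule suminf_finite) (use z in auto)
  also have "\<dots> = ?e 0 + ?e 1 + ?e 2" by (simp add: eval_nat_numeral)
  also have "measure mu {x \<in> space mu. block_label n x = 2} = (1 / 2) ^ Suc n"
    using measure_cyl[of "insert [] (block n 0)" cosets "\<lambda>_. 1"] block_cosets[of n 0] c by (simp add: block_label_sets)
  also have "measure mu {x \<in> space mu. block_label n x = 1} = (1 / 2) ^ Suc n"
    using measure_cyl[of "insert [] (block n 0)" cosets "\<lambda>j. if j = [] then 0 else 1"] block_cosets[of n 0] c
    by (simp only: space_coin block_label_sets) simp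
  also have "measure mu {x \<in> space mu. block_label n x = 0} = 1 - (1 / 2) ^ n"
    using shift.prob_compl[OF sets_cyl[OF block_cosets(2,1)], of n 0 "\<lambda>_. 1"]
      measure_cyl[OF block_cosets(2,1), of n 0 "\<lambda>_. 1"] by (simp add: block_label_sets card_block)
  finally have "ent mu (block_label n) =
      2 * (- ((1 / 2) ^ Suc n) * ln ((1 / 2) ^ Suc n)) + - (1 - (1 / 2) ^ n) * ln (1 - (1 / 2) ^ n)"
    by linarith
  then show ?thesis
    unfolding shift.shannon_entropy_eq_ent[OF fibers_partition fibers_labels[OF block_label_measurable] f]
    by (rule arg_cong)
qed

lemma rokhlin_entropy_shift: "rokhlin_entropy F2 mu shift = 0"
proof -
  have "(\<lambda>n. 2 * (- ((1 / 2 :: real) ^ Suc n) * ln ((1 / 2) ^ Suc n)) + - (1 - (1 / 2) ^ n) * ln (1 - (1 / 2) ^ n)) \<longlonglongrightarrow> 0"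
    by real_asymp
  then have "(\<lambda>n. shannon_entropy mu (fibers mu (block_label n))) \<longlonglongrightarrow> 0"
    unfolding block_entropy using tendsto_ennrealI by fastforce
  moreover have "rokhlin_entropy F2 mu shift \<le> shannon_entropy mu (fibers mu (block_label n))" if "0 < n" for n
    unfolding rokhlin_entropy_def by (rule INF_lower) (use generating_block[OF that] in simp)
  ultimately have "rokhlin_entropy F2 mu shift \<le> 0"
    by (intro LIMSEQ_le_const[of _ 0]) (auto intro!: exI[of _ 1])
  then show ?thesis by simp
qed

subsection \<open>The factor map\<close>

text \<open>The element \<open>h\<close> is taken as an edge from the coset of \<open>h\<close> to
  the coset of \<open>h a\<close>. These edges make the cosets into a tree of infinite valence, on
  which the group acts by left multiplication; it differs from the Schreier graph. Each coordinate
  of the image is the difference along one edge.\<close>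

definition edge_sum :: "((ab \<times> bool) list \<Rightarrow> real) \<Rightarrow> (ab \<times> bool) list \<Rightarrow> real" where
  "edge_sum x = (\<lambda>h\<in>carrier F2. xor2 (x (cact h [])) (x (cact h [gA])))"

lemma edge_sum_zero_one: "edge_sum x \<in> zero_one (carrier F2)"
  unfolding edge_sum_def by (intro zero_one_restrictI xor2_range)

lemma edge_sum_apply: "h \<in> carrier F2 \<Longrightarrow> edge_sum x h = xor2 (x (cact h [])) (x (cact h [gA]))"
  by (simp add: edge_sum_def)

lemma bernoulli_two: "bernoulli_measure F2 two = coin (carrier F2)"
  by (simp add: bernoulli_measure_def coin_def)

text \<open>Left multiplication carries the edge \<open>h\<close> together with both ends to another
  edge, as the ends are found by multiplication on the right.\<close>

lemma edge_sum_shift: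
  assumes g: "g \<in> carrier F2" and x: "x \<in> zero_one cosets"
  shows "edge_sum (shift g x) = bernoulli_shift F2 two g (edge_sum x)"
proof (rule zero_one_eqI[OF edge_sum_zero_one])
  have b: "bernoulli_shift F2 two g (edge_sum x) = (\<lambda>h\<in>carrier F2. edge_sum x (inv\<^bsub>F2\<^esub> g \<otimes>\<^bsub>F2\<^esub> h))"
    unfolding bernoulli_shift_def bernoulli_two using edge_sum_zero_one by simp
  have c: "inv\<^bsub>F2\<^esub> g \<otimes>\<^bsub>F2\<^esub> h \<in> carrier F2" if "h \<in> carrier F2" for h
    using monoid.m_closed[OF group.is_monoid[OF F2_group] F2_inv[OF g] that] .
  show "bernoulli_shift F2 two g (edge_sum x) \<in> zero_one (carrier F2)"
    unfolding b by (rule zero_one_restrictI) (use zero_one_D[OF edge_sum_zero_one c] in blast)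
  fix h assume h: "h \<in> carrier F2"
  have "edge_sum x (inv\<^bsub>F2\<^esub> g \<otimes>\<^bsub>F2\<^esub> h) = xor2 (x (cact (inv\<^bsub>F2\<^esub> g) (cact h []))) (x (cact (inv\<^bsub>F2\<^esub> g) (cact h [gA])))"
    using edge_sum_apply[OF c[OF h]] cact_mult[of "[]"] cact_mult[of "[gA]"] by (simp del: cact_simps)
  then show "edge_sum (shift g x) h = bernoulli_shift F2 two g (edge_sum x) h"
    unfolding b using h shift_apply[OF x cact_cosets[of "[]" h], of g] shift_apply[OF x cact_cosets[of "[gA]" h], of g]
    by (simp add: edge_sum_apply)
qed

lemma edge_sum_hom: "edge_sum \<in> hom (Z2_power cosets) (Z2_power (carrier F2))"
proof (rule homI)
  fix x y assume "x \<in> carrier (Z2_power cosets)" "y \<in> carrier (Z2_power cosets)"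
  then have x: "x \<in> zero_one cosets" and y: "y \<in> zero_one cosets" by simp_all
  have "xor2 (xor2 (x i) (y i)) (xor2 (x j) (y j)) = xor2 (xor2 (x i) (x j)) (xor2 (y i) (y j))"
    if "i \<in> cosets" "j \<in> cosets" for i j
    using zero_one_D[OF x that(1)] zero_one_D[OF x that(2)] zero_one_D[OF y that(1)] zero_one_D[OF y that(2)] by (auto simp: xor2_def)
  then show "edge_sum (x \<otimes>\<^bsub>Z2_power cosets\<^esub> y) = edge_sum x \<otimes>\<^bsub>Z2_power (carrier F2)\<^esub> edge_sum y"
    by (intro zero_one_eqI[OF edge_sum_zero_one]) (simp_all add: translate_zero_one edge_sum_apply cact_cosets)
qed (simp add: edge_sum_zero_one)

lemma edge_sum_continuous: "continuous_map (coin_top cosets) (coin_top (carrier F2)) edge_sum"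
proof (rule continuous_into_coin_top)
  fix h assume h: "h \<in> carrier F2"
  have "continuous_map (coin_top cosets) (discrete_topology {0, 1}) (\<lambda>x. xor2 (x (cact h [])) (x (cact h [gA])))"
    by (intro continuous_xor2 continuous_coin_coordinate cact_cosets) simp_all
  then show "continuous_map (coin_top cosets) (discrete_topology {0, 1}) (\<lambda>x. edge_sum x h)"
    by (simp add: edge_sum_apply[OF h])
qed (use edge_sum_zero_one in auto)

lemma edge_sum_measurable: "edge_sum \<in> measurable mu (coin (carrier F2))"
proof (rule measurable_coin_iff)
  fix h assume h: "h \<in> carrier F2"
  let ?i = "cact h []" and ?j = "cact h [gA]"
  have ij: "?i \<in> cosets" "?j \<in> cosets" by (simp_all only: cact_cosets Nil_cosets gA_cosets)
  have "{x \<in> space mu. edge_sum x h = 1} = ({x \<in> zero_one cosets. x ?i = 0} \<inter> {x \<in> zero_one cosets. x ?j = 1}) \<union>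
      ({x \<in> zero_one cosets. x ?i = 1} \<inter> {x \<in> zero_one cosets. x ?j = 0})"
  proof -
    have "xor2 (x ?i) (x ?j) = 1 \<longleftrightarrow> x ?i = 0 \<and> x ?j = 1 \<or> x ?i = 1 \<and> x ?j = 0" if "x \<in> zero_one cosets" for x
      using zero_one_D[OF that ij(1)] zero_one_D[OF that ij(2)] by (auto simp: xor2_def)
    then show ?thesis unfolding edge_sum_apply[OF h] by auto
  qed
  then show "{x \<in> space mu. edge_sum x h = 1} \<in> sets mu"
    using sets_coin_coordinate[OF ij(1)] sets_coin_coordinate[OF ij(2)] by simp
qed (use edge_sum_zero_one in auto)

text \<open>A preimage of \<open>y\<close> with value \<open>r\<close> at the root is computed along the edges of the tree: the coset
  \<open>w\<close> is joined to its parent by the edge labelled by \<open>butlast w\<close> or by \<open>w\<close>, according to the sign of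
  the last letter.\<close>

function lift :: "real \<Rightarrow> ((ab \<times> bool) list \<Rightarrow> real) \<Rightarrow> (ab \<times> bool) list \<Rightarrow> real" where
  "lift r y w = (if w = [] then r else
     xor2 (lift r y (cact (butlast w) [])) (y (if snd (last w) then butlast w else w)))"
  by auto
termination
proof (relation "Wellfounded.measure (\<lambda>(r, y, w). length w)")
  fix w :: "(ab \<times> bool) list" assume "w \<noteq> []"
  then show "((r, y, cact (butlast w) []), (r, y, w)) \<in> Wellfounded.measure (\<lambda>(r, y, w). length w)" for r :: real and y :: "(ab \<times> bool) list \<Rightarrow> real"
    using length_cact[of "butlast w" "[]"] by (cases w rule: rev_cases) auto
qed simp

declare lift.simps [simp del]

lemma lift_Nil: "lift r y [] = r"
  by (subst lift.simps) simp

lemma lift_snoc: "lift r y (w @ [l]) = xor2 (lift r y (cact w [])) (y (if snd l then w else w @ [l]))"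
  by (subst lift.simps) simp

lemma lift_range: "r \<in> {0, 1} \<Longrightarrow> lift r y w = 0 \<or> lift r y w = 1"
  by (cases w rule: rev_cases) (auto simp only: lift_Nil lift_snoc xor2_range)

text \<open>Every group element is an edge between a coset and its parent: the child is
  \<open>h\<close> itself if \<open>h\<close> ends in the inverse of \<open>a\<close>, and
  \<open>h a\<close> otherwise.\<close>

lemma F2_snoc_cases:
  assumes "h \<in> carrier F2"
  obtains k where "h = k @ [(gen_a, False)]" "h \<in> cosets" "cact h [gA] = cact k []"
  | "h @ [gA] \<in> cosets" "cact h [gA] = h @ [gA]"
proof (cases "h \<noteq> [] \<and> last h = (gen_a, False)")
  case True
  then obtain k where k: "h = k @ [(gen_a, False)]" by (metis append_butlast_last_id)
  moreover have "h \<in> cosets" using assms k by (simp add: cosets_def F2_carrier)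
  moreover have "cact h [gA] = cact k []" by (simp add: k cact_append act_def inv_letter_def)
  ultimately show ?thesis by (rule that(1))
next
  case False
  then have "reduced_word (h @ [gA])"
    using assms by (auto simp: reduced_append F2_carrier inv_letter_def prod_eq_iff)
  then show ?thesis using that(2) cact_eq_append[of "[gA]" h] by (simp add: cosets_def)
qed

lemma edge_sum_lift:
  assumes r: "r \<in> {0, 1}" and y: "y \<in> zero_one (carrier F2)"
  shows "restrict (lift r y) cosets \<in> zero_one cosets" "edge_sum (restrict (lift r y) cosets) = y"
proof -
  let ?x = "restrict (lift r y) cosets"
  show x: "?x \<in> zero_one cosets" by (rule zero_one_restrictI) (rule lift_range[OF r])
  have X: "?x w = lift r y w" if "w \<in> cosets" for w using that by simp
  have co: "cact h [] \<in> cosets" for h by (rule cact_cosets) simp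
  show "edge_sum ?x = y"
  proof (rule zero_one_eqI[OF edge_sum_zero_one y])
    fix h assume h: "h \<in> carrier F2"
    show "edge_sum ?x h = y h"
      using F2_snoc_cases[OF h]
    proof cases
      case (1 k)
      have "lift r y h = xor2 (lift r y (cact k [])) (y h)" by (simp add: 1(1) lift_snoc)
      moreover have "cact h [] = h" by (rule cact_Nil_eq[OF 1(2)])
      ultimately have "edge_sum ?x h = xor2 (xor2 (lift r y (cact k [])) (y h)) (lift r y (cact k []))"
        using h 1(2,3) co by (simp add: edge_sum_apply X)
      then show ?thesis using lift_range[OF r, of y "cact k []"] zero_one_D[OF y h] by (auto simp: xor2_def)
    next
      case 2
      have "edge_sum ?x h = xor2 (lift r y (cact h [])) (xor2 (lift r y (cact h [])) (y h))"
        using h 2 co by (simp add: edge_sum_apply X lift_snoc)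
      then show ?thesis using lift_range[OF r, of y "cact h []"] zero_one_D[OF y h] by (auto simp: xor2_def)
    qed
  qed
qed

text \<open>Induction on the length: the parent of \<open>w\<close> is shorter, and the difference
  along the edge to it determines the value at \<open>w\<close>.\<close>

lemma edge_sum_unique:
  assumes x: "x \<in> zero_one cosets" and w: "w \<in> cosets"
  shows "x w = lift (x []) (edge_sum x) w"
  using w
proof (induction "length w" arbitrary: w rule: less_induct)
  case less
  show ?case
  proof (cases w rule: rev_cases)
    case Nil
    then show ?thesis by (simp add: lift_Nil)
  next
    case (snoc h l)
    have hc: "h \<in> carrier F2" and l: "fst l = gen_a"
      using less.prems reduced_snoc[of h l] unfolding snoc cosets_def F2_carrier by auto
    have ph: "cact h [] \<in> cosets" by (rule cact_cosets) simp
    have "length (cact h []) < length w" using length_cact[of h "[]"] snoc by simp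
    from less.hyps[OF this ph] have IH: "lift (x []) (edge_sum x) (cact h []) = x (cact h [])" by simp
    show ?thesis
    proof (cases "snd l")
      case True
      then have "l = gA" using l by (simp add: prod_eq_iff)
      then have "cact h [gA] = w" using cact_eq_append[of "[gA]" h] less.prems snoc by (simp add: cosets_def)
      then have "lift (x []) (edge_sum x) w = xor2 (x (cact h [])) (xor2 (x (cact h [])) (x w))"
        using True snoc IH edge_sum_apply[OF hc, of x] by (simp add: lift_snoc)
      then show ?thesis using xor2_cancel[OF zero_one_D[OF x ph] zero_one_D[OF x less.prems]] by simp
    next
      case False
      then have l: "l = (gen_a, False)" using l by (simp add: prod_eq_iff)
      have "cact w [gA] = cact h []" by (simp add: snoc l cact_append act_def inv_letter_def)
      moreover have "cact w [] = w" by (rule cact_Nil_eq[OF less.prems])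
      ultimately have "lift (x []) (edge_sum x) w = xor2 (x (cact h [])) (xor2 (x w) (x (cact h [])))"
        using False snoc IH edge_sum_apply[OF cosets_carrier[OF less.prems], of x] by (simp add: lift_snoc)
      then show ?thesis using zero_one_D[OF x ph] zero_one_D[OF x less.prems] by (auto simp: xor2_def)
    qed
  qed
qed

lemma edge_sum_fiber:
  assumes y: "y \<in> zero_one (carrier F2)"
  shows "card {x \<in> zero_one cosets. edge_sum x = y} = 2"
proof -
  have "{x \<in> zero_one cosets. edge_sum x = y} = {restrict (lift 0 y) cosets, restrict (lift 1 y) cosets}"
  proof (intro Set.set_eqI iffI)
    fix x assume x: "x \<in> {x \<in> zero_one cosets. edge_sum x = y}"
    then have xO: "x \<in> zero_one cosets" and fx: "edge_sum x = y" by auto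
    have r: "x [] = 0 \<or> x [] = 1" by (rule zero_one_D[OF xO]) simp
    have eq: "x = restrict (lift (x []) y) cosets"
    proof (rule zero_one_eqI[OF xO])
      show "restrict (lift (x []) y) cosets \<in> zero_one cosets"
        by (rule zero_one_restrictI) (rule lift_range, use r in simp)
      show "x j = restrict (lift (x []) y) cosets j" if "j \<in> cosets" for j
        unfolding restrict_apply'[OF that] fx[symmetric] by (rule edge_sum_unique[OF xO that])
    qed
    from r show "x \<in> {restrict (lift 0 y) cosets, restrict (lift 1 y) cosets}"
    proof
      assume "x [] = 0"
      from eq[unfolded this] show ?thesis by (rule ssubst) simp
    next
      assume "x [] = 1"
      from eq[unfolded this] show ?thesis by (rule ssubst) simp
    qed
  next
    fix x assume "x \<in> {restrict (lift 0 y) cosets, restrict (lift 1 y) cosets}"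
    then show "x \<in> {x \<in> zero_one cosets. edge_sum x = y}" using edge_sum_lift[OF _ y, of 0] edge_sum_lift[OF _ y, of 1] by auto
  qed
  moreover have "restrict (lift 0 y) cosets [] \<noteq> restrict (lift 1 y) cosets []" by (simp add: lift_Nil)
  ultimately show ?thesis by (metis card_2_iff)
qed

text \<open>\<open>edge_sum\<close> is a surjective homomorphism, so translation by \<open>y\<close>
  lifts to translation by a preimage of \<open>y\<close> and the image measure is invariant;
  \<open>haar_unique\<close> identifies it.\<close>

lemma distr_edge_sum: "distr mu (coin (carrier F2)) edge_sum = coin (carrier F2)"
proof (rule haar_unique)
  show "prob_space (distr mu (coin (carrier F2)) edge_sum)"
    by (rule prob_space.prob_space_distr[OF prob_coin edge_sum_measurable])
  fix y A assume y: "y \<in> zero_one (carrier F2)" and "A \<in> sets (distr mu (coin (carrier F2)) edge_sum)"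
  then have A: "A \<in> sets (coin (carrier F2))" by simp
  let ?x = "restrict (lift 0 y) cosets" and ?t = "\<lambda>z. \<lambda>j\<in>carrier F2. xor2 (y j) (z j)"
  have x: "?x \<in> zero_one cosets" "edge_sum ?x = y" using edge_sum_lift[OF _ y] by auto
  have B: "edge_sum -` A \<inter> zero_one cosets \<in> sets mu" using measurable_sets[OF edge_sum_measurable A] by simp
  have tA: "?t -` A \<inter> zero_one (carrier F2) \<in> sets (coin (carrier F2))"
    using measurable_sets[OF translate_measurable[OF y] A] by simp
  have "edge_sum -` (?t -` A \<inter> zero_one (carrier F2)) \<inter> zero_one cosets =
      (\<lambda>z. \<lambda>j\<in>cosets. xor2 (?x j) (z j)) -` (edge_sum -` A \<inter> zero_one cosets) \<inter> space mu"
  proof -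
    have "?t (edge_sum z) = edge_sum (\<lambda>j\<in>cosets. xor2 (?x j) (z j))" if "z \<in> zero_one cosets" for z
      using hom_mult[OF edge_sum_hom, of ?x z] x that by simp
    then show ?thesis using edge_sum_zero_one translate_zero_one by auto
  qed
  then have "emeasure mu (edge_sum -` (?t -` A \<inter> zero_one (carrier F2)) \<inter> zero_one cosets) = emeasure mu (edge_sum -` A \<inter> zero_one cosets)"
    using emeasure_distr[OF translate_measurable[OF x(1)] B] distr_translate[OF x(1)] by simp
  then show "emeasure (distr mu (coin (carrier F2)) edge_sum) (?t -` A \<inter> zero_one (carrier F2)) = emeasure (distr mu (coin (carrier F2)) edge_sum) A"
    by (simp add: emeasure_distr[OF edge_sum_measurable] A tA)
qed simp

lemma factor_map_edge_sum:
  "factor_map F2 mu shift (bernoulli_measure F2 two) (bernoulli_shift F2 two) edge_sum"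
  unfolding factor_map_def bernoulli_two
  using edge_sum_measurable distr_edge_sum edge_sum_shift by (auto intro!: AE_I2)

lemma two_to_one_edge_sum: "two_to_one mu (bernoulli_measure F2 two) edge_sum"
  unfolding two_to_one_def bernoulli_two using edge_sum_fiber by (auto intro!: AE_I2)

section \<open>The base as a compact group\<close>

lemma nontrivial_two: "nontrivial_base two"
proof -
  interpret prob_space two by (rule prob_two)
  have "\<not> (AE x in two. x = k)" if k: "k \<in> {0, 1}" for k
  proof
    assume "AE x in two. x = k"
    then have "measure two {x \<in> space two. x = k} = 1" by (subst prob_Collect_eq_1) auto
    moreover have "{x \<in> space two. x = k} = {k}" using k by auto
    moreover have "measure two {k} = 1 / 2"
      unfolding measure_def measure_two[OF k] by (rule enn2real_ennreal) simp
    ultimately show False by simp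
  qed
  then show ?thesis using prob_two by (auto simp: nontrivial_base_def)
qed

lemma sets_two_borel: "sets two = sets (borel_of (discrete_topology {0, 1}))"
proof -
  have "{U. openin (discrete_topology {0, 1 :: real}) U} = Pow {0, 1}" by (auto simp: openin_discrete_topology)
  then have "borel_of (discrete_topology {0, 1 :: real}) = sigma {0, 1} (Pow {0, 1})"
    by (simp only: borel_of_def topspace_discrete_topology)
  then show ?thesis
    using sigma_algebra.sets_measure_of_eq[OF sigma_algebra_Pow, of "{0, 1 :: real}"] by (simp only: sets_two)
qed

lemma compact_metrizable_group_Z2: "compact_metrizable_group Z2 (discrete_topology {0, 1})"
  unfolding compact_metrizable_group_def
proof (intro conjI)
  show "continuous_map (prod_topology (discrete_topology {0, 1}) (discrete_topology {0, 1})) (discrete_topology {0, 1}) (\<lambda>(x, y). x \<otimes>\<^bsub>Z2\<^esub> y)"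
    unfolding split_beta using continuous_xor2[OF continuous_map_fst continuous_map_snd] by simp
  show "continuous_map (discrete_topology {0, 1}) (discrete_topology {0, 1}) (\<lambda>x. inv\<^bsub>Z2\<^esub> x)"
    using inv_Z2 by auto
qed (auto simp: group_Z2 compact_space_discrete_topology)

subsection \<open>Sofic approximations\<close>

locale sofic =
  fixes V :: "nat \<Rightarrow> nat set" and \<sigma> :: "nat \<Rightarrow> (ab \<times> bool) list \<Rightarrow> nat \<Rightarrow> nat"
  assumes sofic: "sofic_approximation F2 V \<sigma>"
begin

lemma finite_V [simp]: "finite (V i)"
  using sofic by (simp add: sofic_approximation_def)

lemma permutes: "g \<in> carrier F2 \<Longrightarrow> \<sigma> i g permutes V i"
  using sofic by (simp add: sofic_approximation_def)

lemma \<sigma>_in: "g \<in> carrier F2 \<Longrightarrow> v \<in> V i \<Longrightarrow> \<sigma> i g v \<in> V i"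
  using permutes permutes_in_image by metis

lemma card_V_large: "eventually (\<lambda>i. N < card (V i)) sequentially"
proof -
  have "filterlim (\<lambda>i. card (V i)) at_top sequentially" using sofic by (simp add: sofic_approximation_def)
  then have "eventually (\<lambda>i. Suc N \<le> card (V i)) sequentially" by (simp add: filterlim_at_top)
  then show ?thesis by eventually_elim simp
qed

definition dens :: "nat \<Rightarrow> (nat \<Rightarrow> bool) \<Rightarrow> real" where
  "dens i P = real (card {v \<in> V i. P v}) / real (card (V i))"

lemma dens_nonneg: "0 \<le> dens i P"
  by (simp add: dens_def)

lemma dens_mono: "(\<And>v. v \<in> V i \<Longrightarrow> P v \<Longrightarrow> Q v) \<Longrightarrow> dens i P \<le> dens i Q"
  unfolding dens_def by (intro divide_right_mono) (auto intro!: card_mono)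

lemma dens_disj: "dens i (\<lambda>v. P v \<or> Q v) \<le> dens i P + dens i Q"
proof -
  have "{v \<in> V i. P v \<or> Q v} = {v \<in> V i. P v} \<union> {v \<in> V i. Q v}" by auto
  then have "card {v \<in> V i. P v \<or> Q v} \<le> card {v \<in> V i. P v} + card {v \<in> V i. Q v}"
    by (simp add: card_Un_le)
  then show ?thesis unfolding dens_def
    by (simp add: add_divide_distrib[symmetric] divide_right_mono flip: of_nat_add)
qed

lemma dens_Bex: "finite A \<Longrightarrow> dens i (\<lambda>v. \<exists>a\<in>A. P a v) \<le> (\<Sum>a\<in>A. dens i (P a))"
proof (induction A rule: finite_induct)
  case empty
  then show ?case by (simp add: dens_def)
next
  case (insert a A)
  have "dens i (\<lambda>v. \<exists>a\<in>insert a A. P a v) \<le> dens i (\<lambda>v. P a v \<or> (\<exists>a\<in>A. P a v))"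
    by (rule dens_mono) auto
  also have "\<dots> \<le> dens i (P a) + dens i (\<lambda>v. \<exists>a\<in>A. P a v)" by (rule dens_disj)
  finally show ?case using insert by simp
qed

lemma dens_perm:
  assumes "g \<in> carrier F2"
  shows "dens i (\<lambda>v. P (\<sigma> i g v)) = dens i P"
proof -
  have p: "\<sigma> i g permutes V i" by (rule permutes[OF assms])
  have "\<sigma> i g ` {v \<in> V i. P (\<sigma> i g v)} = {v \<in> V i. P v}"
  proof (intro Set.set_eqI iffI)
    fix v assume v: "v \<in> {v \<in> V i. P v}"
    then obtain u where "u \<in> V i" "v = \<sigma> i g u" using permutes_image[OF p] by blast
    then show "v \<in> \<sigma> i g ` {v \<in> V i. P (\<sigma> i g v)}" using v by auto
  qed (use \<sigma>_in[OF assms] in auto)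
  moreover have "inj_on (\<sigma> i g) {v \<in> V i. P (\<sigma> i g v)}" by (rule permutes_inj_on[OF p])
  ultimately have "card {v \<in> V i. P (\<sigma> i g v)} = card {v \<in> V i. P v}" by (metis card_image)
  then show ?thesis by (simp add: dens_def)
qed

text \<open>Exceptional vertices of vanishing density. Closure under finite unions and under
  composition with the permutations lets statements up to rare events replace the exact identities
  of an action.\<close>

definition rare :: "(nat \<Rightarrow> nat \<Rightarrow> bool) \<Rightarrow> bool" where
  "rare P \<longleftrightarrow> (\<lambda>i. dens i (P i)) \<longlonglongrightarrow> 0"

lemma rare_mono:
  assumes "rare Q" "\<And>i v. v \<in> V i \<Longrightarrow> P i v \<Longrightarrow> Q i v"
  shows "rare P"
  unfolding rare_def
proof (rule tendsto_sandwich[OF _ _ tendsto_const])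
  show "(\<lambda>i. dens i (Q i)) \<longlonglongrightarrow> 0" using assms(1) by (simp add: rare_def)
  show "eventually (\<lambda>i. 0 \<le> dens i (P i)) sequentially" by (simp add: dens_nonneg)
  show "eventually (\<lambda>i. dens i (P i) \<le> dens i (Q i)) sequentially"
    by (rule always_eventually, rule allI, rule dens_mono, rule assms(2))
qed

lemma rare_disj:
  assumes "rare P" "rare Q" shows "rare (\<lambda>i v. P i v \<or> Q i v)"
  unfolding rare_def
proof (rule tendsto_sandwich[OF _ _ tendsto_const])
  show "(\<lambda>i. dens i (P i) + dens i (Q i)) \<longlonglongrightarrow> 0"
    using tendsto_add[of _ 0 _ _ 0] assms unfolding rare_def by fastforce
  show "eventually (\<lambda>i. 0 \<le> dens i (\<lambda>v. P i v \<or> Q i v)) sequentially" by (simp add: dens_nonneg)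
  show "eventually (\<lambda>i. dens i (\<lambda>v. P i v \<or> Q i v) \<le> dens i (P i) + dens i (Q i)) sequentially"
    by (rule always_eventually, rule allI, rule dens_disj)
qed

lemma rare_Bex:
  assumes "finite A" "\<And>a. a \<in> A \<Longrightarrow> rare (P a)"
  shows "rare (\<lambda>i v. \<exists>a\<in>A. P a i v)"
  using assms
proof (induction A rule: finite_induct)
  case empty
  then show ?case by (simp add: rare_def dens_def)
next
  case (insert a A)
  have "rare (\<lambda>i v. P a i v \<or> (\<exists>a\<in>A. P a i v))" using insert by (intro rare_disj) auto
  then show ?case by (rule rare_mono) auto
qed

lemma rare_perm: "rare P \<Longrightarrow> g \<in> carrier F2 \<Longrightarrow> rare (\<lambda>i v. P i (\<sigma> i g v))"
  unfolding rare_def by (simp add: dens_perm)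

lemma rareD: "rare P \<Longrightarrow> 0 < \<epsilon> \<Longrightarrow> eventually (\<lambda>i. dens i (P i) < \<epsilon>) sequentially"
  unfolding rare_def by (rule order_tendstoD(2))

lemma carrier_mult: "g \<in> carrier F2 \<Longrightarrow> h \<in> carrier F2 \<Longrightarrow> g \<otimes>\<^bsub>F2\<^esub> h \<in> carrier F2"
  by (rule monoid.m_closed[OF group.is_monoid[OF F2_group]])

lemma rare_mult:
  assumes "g \<in> carrier F2" "h \<in> carrier F2"
  shows "rare (\<lambda>i v. \<sigma> i g (\<sigma> i h v) \<noteq> \<sigma> i (g \<otimes>\<^bsub>F2\<^esub> h) v)"
  unfolding rare_def
proof (rule Lim_transform_eventually)
  let ?P = "\<lambda>i v. \<sigma> i g (\<sigma> i h v) = \<sigma> i (g \<otimes>\<^bsub>F2\<^esub> h) v"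
  have "(\<lambda>i. dens i (?P i)) \<longlonglongrightarrow> 1"
    using sofic assms unfolding sofic_approximation_def dens_def by blast
  then show "(\<lambda>i. 1 - dens i (?P i)) \<longlonglongrightarrow> 0" using tendsto_diff[OF tendsto_const, of _ 1 _ 1] by fastforce
  show "eventually (\<lambda>i. 1 - dens i (?P i) = dens i (\<lambda>v. \<not> ?P i v)) sequentially"
    using card_V_large[of 0]
  proof eventually_elim
    case (elim i)
    have "card {v \<in> V i. ?P i v} + card {v \<in> V i. \<not> ?P i v} = card (V i)"
      by (subst card_Un_disjoint[symmetric]) (auto intro!: arg_cong[where f=card])
    then have "real (card {v \<in> V i. ?P i v}) + real (card {v \<in> V i. \<not> ?P i v}) = real (card (V i))"
      by (simp flip: of_nat_add)
    then have b: "real (card {v \<in> V i. \<not> ?P i v}) = real (card (V i)) - real (card {v \<in> V i. ?P i v})" by linarith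
    have "real (card (V i)) \<noteq> 0" using elim by (metis less_irrefl of_nat_0_eq_iff)
    from divide_self[OF this] show ?case unfolding dens_def b diff_divide_distrib by linarith
  qed
qed

lemma rare_fix: "g \<in> carrier F2 \<Longrightarrow> g \<noteq> [] \<Longrightarrow> rare (\<lambda>i v. \<sigma> i g v = v)"
  using sofic unfolding sofic_approximation_def rare_def dens_def F2_one by blast

text \<open>At most vertices the permutation of the identity agrees with its square, and it is
  injective.\<close>

lemma rare_one: "rare (\<lambda>i v. \<sigma> i [] v \<noteq> v)"
proof (rule rare_mono[OF rare_mult[of "[]" "[]"]])
  show n: "[] \<in> carrier F2" "[] \<in> carrier F2" by (simp_all add: F2_carrier)
  fix i v assume "\<sigma> i [] v \<noteq> v"
  then show "\<sigma> i [] (\<sigma> i [] v) \<noteq> \<sigma> i ([] \<otimes>\<^bsub>F2\<^esub> []) v"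
    using permutes_inj[OF permutes[OF n(1)], of i] by (simp add: F2_mult inj_eq)
qed

text \<open>Up to a rare event, agreement of the two permutations at \<open>v\<close> means that the
  product of \<open>g\<close> with the inverse of \<open>h\<close> fixes the image of
  \<open>v\<close> under \<open>h\<close>.\<close>

lemma rare_eq:
  assumes g: "g \<in> carrier F2" and h: "h \<in> carrier F2" and ne: "g \<noteq> h"
  shows "rare (\<lambda>i v. \<sigma> i g v = \<sigma> i h v)"
proof -
  interpret G: group F2 by (rule F2_group)
  let ?k = "g \<otimes>\<^bsub>F2\<^esub> inv\<^bsub>F2\<^esub> h"
  have k: "?k \<in> carrier F2" using g h by simp
  have kh: "?k \<otimes>\<^bsub>F2\<^esub> h = g" using g h by (simp add: G.m_assoc)
  have "?k \<noteq> []" using ne kh h G.l_one[OF h] by (metis F2_one)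
  from rare_disj[OF rare_perm[OF rare_fix[OF k this] h] rare_mult[OF k h]]
  show ?thesis by (rule rare_mono) (auto simp: kh)
qed

abbreviation pb :: "nat \<Rightarrow> nat \<Rightarrow> nat" where "pb i \<equiv> \<sigma> i [gB]"

lemma gB_carrier: "[gB] \<in> carrier F2" by (simp add: F2_carrier)

lemma rare_pow:
  assumes h: "h \<in> carrier F2"
  shows "rare (\<lambda>i v. (pb i ^^ k) (\<sigma> i h v) \<noteq> \<sigma> i (replicate k gB \<otimes>\<^bsub>F2\<^esub> h) v)"
proof (induction k)
  case 0
  have "[] \<otimes>\<^bsub>F2\<^esub> h = h" by (simp add: F2_mult)
  then show ?case by (simp add: rare_def dens_def)
next
  case (Suc k)
  have c: "replicate k gB \<otimes>\<^bsub>F2\<^esub> h \<in> carrier F2" by (rule carrier_mult[OF replicate_carrier h])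
  have m: "replicate (Suc k) gB \<otimes>\<^bsub>F2\<^esub> h = [gB] \<otimes>\<^bsub>F2\<^esub> (replicate k gB \<otimes>\<^bsub>F2\<^esub> h)"
    by (simp add: F2_mult)
  show ?case
    by (rule rare_mono[OF rare_disj[OF Suc rare_mult[OF gB_carrier c]]]) (auto simp: m simp del: replicate_Suc)
qed

text \<open>Nontrivial powers of \<open>b\<close> differ from the identity, so each of them has few
  fixed vertices.\<close>

lemma rare_short:
  "rare (\<lambda>i v. \<exists>k\<in>{0<..<n}. (pb i ^^ k) v = v)"
proof (rule rare_Bex)
  fix k assume k: "k \<in> {0<..<n}"
  have n: "[] \<in> carrier F2" by (simp add: F2_carrier)
  have "replicate k gB \<otimes>\<^bsub>F2\<^esub> [] = replicate k gB"
    using replicate_carrier[of k gB] group.is_monoid[OF F2_group] monoid.r_one[of F2 "replicate k gB"] by (simp add: F2_one)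
  then have "rare (\<lambda>i v. (pb i ^^ k) (\<sigma> i [] v) \<noteq> \<sigma> i (replicate k gB) v)"
    using rare_pow[OF n, of k] by simp
  moreover have "replicate k gB \<noteq> []" using k by simp
  ultimately have "rare (\<lambda>i v. ((pb i ^^ k) (\<sigma> i [] v) \<noteq> \<sigma> i (replicate k gB) v \<or> \<sigma> i [] v \<noteq> v) \<or> \<sigma> i (replicate k gB) v = v)"
    by (intro rare_disj rare_one rare_fix replicate_carrier)
  then show "rare (\<lambda>i v. (pb i ^^ k) v = v)" by (rule rare_mono) auto
qed simp

end

subsection \<open>Cutting the orbits of a permutation\<close>

lemma permutes_funpow_inj: "p permutes V \<Longrightarrow> (p ^^ k) x = (p ^^ k) y \<Longrightarrow> x = y"
  using inj_fn[OF permutes_inj] by (metis inj_eq)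

lemma funpow_in: "p permutes V \<Longrightarrow> v \<in> V \<Longrightarrow> (p ^^ k) v \<in> V"
  by (induction k) (simp_all add: permutes_in_image)

text \<open>A maximal \<open>n\<close>-separated set, together with the short orbits.\<close>

lemma cut_set:
  fixes V :: "'v set"
  assumes p: "p permutes V" and fin: "finite V" and n: "0 < n"
  obtains R where "R \<subseteq> V" "real (card R) \<le> real (card V) / real n + real (card {v \<in> V. \<exists>k\<in>{0<..<n}. (p ^^ k) v = v})"
    "\<And>v. v \<in> V \<Longrightarrow> \<exists>k<2 * n. \<exists>r\<in>R. (p ^^ k) r = v"
proof -
  define sep where "sep R \<longleftrightarrow> (\<forall>r\<in>R. \<forall>s\<in>R. r \<noteq> s \<longrightarrow> (\<forall>k<n. (p ^^ k) r \<noteq> s))" for R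
  let ?F = "{R. R \<subseteq> V \<and> sep R}"
  have "finite ?F" using fin by simp
  moreover have "{} \<in> ?F" by (simp add: sep_def)
  ultimately obtain R where R: "R \<in> ?F" and max: "\<And>S. S \<in> ?F \<Longrightarrow> card S \<le> card R"
  proof -
    assume fF: "finite ?F" and e: "{} \<in> ?F"
      and th: "\<And>R. R \<in> ?F \<Longrightarrow> (\<And>S. S \<in> ?F \<Longrightarrow> card S \<le> card R) \<Longrightarrow> thesis"
    have "Max (card ` ?F) \<in> card ` ?F" by (rule Max_in) (use fF e in blast)+
    then obtain R where "R \<in> ?F" "card R = Max (card ` ?F)" by auto
    then show thesis using fF by (intro th[of R]) simp_all
  qed
  have RV: "R \<subseteq> V" and Rs: "sep R" using R by auto
  let ?Sh = "{v \<in> V. \<exists>k\<in>{0<..<n}. (p ^^ k) v = v}"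
  show ?thesis
  proof
    show "R \<union> ?Sh \<subseteq> V" using RV by auto
    have inj1: "k = l \<and> r = s" if r: "r \<in> R - ?Sh" "s \<in> R - ?Sh" and kl: "k < n" "l < n" "(p ^^ k) r = (p ^^ l) s" "k \<le> l" for r s k l
    proof -
      have "(p ^^ l) s = (p ^^ k) ((p ^^ (l - k)) s)"
        using kl(4) funpow_add[of k "l - k" p] by simp
      then have e: "(p ^^ (l - k)) s = r" using kl(3) permutes_funpow_inj[OF p] by metis
      have "r = s"
      proof (rule ccontr)
        assume "r \<noteq> s"
        moreover have "l - k < n" using kl by simp
        moreover have "r \<in> R" "s \<in> R" using r by simp_all
        ultimately have "(p ^^ (l - k)) s \<noteq> r" using Rs unfolding sep_def by metis
        then show False using e by simp
      qed
      moreover have "l - k = 0"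
      proof (rule ccontr)
        assume "l - k \<noteq> 0"
        then have "s \<in> ?Sh" using e \<open>r = s\<close> r kl RV by (auto intro!: bexI[of _ "l - k"])
        then show False using r by simp
      qed
      ultimately show ?thesis using kl by simp
    qed
    \<comment> \<open>The segments of length \<open>n\<close> that start at the separated points
      outside \<open>?Sh\<close> are disjoint, whence the term \<open>card V / n\<close>.\<close>
    have "inj_on (\<lambda>(k, r). (p ^^ k) r) ({..<n} \<times> (R - ?Sh))"
    proof (rule inj_onI)
      fix x y assume xy: "x \<in> {..<n} \<times> (R - ?Sh)" "y \<in> {..<n} \<times> (R - ?Sh)"
        "(\<lambda>(k, r). (p ^^ k) r) x = (\<lambda>(k, r). (p ^^ k) r) y"
      obtain k r l s where kl: "x = (k, r)" "y = (l, s)" by (cases x, cases y)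
      then have rs: "r \<in> R - ?Sh" "s \<in> R - ?Sh" and h: "k < n" "l < n" "(p ^^ k) r = (p ^^ l) s" using xy by auto
      have "k = l \<and> r = s"
      proof (cases "k \<le> l")
        case True
        show ?thesis by (rule inj1[OF rs h True])
      next
        case False
        have "l = k \<and> s = r" by (rule inj1[OF rs(2,1) h(2,1) h(3)[symmetric]]) (use False in simp)
        then show ?thesis by simp
      qed
      then show "x = y" using kl by simp
    qed
    moreover have "(\<lambda>(k, r). (p ^^ k) r) ` ({..<n} \<times> (R - ?Sh)) \<subseteq> V"
      using RV funpow_in[OF p] by auto
    ultimately have "card ({..<n} \<times> (R - ?Sh)) \<le> card V" using fin by (rule card_inj_on_le)
    then have "n * card (R - ?Sh) \<le> card V" by (simp add: card_cartesian_product)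
    then have "real (n * card (R - ?Sh)) \<le> real (card V)" by (rule of_nat_mono)
    then have "real (card (R - ?Sh)) \<le> real (card V) / real n"
      unfolding of_nat_mult by (subst pos_le_divide_eq) (use n in \<open>simp_all only: of_nat_0_less_iff mult.commute\<close>)
    moreover have "card (R \<union> ?Sh) \<le> card (R - ?Sh) + card ?Sh"
      using card_Un_le[of "R - ?Sh" ?Sh] by (simp only: Un_Diff_cancel2)
    then have "real (card (R \<union> ?Sh)) \<le> real (card (R - ?Sh) + card ?Sh)" by (rule of_nat_mono)
    ultimately show "real (card (R \<union> ?Sh)) \<le> real (card V) / real n + real (card ?Sh)"
      unfolding of_nat_add by linarith
    fix v assume v: "v \<in> V"
    \<comment> \<open>The point \<open>n\<close> steps before \<open>v\<close>: maximality puts a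
      point of the separated set fewer than \<open>n\<close> steps from \<open>u\<close> on one side
      or the other, hence fewer than \<open>2 * n\<close> steps before \<open>v\<close>.\<close>
    obtain u where u: "u \<in> V" "(p ^^ n) u = v"
    proof -
      have "(p ^^ n) ` V = V"
        using fin funpow_in[OF p] permutes_funpow_inj[OF p]
        by (intro card_subset_eq) (auto intro!: card_image inj_onI)
      then show ?thesis using v that by (metis image_iff)
    qed
    have "\<exists>k<2 * n. \<exists>r\<in>R. (p ^^ k) r = v"
    proof (cases "u \<in> R")
      case True
      then show ?thesis using u n by (intro exI[of _ n]) auto
    next
      case False
      have "card (insert u R) = Suc (card R)" using False finite_subset[OF RV fin] by simp
      then have "insert u R \<notin> ?F" using max[of "insert u R"] by auto
      then have "\<not> sep (insert u R)" using RV u by auto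
      then obtain r k where rk: "r \<in> R" "k < n" "(p ^^ k) r = u \<or> (p ^^ k) u = r"
        using Rs unfolding sep_def by auto
      show ?thesis
      proof (cases "(p ^^ k) r = u")
        case True
        then have "(p ^^ (n + k)) r = v" using u by (simp add: funpow_add)
        then show ?thesis using rk by (intro exI[of _ "n + k"]) auto
      next
        case False
        then have "(p ^^ (n - k)) r = v" using rk u funpow_add[of "n - k" k p] by auto
        then show ?thesis using rk by (intro exI[of _ "n - k"]) auto
      qed
    qed
    then show "\<exists>k<2 * n. \<exists>r\<in>R \<union> ?Sh. (p ^^ k) r = v" by blast
  qed
qed

subsection \<open>Counting small subsets\<close>

lemma sum_Pow_power_card: "finite V \<Longrightarrow> (\<Sum>B\<in>Pow V. (t :: real) ^ card B) = (1 + t) ^ card V"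
proof (induction V rule: finite_induct)
  case (insert x V)
  have "(\<Sum>B\<in>Pow (insert x V). t ^ card B) = (\<Sum>B\<in>Pow V. t ^ card B) + (\<Sum>B\<in>insert x ` Pow V. t ^ card B)"
    unfolding Pow_insert by (rule sum.union_disjoint) (use insert in auto)
  also have "(\<Sum>B\<in>insert x ` Pow V. t ^ card B) = (\<Sum>B\<in>Pow V. t ^ card (insert x B))"
    by (subst sum.reindex) (use insert in \<open>auto intro!: inj_onI simp: insert_ident\<close>)
  also have "\<dots> = (\<Sum>B\<in>Pow V. t * t ^ card B)"
  proof (rule sum.cong[OF refl])
    fix B assume "B \<in> Pow V"
    then have "finite B" "x \<notin> B" using insert finite_subset by auto
    then show "t ^ card (insert x B) = t * t ^ card B" by simp
  qed
  also have "\<dots> = t * (\<Sum>B\<in>Pow V. t ^ card B)" by (simp add: sum_distrib_left)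
  finally show ?case using insert by (simp add: algebra_simps)
qed simp

text \<open>Chernoff bound: each subset is weighted by \<open>t ^ card B\<close>, which is at least
  \<open>t powr (\<theta> * card V)\<close> on the sets counted, and the total weight
  \<open>(1 + t) ^ card V\<close> is at most \<open>exp (t * card V)\<close>.\<close>

lemma card_small_subsets:
  assumes V: "finite V" and t: "0 < t" "t \<le> 1"
  shows "real (card {B. B \<subseteq> V \<and> real (card B) \<le> \<theta> * real (card V)}) \<le> exp (real (card V) * (\<theta> * ln (1 / t) + t))"
proof -
  let ?S = "{B. B \<subseteq> V \<and> real (card B) \<le> \<theta> * real (card V)}" and ?N = "real (card V)"
  have "real (card ?S) * t powr (\<theta> * ?N) = (\<Sum>B\<in>?S. t powr (\<theta> * ?N))" by simp
  also have "\<dots> \<le> (\<Sum>B\<in>?S. t ^ card B)"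
  proof (rule sum_mono)
    fix B assume "B \<in> ?S"
    then have "t powr (\<theta> * ?N) \<le> t powr (real (card B))" using t by (intro powr_mono') auto
    then show "t powr (\<theta> * ?N) \<le> t ^ card B" using t by (simp add: powr_realpow)
  qed
  also have "\<dots> \<le> (\<Sum>B\<in>Pow V. t ^ card B)"
    by (rule sum_mono2) (use V t in auto)
  also have "\<dots> = (1 + t) ^ card V" by (rule sum_Pow_power_card[OF V])
  also have "\<dots> \<le> exp t ^ card V" by (rule power_mono) (use t exp_ge_add_one_self[of t] in auto)
  also have "\<dots> = exp (?N * t)" by (rule exp_of_nat_mult[symmetric])
  finally have "real (card ?S) \<le> exp (?N * t) / t powr (\<theta> * ?N)" using t by (simp add: field_simps)
  also have "\<dots> = exp (?N * (\<theta> * ln (1 / t) + t))"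
    using t by (simp add: powr_def ln_div exp_diff[symmetric] algebra_simps)
  finally show ?thesis .
qed

subsection \<open>Continuous generating pseudometrics\<close>

lemma continuous_shift: "g \<in> carrier F2 \<Longrightarrow> continuous_map (coin_top cosets) (coin_top cosets) (shift g)"
  using algebraic_shift unfolding algebraic_action_def by (blast intro: homeomorphic_imp_continuous_map)

locale shift_metric =
  fixes \<rho> :: "((ab \<times> bool) list \<Rightarrow> real) \<Rightarrow> ((ab \<times> bool) list \<Rightarrow> real) \<Rightarrow> real"
  assumes \<rho>: "generating_pseudometric F2 (coin_top cosets) shift \<rho>"
begin

lemma \<rho>_refl: "x \<in> zero_one cosets \<Longrightarrow> \<rho> x x = 0"
  and \<rho>_nonneg: "x \<in> zero_one cosets \<Longrightarrow> y \<in> zero_one cosets \<Longrightarrow> 0 \<le> \<rho> x y"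
  and \<rho>_sym: "x \<in> zero_one cosets \<Longrightarrow> y \<in> zero_one cosets \<Longrightarrow> \<rho> x y = \<rho> y x"
  and \<rho>_tri: "x \<in> zero_one cosets \<Longrightarrow> y \<in> zero_one cosets \<Longrightarrow> z \<in> zero_one cosets \<Longrightarrow> \<rho> x z \<le> \<rho> x y + \<rho> y z"
  and \<rho>_cont: "continuous_map (prod_topology (coin_top cosets) (coin_top cosets)) euclideanreal (\<lambda>(x, y). \<rho> x y)"
  and \<rho>_gen: "x \<in> zero_one cosets \<Longrightarrow> y \<in> zero_one cosets \<Longrightarrow> x \<noteq> y \<Longrightarrow> \<exists>g\<in>carrier F2. 0 < \<rho> (shift g x) (shift g y)"
  using \<rho> unfolding generating_pseudometric_def by simp_all

text \<open>\<open>\<rho>\<close> is continuous and vanishes on the diagonal, so every point has a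
  cylinder neighbourhood on which \<open>\<rho>\<close> stays below the bound; compactness leaves a
  finite window.\<close>

lemma metric_window:
  assumes e: "0 < \<epsilon>"
  obtains D where "finite D" "D \<subseteq> cosets"
    "\<And>x y. x \<in> zero_one cosets \<Longrightarrow> y \<in> zero_one cosets \<Longrightarrow> (\<And>j. j \<in> D \<Longrightarrow> x j = y j) \<Longrightarrow> \<rho> x y < \<epsilon>"
proof -
  let ?W = "{z \<in> topspace (prod_topology (coin_top cosets) (coin_top cosets)). (\<lambda>(x, y). \<rho> x y) z \<in> {..<\<epsilon>}}"
  have W: "openin (prod_topology (coin_top cosets) (coin_top cosets)) ?W"
    by (rule openin_continuous_map_preimage[OF \<rho>_cont]) (simp add: open_openin[symmetric])
  have "\<exists>D. finite D \<and> D \<subseteq> cosets \<and> (\<forall>y\<in>cyl cosets D x. \<forall>z\<in>cyl cosets D x. \<rho> y z < \<epsilon>)" if x: "x \<in> zero_one cosets" for x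
  proof -
    have "(x, x) \<in> ?W" using x e \<rho>_refl[OF x] by simp
    then obtain A B where AB: "openin (coin_top cosets) A" "openin (coin_top cosets) B" "x \<in> A" "x \<in> B" "A \<times> B \<subseteq> ?W"
      using W unfolding openin_prod_topology_alt by meson
    obtain D1 D2 where D: "finite D1" "D1 \<subseteq> cosets" "cyl cosets D1 x \<subseteq> A" "finite D2" "D2 \<subseteq> cosets" "cyl cosets D2 x \<subseteq> B"
      using coin_top_basis[OF AB(1,3)] coin_top_basis[OF AB(2,4)] by metis
    have "\<rho> y z < \<epsilon>" if "y \<in> cyl cosets (D1 \<union> D2) x" "z \<in> cyl cosets (D1 \<union> D2) x" for y z
    proof -
      have "y \<in> A" "z \<in> B" using that D by (auto simp: cyl_def)
      then have "(y, z) \<in> ?W" using AB(5) by blast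
      then show ?thesis by simp
    qed
    then show ?thesis using D by (intro exI[of _ "D1 \<union> D2"]) auto
  qed
  then obtain D where D: "\<And>x. x \<in> zero_one cosets \<Longrightarrow> finite (D x) \<and> D x \<subseteq> cosets"
    "\<And>x y z. x \<in> zero_one cosets \<Longrightarrow> y \<in> cyl cosets (D x) x \<Longrightarrow> z \<in> cyl cosets (D x) x \<Longrightarrow> \<rho> y z < \<epsilon>" by metis
  obtain F where F: "finite F" "F \<subseteq> zero_one cosets" "\<forall>y\<in>zero_one cosets. \<exists>x\<in>F. y \<in> cyl cosets (D x) x"
    using coin_top_cover[of cosets D] D(1) by blast
  show ?thesis
  proof
    show "finite (\<Union>(D ` F))" "\<Union>(D ` F) \<subseteq> cosets" using D(1) F by auto
    fix x y assume xy: "x \<in> zero_one cosets" "y \<in> zero_one cosets" "\<And>j. j \<in> \<Union>(D ` F) \<Longrightarrow> x j = y j"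
    obtain z where z: "z \<in> F" "x \<in> cyl cosets (D z) z" using F(3) xy(1) by blast
    have "y \<in> cyl cosets (D z) z"
      unfolding cyl_def
    proof (intro CollectI conjI xy ballI)
      fix j assume j: "j \<in> D z"
      then have "x j = y j" using z(1) by (intro xy(3)) auto
      then show "y j = z j" using z(2) j by (simp add: cyl_def)
    qed
    then show "\<rho> x y < \<epsilon>" using D(2) z F(2) by blast
  qed
qed

lemma metric_bounded:
  obtains C where "0 < C" "\<And>x y. x \<in> zero_one cosets \<Longrightarrow> y \<in> zero_one cosets \<Longrightarrow> \<rho> x y \<le> C"
proof -
  let ?P = "prod_topology (coin_top cosets) (coin_top cosets)"
  have "compactin ?P (topspace ?P)"
    using compact_coin_top[of cosets] compact_space_prod_topology unfolding compact_space_def[symmetric] by blast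
  then have "compactin euclideanreal ((\<lambda>(x, y). \<rho> x y) ` topspace ?P)"
    using \<rho>_cont by (rule image_compactin)
  then have "bounded ((\<lambda>(x, y). \<rho> x y) ` topspace ?P)"
    by (simp add: compactin_euclidean_iff compact_imp_bounded)
  then obtain C where C: "\<And>t. t \<in> (\<lambda>(x, y). \<rho> x y) ` topspace ?P \<Longrightarrow> norm t \<le> C"
    unfolding bounded_iff by blast
  show ?thesis
  proof
    show "0 < \<bar>C\<bar> + 1" by simp
    fix x y assume "x \<in> zero_one cosets" "y \<in> zero_one cosets"
    then have "norm (\<rho> x y) \<le> C" by (intro C) (auto intro!: image_eqI[of _ _ "(x, y)"])
    then show "\<rho> x y \<le> \<bar>C\<bar> + 1" unfolding real_norm_def by linarith
  qed
qed

text \<open>Pairs with different root coordinates form a compact set, covered by the open sets on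
  which some translate is at distance more than \<open>1 / (m + 1)\<close>. A finite subcover yields
  \<open>E\<close> and \<open>\<kappa>\<close>.\<close>

lemma generating_window:
  obtains E \<kappa> where "finite E" "E \<subseteq> carrier F2" "0 < \<kappa>"
    "\<And>x y. x \<in> zero_one cosets \<Longrightarrow> y \<in> zero_one cosets \<Longrightarrow> (\<And>g. g \<in> E \<Longrightarrow> \<rho> (shift g x) (shift g y) < \<kappa>) \<Longrightarrow> x [] = y []"
proof -
  let ?P = "prod_topology (coin_top cosets) (coin_top cosets)"
  define S where "S gm = {z \<in> topspace ?P. \<rho> (shift (fst gm) (fst z)) (shift (fst gm) (snd z)) \<in> {1 / (real (snd gm) + 1) <..}}" for gm :: "(ab \<times> bool) list \<times> nat"
  define N where "N = {z \<in> topspace ?P. fst z [] = snd z []}"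
  have S: "openin ?P (S gm)" if gm: "gm \<in> carrier F2 \<times> UNIV" for gm
    unfolding S_def
  proof (rule openin_continuous_map_preimage)
    have g: "fst gm \<in> carrier F2" using gm by auto
    have "continuous_map ?P (coin_top cosets) (\<lambda>z. shift (fst gm) (fst z))"
      using continuous_map_compose[OF continuous_map_fst continuous_shift[OF g]] by (simp add: comp_def)
    moreover have "continuous_map ?P (coin_top cosets) (\<lambda>z. shift (fst gm) (snd z))"
      using continuous_map_compose[OF continuous_map_snd continuous_shift[OF g]] by (simp add: comp_def)
    ultimately have "continuous_map ?P ?P (\<lambda>z. (shift (fst gm) (fst z), shift (fst gm) (snd z)))"
      by (simp add: continuous_map_pairwise comp_def)
    from continuous_map_compose[OF this \<rho>_cont]
    show "continuous_map ?P euclideanreal (\<lambda>z. \<rho> (shift (fst gm) (fst z)) (shift (fst gm) (snd z)))"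
      by (simp add: comp_def)
    show "openin euclideanreal {1 / (real (snd gm) + 1) <..}" by (simp add: open_openin[symmetric])
  qed
  have N: "openin ?P N"
  proof -
    have o: "openin ?P ({x \<in> zero_one cosets. x [] = c} \<times> {x \<in> zero_one cosets. x [] = c})" for c
      by (simp add: openin_prod_Times_iff openin_coordinate)
    have "N = ({x \<in> zero_one cosets. x [] = 0} \<times> {x \<in> zero_one cosets. x [] = 0}) \<union> ({x \<in> zero_one cosets. x [] = 1} \<times> {x \<in> zero_one cosets. x [] = 1})"
      using zero_one_D[OF _ Nil_cosets] by (fastforce simp: N_def)
    then show ?thesis using o[of 0] o[of 1] by (simp add: openin_Un)
  qed
  have "topspace ?P \<subseteq> \<Union>(insert N (S ` (carrier F2 \<times> UNIV)))"
  proof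
    fix z assume z: "z \<in> topspace ?P"
    show "z \<in> \<Union>(insert N (S ` (carrier F2 \<times> UNIV)))"
    proof (cases "z \<in> N")
      case False
      then have ne: "fst z \<noteq> snd z" and zO: "fst z \<in> zero_one cosets" "snd z \<in> zero_one cosets" using z by (auto simp: N_def)
      obtain g where g: "g \<in> carrier F2" "0 < \<rho> (shift g (fst z)) (shift g (snd z))" using \<rho>_gen[OF zO ne] by blast
      obtain m where "inverse (real (Suc m)) < \<rho> (shift g (fst z)) (shift g (snd z))"
        using reals_Archimedean[OF g(2)] by blast
      then have "z \<in> S (g, m)" using z by (simp add: S_def inverse_eq_divide add.commute)
      then show ?thesis using g(1) by blast
    qed simp
  qed
  moreover have "\<forall>U\<in>insert N (S ` (carrier F2 \<times> UNIV)). openin ?P U" using S N by blast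
  moreover have "compact_space ?P" using compact_coin_top[of cosets] compact_space_prod_topology by blast
  ultimately obtain \<F> where \<F>: "finite \<F>" "\<F> \<subseteq> insert N (S ` (carrier F2 \<times> UNIV))" "topspace ?P \<subseteq> \<Union>\<F>"
    unfolding compact_space_alt by meson
  have "finite (\<F> - {N})" "\<F> - {N} \<subseteq> S ` (carrier F2 \<times> UNIV)" using \<F> by auto
  from finite_subset_image[OF this] obtain Q where Q: "Q \<subseteq> carrier F2 \<times> UNIV" "finite Q" "\<F> - {N} = S ` Q"
    by auto
  obtain M where M: "\<And>m. m \<in> snd ` Q \<Longrightarrow> m \<le> M" using finite_nat_set_iff_bounded_le[of "snd ` Q"] Q(2) by auto
  show ?thesis
  proof
    show "finite (fst ` Q)" "fst ` Q \<subseteq> carrier F2" "0 < 1 / (real M + 1)" using Q by auto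
    fix x y assume xy: "x \<in> zero_one cosets" "y \<in> zero_one cosets" "\<And>g. g \<in> fst ` Q \<Longrightarrow> \<rho> (shift g x) (shift g y) < 1 / (real M + 1)"
    have "(x, y) \<in> \<Union>\<F>" using \<F>(3) xy(1,2) by auto
    moreover have "(x, y) \<notin> S gm" if gm: "gm \<in> Q" for gm
    proof -
      have "\<rho> (shift (fst gm) x) (shift (fst gm) y) < 1 / (real M + 1)" using xy(3) gm by blast
      also have "\<dots> \<le> 1 / (real (snd gm) + 1)" using M[of "snd gm"] gm by (simp add: frac_le)
      finally show ?thesis by (simp add: S_def)
    qed
    ultimately have "(x, y) \<in> N" using Q(3) by blast
    then show "x [] = y []" by (simp add: N_def)
  qed
qed

end

locale sofic_shift = sofic V \<sigma> + shift_metric \<rho>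
  for V :: "nat \<Rightarrow> nat set" and \<sigma> and \<rho>
begin

abbreviation maps :: "((ab \<times> bool) list \<Rightarrow> real) measure set \<Rightarrow> (ab \<times> bool) list set \<Rightarrow> real \<Rightarrow> nat \<Rightarrow> (nat \<Rightarrow> (ab \<times> bool) list \<Rightarrow> real) set" where
  "maps U F \<delta> i \<equiv> sofic_maps (coin_top cosets) shift \<rho> U F \<delta> (V i) (\<sigma> i)"

text \<open>Chebyshev's inequality for the mean square.\<close>

lemma dens_le_rho_2:
  assumes c: "0 < c" and r: "rho_2 \<rho> (V i) x y < \<delta>" and O: "\<And>v. v \<in> V i \<Longrightarrow> x v \<in> zero_one cosets \<and> y v \<in> zero_one cosets"
  shows "dens i (\<lambda>v. c \<le> \<rho> (x v) (y v)) \<le> (\<delta> / c)\<^sup>2"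
proof -
  let ?S = "(\<Sum>v\<in>V i. (\<rho> (x v) (y v))\<^sup>2) / real (card (V i))"
  have S: "0 \<le> ?S" by (intro divide_nonneg_nonneg sum_nonneg) auto
  have "sqrt ?S < \<delta>" using r by (simp add: rho_2_def)
  then have "(sqrt ?S)\<^sup>2 < \<delta>\<^sup>2" using real_sqrt_ge_zero[OF S] by (rule power_strict_mono) simp
  then have "?S < \<delta>\<^sup>2" unfolding real_sqrt_pow2[OF S] .
  have "real (card {v \<in> V i. c \<le> \<rho> (x v) (y v)}) * c\<^sup>2 = (\<Sum>v\<in>{v \<in> V i. c \<le> \<rho> (x v) (y v)}. c\<^sup>2)" by simp
  also have "\<dots> \<le> (\<Sum>v\<in>{v \<in> V i. c \<le> \<rho> (x v) (y v)}. (\<rho> (x v) (y v))\<^sup>2)"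
    by (intro sum_mono power_mono) (use c in auto)
  also have "\<dots> \<le> (\<Sum>v\<in>V i. (\<rho> (x v) (y v))\<^sup>2)" by (rule sum_mono2) auto
  finally have "dens i (\<lambda>v. c \<le> \<rho> (x v) (y v)) * c\<^sup>2 \<le> ?S"
    unfolding dens_def by (simp add: divide_right_mono)
  also have "\<dots> \<le> \<delta>\<^sup>2" using \<open>?S < \<delta>\<^sup>2\<close> by simp
  finally show ?thesis using c by (simp add: power_divide field_simps)
qed

text \<open>Where \<open>\<sigma>\<close> is multiplicative and the model almost equivariant, the
  translates by \<open>g\<close> of \<open>x (\<sigma> i h v)\<close> and of
  \<open>shift h (x v)\<close> are both within \<open>\<kappa> / 2\<close> of the value of
  \<open>x\<close> at the vertex of the product; the choice of \<open>E\<close> then equates the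
  root coordinates. The last term is a union bound with two failures per pair, each of density at
  most \<open>(2 * \<delta> / \<kappa>)\<^sup>2\<close>.\<close>

lemma bad_density:
  assumes E: "finite E" "E \<subseteq> carrier F2" and \<kappa>: "0 < \<kappa>"
    and gen: "\<And>x y. x \<in> zero_one cosets \<Longrightarrow> y \<in> zero_one cosets \<Longrightarrow> (\<And>g. g \<in> E \<Longrightarrow> \<rho> (shift g x) (shift g y) < \<kappa>) \<Longrightarrow> x [] = y []"
    and H: "finite H" "H \<subseteq> carrier F2"
    and F: "E \<subseteq> F" "\<And>g h. g \<in> E \<Longrightarrow> h \<in> H \<Longrightarrow> g \<otimes>\<^bsub>F2\<^esub> h \<in> F"
    and x: "x \<in> maps U F \<delta> i"
  shows "dens i (\<lambda>v. \<exists>h\<in>H. x (\<sigma> i h v) [] \<noteq> x v (cact (inv\<^bsub>F2\<^esub> h) []))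
    \<le> dens i (\<lambda>v. \<exists>h\<in>H. \<exists>g\<in>E. \<sigma> i g (\<sigma> i h v) \<noteq> \<sigma> i (g \<otimes>\<^bsub>F2\<^esub> h) v)
      + real (card H) * (real (card E) * (2 * (2 * \<delta> / \<kappa>)\<^sup>2))"
proof -
  have xO: "x v \<in> zero_one cosets" if "v \<in> V i" for v using x that by (auto simp: sofic_maps_def)
  define P where "P f v \<longleftrightarrow> \<kappa> / 2 \<le> \<rho> (shift f (x v)) (x (\<sigma> i f v))" for f v
  have dP: "dens i (P f) \<le> (2 * \<delta> / \<kappa>)\<^sup>2" if f: "f \<in> F" "f \<in> carrier F2" for f
  proof -
    have "rho_2 \<rho> (V i) (\<lambda>v. shift f (x v)) (\<lambda>v. x (\<sigma> i f v)) < \<delta>" using x f by (auto simp: sofic_maps_def)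
    from dens_le_rho_2[OF _ this, of "\<kappa> / 2"] show ?thesis
      using \<kappa> xO shift_zero_one \<sigma>_in[OF f(2)] by (simp add: P_def[abs_def] mult.commute)
  qed
  let ?m = "\<lambda>v. \<exists>h\<in>H. \<exists>g\<in>E. \<sigma> i g (\<sigma> i h v) \<noteq> \<sigma> i (g \<otimes>\<^bsub>F2\<^esub> h) v"
  let ?p = "\<lambda>v. \<exists>h\<in>H. \<exists>g\<in>E. P (g \<otimes>\<^bsub>F2\<^esub> h) v \<or> P g (\<sigma> i h v)"
  have "dens i (\<lambda>v. \<exists>h\<in>H. x (\<sigma> i h v) [] \<noteq> x v (cact (inv\<^bsub>F2\<^esub> h) [])) \<le> dens i (\<lambda>v. ?m v \<or> ?p v)"
  proof (rule dens_mono, rule ccontr)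
    fix v assume v: "v \<in> V i" and bad: "\<exists>h\<in>H. x (\<sigma> i h v) [] \<noteq> x v (cact (inv\<^bsub>F2\<^esub> h) [])" and good: "\<not> (?m v \<or> ?p v)"
    obtain h where h: "h \<in> H" "x (\<sigma> i h v) [] \<noteq> x v (cact (inv\<^bsub>F2\<^esub> h) [])" using bad by blast
    have hc: "h \<in> carrier F2" using h H by auto
    have u: "\<sigma> i h v \<in> V i" by (rule \<sigma>_in[OF hc v])
    have "x (\<sigma> i h v) [] = shift h (x v) []"
    proof (rule gen[OF xO[OF u] shift_zero_one[OF xO[OF v]]])
      fix g assume g: "g \<in> E"
      then have gc: "g \<in> carrier F2" using E by auto
      have m: "\<sigma> i g (\<sigma> i h v) = \<sigma> i (g \<otimes>\<^bsub>F2\<^esub> h) v" and p1: "\<not> P (g \<otimes>\<^bsub>F2\<^esub> h) v" and p2: "\<not> P g (\<sigma> i h v)"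
        using good g h(1) by blast+
      let ?w = "x (\<sigma> i (g \<otimes>\<^bsub>F2\<^esub> h) v)"
      have w: "?w \<in> zero_one cosets" by (rule xO[OF \<sigma>_in[OF carrier_mult[OF gc hc] v]])
      have "\<rho> (shift g (x (\<sigma> i h v))) (shift g (shift h (x v))) \<le> \<rho> (shift g (x (\<sigma> i h v))) ?w + \<rho> ?w (shift g (shift h (x v)))"
        by (intro \<rho>_tri shift_zero_one w xO u v)
      also have "\<rho> (shift g (x (\<sigma> i h v))) ?w < \<kappa> / 2" using p2 m by (simp add: P_def)
      also have "\<rho> ?w (shift g (shift h (x v))) = \<rho> (shift (g \<otimes>\<^bsub>F2\<^esub> h) (x v)) ?w"
        using \<rho>_sym[OF w shift_zero_one[OF shift_zero_one[OF xO[OF v]]]] shift_mult[OF gc hc xO[OF v]] by simp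
      also have "\<dots> < \<kappa> / 2" using p1 by (simp add: P_def)
      finally show "\<rho> (shift g (x (\<sigma> i h v))) (shift g (shift h (x v))) < \<kappa>" by simp
    qed
    then show False using h(2) shift_apply[OF xO[OF v] Nil_cosets, of h] by simp
  qed
  also have "\<dots> \<le> dens i ?m + dens i ?p" by (rule dens_disj)
  also have "dens i ?p \<le> (\<Sum>h\<in>H. dens i (\<lambda>v. \<exists>g\<in>E. P (g \<otimes>\<^bsub>F2\<^esub> h) v \<or> P g (\<sigma> i h v)))" by (rule dens_Bex[OF H(1)])
  also have "\<dots> \<le> (\<Sum>h\<in>H. \<Sum>g\<in>E. 2 * (2 * \<delta> / \<kappa>)\<^sup>2)"
  proof (rule sum_mono)
    fix h assume h: "h \<in> H"
    then have hc: "h \<in> carrier F2" using H by auto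
    have "dens i (\<lambda>v. \<exists>g\<in>E. P (g \<otimes>\<^bsub>F2\<^esub> h) v \<or> P g (\<sigma> i h v)) \<le> (\<Sum>g\<in>E. dens i (\<lambda>v. P (g \<otimes>\<^bsub>F2\<^esub> h) v \<or> P g (\<sigma> i h v)))"
      by (rule dens_Bex[OF E(1)])
    also have "\<dots> \<le> (\<Sum>g\<in>E. 2 * (2 * \<delta> / \<kappa>)\<^sup>2)"
    proof (rule sum_mono)
      fix g assume g: "g \<in> E"
      then have gc: "g \<in> carrier F2" using E by auto
      have "dens i (\<lambda>v. P (g \<otimes>\<^bsub>F2\<^esub> h) v \<or> P g (\<sigma> i h v)) \<le> dens i (P (g \<otimes>\<^bsub>F2\<^esub> h)) + dens i (\<lambda>v. P g (\<sigma> i h v))"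
        by (rule dens_disj)
      also have "\<dots> = dens i (P (g \<otimes>\<^bsub>F2\<^esub> h)) + dens i (P g)" by (simp add: dens_perm[OF hc])
      also have "\<dots> \<le> 2 * (2 * \<delta> / \<kappa>)\<^sup>2"
        using dP[OF F(2)[OF g h] carrier_mult[OF gc hc]] dP[of g] F(1) g gc by auto
      finally show "dens i (\<lambda>v. P (g \<otimes>\<^bsub>F2\<^esub> h) v \<or> P g (\<sigma> i h v)) \<le> 2 * (2 * \<delta> / \<kappa>)\<^sup>2" .
    qed
    finally show "dens i (\<lambda>v. \<exists>g\<in>E. P (g \<otimes>\<^bsub>F2\<^esub> h) v \<or> P g (\<sigma> i h v)) \<le> (\<Sum>g\<in>E. 2 * (2 * \<delta> / \<kappa>)\<^sup>2)" .
  qed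
  finally show ?thesis by simp
qed

text \<open>A model is reconstructed on the window \<open>D\<close> from its root coordinates on a set \<open>R\<close> meeting every
  orbit segment of \<open>b\<close>, and from full information at the few places \<open>B\<close> where it is not equivariant.\<close>

lemma patterns_determined:
  assumes R: "\<And>v. v \<in> V i \<Longrightarrow> \<exists>k<n. \<exists>r\<in>R. (pb i ^^ k) r = v" "R \<subseteq> V i"
    and D: "D \<subseteq> cosets"
  defines "H \<equiv> insert [gB] ((\<lambda>j. inv\<^bsub>F2\<^esub> j) ` D)"
  defines "B \<equiv> \<lambda>x. {v \<in> V i. \<exists>h\<in>H. x (\<sigma> i h v) [] \<noteq> x v (cact (inv\<^bsub>F2\<^esub> h) [])}"
  assumes x: "\<And>v. v \<in> V i \<Longrightarrow> x v \<in> zero_one cosets" and y: "\<And>v. v \<in> V i \<Longrightarrow> y v \<in> zero_one cosets"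
    and BB: "B x = B y"
    and eqD: "{(v, j) \<in> B x \<times> D. x v j = 1} = {(v, j) \<in> B y \<times> D. y v j = 1}"
    and eqB: "{v \<in> B x. x (pb i v) [] = 1} = {v \<in> B y. y (pb i v) [] = 1}"
    and eqR: "{r \<in> R. x r [] = 1} = {r \<in> R. y r [] = 1}"
    and v: "v \<in> V i" and j: "j \<in> D"
  shows "x v j = y v j"
proof -
  have bin: "x u k = y u k" if "u \<in> V i" "k \<in> cosets" "x u k = 1 \<longleftrightarrow> y u k = 1" for u k
    using zero_one_D[OF x[OF that(1)] that(2)] zero_one_D[OF y[OF that(1)] that(2)] that(3) by auto
  have pV: "pb i u \<in> V i" if "u \<in> V i" for u by (rule \<sigma>_in[OF gB_carrier that])
  have root: "x ((pb i ^^ k) r) [] = y ((pb i ^^ k) r) []" if r: "r \<in> R" for r k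
  proof (induction k)
    case 0
    have "x r [] = 1 \<longleftrightarrow> y r [] = 1" using eqR r by blast
    then show ?case using bin[of r "[]"] r R(2) by auto
  next
    case (Suc k)
    let ?u = "(pb i ^^ k) r"
    have u: "?u \<in> V i" by (rule funpow_in[OF permutes[OF gB_carrier]]) (use r R(2) in auto)
    show ?case
    proof (cases "?u \<in> B x")
      case True
      then have "x (pb i ?u) [] = 1 \<longleftrightarrow> y (pb i ?u) [] = 1" using eqB BB by blast
      then show ?thesis using bin[OF pV[OF u] Nil_cosets] by simp
    next
      case False
      then have "?u \<notin> B y" using BB by simp
      have c: "cact (inv\<^bsub>F2\<^esub> [gB]) [] = []" by (simp add: F2_inv_letter act_def)
      have "x (pb i ?u) [] = x ?u []" "y (pb i ?u) [] = y ?u []"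
        using False \<open>?u \<notin> B y\<close> u c unfolding B_def H_def by auto
      then show ?thesis using Suc by simp
    qed
  qed
  have root': "x u [] = y u []" if "u \<in> V i" for u using R(1)[OF that] root by blast
  have jc: "j \<in> cosets" using D j by auto
  show ?thesis
  proof (cases "v \<in> B x")
    case True
    then have "x v j = 1 \<longleftrightarrow> y v j = 1" using eqD BB j by blast
    then show ?thesis by (rule bin[OF v jc])
  next
    case False
    then have nB: "v \<notin> B y" using BB by simp
    let ?h = "inv\<^bsub>F2\<^esub> j"
    have hc: "?h \<in> carrier F2" by (rule F2_inv[OF cosets_carrier[OF jc]])
    have c: "cact (inv\<^bsub>F2\<^esub> ?h) [] = j" using cact_Nil_eq[OF jc] cosets_carrier[OF jc] by simp
    have "?h \<in> H" using j by (simp add: H_def)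
    then have "x (\<sigma> i ?h v) [] = x v j" "y (\<sigma> i ?h v) [] = y v j"
      using False nB v c unfolding B_def by auto
    then show ?thesis using root'[OF \<sigma>_in[OF hc v]] by simp
  qed
qed

text \<open>A separated set injects into the data of \<open>patterns_determined\<close>: the bad
  set, two kinds of bits on it, and the root bits on \<open>R\<close>. The bad sets, of density at
  most \<open>\<theta>\<close>, are counted by \<open>card_small_subsets\<close>; the bits give a
  power of 2, bounded by the same power of \<open>exp 1\<close>.\<close>

lemma card_separated:
  assumes R: "\<And>v. v \<in> V i \<Longrightarrow> \<exists>k<n. \<exists>r\<in>R. (pb i ^^ k) r = v" "R \<subseteq> V i"
    and D: "finite D" "D \<subseteq> cosets"
    and win: "\<And>x y. x \<in> zero_one cosets \<Longrightarrow> y \<in> zero_one cosets \<Longrightarrow> (\<And>j. j \<in> D \<Longrightarrow> x j = y j) \<Longrightarrow> \<rho> x y < \<epsilon>"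
  defines "H \<equiv> insert [gB] ((\<lambda>j. inv\<^bsub>F2\<^esub> j) ` D)"
  assumes A: "finite A" "A \<subseteq> V i \<rightarrow>\<^sub>E zero_one cosets" "\<And>x y. x \<in> A \<Longrightarrow> y \<in> A \<Longrightarrow> x \<noteq> y \<Longrightarrow> \<epsilon> \<le> rho_inf \<rho> (V i) x y"
    and bad: "\<And>x. x \<in> A \<Longrightarrow> dens i (\<lambda>v. \<exists>h\<in>H. x (\<sigma> i h v) [] \<noteq> x v (cact (inv\<^bsub>F2\<^esub> h) [])) \<le> \<theta>"
    and V0: "0 < card (V i)" and t: "0 < t" "t \<le> 1" and \<theta>: "0 \<le> \<theta>"
  shows "real (card A) \<le> exp (real (card (V i)) * (\<theta> * ln (1 / t) + t + \<theta> * (real (card D) + 1)) + real (card R))"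
proof -
  let ?N = "real (card (V i))"
  define B where "B x = {v \<in> V i. \<exists>h\<in>H. x (\<sigma> i h v) [] \<noteq> x v (cact (inv\<^bsub>F2\<^esub> h) [])}" for x :: "nat \<Rightarrow> (ab \<times> bool) list \<Rightarrow> real"
  define \<Psi> where "\<Psi> x = (B x, {(v, j) \<in> B x \<times> D. x v j = 1}, {v \<in> B x. x (pb i v) [] = 1}, {r \<in> R. x r [] = 1})" for x :: "nat \<Rightarrow> (ab \<times> bool) list \<Rightarrow> real"
  define Sm where "Sm = {B. B \<subseteq> V i \<and> real (card B) \<le> \<theta> * ?N}"
  define \<Omega> where "\<Omega> = (SIGMA B:Sm. Pow (B \<times> D) \<times> Pow B \<times> Pow R)"
  have fR: "finite R" by (rule finite_subset[OF R(2) finite_V])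
  have fB: "finite B" if "B \<in> Sm" for B using that finite_subset[OF _ finite_V] by (auto simp: Sm_def)
  have fSm: "finite Sm" unfolding Sm_def by (rule finite_subset[of _ "Pow (V i)"]) auto
  have xO: "x v \<in> zero_one cosets" if "x \<in> A" "v \<in> V i" for x v using A(2) that by auto
  have inj: "inj_on \<Psi> A"
  proof (rule inj_onI, rule ccontr)
    fix x y assume xy: "x \<in> A" "y \<in> A" "\<Psi> x = \<Psi> y" "x \<noteq> y"
    then have \<Psi>: "B x = B y" "{(v, j) \<in> B x \<times> D. x v j = 1} = {(v, j) \<in> B y \<times> D. y v j = 1}"
      "{v \<in> B x. x (pb i v) [] = 1} = {v \<in> B y. y (pb i v) [] = 1}" "{r \<in> R. x r [] = 1} = {r \<in> R. y r [] = 1}"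
      unfolding \<Psi>_def prod.inject by blast+
    have eq: "x v j = y v j" if "v \<in> V i" "j \<in> D" for v j
      by (rule patterns_determined[OF R D(2) xO[OF xy(1)] xO[OF xy(2)] \<Psi>[unfolded B_def H_def] that])
    have lt: "\<rho> (x v) (y v) < \<epsilon>" if "v \<in> V i" for v
      by (rule win[OF xO[OF xy(1) that] xO[OF xy(2) that] eq[OF that]])
    have "rho_inf \<rho> (V i) x y \<in> (\<lambda>v. \<rho> (x v) (y v)) ` V i"
      unfolding rho_inf_def by (rule Max_in) (use V0 in auto)
    then have "rho_inf \<rho> (V i) x y < \<epsilon>" using lt by auto
    then show False using A(3)[OF xy(1,2,4)] by simp
  qed
  have sub: "\<Psi> ` A \<subseteq> \<Omega>"
  proof (rule image_subsetI)
    fix x assume x: "x \<in> A"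
    have "real (card (B x)) \<le> \<theta> * ?N"
      using bad[OF x] V0 unfolding dens_def B_def by (simp add: field_simps)
    then have "B x \<in> Sm" by (auto simp: Sm_def B_def)
    then show "\<Psi> x \<in> \<Omega>" by (auto simp: \<Psi>_def \<Omega>_def)
  qed
  have f\<Omega>: "finite \<Omega>" unfolding \<Omega>_def
    by (rule finite_SigmaI[OF fSm]) (use fB fR D(1) in auto)
  have "real (card A) \<le> real (card \<Omega>)" using card_inj_on_le[OF inj sub f\<Omega>] by simp
  also have "card \<Omega> = (\<Sum>B\<in>Sm. card (Pow (B \<times> D) \<times> Pow B \<times> Pow R))"
    unfolding \<Omega>_def by (rule card_SigmaI[OF fSm]) (use fB fR D(1) in auto)
  also have "real \<dots> \<le> (\<Sum>B\<in>Sm. exp (?N * (\<theta> * (real (card D) + 1)) + real (card R)))"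
    unfolding of_nat_sum
  proof (rule sum_mono)
    fix B assume B: "B \<in> Sm"
    have "card (Pow (B \<times> D) \<times> Pow B \<times> Pow R) = 2 ^ (card B * card D + card B + card R)"
      using fB[OF B] fR D(1) by (simp add: card_cartesian_product card_Pow power_add mult.assoc)
    then have "real (card (Pow (B \<times> D) \<times> Pow B \<times> Pow R)) = 2 ^ (card B * card D + card B + card R)"
      by (simp only: of_nat_power of_nat_numeral)
    also have "\<dots> \<le> exp 1 ^ (card B * card D + card B + card R)"
      by (rule power_mono) (use exp_ge_add_one_self[of 1] in auto)
    also have "\<dots> = exp (real (card B) * (real (card D) + 1) + real (card R))"
      by (simp add: exp_of_nat_mult[symmetric] algebra_simps)
    also have "\<dots> \<le> exp (\<theta> * ?N * (real (card D) + 1) + real (card R))"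
      using B by (auto simp: Sm_def intro!: mult_right_mono)
    finally show "real (card (Pow (B \<times> D) \<times> Pow B \<times> Pow R)) \<le> exp (?N * (\<theta> * (real (card D) + 1)) + real (card R))"
      by (simp add: algebra_simps)
  qed
  also have "\<dots> = real (card Sm) * exp (?N * (\<theta> * (real (card D) + 1)) + real (card R))" by simp
  also have "\<dots> \<le> exp (?N * (\<theta> * ln (1 / t) + t)) * exp (?N * (\<theta> * (real (card D) + 1)) + real (card R))"
    unfolding Sm_def by (intro mult_right_mono card_small_subsets finite_V t) simp
  also have "\<dots> = exp (?N * (\<theta> * ln (1 / t) + t + \<theta> * (real (card D) + 1)) + real (card R))"
    by (simp add: exp_add[symmetric] algebra_simps)
  finally show ?thesis .
qed

lemma log_separation_number_le:
  assumes "\<And>A. A \<subseteq> S \<Longrightarrow> finite A \<Longrightarrow> (\<And>x y. x \<in> A \<Longrightarrow> y \<in> A \<Longrightarrow> x \<noteq> y \<Longrightarrow> \<epsilon> \<le> d x y) \<Longrightarrow> real (card A) \<le> exp c"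
  shows "log_enat (separation_number \<epsilon> S d) \<le> ereal c"
proof -
  let ?K = "nat \<lfloor>exp c\<rfloor>"
  have "separation_number \<epsilon> S d \<le> enat ?K"
    unfolding separation_number_def
  proof (rule SUP_least)
    fix A assume "A \<in> {A. A \<subseteq> S \<and> finite A \<and> (\<forall>x\<in>A. \<forall>y\<in>A. x \<noteq> y \<longrightarrow> \<epsilon> \<le> d x y)}"
    then have "real (card A) \<le> exp c" by (intro assms) auto
    then show "enat (card A) \<le> enat ?K" by (simp add: le_nat_floor)
  qed
  then obtain k where k: "separation_number \<epsilon> S d = enat k" "k \<le> ?K"
    by (metis enat_ile enat_ord_simps(1))
  show ?thesis
  proof (cases "k = 0")
    case False
    have "real k \<le> exp c" using k(2) by (meson exp_ge_zero of_nat_floor of_nat_le_iff order_trans)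
    then have "ln (real k) \<le> c" using False ln_le_cancel_iff[of "real k" "exp c"] by simp
    then show ?thesis using False by (simp add: log_enat_def k)
  qed (simp add: log_enat_def k)
qed

text \<open>The rate \<open>\<eta>\<close> is spent in quarters: one on the parameter
  \<open>t\<close>, one on the two terms with \<open>\<theta>\<close>, and one each on the separated
  points and the short cycles, which together bound \<open>card R\<close>.\<close>

lemma entropy_upper:
  assumes e: "0 < \<epsilon>" and \<eta>: "0 < \<eta>"
  shows "\<exists>F \<delta>. finite F \<and> F \<subseteq> carrier F2 \<and> 0 < \<delta> \<and>
    limsup (\<lambda>i. log_enat (separation_number \<epsilon> (maps U F \<delta> i) (rho_inf \<rho> (V i))) / ereal (real (card (V i)))) \<le> ereal \<eta>"
proof -
  obtain D where D: "finite D" "D \<subseteq> cosets"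
    and win: "\<And>x y. x \<in> zero_one cosets \<Longrightarrow> y \<in> zero_one cosets \<Longrightarrow> (\<And>j. j \<in> D \<Longrightarrow> x j = y j) \<Longrightarrow> \<rho> x y < \<epsilon>"
    using metric_window[OF e] by blast
  obtain E \<kappa> where E: "finite E" "E \<subseteq> carrier F2" and \<kappa>: "0 < \<kappa>"
    and gen: "\<And>x y. x \<in> zero_one cosets \<Longrightarrow> y \<in> zero_one cosets \<Longrightarrow> (\<And>g. g \<in> E \<Longrightarrow> \<rho> (shift g x) (shift g y) < \<kappa>) \<Longrightarrow> x [] = y []"
    using generating_window by blast
  define H where "H = insert [gB] ((\<lambda>j. inv\<^bsub>F2\<^esub> j) ` D)"
  have H: "finite H" "H \<subseteq> carrier F2" using D cosets_carrier F2_inv gB_carrier by (auto simp: H_def)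
  define F where "F = E \<union> (\<lambda>(g, h). g \<otimes>\<^bsub>F2\<^esub> h) ` (E \<times> H)"
  have F: "finite F" "F \<subseteq> carrier F2" using E H carrier_mult by (auto simp: F_def)
  have F': "E \<subseteq> F" "\<And>g h. g \<in> E \<Longrightarrow> h \<in> H \<Longrightarrow> g \<otimes>\<^bsub>F2\<^esub> h \<in> F" by (auto simp: F_def)
  define t where "t = min 1 (\<eta> / 4)"
  have t: "0 < t" "t \<le> 1" "t \<le> \<eta> / 4" using \<eta> by (auto simp: t_def)
  have lt: "0 \<le> ln (1 / t)" using t by simp
  define \<theta> where "\<theta> = \<eta> / (4 * (ln (1 / t) + (real (card D) + 1)))"
  have den: "0 < ln (1 / t) + (real (card D) + 1)" using lt by linarith
  have \<theta>: "0 < \<theta>" "\<theta> * ln (1 / t) + \<theta> * (real (card D) + 1) = \<eta> / 4"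
  proof -
    show "0 < \<theta>" unfolding \<theta>_def using \<eta> den by simp
    have "\<eta> / (4 * L) * L = \<eta> / 4" if "0 < L" for L :: real using that by simp
    from this[OF den] have "\<theta> * (ln (1 / t) + (real (card D) + 1)) = \<eta> / 4" unfolding \<theta>_def .
    then show "\<theta> * ln (1 / t) + \<theta> * (real (card D) + 1) = \<eta> / 4" by (simp only: distrib_left)
  qed
  \<comment> \<open>Half of \<open>\<theta>\<close> is reserved for failures of multiplicativity;
    \<open>\<beta>\<close> makes the union bound over \<open>H\<close> and \<open>E\<close> cost at
    most the other half.\<close>
  define \<beta> where "\<beta> = \<theta> / (4 * (real (card H) * real (card E) + 1))"
  have \<beta>: "0 < \<beta>" unfolding \<beta>_def using \<theta>(1) by (simp add: add_nonneg_pos)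
  have \<beta>2: "real (card H) * (real (card E) * (2 * \<beta>)) \<le> \<theta> / 2"
  proof -
    let ?c = "real (card H) * real (card E)"
    have "?c * (2 * \<beta>) \<le> (?c + 1) * (2 * \<beta>)" using \<beta> by (intro mult_right_mono) auto
    also have "(?c + 1) * (2 * \<beta>) = \<theta> / 2"
    proof -
      have "0 < ?c + 1" by (simp add: add_nonneg_pos)
      then show ?thesis unfolding \<beta>_def by (simp add: field_simps)
    qed
    finally show ?thesis by (simp add: mult.assoc)
  qed
  \<comment> \<open>Chosen so that the Chebyshev bound
    \<open>(2 * \<delta> / \<kappa>)\<^sup>2\<close> equals \<open>\<beta>\<close>.\<close>
  define \<delta> where "\<delta> = \<kappa> / 2 * sqrt \<beta>"
  have \<delta>: "0 < \<delta>" "(2 * \<delta> / \<kappa>)\<^sup>2 = \<beta>" using \<kappa> \<beta> by (auto simp: \<delta>_def)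
  define n where "n = nat \<lceil>4 / \<eta>\<rceil>"
  have n: "0 < n" "1 / real n \<le> \<eta> / 4"
  proof -
    have "4 / \<eta> \<le> real n" unfolding n_def by (rule real_nat_ceiling_ge)
    moreover have "0 < 4 / \<eta>" using \<eta> by simp
    ultimately have "0 < real n" by linarith
    then show "0 < n" by simp
    show "1 / real n \<le> \<eta> / 4" using \<open>4 / \<eta> \<le> real n\<close> \<open>0 < real n\<close> \<eta> by (simp add: field_simps)
  qed
  have "rare (\<lambda>i v. \<exists>h\<in>H. \<exists>g\<in>E. \<sigma> i g (\<sigma> i h v) \<noteq> \<sigma> i (g \<otimes>\<^bsub>F2\<^esub> h) v)"
    by (intro rare_Bex H(1) E(1) rare_mult) (use H E in auto)
  then have ev1: "eventually (\<lambda>i. dens i (\<lambda>v. \<exists>h\<in>H. \<exists>g\<in>E. \<sigma> i g (\<sigma> i h v) \<noteq> \<sigma> i (g \<otimes>\<^bsub>F2\<^esub> h) v) < \<theta> / 2) sequentially"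
    by (rule rareD) (use \<theta> in simp)
  have ev2: "eventually (\<lambda>i. dens i (\<lambda>v. \<exists>k\<in>{0<..<n}. (pb i ^^ k) v = v) < \<eta> / 4) sequentially"
    by (rule rareD[OF rare_short]) (use \<eta> in simp)
  have "eventually (\<lambda>i. log_enat (separation_number \<epsilon> (maps U F \<delta> i) (rho_inf \<rho> (V i))) / ereal (real (card (V i))) \<le> ereal \<eta>) sequentially"
    using ev1 ev2 card_V_large[of 0]
  proof eventually_elim
    case (elim i)
    let ?N = "real (card (V i))"
    have N: "0 < ?N" using elim(3) by (simp only: of_nat_0_less_iff)
    obtain R where R: "R \<subseteq> V i" "real (card R) \<le> ?N / real n + real (card {v \<in> V i. \<exists>k\<in>{0<..<n}. (pb i ^^ k) v = v})"
      "\<And>v. v \<in> V i \<Longrightarrow> \<exists>k<2 * n. \<exists>r\<in>R. (pb i ^^ k) r = v"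
      using cut_set[OF permutes[OF gB_carrier] finite_V n(1)] by blast
    have "real (card {v \<in> V i. \<exists>k\<in>{0<..<n}. (pb i ^^ k) v = v}) \<le> ?N * (\<eta> / 4)"
      using elim(2) N unfolding dens_def by (simp add: field_simps)
    moreover have "?N / real n \<le> ?N * (\<eta> / 4)" using mult_left_mono[OF n(2), of ?N] N by simp
    moreover have "?N * (\<eta> / 2) = ?N * (\<eta> / 4) + ?N * (\<eta> / 4)" by (simp add: field_simps)
    ultimately have cR: "real (card R) \<le> ?N * (\<eta> / 2)" using R(2) by linarith
    have "log_enat (separation_number \<epsilon> (maps U F \<delta> i) (rho_inf \<rho> (V i))) \<le> ereal (?N * \<eta>)"
    proof (rule log_separation_number_le)
      fix A assume A: "A \<subseteq> maps U F \<delta> i" "finite A" "\<And>x y. x \<in> A \<Longrightarrow> y \<in> A \<Longrightarrow> x \<noteq> y \<Longrightarrow> \<epsilon> \<le> rho_inf \<rho> (V i) x y"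
      have bad: "dens i (\<lambda>v. \<exists>h\<in>H. x (\<sigma> i h v) [] \<noteq> x v (cact (inv\<^bsub>F2\<^esub> h) [])) \<le> \<theta>" if x: "x \<in> A" for x
      proof -
        have xm: "x \<in> maps U F \<delta> i" using A(1) x by (rule subsetD)
        have "dens i (\<lambda>v. \<exists>h\<in>H. x (\<sigma> i h v) [] \<noteq> x v (cact (inv\<^bsub>F2\<^esub> h) []))
          \<le> dens i (\<lambda>v. \<exists>h\<in>H. \<exists>g\<in>E. \<sigma> i g (\<sigma> i h v) \<noteq> \<sigma> i (g \<otimes>\<^bsub>F2\<^esub> h) v) + real (card H) * (real (card E) * (2 * (2 * \<delta> / \<kappa>)\<^sup>2))"
          by (rule bad_density) (rule E H \<kappa> F' xm gen | assumption)+
        then show ?thesis using elim(1) \<beta>2 unfolding \<delta>(2) by linarith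
      qed
      have AO: "A \<subseteq> V i \<rightarrow>\<^sub>E zero_one cosets" using A(1) by (auto simp: sofic_maps_def)
      have "real (card A) \<le> exp (?N * (\<theta> * ln (1 / t) + t + \<theta> * (real (card D) + 1)) + real (card R))"
      proof (rule card_separated[OF R(3,1) D])
        fix x y assume "x \<in> zero_one cosets" "y \<in> zero_one cosets" "\<And>j. j \<in> D \<Longrightarrow> x j = y j"
        then show "\<rho> x y < \<epsilon>" by (rule win)
      next
        fix x assume "x \<in> A"
        from bad[OF this] show "dens i (\<lambda>v. \<exists>h\<in>insert [gB] ((\<lambda>j. inv\<^bsub>F2\<^esub> j) ` D). x (\<sigma> i h v) [] \<noteq> x v (cact (inv\<^bsub>F2\<^esub> h) [])) \<le> \<theta>"
          unfolding H_def .
      qed (rule A(2) AO A(3) elim(3) t(1,2) less_imp_le[OF \<theta>(1)] | assumption)+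
      also have "\<dots> \<le> exp (?N * (\<eta> / 4 + \<eta> / 4) + ?N * (\<eta> / 2))"
      proof -
        have "\<theta> * ln (1 / t) + t + \<theta> * (real (card D) + 1) \<le> \<eta> / 4 + \<eta> / 4" using \<theta>(2) t(3) by linarith
        then have "?N * (\<theta> * ln (1 / t) + t + \<theta> * (real (card D) + 1)) \<le> ?N * (\<eta> / 4 + \<eta> / 4)"
          using N by (intro mult_left_mono) auto
        then show ?thesis unfolding exp_le_cancel_iff using cR by (rule add_mono)
      qed
      also have "?N * (\<eta> / 4 + \<eta> / 4) + ?N * (\<eta> / 2) = ?N * \<eta>" by (simp add: field_simps)
      finally show "real (card A) \<le> exp (?N * \<eta>)" .
    qed
    then have "log_enat (separation_number \<epsilon> (maps U F \<delta> i) (rho_inf \<rho> (V i))) / ereal ?N \<le> ereal (?N * \<eta>) / ereal ?N"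
      using N by (intro ereal_divide_right_mono) auto
    also have "\<dots> = ereal \<eta>" using elim(3) by auto
    finally show ?case .
  qed
  then show ?thesis using F \<delta>(1) by (intro exI[of _ F] exI[of _ \<delta>] conjI Limsup_bounded)
qed

end

subsection \<open>Random labellings of the segments\<close>

text \<open>Fourier expansion: the indicator of a pattern is a product of factors
  \<open>(1 + \<chi> t) / 2\<close> with signs \<open>\<chi> = 1 - 2 q\<close>. The empty set gives
  the main term, and the at most \<open>2 ^ card D\<close> other terms are compensated by the
  prefactor \<open>(1 / 2) ^ card D\<close>.\<close>

lemma pattern_frequency:
  fixes t :: "'v \<Rightarrow> 'j \<Rightarrow> real"
  assumes V: "finite V" "0 < card V" and D: "finite D"
    and t: "\<And>v j. v \<in> V \<Longrightarrow> j \<in> D \<Longrightarrow> t v j \<in> {-1, 1}" and q: "\<And>j. j \<in> D \<Longrightarrow> q j \<in> {0, 1}"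
    and \<theta>: "0 \<le> \<theta>" and small: "\<And>E. E \<subseteq> D \<Longrightarrow> E \<noteq> {} \<Longrightarrow> \<bar>\<Sum>v\<in>V. \<Prod>j\<in>E. t v j\<bar> \<le> \<theta> * real (card V)"
  shows "\<bar>real (card {v \<in> V. \<forall>j\<in>D. (1 - t v j) / 2 = q j}) / real (card V) - (1 / 2) ^ card D\<bar> \<le> \<theta>"
proof -
  let ?\<chi> = "\<lambda>j. 1 - 2 * q j"
  let ?S = "\<lambda>E. \<Sum>v\<in>V. \<Prod>j\<in>E. t v j"
  have edge_sum: "(1 + ?\<chi> j * t v j) / 2 = (if (1 - t v j) / 2 = q j then 1 else 0)" if "v \<in> V" "j \<in> D" for v j
    using t[OF that] q[OF that(2)] by auto
  have ind: "(if \<forall>j\<in>D. (1 - t v j) / 2 = q j then 1 else 0 :: real) = (\<Prod>j\<in>D. (1 + ?\<chi> j * t v j) / 2)" if v: "v \<in> V" for v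
  proof -
    have "(\<Prod>j\<in>D. (1 + ?\<chi> j * t v j) / 2) = (\<Prod>j\<in>D. if (1 - t v j) / 2 = q j then 1 else 0)"
      by (rule prod.cong[OF refl edge_sum[OF v]])
    also have "\<dots> = (if \<forall>j\<in>D. (1 - t v j) / 2 = q j then 1 else 0)"
    proof (cases "\<forall>j\<in>D. (1 - t v j) / 2 = q j")
      case False
      then obtain j where "j \<in> D" "(1 - t v j) / 2 \<noteq> q j" by blast
      then have "(\<Prod>j\<in>D. if (1 - t v j) / 2 = q j then 1 else 0 :: real) = 0" using D by (intro prod_zero) auto
      with False show ?thesis by (simp only: if_False)
    qed (simp cong: prod.cong)
    finally show ?thesis by simp
  qed
  have "real (card {v \<in> V. \<forall>j\<in>D. (1 - t v j) / 2 = q j}) = (\<Sum>v\<in>V. if \<forall>j\<in>D. (1 - t v j) / 2 = q j then 1 else 0)"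
    using V(1) by (simp add: sum.If_cases Int_def conj_commute)
  also have "\<dots> = (\<Sum>v\<in>V. \<Prod>j\<in>D. (1 + ?\<chi> j * t v j) / 2)" by (rule sum.cong[OF refl ind])
  also have "\<dots> = (\<Sum>v\<in>V. (1 / 2) ^ card D * (\<Sum>E\<in>Pow D. (\<Prod>j\<in>E. ?\<chi> j) * (\<Prod>j\<in>E. t v j)))"
  proof (rule sum.cong[OF refl])
    fix v
    have "(\<Prod>j\<in>D. (1 + ?\<chi> j * t v j) / 2) = (1 / 2) ^ card D * (\<Prod>j\<in>D. ?\<chi> j * t v j + 1)"
      by (simp add: prod_dividef power_one_over add.commute)
    also have "(\<Prod>j\<in>D. ?\<chi> j * t v j + 1) = (\<Sum>E\<in>Pow D. (\<Prod>j\<in>E. ?\<chi> j * t v j) * (\<Prod>j\<in>D - E. 1))"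
      by (rule prod_add[OF D])
    also have "\<dots> = (\<Sum>E\<in>Pow D. (\<Prod>j\<in>E. ?\<chi> j) * (\<Prod>j\<in>E. t v j))" by (simp only: prod.distrib prod.neutral_const mult_1_right)
    finally show "(\<Prod>j\<in>D. (1 + ?\<chi> j * t v j) / 2) = (1 / 2) ^ card D * (\<Sum>E\<in>Pow D. (\<Prod>j\<in>E. ?\<chi> j) * (\<Prod>j\<in>E. t v j))" .
  qed
  also have "\<dots> = (1 / 2) ^ card D * (\<Sum>v\<in>V. \<Sum>E\<in>Pow D. (\<Prod>j\<in>E. ?\<chi> j) * (\<Prod>j\<in>E. t v j))"
    by (rule sum_distrib_left[symmetric])
  also have "(\<Sum>v\<in>V. \<Sum>E\<in>Pow D. (\<Prod>j\<in>E. ?\<chi> j) * (\<Prod>j\<in>E. t v j)) = (\<Sum>E\<in>Pow D. (\<Prod>j\<in>E. ?\<chi> j) * ?S E)"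
    by (subst sum.swap) (simp only: sum_distrib_left)
  also have "\<dots> = real (card V) + (\<Sum>E\<in>Pow D - {{}}. (\<Prod>j\<in>E. ?\<chi> j) * ?S E)"
    using D by (subst sum.remove[of _ "{}"]) simp_all
  finally have eq: "real (card {v \<in> V. \<forall>j\<in>D. (1 - t v j) / 2 = q j})
    = (1 / 2) ^ card D * (real (card V) + (\<Sum>E\<in>Pow D - {{}}. (\<Prod>j\<in>E. ?\<chi> j) * ?S E))" (is "?L = ?p * (?N + ?R)") .
  have "\<bar>?R\<bar> \<le> (\<Sum>E\<in>Pow D - {{}}. \<bar>(\<Prod>j\<in>E. ?\<chi> j) * ?S E\<bar>)" by (rule sum_abs)
  also have "\<dots> \<le> (\<Sum>E\<in>Pow D - {{}}. \<theta> * ?N)"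
  proof (rule sum_mono)
    fix E assume E: "E \<in> Pow D - {{}}"
    have "\<bar>\<Prod>j\<in>E. ?\<chi> j\<bar> = (\<Prod>j\<in>E. \<bar>?\<chi> j\<bar>)" by (rule abs_prod)
    also have "\<dots> = (\<Prod>j\<in>E. 1)"
    proof (rule prod.cong[OF refl])
      fix j assume "j \<in> E"
      then have "q j \<in> {0, 1}" using E by (intro q) auto
      then show "\<bar>?\<chi> j\<bar> = 1" by auto
    qed
    finally have "\<bar>(\<Prod>j\<in>E. ?\<chi> j) * ?S E\<bar> = \<bar>?S E\<bar>" by (simp only: abs_mult prod.neutral_const mult_1_left)
    then show "\<bar>(\<Prod>j\<in>E. ?\<chi> j) * ?S E\<bar> \<le> \<theta> * ?N" using small[of E] E by simp
  qed
  also have "\<dots> = real (card (Pow D - {{}})) * (\<theta> * ?N)" by simp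
  also have "\<dots> \<le> 2 ^ card D * (\<theta> * ?N)"
  proof (rule mult_right_mono)
    have "card (Pow D - {{}}) \<le> card (Pow D)" using D by (intro card_mono) auto
    also have "\<dots> = 2 ^ card D" by (rule card_Pow[OF D])
    finally have "real (card (Pow D - {{}})) \<le> real (2 ^ card D)" by (rule of_nat_mono)
    then show "real (card (Pow D - {{}})) \<le> 2 ^ card D" by simp
    show "0 \<le> \<theta> * ?N" using \<theta> by simp
  qed
  finally have "?p * \<bar>?R\<bar> \<le> ?p * (2 ^ card D * (\<theta> * ?N))" by (intro mult_left_mono) simp_all
  also have "\<dots> = \<theta> * ?N" by (simp add: power_one_over)
  finally have R: "?p * \<bar>?R\<bar> \<le> \<theta> * ?N" .
  have N: "0 < ?N" using V(2) by (simp only: of_nat_0_less_iff)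
  have "?L / ?N - ?p = (?p * ?R) / ?N" unfolding eq using N by (simp add: field_simps)
  then have "\<bar>?L / ?N - ?p\<bar> = \<bar>?p * ?R\<bar> / ?N" using N by simp
  also have "\<bar>?p * ?R\<bar> = ?p * \<bar>?R\<bar>" by (simp add: abs_mult)
  also have "\<dots> / ?N \<le> \<theta>" by (subst pos_divide_le_eq[OF N]) (rule R)
  finally show ?thesis .
qed

abbreviation signs :: "'v set \<Rightarrow> ('v \<Rightarrow> real) set" where "signs V \<equiv> V \<rightarrow>\<^sub>E {-1, 1}"

lemma sum_signs_flip:
  assumes r: "r \<in> V" and f: "\<And>s. s \<in> signs V \<Longrightarrow> f (s(r := - s r)) = - f s"
  shows "(\<Sum>s\<in>signs V. f s) = (0 :: real)"
proof -
  let ?fl = "\<lambda>s. s(r := - s r) :: 'a \<Rightarrow> real"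
  have "?fl s \<in> signs V" if "s \<in> signs V" for s
    using that r by (auto simp: PiE_iff extensional_def)
  then have "(\<Sum>s\<in>signs V. f s) = (\<Sum>s\<in>signs V. f (?fl s))"
    by (intro sum.reindex_bij_witness[of _ ?fl ?fl]) auto
  also have "\<dots> = (\<Sum>s\<in>signs V. - f s)" by (rule sum.cong[OF refl f])
  finally show ?thesis by (simp add: sum_negf)
qed

lemma abs_prod_signs:
  assumes "s \<in> signs V" "\<And>j. j \<in> E \<Longrightarrow> l j \<in> V"
  shows "\<bar>\<Prod>j\<in>E. s (l j)\<bar> = 1"
proof -
  have "\<bar>\<Prod>j\<in>E. s (l j)\<bar> = (\<Prod>j\<in>E. \<bar>s (l j)\<bar>)" by (rule abs_prod)
  also have "\<dots> = (\<Prod>j\<in>E. 1)"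
  proof (rule prod.cong[OF refl])
    fix j assume "j \<in> E"
    then have "s (l j) \<in> {-1, 1}" using assms by (metis PiE_mem)
    then show "\<bar>s (l j)\<bar> = 1" by auto
  qed
  finally show ?thesis by simp
qed

text \<open>The products over \<open>E\<close> at \<open>v\<close> and \<open>u\<close> are uncorrelated unless a label occurs twice: otherwise
  flipping the sign of the label \<open>c e v\<close> cancels the sum.\<close>

lemma signs_uncorrelated:
  assumes E: "finite E" "e \<in> E" and c: "c e v \<in> V"
    and v: "inj_on (\<lambda>j. c j v) E" and u: "\<And>j. j \<in> E \<Longrightarrow> c j u \<noteq> c e v"
  shows "(\<Sum>s\<in>signs V. (\<Prod>j\<in>E. s (c j v)) * (\<Prod>j\<in>E. s (c j u))) = (0 :: real)"
proof (rule sum_signs_flip[OF c])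
  fix s :: "'b \<Rightarrow> real"
  let ?s = "s(c e v := - s (c e v))"
  have "(\<Prod>j\<in>E. ?s (c j u)) = (\<Prod>j\<in>E. s (c j u))" by (rule prod.cong[OF refl]) (use u in simp)
  moreover have "(\<Prod>j\<in>E. ?s (c j v)) = - (\<Prod>j\<in>E. s (c j v))"
  proof -
    have "(\<Prod>j\<in>E. ?s (c j v)) = ?s (c e v) * (\<Prod>j\<in>E - {e}. ?s (c j v))" by (rule prod.remove[OF E])
    also have "(\<Prod>j\<in>E - {e}. ?s (c j v)) = (\<Prod>j\<in>E - {e}. s (c j v))"
    proof (rule prod.cong[OF refl])
      fix j assume "j \<in> E - {e}"
      then have "c j v \<noteq> c e v" using inj_onD[OF v, of j e] E(2) by blast
      then show "?s (c j v) = s (c j v)" by simp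
    qed
    finally show ?thesis using prod.remove[OF E, of "\<lambda>j. s (c j v)"] by simp
  qed
  ultimately show "(\<Prod>j\<in>E. ?s (c j v)) * (\<Prod>j\<in>E. ?s (c j u)) = - ((\<Prod>j\<in>E. s (c j v)) * (\<Prod>j\<in>E. s (c j u)))"
    by simp
qed

text \<open>After expanding the square, only pairs with correlated products survive, each bounded by
  the number of sign vectors. Either the labels at \<open>v\<close> are not distinct, or the label
  \<open>c e v\<close> occurs at \<open>u\<close>; for given \<open>u\<close> the latter leaves at
  most \<open>card D * m\<close> choices of \<open>v\<close>.\<close>

lemma second_moment:
  fixes V :: "'v set"
  assumes V: "finite V" and D: "finite D" and E: "E \<subseteq> D" "E \<noteq> {}"
    and c: "\<And>j v. j \<in> D \<Longrightarrow> v \<in> V \<Longrightarrow> c j v \<in> V"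
    and fib: "\<And>j r. j \<in> D \<Longrightarrow> r \<in> V \<Longrightarrow> card {v \<in> V. c j v = r} \<le> m"
  shows "(\<Sum>s\<in>signs V. (\<Sum>v\<in>V. \<Prod>j\<in>E. s (c j v))\<^sup>2)
    \<le> real (card (signs V)) * (real (card {v \<in> V. \<not> inj_on (\<lambda>j. c j v) D}) * real (card V) + real (card V) * (real (card D) * real m))"
proof -
  obtain e where e: "e \<in> E" using E(2) by blast
  have fE: "finite E" using E(1) D by (rule finite_subset)
  let ?w = "\<lambda>s v. \<Prod>j\<in>E. s (c j v) :: real"
  let ?A = "{v \<in> V. \<not> inj_on (\<lambda>j. c j v) D}"
  let ?B = "{(v, u) \<in> V \<times> V. v \<in> ?A \<or> (\<exists>j\<in>D. c e v = c j u)}"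
  have fB: "finite ?B" by (rule finite_subset[of _ "V \<times> V"]) (use V in auto)
  have cE: "c j v \<in> V" if "j \<in> E" "v \<in> V" for j v using c that E(1) by blast
  have "(\<Sum>s\<in>signs V. (\<Sum>v\<in>V. ?w s v)\<^sup>2) = (\<Sum>s\<in>signs V. \<Sum>(v, u)\<in>V \<times> V. ?w s v * ?w s u)"
    by (simp only: power2_eq_square sum_product sum.cartesian_product)
  also have "\<dots> = (\<Sum>(v, u)\<in>V \<times> V. \<Sum>s\<in>signs V. ?w s v * ?w s u)"
    by (subst sum.swap) (simp only: case_prod_unfold)
  also have "\<dots> = (\<Sum>(v, u)\<in>?B. \<Sum>s\<in>signs V. ?w s v * ?w s u)"
  proof (rule sum.mono_neutral_right)
    show "\<forall>i\<in>V \<times> V - ?B. (case i of (v, u) \<Rightarrow> \<Sum>s\<in>signs V. ?w s v * ?w s u) = 0"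
    proof
      fix i assume i: "i \<in> V \<times> V - ?B"
      obtain v u where vu: "i = (v, u)" by (cases i)
      have v: "v \<in> V" "inj_on (\<lambda>j. c j v) D" "\<forall>j\<in>D. c e v \<noteq> c j u" using i vu by auto
      have "(\<Sum>s\<in>signs V. ?w s v * ?w s u) = 0"
      proof (rule signs_uncorrelated[where c=c and v=v and u=u and e=e, OF fE e cE[OF e v(1)]])
        show "inj_on (\<lambda>j. c j v) E" by (rule inj_on_subset[OF v(2) E(1)])
      qed (use v(3) E(1) in fastforce)
      then show "(case i of (v, u) \<Rightarrow> \<Sum>s\<in>signs V. ?w s v * ?w s u) = 0" using vu by simp
    qed
  qed (use V in auto)
  also have "\<dots> \<le> (\<Sum>(v, u)\<in>?B. real (card (signs V)))"
  proof (rule sum_mono)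
    fix i assume i: "i \<in> ?B"
    obtain v u where vu: "i = (v, u)" by (cases i)
    have v: "v \<in> V" "u \<in> V" using i vu by auto
    have "(\<Sum>s\<in>signs V. ?w s v * ?w s u) \<le> (\<Sum>s\<in>signs V. 1)"
    proof (rule sum_mono)
      fix s assume s: "s \<in> signs V"
      have "\<bar>?w s v * ?w s u\<bar> = 1"
      proof -
        have "\<bar>?w s v\<bar> = 1" "\<bar>?w s u\<bar> = 1" using abs_prod_signs[OF s, of E "\<lambda>j. c j v"] abs_prod_signs[OF s, of E "\<lambda>j. c j u"] cE v by blast+
        then show ?thesis unfolding abs_mult by simp
      qed
      then show "?w s v * ?w s u \<le> 1" by linarith
    qed
    then show "(case i of (v, u) \<Rightarrow> \<Sum>s\<in>signs V. ?w s v * ?w s u) \<le> (case i of (v, u) \<Rightarrow> real (card (signs V)))"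
      using vu by simp
  qed
  also have "\<dots> = real (card (signs V)) * real (card ?B)" by (simp add: case_prod_unfold)
  also have "\<dots> \<le> real (card (signs V)) * (real (card ?A) * real (card V) + real (card V) * (real (card D) * real m))"
  proof (rule mult_left_mono)
    have sub: "?B \<subseteq> ?A \<times> V \<union> (\<lambda>(u, v). (v, u)) ` (SIGMA u:V. \<Union>j\<in>D. {v \<in> V. c e v = c j u})"
      by (auto simp: image_iff)
    have fS: "finite (SIGMA u:V. \<Union>j\<in>D. {v \<in> V. c e v = c j u})" by (rule finite_SigmaI) (use V D in auto)
    have "card ?B \<le> card (?A \<times> V \<union> (\<lambda>(u, v). (v, u)) ` (SIGMA u:V. \<Union>j\<in>D. {v \<in> V. c e v = c j u}))"
      by (rule card_mono[OF _ sub]) (use V fS in auto)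
    also have "\<dots> \<le> card (?A \<times> V) + card ((\<lambda>(u, v). (v, u)) ` (SIGMA u:V. \<Union>j\<in>D. {v \<in> V. c e v = c j u}))"
      by (rule card_Un_le)
    also have "\<dots> \<le> card ?A * card V + card (SIGMA u:V. \<Union>j\<in>D. {v \<in> V. c e v = c j u})"
      by (rule add_mono) (simp_all only: card_cartesian_product order_refl card_image_le[OF fS])
    also have "card (SIGMA u:V. \<Union>j\<in>D. {v \<in> V. c e v = c j u}) = (\<Sum>u\<in>V. card (\<Union>j\<in>D. {v \<in> V. c e v = c j u}))"
      by (rule card_SigmaI) (use V D in auto)
    also have "\<dots> \<le> (\<Sum>u\<in>V. card D * m)"
    proof (rule sum_mono)
      fix u assume u: "u \<in> V"
      have "card (\<Union>j\<in>D. {v \<in> V. c e v = c j u}) \<le> (\<Sum>j\<in>D. card {v \<in> V. c e v = c j u})" by (rule card_UN_le[OF D])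
      also have "\<dots> \<le> (\<Sum>j\<in>D. m)" by (rule sum_mono, rule fib) (use e E(1) c u in auto)
      finally show "card (\<Union>j\<in>D. {v \<in> V. c e v = c j u}) \<le> card D * m" by simp
    qed
    finally have "card ?B \<le> card ?A * card V + card V * (card D * m)" by simp
    then have "real (card ?B) \<le> real (card ?A * card V + card V * (card D * m))" by (rule of_nat_mono)
    then show "real (card ?B) \<le> real (card ?A) * real (card V) + real (card V) * (real (card D) * real m)"
      by (simp only: of_nat_add of_nat_mult)
  qed simp
  finally show ?thesis .
qed

text \<open>The squares are summed over all nonempty \<open>E\<close> before averaging, so that one
  sign vector serves all of them at once; the factor \<open>2 ^ card D\<close> is the price.\<close>

lemma good_signs:
  fixes V :: "'v set"
  assumes V: "finite V" and D: "finite D"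
    and c: "\<And>j v. j \<in> D \<Longrightarrow> v \<in> V \<Longrightarrow> c j v \<in> V"
    and fib: "\<And>j r. j \<in> D \<Longrightarrow> r \<in> V \<Longrightarrow> card {v \<in> V. c j v = r} \<le> m"
  shows "\<exists>s\<in>signs V. \<forall>E. E \<subseteq> D \<longrightarrow> E \<noteq> {} \<longrightarrow> (\<Sum>v\<in>V. \<Prod>j\<in>E. s (c j v))\<^sup>2
    \<le> 2 ^ card D * (real (card {v \<in> V. \<not> inj_on (\<lambda>j. c j v) D}) * real (card V) + real (card V) * (real (card D) * real m))"
proof -
  let ?B = "real (card {v \<in> V. \<not> inj_on (\<lambda>j. c j v) D}) * real (card V) + real (card V) * (real (card D) * real m)"
  let ?\<E> = "Pow D - {{}}"
  let ?g = "\<lambda>s. \<Sum>E\<in>?\<E>. (\<Sum>v\<in>V. \<Prod>j\<in>E. s (c j v))\<^sup>2 :: real"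
  have fS: "finite (signs V)" using V by (intro finite_PiE) auto
  have S0: "signs V \<noteq> {}" by (simp add: PiE_eq_empty_iff)
  have B0: "0 \<le> ?B" by simp
  have "\<exists>s\<in>signs V. ?g s \<le> 2 ^ card D * ?B"
  proof (rule ccontr)
    assume "\<not> (\<exists>s\<in>signs V. ?g s \<le> 2 ^ card D * ?B)"
    then have "(\<Sum>s\<in>signs V. 2 ^ card D * ?B) < (\<Sum>s\<in>signs V. ?g s)"
      by (intro sum_strict_mono fS S0) (simp add: not_le)
    moreover have "(\<Sum>s\<in>signs V. ?g s) = (\<Sum>E\<in>?\<E>. \<Sum>s\<in>signs V. (\<Sum>v\<in>V. \<Prod>j\<in>E. s (c j v))\<^sup>2)" by (rule sum.swap)
    moreover have "\<dots> \<le> (\<Sum>E\<in>?\<E>. real (card (signs V)) * ?B)"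
    proof (rule sum_mono)
      fix E assume "E \<in> ?\<E>"
      then have "E \<subseteq> D" "E \<noteq> {}" by auto
      then show "(\<Sum>s\<in>signs V. (\<Sum>v\<in>V. \<Prod>j\<in>E. s (c j v))\<^sup>2) \<le> real (card (signs V)) * ?B"
        by (rule second_moment[OF V D _ _ c fib])
    qed
    moreover have "\<dots> = real (card ?\<E>) * (real (card (signs V)) * ?B)" by simp
    moreover have "\<dots> \<le> 2 ^ card D * (real (card (signs V)) * ?B)"
    proof (rule mult_right_mono)
      have "card ?\<E> \<le> card (Pow D)" using D by (intro card_mono) auto
      also have "\<dots> = 2 ^ card D" by (rule card_Pow[OF D])
      finally have "real (card ?\<E>) \<le> real (2 ^ card D)" by (rule of_nat_mono)
      then show "real (card ?\<E>) \<le> 2 ^ card D" by simp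
      show "0 \<le> real (card (signs V)) * ?B" using B0 by (intro mult_nonneg_nonneg) simp_all
    qed
    moreover have "(\<Sum>s\<in>signs V. 2 ^ card D * ?B) = 2 ^ card D * (real (card (signs V)) * ?B)" by simp
    ultimately show False by linarith
  qed
  then obtain s where s: "s \<in> signs V" "?g s \<le> 2 ^ card D * ?B" by blast
  show ?thesis
  proof (rule bexI[OF _ s(1)], intro allI impI)
    fix E assume "E \<subseteq> D" "E \<noteq> {}"
    then have "(\<Sum>v\<in>V. \<Prod>j\<in>E. s (c j v))\<^sup>2 \<le> ?g s"
      using D by (intro member_le_sum) auto
    then show "(\<Sum>v\<in>V. \<Prod>j\<in>E. s (c j v))\<^sup>2 \<le> 2 ^ card D * ?B" using s(2) by linarith
  qed
qed

text \<open>\<open>c v\<close> is the point of the cut set \<open>R\<close> met soonest on the way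
  back from \<open>v\<close>; its existence within \<open>2 * n\<close> steps is the covering
  property of \<open>cut_set\<close>.\<close>

lemma segmentation:
  fixes V :: "'v set"
  assumes p: "p permutes V" and fin: "finite V" and n: "0 < n"
  shows "\<exists>c. (\<forall>v\<in>V. c v \<in> V \<and> (\<exists>k<2 * n. (p ^^ k) (c v) = v)) \<and>
    real (card {v \<in> V. c (p v) \<noteq> c v}) \<le> real (card V) / real n + real (card {v \<in> V. \<exists>k\<in>{0<..<n}. (p ^^ k) v = v})"
proof -
  obtain R where R: "R \<subseteq> V" "real (card R) \<le> real (card V) / real n + real (card {v \<in> V. \<exists>k\<in>{0<..<n}. (p ^^ k) v = v})"
    "\<And>v. v \<in> V \<Longrightarrow> \<exists>k<2 * n. \<exists>r\<in>R. (p ^^ k) r = v"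
    using cut_set[OF p fin n] by blast
  define K where "K v = (LEAST k. \<exists>r\<in>R. (p ^^ k) r = v)" for v
  define c where "c v = (SOME r. r \<in> R \<and> (p ^^ K v) r = v)" for v
  have K: "\<exists>r\<in>R. (p ^^ K v) r = v" "K v < 2 * n" if v: "v \<in> V" for v
  proof -
    obtain k where k: "k < 2 * n" "\<exists>r\<in>R. (p ^^ k) r = v" using R(3)[OF v] by blast
    show "\<exists>r\<in>R. (p ^^ K v) r = v" unfolding K_def by (rule LeastI[of "\<lambda>k. \<exists>r\<in>R. (p ^^ k) r = v", OF k(2)])
    have "K v \<le> k" unfolding K_def by (rule Least_le[of "\<lambda>k. \<exists>r\<in>R. (p ^^ k) r = v", OF k(2)])
    then show "K v < 2 * n" using k(1) by simp
  qed
  have c: "c v \<in> R \<and> (p ^^ K v) (c v) = v" if v: "v \<in> V" for v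
    unfolding c_def by (rule someI_ex) (use K(1)[OF v] in blast)
  \<comment> \<open>The base point can change only on entering \<open>R\<close>, so the number of
    changes is at most \<open>card R\<close>.\<close>
  have step: "c (p v) = c v" if v: "v \<in> V" and nR: "p v \<notin> R" for v
  proof -
    have pv: "p v \<in> V" using v p by (simp add: permutes_in_image)
    have "K (p v) \<noteq> 0"
    proof
      assume "K (p v) = 0"
      then have "c (p v) = p v" using c[OF pv] by simp
      then show False using c[OF pv] nR by simp
    qed
    then obtain k where k: "K (p v) = Suc k" by (cases "K (p v)") auto
    have "p ((p ^^ k) (c (p v))) = p v" using c[OF pv] k by simp
    then have kc: "(p ^^ k) (c (p v)) = v" using permutes_inj[OF p] by (simp add: inj_eq)
    have "K v \<le> k" unfolding K_def by (rule Least_le) (use kc c[OF pv] in blast)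
    moreover have "K (p v) \<le> Suc (K v)" unfolding K_def[of "p v"] by (rule Least_le, rule bexI[of _ "c v"]) (use c[OF v] in simp_all)
    ultimately have "k = K v" using k by simp
    then have "(p ^^ K v) (c (p v)) = (p ^^ K v) (c v)" using kc c[OF v] by simp
    then show ?thesis by (rule permutes_funpow_inj[OF p])
  qed
  have "p ` {v \<in> V. c (p v) \<noteq> c v} \<subseteq> R" using step by blast
  then have "card (p ` {v \<in> V. c (p v) \<noteq> c v}) \<le> card R" by (rule card_mono[OF finite_subset[OF R(1) fin]])
  moreover have "card (p ` {v \<in> V. c (p v) \<noteq> c v}) = card {v \<in> V. c (p v) \<noteq> c v}"
    by (rule card_image) (rule permutes_inj_on[OF p])
  ultimately have "real (card {v \<in> V. c (p v) \<noteq> c v}) \<le> real (card R)" by simp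
  moreover have "\<forall>v\<in>V. c v \<in> V \<and> (\<exists>k<2 * n. (p ^^ k) (c v) = v)" using c K(2) R(1) by blast
  ultimately show ?thesis using R(2) by (intro exI[of _ c] conjI) linarith+
qed

subsection \<open>Neighbourhoods of the coin measure\<close>

text \<open>\<open>f\<close> is replaced by the step function that evaluates it at the pattern on
  \<open>D\<close> completed by zeros. The error is at most \<open>\<epsilon>\<close> at every
  point, hence uniform over all measures \<open>\<nu>\<close>.\<close>

lemma integral_cylinder_approximation:
  assumes J: "countable J" and D: "finite D" "D \<subseteq> J"
    and osc: "\<And>x y. x \<in> zero_one J \<Longrightarrow> y \<in> zero_one J \<Longrightarrow> (\<And>j. j \<in> D \<Longrightarrow> x j = y j) \<Longrightarrow> \<bar>f x - f y\<bar> \<le> \<epsilon>"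
    and f: "continuous_map (coin_top J) euclideanreal f" and e: "0 \<le> \<epsilon>"
    and \<nu>: "prob_space \<nu>" "sets \<nu> = sets (coin J)"
  defines "h \<equiv> \<lambda>q. f (\<lambda>j\<in>J. if j \<in> D then q j else 0)"
  shows "\<bar>integral\<^sup>L \<nu> f - (\<Sum>q\<in>D \<rightarrow>\<^sub>E {0, 1}. h q * measure \<nu> (cyl J D q))\<bar> \<le> \<epsilon>"
proof -
  interpret \<nu>: prob_space \<nu> by (rule \<nu>(1))
  have sp: "space \<nu> = zero_one J" using sets_eq_imp_space_eq[OF \<nu>(2)] by (simp add: space_coin)
  let ?Q = "D \<rightarrow>\<^sub>E {0, 1 :: real}"
  have fQ: "finite ?Q" using D(1) by (intro finite_PiE) auto
  define g where "g x = (\<Sum>q\<in>?Q. h q * indicator (cyl J D q) x)" for x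
  have cs: "cyl J D q \<in> sets \<nu>" for q using sets_cyl[OF D] \<nu>(2) by simp
  have ig: "integrable \<nu> g" unfolding g_def
    by (intro Bochner_Integration.integrable_sum Bochner_Integration.integrable_mult_right integrable_real_indicator cs) (simp add: \<nu>.emeasure_eq_measure)
  have "integral\<^sup>L \<nu> g = (\<Sum>q\<in>?Q. \<integral>x. h q * indicator (cyl J D q) x \<partial>\<nu>)"
    unfolding g_def by (intro Bochner_Integration.integral_sum Bochner_Integration.integrable_mult_right integrable_real_indicator cs) (simp add: \<nu>.emeasure_eq_measure)
  also have "\<dots> = (\<Sum>q\<in>?Q. h q * measure \<nu> (cyl J D q))"
    using sets.sets_into_space[OF cs] by (intro sum.cong refl) (simp add: Int_absorb2)
  finally have Ig: "integral\<^sup>L \<nu> g = (\<Sum>q\<in>?Q. h q * measure \<nu> (cyl J D q))" .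
  have near: "\<bar>f x - g x\<bar> \<le> \<epsilon>" if x: "x \<in> zero_one J" for x
  proof -
    have rQ: "restrict x D \<in> ?Q" using x D(2) by (auto simp: zero_one_def PiE_iff)
    have "g x = (\<Sum>q\<in>?Q. if q = restrict x D then h q else 0)"
      unfolding g_def
    proof (rule sum.cong[OF refl])
      fix q assume q: "q \<in> ?Q"
      have "x \<in> cyl J D q \<longleftrightarrow> q = restrict x D"
      proof
        assume "x \<in> cyl J D q"
        then show "q = restrict x D" using q by (intro ext) (auto simp: cyl_def PiE_iff extensional_def restrict_def)
      qed (use x in \<open>auto simp: cyl_def\<close>)
      then show "h q * indicator (cyl J D q) x = (if q = restrict x D then h q else 0)"
        unfolding indicator_def by (simp split del: if_split)
    qed
    also have "\<dots> = h (restrict x D)" using fQ rQ by simp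
    finally have "g x = f (\<lambda>j\<in>J. if j \<in> D then restrict x D j else 0)" by (simp only: h_def)
    moreover have "\<bar>f x - f (\<lambda>j\<in>J. if j \<in> D then restrict x D j else 0)\<bar> \<le> \<epsilon>"
    proof (rule osc[OF x])
      show "(\<lambda>j\<in>J. if j \<in> D then restrict x D j else 0) \<in> zero_one J" using x by (auto simp: zero_one_def PiE_iff)
    qed (use D(2) in auto)
    ultimately show ?thesis by simp
  qed
  have mf: "f \<in> borel_measurable \<nu>"
  proof (rule borel_measurableI)
    fix S :: "real set" assume "open S"
    then have "openin (coin_top J) {x \<in> topspace (coin_top J). f x \<in> S}"
      by (intro openin_continuous_map_preimage[OF f]) (simp add: open_openin[symmetric])
    then have "{x \<in> zero_one J. f x \<in> S} \<in> sets (borel_of (coin_top J))" unfolding borel_of_def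
      by (subst sets_measure_of) (auto dest!: openin_subset)
    moreover have "f -` S \<inter> space \<nu> = {x \<in> zero_one J. f x \<in> S}" using sp by auto
    ultimately show "f -` S \<inter> space \<nu> \<in> sets \<nu>" using sets_borel_of_coin_top[OF J] \<nu>(2) by simp
  qed
  have idf: "integrable \<nu> (\<lambda>x. f x - g x)"
  proof (rule \<nu>.integrable_const_bound[where B=\<epsilon>])
    show "AE x in \<nu>. norm (f x - g x) \<le> \<epsilon>" by (rule AE_I2) (use near sp in simp)
    show "(\<lambda>x. f x - g x) \<in> borel_measurable \<nu>" using mf borel_measurable_integrable[OF ig] by (rule borel_measurable_diff)
  qed
  have "integrable \<nu> (\<lambda>x. (f x - g x) + g x)" by (rule Bochner_Integration.integrable_add[OF idf ig])
  then have intf: "integrable \<nu> f" by simp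
  have "\<bar>integral\<^sup>L \<nu> f - integral\<^sup>L \<nu> g\<bar> = \<bar>\<integral>x. f x - g x \<partial>\<nu>\<bar>"
    by (simp add: Bochner_Integration.integral_diff[OF intf ig])
  also have "\<dots> \<le> (\<integral>x. \<bar>f x - g x\<bar> \<partial>\<nu>)" by (rule integral_abs_bound)
  also have "\<dots> \<le> (\<integral>x. \<epsilon> \<partial>\<nu>)"
    by (rule integral_mono) (use idf near sp in \<open>auto intro: integrable_abs\<close>)
  also have "\<dots> = \<epsilon>" by (simp add: \<nu>.prob_space)
  finally show ?thesis unfolding Ig .
qed

text \<open>All subsets \<open>E\<close> of the window are included so that the condition passes to
  smaller windows, as is required for finite intersections of neighbourhoods.\<close>

definition near_coin :: "'j set \<Rightarrow> 'j set \<Rightarrow> real \<Rightarrow> ('j \<Rightarrow> real) measure \<Rightarrow> bool" where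
  "near_coin J D \<theta> \<nu> \<longleftrightarrow> \<nu> \<in> prob_measures (coin_top J) \<and>
    (\<forall>E q. E \<subseteq> D \<longrightarrow> q \<in> E \<rightarrow>\<^sub>E {0, 1} \<longrightarrow> \<bar>measure \<nu> (cyl J E q) - (1 / 2) ^ card E\<bar> \<le> \<theta>)"

lemma near_coin_mono:
  assumes "near_coin J D \<theta> \<nu>" "D' \<subseteq> D" "\<theta> \<le> \<theta>'"
  shows "near_coin J D' \<theta>' \<nu>"
  unfolding near_coin_def
proof (intro conjI allI impI)
  show "\<nu> \<in> prob_measures (coin_top J)" using assms(1) by (simp add: near_coin_def)
  fix E q assume "E \<subseteq> D'" "q \<in> E \<rightarrow>\<^sub>E {0, 1 :: real}"
  then have "\<bar>measure \<nu> (cyl J E q) - (1 / 2) ^ card E\<bar> \<le> \<theta>"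
    using assms(1,2) unfolding near_coin_def by (meson subset_trans)
  then show "\<bar>measure \<nu> (cyl J E q) - (1 / 2) ^ card E\<bar> \<le> \<theta>'" using assms(3) by linarith
qed

text \<open>Induction over the generation of the topology. Intersections unite the windows and take
  the smaller bound; for a subbasic set the integral is approximated by a combination of cylinder
  probabilities.\<close>

lemma weak_star_neighbourhood:
  assumes J: "countable J" and U: "openin (weak_star (coin_top J)) U" "coin J \<in> U"
  shows "\<exists>D \<theta>. finite D \<and> D \<subseteq> J \<and> 0 < \<theta> \<and> (\<forall>\<nu>. near_coin J D \<theta> \<nu> \<longrightarrow> \<nu> \<in> U)"
proof -
  have "generate_topology_on {{\<nu> \<in> prob_measures (coin_top J). integral\<^sup>L \<nu> f \<in> U} |f U. continuous_map (coin_top J) euclideanreal f \<and> open U} U"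
    using U(1) unfolding weak_star_def openin_topology_generated_by_iff .
  then show ?thesis using U(2)
  proof (induction rule: generate_topology_on.induct)
    case Empty
    then show ?case by simp
  next
    case (Int a b)
    have ab: "coin J \<in> a" "coin J \<in> b" using Int.prems by simp_all
    obtain D \<theta> where D: "finite D" "D \<subseteq> J" "0 < \<theta>" "\<forall>\<nu>. near_coin J D \<theta> \<nu> \<longrightarrow> \<nu> \<in> a"
      using Int.IH(1)[OF ab(1)] by (elim exE conjE)
    obtain D' \<theta>' where D': "finite D'" "D' \<subseteq> J" "0 < \<theta>'" "\<forall>\<nu>. near_coin J D' \<theta>' \<nu> \<longrightarrow> \<nu> \<in> b"
      using Int.IH(2)[OF ab(2)] by (elim exE conjE)
    show ?case
    proof (intro exI[of _ "D \<union> D'"] exI[of _ "min \<theta> \<theta>'"] conjI allI impI IntI)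
      fix \<nu> assume \<nu>: "near_coin J (D \<union> D') (min \<theta> \<theta>') \<nu>"
      show "\<nu> \<in> a" using near_coin_mono[OF \<nu>, of D \<theta>] D(4) by simp
      show "\<nu> \<in> b" using near_coin_mono[OF \<nu>, of D' \<theta>'] D'(4) by simp
    qed (use D D' in auto)
  next
    case (UN K)
    obtain k where k: "k \<in> K" "coin J \<in> k" using UN.prems by (elim UnionE)
    obtain D \<theta> where D: "finite D" "D \<subseteq> J" "0 < \<theta>" "\<forall>\<nu>. near_coin J D \<theta> \<nu> \<longrightarrow> \<nu> \<in> k"
      using UN.IH[OF k] by (elim exE conjE)
    have "\<forall>\<nu>. near_coin J D \<theta> \<nu> \<longrightarrow> \<nu> \<in> \<Union>K" using D(4) k(1) by (intro allI impI UnionI[OF k(1)]) simp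
    then show ?case by (intro exI[of _ D] exI[of _ \<theta>] conjI D(1-3))
  next
    case (Basis s)
    obtain f W where s: "s = {\<nu> \<in> prob_measures (coin_top J). integral\<^sup>L \<nu> f \<in> W}"
      and f: "continuous_map (coin_top J) euclideanreal f" and W: "open W"
      using Basis.hyps unfolding mem_Collect_eq by (elim exE conjE)
    have "integral\<^sup>L (coin J) f \<in> W" using Basis.prems s by simp
    then obtain \<epsilon> where e: "0 < \<epsilon>" "\<And>y. dist y (integral\<^sup>L (coin J) f) < \<epsilon> \<Longrightarrow> y \<in> W"
      using W unfolding open_dist by blast
    obtain D where D: "finite D" "D \<subseteq> J" "\<forall>x\<in>zero_one J. \<forall>y\<in>zero_one J. (\<forall>j\<in>D. x j = y j) \<longrightarrow> \<bar>f x - f y\<bar> < \<epsilon> / 4"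
      using uniformly_continuous_coin_top[OF f, of "\<epsilon> / 4"] e(1) by auto
    define h where "h q = f (\<lambda>j\<in>J. if j \<in> D then q j else 0)" for q
    let ?Q = "D \<rightarrow>\<^sub>E {0, 1 :: real}"
    define M where "M = (\<Sum>q\<in>?Q. \<bar>h q\<bar>)"
    have M0: "0 \<le> M" unfolding M_def by (rule sum_nonneg) simp
    \<comment> \<open>Three errors of at most \<open>\<epsilon> / 4\<close> arise: one step function
      approximation for each of the two measures, and \<open>\<theta> * M\<close> for the difference
      of their cylinder probabilities.\<close>
    define \<theta> where "\<theta> = \<epsilon> / (4 * (M + 1))"
    have \<theta>: "0 < \<theta>" "\<theta> * M \<le> \<epsilon> / 4"
    proof -
      show t: "0 < \<theta>" unfolding \<theta>_def using e(1) M0 by simp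
      have "\<theta> * (M + 1) = \<epsilon> / 4" unfolding \<theta>_def using M0 by (simp add: field_simps)
      moreover have "\<theta> * M \<le> \<theta> * (M + 1)" using t by (intro mult_left_mono) auto
      ultimately show "\<theta> * M \<le> \<epsilon> / 4" by simp
    qed
    have app: "\<bar>integral\<^sup>L \<nu> f - (\<Sum>q\<in>?Q. h q * measure \<nu> (cyl J D q))\<bar> \<le> \<epsilon> / 4"
      if "prob_space \<nu>" "sets \<nu> = sets (coin J)" for \<nu>
      unfolding h_def by (rule integral_cylinder_approximation[OF J D(1,2) _ f _ that])
        (use D(3) e(1) in \<open>auto intro: less_imp_le\<close>)
    show ?case
    proof (intro exI[of _ D] exI[of _ \<theta>] conjI allI impI D(1,2) \<theta>(1))
      fix \<nu> assume nc: "near_coin J D \<theta> \<nu>"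
      then have \<nu>: "\<nu> \<in> prob_measures (coin_top J)"
        and near: "\<And>q. q \<in> ?Q \<Longrightarrow> \<bar>measure \<nu> (cyl J D q) - (1 / 2) ^ card D\<bar> \<le> \<theta>"
        by (simp_all add: near_coin_def)
      have \<nu>': "prob_space \<nu>" "sets \<nu> = sets (coin J)"
        using \<nu> sets_borel_of_coin_top[OF J] by (auto simp: prob_measures_def)
      have "\<bar>(\<Sum>q\<in>?Q. h q * measure \<nu> (cyl J D q)) - (\<Sum>q\<in>?Q. h q * measure (coin J) (cyl J D q))\<bar>
        = \<bar>\<Sum>q\<in>?Q. h q * (measure \<nu> (cyl J D q) - measure (coin J) (cyl J D q))\<bar>"
        by (simp only: sum_subtractf[symmetric] right_diff_distrib)
      also have "\<dots> \<le> (\<Sum>q\<in>?Q. \<bar>h q * (measure \<nu> (cyl J D q) - measure (coin J) (cyl J D q))\<bar>)" by (rule sum_abs)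
      also have "\<dots> \<le> (\<Sum>q\<in>?Q. \<bar>h q\<bar> * \<theta>)"
      proof (rule sum_mono)
        fix q assume q: "q \<in> ?Q"
        have "measure (coin J) (cyl J D q) = (1 / 2) ^ card D"
          by (rule measure_cyl[OF D(1,2)]) (use q in auto)
        then have "\<bar>measure \<nu> (cyl J D q) - measure (coin J) (cyl J D q)\<bar> \<le> \<theta>" using near[OF q] by simp
        then show "\<bar>h q * (measure \<nu> (cyl J D q) - measure (coin J) (cyl J D q))\<bar> \<le> \<bar>h q\<bar> * \<theta>"
          unfolding abs_mult by (rule mult_left_mono) simp
      qed
      also have "\<dots> = \<theta> * M" unfolding M_def by (simp add: sum_distrib_right[symmetric])
      finally have "\<bar>integral\<^sup>L \<nu> f - integral\<^sup>L (coin J) f\<bar> < \<epsilon>"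
        using app[OF \<nu>'] app[OF prob_coin refl] \<theta>(2) e(1) by linarith
      then have "integral\<^sup>L \<nu> f \<in> W" by (intro e(2)) (simp add: dist_real_def)
      then show "\<nu> \<in> s" using \<nu> s by simp
    qed
  qed
qed

subsection \<open>Existence of models\<close>

context sofic
begin

text \<open>One segmentation is chosen for each \<open>n\<close> and \<open>i\<close>, so that all
  later statements speak of the same segments.\<close>

definition seg :: "nat \<Rightarrow> nat \<Rightarrow> nat \<Rightarrow> nat" where
  "seg n i = (SOME c. (\<forall>v\<in>V i. c v \<in> V i \<and> (\<exists>k<2 * n. (pb i ^^ k) (c v) = v)) \<and>
    real (card {v \<in> V i. c (pb i v) \<noteq> c v}) \<le> real (card (V i)) / real n + real (card {v \<in> V i. \<exists>k\<in>{0<..<n}. (pb i ^^ k) v = v}))"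

lemma seg_props:
  assumes n: "0 < n"
  shows "v \<in> V i \<Longrightarrow> seg n i v \<in> V i" "v \<in> V i \<Longrightarrow> \<exists>k<2 * n. (pb i ^^ k) (seg n i v) = v"
    "real (card {v \<in> V i. seg n i (pb i v) \<noteq> seg n i v}) \<le> real (card (V i)) / real n + real (card {v \<in> V i. \<exists>k\<in>{0<..<n}. (pb i ^^ k) v = v})"
  using someI_ex[OF segmentation[OF permutes[OF gB_carrier] finite_V n], folded seg_def, of i] by blast+

text \<open>The vertices reached by \<open>g\<close> and by \<open>h\<close> mostly lie in the same
  segment. The order of the quantifiers matters: the share of segment ends is controlled by the
  length \<open>n\<close>, which is fixed before \<open>i\<close> tends to infinity.\<close>

definition close :: "(ab \<times> bool) list \<Rightarrow> (ab \<times> bool) list \<Rightarrow> bool" where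
  "close g h \<longleftrightarrow> (\<forall>\<epsilon>>0. \<exists>N. \<forall>n>N. eventually (\<lambda>i. dens i (\<lambda>v. seg n i (\<sigma> i g v) \<noteq> seg n i (\<sigma> i h v)) \<le> \<epsilon>) sequentially)"

lemma close_refl: "close g g"
  by (simp add: close_def dens_def)

lemma close_sym: "close g h \<Longrightarrow> close h g"
  unfolding close_def by (simp add: eq_commute)

lemma close_trans:
  assumes "close g h" "close h k"
  shows "close g k"
  unfolding close_def
proof (intro allI impI)
  fix \<epsilon> :: real assume "0 < \<epsilon>"
  then have e: "0 < \<epsilon> / 2" by simp
  obtain N where N: "\<forall>n>N. eventually (\<lambda>i. dens i (\<lambda>v. seg n i (\<sigma> i g v) \<noteq> seg n i (\<sigma> i h v)) \<le> \<epsilon> / 2) sequentially"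
    using assms(1) e unfolding close_def by blast
  obtain M where M: "\<forall>n>M. eventually (\<lambda>i. dens i (\<lambda>v. seg n i (\<sigma> i h v) \<noteq> seg n i (\<sigma> i k v)) \<le> \<epsilon> / 2) sequentially"
    using assms(2) e unfolding close_def by blast
  show "\<exists>N. \<forall>n>N. eventually (\<lambda>i. dens i (\<lambda>v. seg n i (\<sigma> i g v) \<noteq> seg n i (\<sigma> i k v)) \<le> \<epsilon>) sequentially"
  proof (intro exI[of _ "max N M"] allI impI)
    fix n assume "max N M < n"
    then have "N < n" "M < n" by simp_all
    from N[rule_format, OF this(1)] M[rule_format, OF this(2)]
    show "eventually (\<lambda>i. dens i (\<lambda>v. seg n i (\<sigma> i g v) \<noteq> seg n i (\<sigma> i k v)) \<le> \<epsilon>) sequentially"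
    proof eventually_elim
      case (elim i)
      have "dens i (\<lambda>v. seg n i (\<sigma> i g v) \<noteq> seg n i (\<sigma> i k v))
        \<le> dens i (\<lambda>v. seg n i (\<sigma> i g v) \<noteq> seg n i (\<sigma> i h v) \<or> seg n i (\<sigma> i h v) \<noteq> seg n i (\<sigma> i k v))"
        by (rule dens_mono) simp
      also note dens_disj
      finally show ?case using elim by linarith
    qed
  qed
qed

text \<open>Right multiplication by \<open>k\<close> amounts, up to rare events, to starting from
  the image of \<open>v\<close> under the permutation of \<open>k\<close>, which preserves
  densities.\<close>

lemma close_right:
  assumes gh: "close g h" and c: "g \<in> carrier F2" "h \<in> carrier F2" "k \<in> carrier F2"
  shows "close (g \<otimes>\<^bsub>F2\<^esub> k) (h \<otimes>\<^bsub>F2\<^esub> k)"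
  unfolding close_def
proof (intro allI impI)
  fix \<epsilon> :: real assume "0 < \<epsilon>"
  then have e: "0 < \<epsilon> / 2" "0 < \<epsilon> / 4" by simp_all
  obtain N where N: "\<forall>n>N. eventually (\<lambda>i. dens i (\<lambda>v. seg n i (\<sigma> i g v) \<noteq> seg n i (\<sigma> i h v)) \<le> \<epsilon> / 2) sequentially"
    using gh e unfolding close_def by blast
  show "\<exists>N. \<forall>n>N. eventually (\<lambda>i. dens i (\<lambda>v. seg n i (\<sigma> i (g \<otimes>\<^bsub>F2\<^esub> k) v) \<noteq> seg n i (\<sigma> i (h \<otimes>\<^bsub>F2\<^esub> k) v)) \<le> \<epsilon>) sequentially"
  proof (intro exI[of _ N] allI impI)
    fix n assume n: "N < n"
    from N[rule_format, OF n] rareD[OF rare_mult[OF c(1,3)] e(2)] rareD[OF rare_mult[OF c(2,3)] e(2)]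
    show "eventually (\<lambda>i. dens i (\<lambda>v. seg n i (\<sigma> i (g \<otimes>\<^bsub>F2\<^esub> k) v) \<noteq> seg n i (\<sigma> i (h \<otimes>\<^bsub>F2\<^esub> k) v)) \<le> \<epsilon>) sequentially"
    proof eventually_elim
      case (elim i)
      let ?P = "\<lambda>v. seg n i (\<sigma> i g v) \<noteq> seg n i (\<sigma> i h v)"
      let ?G = "\<lambda>v. \<sigma> i g (\<sigma> i k v) \<noteq> \<sigma> i (g \<otimes>\<^bsub>F2\<^esub> k) v"
      let ?H = "\<lambda>v. \<sigma> i h (\<sigma> i k v) \<noteq> \<sigma> i (h \<otimes>\<^bsub>F2\<^esub> k) v"
      have "dens i (\<lambda>v. seg n i (\<sigma> i (g \<otimes>\<^bsub>F2\<^esub> k) v) \<noteq> seg n i (\<sigma> i (h \<otimes>\<^bsub>F2\<^esub> k) v))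
        \<le> dens i (\<lambda>v. ?P (\<sigma> i k v) \<or> (?G v \<or> ?H v))"
        by (rule dens_mono) metis
      also have "\<dots> \<le> dens i (\<lambda>v. ?P (\<sigma> i k v)) + dens i (\<lambda>v. ?G v \<or> ?H v)" by (rule dens_disj)
      also have "dens i (\<lambda>v. ?P (\<sigma> i k v)) = dens i ?P" by (rule dens_perm[OF c(3)])
      finally show ?case using elim dens_disj[of i ?G ?H] by linarith
    qed
  qed
qed

text \<open>A step along \<open>b\<close> changes the segment only at a segment end.\<close>

lemma close_gB: "close [gB] []"
  unfolding close_def
proof (intro allI impI)
  fix \<epsilon> :: real assume e: "0 < \<epsilon>"
  \<comment> \<open>For \<open>n\<close> beyond this bound the term \<open>1 / n\<close> is at most
    \<open>\<epsilon> / 2\<close>; the short cycles and the permutation of the identity take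
    \<open>\<epsilon> / 4\<close> each.\<close>
  define N where "N = nat \<lceil>2 / \<epsilon>\<rceil>"
  show "\<exists>N. \<forall>n>N. eventually (\<lambda>i. dens i (\<lambda>v. seg n i (pb i v) \<noteq> seg n i (\<sigma> i [] v)) \<le> \<epsilon>) sequentially"
  proof (intro exI[of _ N] allI impI)
    fix n assume n: "N < n"
    have "2 / \<epsilon> \<le> real N" unfolding N_def by (rule real_nat_ceiling_ge)
    then have "2 / \<epsilon> \<le> real n" using n by linarith
    moreover have "0 < real n" using n by simp
    ultimately have n2: "1 / real n \<le> \<epsilon> / 2" using e by (simp add: field_simps)
    have e4: "0 < \<epsilon> / 4" using e by simp
    from rareD[OF rare_short[of n] e4] rareD[OF rare_one e4] card_V_large[of 0]
    show "eventually (\<lambda>i. dens i (\<lambda>v. seg n i (pb i v) \<noteq> seg n i (\<sigma> i [] v)) \<le> \<epsilon>) sequentially"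
    proof eventually_elim
      case (elim i)
      have N: "0 < real (card (V i))" using elim(3) by (simp only: of_nat_0_less_iff)
      have n0: "0 < n" using n by simp
      have "dens i (\<lambda>v. seg n i (pb i v) \<noteq> seg n i v)
        \<le> (real (card (V i)) / real n + real (card {v \<in> V i. \<exists>k\<in>{0<..<n}. (pb i ^^ k) v = v})) / real (card (V i))"
        unfolding dens_def by (rule divide_right_mono[OF seg_props(3)[OF n0]]) simp
      also have "\<dots> = 1 / real n + dens i (\<lambda>v. \<exists>k\<in>{0<..<n}. (pb i ^^ k) v = v)"
        unfolding dens_def add_divide_distrib using N by (simp only: divide_divide_eq_left mult.commute) (auto simp: field_simps)
      finally have "dens i (\<lambda>v. seg n i (pb i v) \<noteq> seg n i v) \<le> \<epsilon> / 2 + \<epsilon> / 4" using elim(1) n2 by linarith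
      moreover have "dens i (\<lambda>v. seg n i (pb i v) \<noteq> seg n i (\<sigma> i [] v)) \<le> dens i (\<lambda>v. seg n i (pb i v) \<noteq> seg n i v \<or> \<sigma> i [] v \<noteq> v)"
        by (rule dens_mono) metis
      ultimately show ?case using elim(2) dens_disj[of i "\<lambda>v. seg n i (pb i v) \<noteq> seg n i v" "\<lambda>v. \<sigma> i [] v \<noteq> v"] by linarith
    qed
  qed
qed

lemma letter_carrier: "[l] \<in> carrier F2"
  by (cases "fst l") (auto simp: F2_carrier)

text \<open>\<open>act\<close> differs from multiplication only where a letter of
  \<open>gen_b\<close> is absorbed by the trivial coset; there closeness of \<open>b\<close> to the
  identity is used.\<close>

lemma close_act:
  assumes k: "k \<in> cosets"
  shows "close (inv\<^bsub>F2\<^esub> (act l k)) (inv\<^bsub>F2\<^esub> ([l] \<otimes>\<^bsub>F2\<^esub> k))"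
proof (cases "k = [] \<and> fst l = gen_b")
  case True
  have c: "close [] [(gen_b, False)]"
  proof -
    have "close ([gB] \<otimes>\<^bsub>F2\<^esub> [(gen_b, False)]) ([] \<otimes>\<^bsub>F2\<^esub> [(gen_b, False)])"
      by (rule close_right[OF close_gB]) (simp_all add: F2_carrier)
    then show ?thesis by (simp add: F2_mult inv_letter_def)
  qed
  have "close [] [inv_letter l]"
    using True c close_sym[OF close_gB] by (cases l; cases "snd l") (auto simp: inv_letter_def)
  then show ?thesis using True by (simp add: act_def F2_mult F2_inv_letter)
next
  case False
  then have "act l k = [l] \<otimes>\<^bsub>F2\<^esub> k" by (auto simp: act_def F2_mult)
  then show ?thesis by (simp add: close_refl)
qed

text \<open>Induction over the letters of \<open>g\<close>. Models are read at inverses, which turns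
  left multiplication of cosets into the right multiplication handled by
  \<open>close_right\<close>.\<close>

lemma close_cact:
  assumes w: "w \<in> cosets"
  shows "g \<in> carrier F2 \<Longrightarrow> close (inv\<^bsub>F2\<^esub> (cact g w)) (inv\<^bsub>F2\<^esub> (g \<otimes>\<^bsub>F2\<^esub> w))"
proof (induction g)
  case Nil
  then show ?case by (simp add: F2_mult close_refl)
next
  case (Cons l g)
  have g: "g \<in> carrier F2" using Cons.prems by (auto simp: F2_carrier dest: reduced_tl)
  have k: "cact g w \<in> cosets" by (rule cact_cosets[OF w])
  have gw: "g \<otimes>\<^bsub>F2\<^esub> w \<in> carrier F2" by (rule carrier_mult[OF g cosets_carrier[OF w]])
  have lgw: "(l # g) \<otimes>\<^bsub>F2\<^esub> w = [l] \<otimes>\<^bsub>F2\<^esub> (g \<otimes>\<^bsub>F2\<^esub> w)" by (simp add: F2_mult)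
  have "close (inv\<^bsub>F2\<^esub> (act l (cact g w))) (inv\<^bsub>F2\<^esub> ([l] \<otimes>\<^bsub>F2\<^esub> cact g w))" by (rule close_act[OF k])
  moreover have "close (inv\<^bsub>F2\<^esub> ([l] \<otimes>\<^bsub>F2\<^esub> cact g w)) (inv\<^bsub>F2\<^esub> ([l] \<otimes>\<^bsub>F2\<^esub> (g \<otimes>\<^bsub>F2\<^esub> w)))"
    unfolding F2_inv_mult[OF letter_carrier cosets_carrier[OF k]] F2_inv_mult[OF letter_carrier gw]
    by (rule close_right[OF Cons.IH[OF g] F2_inv[OF cosets_carrier[OF k]] F2_inv[OF gw] F2_inv[OF letter_carrier]])
  ultimately show ?case unfolding lgw by (simp only: cact_simps) (rule close_trans)
qed

text \<open>The model to be built reads its coordinate \<open>j\<close> at \<open>v\<close> from the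
  segment of \<open>\<sigma> i (inv j) v\<close>. The two vertices compared here are those read by
  the coordinate \<open>j\<close> of the shift by \<open>f\<close> of the value at \<open>v\<close>,
  and of the value at \<open>\<sigma> i f v\<close>.\<close>

lemma model_equivariant:
  assumes f: "f \<in> carrier F2" and j: "j \<in> cosets" and e: "0 < \<epsilon>"
  shows "\<exists>N. \<forall>n>N. eventually (\<lambda>i. dens i (\<lambda>v. seg n i (\<sigma> i (inv\<^bsub>F2\<^esub> (cact (inv\<^bsub>F2\<^esub> f) j)) v)
    \<noteq> seg n i (\<sigma> i (inv\<^bsub>F2\<^esub> j) (\<sigma> i f v))) \<le> \<epsilon>) sequentially"
proof -
  have j': "inv\<^bsub>F2\<^esub> j \<in> carrier F2" by (rule F2_inv[OF cosets_carrier[OF j]])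
  let ?g = "inv\<^bsub>F2\<^esub> (cact (inv\<^bsub>F2\<^esub> f) j)"
  have "close ?g (inv\<^bsub>F2\<^esub> (inv\<^bsub>F2\<^esub> f \<otimes>\<^bsub>F2\<^esub> j))" by (rule close_cact[OF j F2_inv[OF f]])
  then have c: "close ?g (inv\<^bsub>F2\<^esub> j \<otimes>\<^bsub>F2\<^esub> f)"
    by (simp add: F2_inv_mult[OF F2_inv[OF f] cosets_carrier[OF j]] f)
  have e2: "0 < \<epsilon> / 2" using e by simp
  obtain N where N: "\<forall>n>N. eventually (\<lambda>i. dens i (\<lambda>v. seg n i (\<sigma> i ?g v) \<noteq> seg n i (\<sigma> i (inv\<^bsub>F2\<^esub> j \<otimes>\<^bsub>F2\<^esub> f) v)) \<le> \<epsilon> / 2) sequentially"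
    using c e2 unfolding close_def by blast
  show ?thesis
  proof (intro exI[of _ N] allI impI)
    fix n assume n: "N < n"
    from N[rule_format, OF n] rareD[OF rare_mult[OF j' f] e2]
    show "eventually (\<lambda>i. dens i (\<lambda>v. seg n i (\<sigma> i ?g v) \<noteq> seg n i (\<sigma> i (inv\<^bsub>F2\<^esub> j) (\<sigma> i f v))) \<le> \<epsilon>) sequentially"
    proof eventually_elim
      case (elim i)
      let ?P = "\<lambda>v. seg n i (\<sigma> i ?g v) \<noteq> seg n i (\<sigma> i (inv\<^bsub>F2\<^esub> j \<otimes>\<^bsub>F2\<^esub> f) v)"
      let ?G = "\<lambda>v. \<sigma> i (inv\<^bsub>F2\<^esub> j) (\<sigma> i f v) \<noteq> \<sigma> i (inv\<^bsub>F2\<^esub> j \<otimes>\<^bsub>F2\<^esub> f) v"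
      have "dens i (\<lambda>v. seg n i (\<sigma> i ?g v) \<noteq> seg n i (\<sigma> i (inv\<^bsub>F2\<^esub> j) (\<sigma> i f v))) \<le> dens i (\<lambda>v. ?P v \<or> ?G v)"
        by (rule dens_mono) metis
      then show ?case using elim dens_disj[of i ?P ?G] by linarith
    qed
  qed
qed

text \<open>Two vertices of one segment are fewer than \<open>2 * n\<close> steps of
  \<open>b\<close> apart. If a power of \<open>b\<close> carried the inverse of \<open>j\<close> to
  the inverse of \<open>j'\<close>, the two would represent the same coset; hence such coincidences
  are rare.\<close>

lemma rare_same_segment:
  assumes n: "0 < n" and j: "j \<in> cosets" "j' \<in> cosets" "j \<noteq> j'"
  shows "rare (\<lambda>i v. seg n i (\<sigma> i (inv\<^bsub>F2\<^esub> j) v) = seg n i (\<sigma> i (inv\<^bsub>F2\<^esub> j') v))"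
proof -
  have meet: "rare (\<lambda>i v. (pb i ^^ m) (\<sigma> i (inv\<^bsub>F2\<^esub> k) v) = \<sigma> i (inv\<^bsub>F2\<^esub> k') v)"
    if k: "k \<in> cosets" "k' \<in> cosets" "k \<noteq> k'" for m k k'
  proof -
    have c: "k \<in> carrier F2" "k' \<in> carrier F2" using k cosets_carrier by auto
    have ne: "replicate m gB \<otimes>\<^bsub>F2\<^esub> inv\<^bsub>F2\<^esub> k \<noteq> inv\<^bsub>F2\<^esub> k'"
    proof
      assume eq: "replicate m gB \<otimes>\<^bsub>F2\<^esub> inv\<^bsub>F2\<^esub> k = inv\<^bsub>F2\<^esub> k'"
      have k0: "cact (inv\<^bsub>F2\<^esub> k) k = []" using cact_inv(2)[OF c(1) Nil_cosets] cact_Nil_eq[OF k(1)] by simp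
      have k0': "cact (inv\<^bsub>F2\<^esub> k') k' = []" using cact_inv(2)[OF c(2) Nil_cosets] cact_Nil_eq[OF k(2)] by simp
      have "cact (inv\<^bsub>F2\<^esub> k') k = cact (replicate m gB) (cact (inv\<^bsub>F2\<^esub> k) k)"
        using cact_mult[OF k(1), of "replicate m gB" "inv\<^bsub>F2\<^esub> k"] eq by simp
      then have "cact (inv\<^bsub>F2\<^esub> k') k = cact (inv\<^bsub>F2\<^esub> k') k'" using k0 k0' by (simp add: cact_gB_root)
      then show False using inj_onD[OF inj_cact[OF F2_inv[OF c(2)]] _ k(1,2)] k(3) by blast
    qed
    have "rare (\<lambda>i v. (pb i ^^ m) (\<sigma> i (inv\<^bsub>F2\<^esub> k) v) \<noteq> \<sigma> i (replicate m gB \<otimes>\<^bsub>F2\<^esub> inv\<^bsub>F2\<^esub> k) v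
      \<or> \<sigma> i (replicate m gB \<otimes>\<^bsub>F2\<^esub> inv\<^bsub>F2\<^esub> k) v = \<sigma> i (inv\<^bsub>F2\<^esub> k') v)"
      by (intro rare_disj rare_pow rare_eq ne carrier_mult replicate_carrier F2_inv c)
    then show ?thesis by (rule rare_mono) metis
  qed
  have "rare (\<lambda>i v. \<exists>m\<in>{..<2 * n}. (pb i ^^ m) (\<sigma> i (inv\<^bsub>F2\<^esub> j) v) = \<sigma> i (inv\<^bsub>F2\<^esub> j') v
    \<or> (pb i ^^ m) (\<sigma> i (inv\<^bsub>F2\<^esub> j') v) = \<sigma> i (inv\<^bsub>F2\<^esub> j) v)"
    by (intro rare_Bex rare_disj meet j j(3)[symmetric]) simp
  then show ?thesis
  proof (rule rare_mono)
    fix i v assume v: "v \<in> V i" and eq: "seg n i (\<sigma> i (inv\<^bsub>F2\<^esub> j) v) = seg n i (\<sigma> i (inv\<^bsub>F2\<^esub> j') v)"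
    let ?u = "\<sigma> i (inv\<^bsub>F2\<^esub> j) v" and ?u' = "\<sigma> i (inv\<^bsub>F2\<^esub> j') v"
    have u: "?u \<in> V i" "?u' \<in> V i" by (rule \<sigma>_in[OF F2_inv[OF cosets_carrier] v], rule j)+
    obtain k where k: "k < 2 * n" "(pb i ^^ k) (seg n i ?u) = ?u" using seg_props(2)[OF n u(1)] by blast
    obtain k' where k': "k' < 2 * n" "(pb i ^^ k') (seg n i ?u) = ?u'" using seg_props(2)[OF n u(2)] eq by auto
    show "\<exists>m\<in>{..<2 * n}. (pb i ^^ m) ?u = ?u' \<or> (pb i ^^ m) ?u' = ?u"
    proof (cases "k \<le> k'")
      case True
      have "(pb i ^^ (k' - k)) ?u = (pb i ^^ (k' - k)) ((pb i ^^ k) (seg n i ?u))" using k(2) by simp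
      also have "\<dots> = (pb i ^^ k') (seg n i ?u)" using True funpow_add[of "k' - k" k "pb i"] by (simp add: fun_eq_iff)
      finally have "(pb i ^^ (k' - k)) ?u = ?u'" using k'(2) by simp
      moreover have "k' - k \<in> {..<2 * n}" using k'(1) by simp
      ultimately show ?thesis by blast
    next
      case False
      have "(pb i ^^ (k - k')) ?u' = (pb i ^^ (k - k')) ((pb i ^^ k') (seg n i ?u))" using k'(2) by simp
      also have "\<dots> = (pb i ^^ k) (seg n i ?u)" using False funpow_add[of "k - k'" k' "pb i"] by (simp add: fun_eq_iff)
      finally have "(pb i ^^ (k - k')) ?u' = ?u" using k(2) by simp
      moreover have "k - k' \<in> {..<2 * n}" using k(1) by simp
      ultimately show ?thesis by blast
    qed
  qed
qed

lemma rare_not_inj: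
  assumes n: "0 < n" and D: "finite D" "D \<subseteq> cosets"
  shows "rare (\<lambda>i v. \<not> inj_on (\<lambda>j. seg n i (\<sigma> i (inv\<^bsub>F2\<^esub> j) v)) D)"
proof (rule rare_mono)
  let ?Z = "{z \<in> D \<times> D. fst z \<noteq> snd z}"
  show "rare (\<lambda>i v. \<exists>z\<in>?Z. seg n i (\<sigma> i (inv\<^bsub>F2\<^esub> (fst z)) v) = seg n i (\<sigma> i (inv\<^bsub>F2\<^esub> (snd z)) v))"
    by (rule rare_Bex, use D in simp, rule rare_same_segment[OF n]) (use D in auto)
  show "\<exists>z\<in>?Z. seg n i (\<sigma> i (inv\<^bsub>F2\<^esub> (fst z)) v) = seg n i (\<sigma> i (inv\<^bsub>F2\<^esub> (snd z)) v)"
    if "\<not> inj_on (\<lambda>j. seg n i (\<sigma> i (inv\<^bsub>F2\<^esub> j) v)) D" for i v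
    using that unfolding inj_on_def by fastforce
qed

text \<open>All vertices with base point \<open>r\<close> are reached from \<open>r\<close> in fewer
  than \<open>2 * n\<close> steps, and the permutation of \<open>g\<close> is injective.\<close>

lemma card_label_fiber:
  assumes n: "0 < n" and g: "g \<in> carrier F2"
  shows "card {v \<in> V i. seg n i (\<sigma> i g v) = r} \<le> 2 * n"
proof -
  have "\<sigma> i g ` {v \<in> V i. seg n i (\<sigma> i g v) = r} \<subseteq> (\<lambda>k. (pb i ^^ k) r) ` {..<2 * n}"
  proof (rule image_subsetI)
    fix v assume "v \<in> {v \<in> V i. seg n i (\<sigma> i g v) = r}"
    then have v: "\<sigma> i g v \<in> V i" "seg n i (\<sigma> i g v) = r" using \<sigma>_in[OF g] by auto
    then obtain k where "k < 2 * n" "(pb i ^^ k) r = \<sigma> i g v" using seg_props(2)[OF n v(1)] by auto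
    then show "\<sigma> i g v \<in> (\<lambda>k. (pb i ^^ k) r) ` {..<2 * n}" by (intro image_eqI[of _ _ k]) auto
  qed
  then have "card (\<sigma> i g ` {v \<in> V i. seg n i (\<sigma> i g v) = r}) \<le> card ((\<lambda>k. (pb i ^^ k) r) ` {..<2 * n})"
    by (intro card_mono) auto
  also have "\<dots> \<le> card {..<2 * n}" by (rule card_image_le) simp
  finally show ?thesis
    by (subst (asm) card_image) (auto intro: permutes_inj_on[OF permutes[OF g]])
qed

end

lemma near_coin_empirical:
  assumes V: "finite V" "0 < card V" and x: "\<And>v. v \<in> V \<Longrightarrow> x v \<in> zero_one J" and J: "countable J"
    and D: "finite D" "D \<subseteq> J"
    and freq: "\<And>E q. E \<subseteq> D \<Longrightarrow> q \<in> E \<rightarrow>\<^sub>E {0, 1} \<Longrightarrow>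
      \<bar>real (card {v \<in> V. \<forall>j\<in>E. x v j = q j}) / real (card V) - (1 / 2) ^ card E\<bar> \<le> \<theta>"
  shows "near_coin J D \<theta> (empirical_measure (coin_top J) V x)"
proof -
  let ?B = "borel_of (coin_top J)"
  have sB: "sets ?B = sets (coin J)" by (rule sets_borel_of_coin_top[OF J])
  have spB: "space ?B = zero_one J" using sets_eq_imp_space_eq[OF sB] by (simp add: space_coin)
  have V0: "V \<noteq> {}" using V(2) by auto
  interpret u: prob_space "uniform_count_measure V" by (rule prob_space_uniform_count_measure[OF V(1) V0])
  have m: "x \<in> measurable (uniform_count_measure V) ?B"
    by (rule measurableI) (use x spB in \<open>auto simp: space_uniform_count_measure sets_uniform_count_measure\<close>)
  have meas: "measure (empirical_measure (coin_top J) V x) (cyl J E q) = real (card {v \<in> V. \<forall>j\<in>E. x v j = q j}) / real (card V)"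
    if E: "E \<subseteq> D" for E q
  proof -
    have "cyl J E q \<in> sets ?B" unfolding sB by (rule sets_cyl) (use E D finite_subset in auto)
    then have "measure (empirical_measure (coin_top J) V x) (cyl J E q) = measure (uniform_count_measure V) (x -` cyl J E q \<inter> V)"
      unfolding empirical_measure_def using measure_distr[OF m] by (simp add: space_uniform_count_measure)
    also have "x -` cyl J E q \<inter> V = {v \<in> V. \<forall>j\<in>E. x v j = q j}" using x by (auto simp: cyl_def)
    finally show ?thesis using V(1) by (simp add: measure_uniform_count_measure)
  qed
  show ?thesis
    unfolding near_coin_def
  proof (intro conjI allI impI)
    show "empirical_measure (coin_top J) V x \<in> prob_measures (coin_top J)"
      unfolding prob_measures_def empirical_measure_def using u.prob_space_distr[OF m] by simp
    fix E q assume "E \<subseteq> D" "q \<in> E \<rightarrow>\<^sub>E {0, 1 :: real}"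
    then show "\<bar>measure (empirical_measure (coin_top J) V x) (cyl J E q) - (1 / 2) ^ card E\<bar> \<le> \<theta>"
      unfolding meas[OF \<open>E \<subseteq> D\<close>] by (rule freq)
  qed
qed

context sofic_shift
begin

text \<open>Vertices with a mismatch on \<open>D\<close> contribute at most \<open>C\<^sup>2\<close>
  each, all others at most \<open>(\<delta> / 2)\<^sup>2\<close>.\<close>

lemma rho_2_less:
  assumes V0: "0 < card (V i)" and \<delta>: "0 < \<delta>" and C: "\<And>x y. x \<in> zero_one cosets \<Longrightarrow> y \<in> zero_one cosets \<Longrightarrow> \<rho> x y \<le> C"
    and x: "\<And>v. v \<in> V i \<Longrightarrow> x v \<in> zero_one cosets" and y: "\<And>v. v \<in> V i \<Longrightarrow> y v \<in> zero_one cosets"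
    and win: "\<And>x y. x \<in> zero_one cosets \<Longrightarrow> y \<in> zero_one cosets \<Longrightarrow> (\<And>j. j \<in> D \<Longrightarrow> x j = y j) \<Longrightarrow> \<rho> x y < \<delta> / 2"
    and bad: "dens i (\<lambda>v. \<exists>j\<in>D. x v j \<noteq> y v j) * C\<^sup>2 \<le> \<delta>\<^sup>2 / 2"
  shows "rho_2 \<rho> (V i) x y < \<delta>"
proof -
  let ?P = "\<lambda>v. \<exists>j\<in>D. x v j \<noteq> y v j"
  have N: "0 < real (card (V i))" using V0 by (simp only: of_nat_0_less_iff)
  have "(\<Sum>v\<in>V i. (\<rho> (x v) (y v))\<^sup>2) \<le> (\<Sum>v\<in>V i. (if ?P v then C\<^sup>2 else 0) + \<delta>\<^sup>2 / 4)"
  proof (rule sum_mono)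
    fix v assume v: "v \<in> V i"
    have p: "0 \<le> \<rho> (x v) (y v)" by (rule \<rho>_nonneg[OF x[OF v] y[OF v]])
    show "(\<rho> (x v) (y v))\<^sup>2 \<le> (if ?P v then C\<^sup>2 else 0) + \<delta>\<^sup>2 / 4"
    proof (cases "?P v")
      case True
      have "(\<rho> (x v) (y v))\<^sup>2 \<le> C\<^sup>2" by (rule power_mono[OF C[OF x[OF v] y[OF v]] p])
      then show ?thesis using True by (simp add: add_increasing2)
    next
      case False
      have "\<rho> (x v) (y v) < \<delta> / 2" by (rule win[OF x[OF v] y[OF v]]) (use False in blast)
      then have "(\<rho> (x v) (y v))\<^sup>2 \<le> (\<delta> / 2)\<^sup>2" by (intro power_mono p) simp
      then show ?thesis using False by (simp add: power_divide)
    qed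
  qed
  also have "\<dots> = real (card {v \<in> V i. ?P v}) * C\<^sup>2 + real (card (V i)) * (\<delta>\<^sup>2 / 4)"
    by (simp add: sum.distrib sum.If_cases Int_def conj_commute)
  finally have "(\<Sum>v\<in>V i. (\<rho> (x v) (y v))\<^sup>2) / real (card (V i))
    \<le> (real (card {v \<in> V i. ?P v}) * C\<^sup>2 + real (card (V i)) * (\<delta>\<^sup>2 / 4)) / real (card (V i))"
    using N by (intro divide_right_mono) simp_all
  also have "\<dots> = dens i ?P * C\<^sup>2 + \<delta>\<^sup>2 / 4" using N unfolding dens_def add_divide_distrib by (simp only: times_divide_eq_left) auto
  also have "\<dots> < \<delta>\<^sup>2"
  proof -
    have "0 < \<delta>\<^sup>2" using \<delta> by simp
    then show ?thesis using bad by linarith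
  qed
  finally have "rho_2 \<rho> (V i) x y < sqrt (\<delta>\<^sup>2)" unfolding rho_2_def by (simp only: real_sqrt_less_iff)
  then show ?thesis using \<delta> by simp
qed

text \<open>Signs are attached to the base points of segments. \<open>model_equivariant\<close>
  gives almost equivariance for every choice of signs; a choice with small character sums, from
  \<open>good_signs\<close>, gives the right pattern frequencies. The segment length depends on the
  equivariance requirement alone, and the number of vertices is taken large afterwards.\<close>

lemma maps_nonempty:
  assumes U: "openin (weak_star (coin_top cosets)) U" "mu \<in> U"
    and F: "finite F" "F \<subseteq> carrier F2" and \<delta>: "0 < \<delta>"
  shows "eventually (\<lambda>i. maps U F \<delta> i \<noteq> {}) sequentially"
proof -
  obtain D \<theta> where D: "finite D" "D \<subseteq> cosets" "0 < \<theta>" "\<forall>\<nu>. near_coin cosets D \<theta> \<nu> \<longrightarrow> \<nu> \<in> U"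
    using weak_star_neighbourhood[OF countable_words U] by (elim exE conjE)
  have "0 < \<delta> / 2" using \<delta> by simp
  then obtain D' where D': "finite D'" "D' \<subseteq> cosets"
    and win: "\<And>x y. x \<in> zero_one cosets \<Longrightarrow> y \<in> zero_one cosets \<Longrightarrow> (\<And>j. j \<in> D' \<Longrightarrow> x j = y j) \<Longrightarrow> \<rho> x y < \<delta> / 2"
    using metric_window by blast
  obtain C where C: "0 < C" "\<And>x y. x \<in> zero_one cosets \<Longrightarrow> y \<in> zero_one cosets \<Longrightarrow> \<rho> x y \<le> C" using metric_bounded by blast
  \<comment> \<open>Each coordinate of \<open>D'\<close> may mismatch with density
    \<open>\<beta>\<close>; the sum of these, times \<open>C\<^sup>2\<close>, stays below
    \<open>\<delta>\<^sup>2 / 2\<close>.\<close>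
  define \<beta> where "\<beta> = \<delta>\<^sup>2 / (2 * C\<^sup>2) / (real (card D') + 1)"
  have \<beta>: "0 < \<beta>" unfolding \<beta>_def using \<delta> C(1) by (simp add: add_nonneg_pos)
  have \<beta>2: "real (card D') * \<beta> * C\<^sup>2 \<le> \<delta>\<^sup>2 / 2"
  proof -
    have "real (card D') * \<beta> * C\<^sup>2 \<le> (real (card D') + 1) * \<beta> * C\<^sup>2" using \<beta> by (intro mult_right_mono) auto
    also have "(real (card D') + 1) * \<beta> = \<delta>\<^sup>2 / (2 * C\<^sup>2)"
      unfolding \<beta>_def by (subst times_divide_eq_right, subst nonzero_mult_div_cancel_left) (simp_all add: add_nonneg_eq_0_iff)
    also have "\<dots> * C\<^sup>2 = \<delta>\<^sup>2 / 2" using C(1) by simp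
    finally show ?thesis .
  qed
  let ?mis = "\<lambda>n i f j v. seg n i (\<sigma> i (inv\<^bsub>F2\<^esub> (cact (inv\<^bsub>F2\<^esub> f) j)) v) \<noteq> seg n i (\<sigma> i (inv\<^bsub>F2\<^esub> j) (\<sigma> i f v))"
  have "\<forall>z\<in>F \<times> D'. \<exists>N. \<forall>n>N. eventually (\<lambda>i. dens i (?mis n i (fst z) (snd z)) \<le> \<beta>) sequentially"
  proof
    fix z assume z: "z \<in> F \<times> D'"
    show "\<exists>N. \<forall>n>N. eventually (\<lambda>i. dens i (?mis n i (fst z) (snd z)) \<le> \<beta>) sequentially"
      by (rule model_equivariant[OF _ _ \<beta>]) (use z F D' in auto)
  qed
  from bchoice[OF this] obtain N
    where N: "\<forall>z\<in>F \<times> D'. \<forall>n>N z. eventually (\<lambda>i. dens i (?mis n i (fst z) (snd z)) \<le> \<beta>) sequentially" ..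
  \<comment> \<open>The sum exceeds every threshold \<open>N z\<close> at once, and the successor
    makes the inequality strict.\<close>
  define n where "n = Suc (\<Sum>z\<in>F \<times> D'. N z)"
  have n: "0 < n" by (simp add: n_def)
  have nN: "N z < n" if "z \<in> F \<times> D'" for z
    using member_le_sum[OF that, of N] F D' by (simp add: n_def)
  have ev1: "eventually (\<lambda>i. \<forall>z\<in>F \<times> D'. dens i (?mis n i (fst z) (snd z)) \<le> \<beta>) sequentially"
  proof (rule eventually_ball_finite)
    show "finite (F \<times> D')" using F D' by simp
    show "\<forall>z\<in>F \<times> D'. eventually (\<lambda>i. dens i (?mis n i (fst z) (snd z)) \<le> \<beta>) sequentially"
    proof
      fix z assume z: "z \<in> F \<times> D'"
      show "eventually (\<lambda>i. dens i (?mis n i (fst z) (snd z)) \<le> \<beta>) sequentially"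
        by (rule N[rule_format, OF z nN[OF z]])
    qed
  qed
  \<comment> \<open>Each of the two terms of the second moment will be at most
    \<open>\<gamma>\<close> times the squared number of vertices; with the factor
    \<open>2 ^ card D\<close> their sum is \<open>\<theta>\<^sup>2\<close> times that
    square.\<close>
  define \<gamma> where "\<gamma> = \<theta>\<^sup>2 / 2 ^ card D / 2"
  have \<gamma>: "0 < \<gamma>" using D(3) by (simp add: \<gamma>_def)
  \<comment> \<open>Beyond this number of vertices the repeated labels,
    \<open>card D * (2 * n)\<close> per vertex, are at most the fraction \<open>\<gamma>\<close> of
    all vertices.\<close>
  define K where "K = nat \<lceil>real (card D) * real (2 * n) / \<gamma>\<rceil>"
  from ev1 rareD[OF rare_not_inj[OF n D(1,2)] \<gamma>] card_V_large[of K]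
  show ?thesis
  proof eventually_elim
    case (elim i)
    let ?N = "real (card (V i))"
    have V0: "0 < card (V i)" using elim(3) by simp
    then have N0: "0 < ?N" by (simp only: of_nat_0_less_iff)
    define c where "c j v = seg n i (\<sigma> i (inv\<^bsub>F2\<^esub> j) v)" for j v
    have cV: "c j v \<in> V i" if "j \<in> cosets" "v \<in> V i" for j v
      unfolding c_def by (intro seg_props(1)[OF n] \<sigma>_in F2_inv cosets_carrier that)
    have fib: "card {v \<in> V i. c j v = r} \<le> 2 * n" if "j \<in> cosets" for j r
      unfolding c_def by (intro card_label_fiber[OF n] F2_inv cosets_carrier that)
    have "\<exists>s\<in>signs (V i). \<forall>E. E \<subseteq> D \<longrightarrow> E \<noteq> {} \<longrightarrow> (\<Sum>v\<in>V i. \<Prod>j\<in>E. s (c j v))\<^sup>2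
      \<le> 2 ^ card D * (real (card {v \<in> V i. \<not> inj_on (\<lambda>j. c j v) D}) * ?N + ?N * (real (card D) * real (2 * n)))"
      by (rule good_signs[OF finite_V D(1)]) (rule cV fib, erule subsetD[OF D(2)], assumption?)+
    then obtain s where s: "s \<in> signs (V i)" and sE: "\<forall>E. E \<subseteq> D \<longrightarrow> E \<noteq> {} \<longrightarrow> (\<Sum>v\<in>V i. \<Prod>j\<in>E. s (c j v))\<^sup>2
      \<le> 2 ^ card D * (real (card {v \<in> V i. \<not> inj_on (\<lambda>j. c j v) D}) * ?N + ?N * (real (card D) * real (2 * n)))" ..
    have small: "\<bar>\<Sum>v\<in>V i. \<Prod>j\<in>E. s (c j v)\<bar> \<le> \<theta> * ?N" if E: "E \<subseteq> D" "E \<noteq> {}" for E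
    proof -
      have a: "real (card {v \<in> V i. \<not> inj_on (\<lambda>j. c j v) D}) \<le> \<gamma> * ?N"
        using elim(2) N0 unfolding dens_def c_def by (simp add: field_simps)
      have "real (card D) * real (2 * n) / \<gamma> \<le> real K" unfolding K_def by (rule real_nat_ceiling_ge)
      also have "real K \<le> ?N" using elim(3) by simp
      finally have b: "real (card D) * real (2 * n) \<le> \<gamma> * ?N" using \<gamma> by (simp add: field_simps)
      have "(\<Sum>v\<in>V i. \<Prod>j\<in>E. s (c j v))\<^sup>2
        \<le> 2 ^ card D * (real (card {v \<in> V i. \<not> inj_on (\<lambda>j. c j v) D}) * ?N + ?N * (real (card D) * real (2 * n)))" by (rule sE[rule_format, OF E])
      also have "\<dots> \<le> 2 ^ card D * (\<gamma> * ?N * ?N + ?N * (\<gamma> * ?N))"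
        by (intro mult_left_mono add_mono mult_right_mono a b) simp_all
      also have "\<dots> = (2 ^ card D * (2 * \<gamma>)) * (?N * ?N)" by (simp only: algebra_simps)
      also have "2 ^ card D * (2 * \<gamma>) = \<theta>\<^sup>2" by (simp add: \<gamma>_def)
      also have "\<theta>\<^sup>2 * (?N * ?N) = (\<theta> * ?N)\<^sup>2" by (simp only: power2_eq_square mult_ac)
      finally have "\<bar>\<Sum>v\<in>V i. \<Prod>j\<in>E. s (c j v)\<bar> \<le> \<bar>\<theta> * ?N\<bar>" by (simp only: abs_le_square_iff)
      also have "\<bar>\<theta> * ?N\<bar> = \<theta> * ?N" using D(3) N0 by (intro abs_of_nonneg mult_nonneg_nonneg) auto
      finally show ?thesis .
    qed
    have s1: "s (c j v) \<in> {-1, 1}" if "j \<in> cosets" "v \<in> V i" for j v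
      using s cV[OF that] by (rule PiE_mem)
    \<comment> \<open>The sign 1 is read as the bit 0 and the sign -1 as the bit 1.\<close>
    define x where "x = (\<lambda>v\<in>V i. \<lambda>j\<in>cosets. (1 - s (c j v)) / 2)"
    have xO: "x v \<in> zero_one cosets" if "v \<in> V i" for v
    proof -
      have "(1 - s (c j v)) / 2 \<in> {0, 1}" if j: "j \<in> cosets" for j using s1[OF j \<open>v \<in> V i\<close>] by auto
      then show ?thesis using that by (auto simp: x_def zero_one_def)
    qed
    have xE: "x \<in> V i \<rightarrow>\<^sub>E zero_one cosets" using xO by (auto simp: x_def)
    have near: "near_coin cosets D \<theta> (empirical_measure (coin_top cosets) (V i) x)"
    proof (rule near_coin_empirical[OF finite_V V0 xO countable_words D(1,2)])
      fix E q assume E: "E \<subseteq> D" and q: "q \<in> E \<rightarrow>\<^sub>E {0, 1 :: real}"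
      have "{v \<in> V i. \<forall>j\<in>E. x v j = q j} = {v \<in> V i. \<forall>j\<in>E. (1 - s (c j v)) / 2 = q j}"
        using E D(2) by (intro Collect_cong conj_cong refl ball_cong) (auto simp: x_def)
      moreover have "\<bar>real (card {v \<in> V i. \<forall>j\<in>E. (1 - s (c j v)) / 2 = q j}) / ?N - (1 / 2) ^ card E\<bar> \<le> \<theta>"
      proof (rule pattern_frequency[OF finite_V V0 finite_subset[OF E D(1)]])
        show "s (c j v) \<in> {-1, 1}" if "v \<in> V i" "j \<in> E" for v j using s1 that E D(2) by blast
        show "q j \<in> {0, 1}" if "j \<in> E" for j using q that by (rule PiE_mem)
        show "\<bar>\<Sum>v\<in>V i. \<Prod>j\<in>E'. s (c j v)\<bar> \<le> \<theta> * ?N" if "E' \<subseteq> E" "E' \<noteq> {}" for E'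
          by (rule small[OF subset_trans[OF that(1) E] that(2)])
      qed (use D(3) in simp)
      ultimately show "\<bar>real (card {v \<in> V i. \<forall>j\<in>E. x v j = q j}) / ?N - (1 / 2) ^ card E\<bar> \<le> \<theta>" by simp
    qed
    have rho: "rho_2 \<rho> (V i) (\<lambda>v. shift f (x v)) (\<lambda>v. x (\<sigma> i f v)) < \<delta>" if f: "f \<in> F" for f
    proof (rule rho_2_less[OF V0 \<delta> C(2)])
      have fc: "f \<in> carrier F2" using f F by blast
      show "shift f (x v) \<in> zero_one cosets" if "v \<in> V i" for v by (rule shift_zero_one[OF xO[OF that]])
      show "x (\<sigma> i f v) \<in> zero_one cosets" if "v \<in> V i" for v by (rule xO[OF \<sigma>_in[OF fc that]])
      have "dens i (\<lambda>v. \<exists>j\<in>D'. shift f (x v) j \<noteq> x (\<sigma> i f v) j) \<le> dens i (\<lambda>v. \<exists>j\<in>D'. ?mis n i f j v)"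
      proof (rule dens_mono)
        fix v assume v: "v \<in> V i" and "\<exists>j\<in>D'. shift f (x v) j \<noteq> x (\<sigma> i f v) j"
        then obtain j where j: "j \<in> D'" "shift f (x v) j \<noteq> x (\<sigma> i f v) j" by blast
        have jc: "j \<in> cosets" using j D' by blast
        have "shift f (x v) j = (1 - s (c (cact (inv\<^bsub>F2\<^esub> f) j) v)) / 2"
          unfolding shift_apply[OF xO[OF v] jc] using v cact_cosets[OF jc, of "inv\<^bsub>F2\<^esub> f"] by (simp add: x_def)
        moreover have "x (\<sigma> i f v) j = (1 - s (c j (\<sigma> i f v))) / 2" using \<sigma>_in[OF fc v] jc by (simp add: x_def)
        ultimately have "c (cact (inv\<^bsub>F2\<^esub> f) j) v \<noteq> c j (\<sigma> i f v)" using j(2) by metis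
        then show "\<exists>j\<in>D'. ?mis n i f j v" unfolding c_def using j(1) by blast
      qed
      also have "\<dots> \<le> (\<Sum>j\<in>D'. dens i (?mis n i f j))" by (rule dens_Bex[OF D'(1)])
      also have "\<dots> \<le> (\<Sum>j\<in>D'. \<beta>)"
      proof (rule sum_mono)
        fix j assume "j \<in> D'"
        then have "(f, j) \<in> F \<times> D'" using f by simp
        from elim(1)[rule_format, OF this] show "dens i (?mis n i f j) \<le> \<beta>" by simp
      qed
      finally have "dens i (\<lambda>v. \<exists>j\<in>D'. shift f (x v) j \<noteq> x (\<sigma> i f v) j) \<le> real (card D') * \<beta>" by simp
      then have "dens i (\<lambda>v. \<exists>j\<in>D'. shift f (x v) j \<noteq> x (\<sigma> i f v) j) * C\<^sup>2 \<le> real (card D') * \<beta> * C\<^sup>2"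
        by (rule mult_right_mono) simp
      then show "dens i (\<lambda>v. \<exists>j\<in>D'. shift f (x v) j \<noteq> x (\<sigma> i f v) j) * C\<^sup>2 \<le> \<delta>\<^sup>2 / 2" using \<beta>2 by (rule order_trans)
    qed (rule win | assumption)+
    have "x \<in> maps U F \<delta> i"
      unfolding sofic_maps_def topspace_coin_top using xE rho near D(4) by blast
    then show ?case by blast
  qed
qed

lemma separation_number_pos:
  assumes "S \<noteq> {}" shows "0 \<le> log_enat (separation_number \<epsilon> S d)"
proof -
  obtain x where "x \<in> S" using assms by blast
  then have "enat (card {x}) \<le> separation_number \<epsilon> S d"
    unfolding separation_number_def by (intro SUP_upper) auto
  then have "1 \<le> separation_number \<epsilon> S d" by (simp add: one_enat_def)
  then show ?thesis
    by (cases "separation_number \<epsilon> S d") (auto simp: log_enat_def one_enat_def)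
qed

text \<open>The whole space is the subbasic set of the zero function. It serves as the neighbourhood
  in the upper bound of the entropy.\<close>

lemma prob_measures_open: "openin (weak_star \<tau>) (prob_measures \<tau>)"
proof -
  have m: "{\<nu> \<in> prob_measures \<tau>. integral\<^sup>L \<nu> (\<lambda>_. 0) \<in> UNIV} \<in> {{\<nu> \<in> prob_measures \<tau>. integral\<^sup>L \<nu> f \<in> U} |f U. continuous_map \<tau> euclideanreal f \<and> open U}"
    by (intro CollectI exI[of _ "\<lambda>_. 0"] exI[of _ UNIV]) simp
  have e: "{\<nu> \<in> prob_measures \<tau>. integral\<^sup>L \<nu> (\<lambda>_. 0) \<in> UNIV} = prob_measures \<tau>" by simp
  show ?thesis
    unfolding weak_star_def openin_topology_generated_by_iff
    using m unfolding e by (rule generate_topology_on.Basis)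
qed

text \<open>For the upper bound the infimum is evaluated at the neighbourhood of all probability
  measures and at the \<open>F\<close> and \<open>\<delta>\<close> of \<open>entropy_upper\<close>.
  For the lower bound a nonempty set of models has separation number at least one, hence a
  nonnegative logarithm.\<close>

lemma sofic_entropy_shift: "sofic_entropy F2 V \<sigma> (coin_top cosets) mu shift \<rho> = 0"
proof (rule antisym)
  let ?h = "\<lambda>\<epsilon> U F \<delta>. limsup (\<lambda>i. log_enat (separation_number \<epsilon> (maps U F \<delta> i) (rho_inf \<rho> (V i))) / ereal (real (card (V i))))"
  let ?U = "{U. openin (weak_star (coin_top cosets)) U \<and> mu \<in> U}"
  let ?F = "{F. finite F \<and> F \<subseteq> carrier F2}"
  have mu: "prob_measures (coin_top cosets) \<in> ?U"
  proof -
    have "mu \<in> prob_measures (coin_top cosets)"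
      unfolding prob_measures_def mem_Collect_eq
      by (intro conjI prob_coin sets_borel_of_coin_top[OF countable_words, symmetric])
    then show ?thesis using prob_measures_open by blast
  qed
  show "sofic_entropy F2 V \<sigma> (coin_top cosets) mu shift \<rho> \<le> 0"
    unfolding sofic_entropy_def
  proof (rule SUP_least)
    fix \<epsilon> :: real assume e: "\<epsilon> \<in> {0<..}"
    show "(INF U\<in>?U. INF F\<in>?F. INF \<delta>\<in>{0<..}. ?h \<epsilon> U F \<delta>) \<le> 0"
    proof (rule ereal_le_epsilon2)
      fix \<eta> :: real assume \<eta>: "0 < \<eta>"
      have "0 < \<epsilon>" using e by simp
      from entropy_upper[OF this \<eta>, of "prob_measures (coin_top cosets)"]
      obtain F \<delta> where F: "F \<in> ?F" and \<delta>: "\<delta> \<in> {0<..}" and le: "?h \<epsilon> (prob_measures (coin_top cosets)) F \<delta> \<le> ereal \<eta>"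
        by auto
      have "(INF U\<in>?U. INF F\<in>?F. INF \<delta>\<in>{0<..}. ?h \<epsilon> U F \<delta>) \<le> ?h \<epsilon> (prob_measures (coin_top cosets)) F \<delta>"
        by (rule INF_lower2[OF mu], rule INF_lower2[OF F], rule INF_lower[OF \<delta>])
      then show "(INF U\<in>?U. INF F\<in>?F. INF \<delta>\<in>{0<..}. ?h \<epsilon> U F \<delta>) \<le> 0 + ereal \<eta>" using le by simp
    qed
  qed
  have pos: "0 \<le> ?h \<epsilon> U F \<delta>" if U: "U \<in> ?U" and F: "F \<in> ?F" and \<delta>: "\<delta> \<in> {0<..}" for \<epsilon> U F \<delta>
  proof -
    have "eventually (\<lambda>i. maps U F \<delta> i \<noteq> {}) sequentially" by (rule maps_nonempty) (use U F \<delta> in auto)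
    then have "eventually (\<lambda>i. 0 \<le> log_enat (separation_number \<epsilon> (maps U F \<delta> i) (rho_inf \<rho> (V i))) / ereal (real (card (V i)))) sequentially"
      using card_V_large[of 0]
    proof eventually_elim
      case (elim i)
      have "0 < ereal (real (card (V i)))" using elim(2) by simp
      from ereal_divide_right_mono[OF separation_number_pos[OF elim(1)] this]
      show ?case by simp
    qed
    then have "0 \<le> liminf (\<lambda>i. log_enat (separation_number \<epsilon> (maps U F \<delta> i) (rho_inf \<rho> (V i))) / ereal (real (card (V i))))"
      by (rule Liminf_bounded)
    also have "\<dots> \<le> ?h \<epsilon> U F \<delta>" by (rule Liminf_le_Limsup) simp
    finally show ?thesis .
  qed
  show "0 \<le> sofic_entropy F2 V \<sigma> (coin_top cosets) mu shift \<rho>"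
    unfolding sofic_entropy_def
    \<comment> \<open>Any scale serves as a witness, since a single model is separated at every
      scale.\<close>
    by (rule SUP_upper2[of 1]) (auto intro!: INF_greatest pos)
qed

end

(* Every compact metrizable group has at most the cardinality of the continuum, hence an isomorphic
   copy carried by a subset of each of the types (ab * bool) list => real and real; the topologies
   are arbitrary. *)
theorem theorem5p1:
  shows "\<exists>(X :: ((ab \<times> bool) list \<Rightarrow> real) monoid) (\<tau> :: ((ab \<times> bool) list \<Rightarrow> real) topology)
            (\<mu> :: ((ab \<times> bool) list \<Rightarrow> real) measure) T.
    pmp_action F2 \<mu> T \<and> ergodic_action F2 \<mu> T \<and> essentially_free F2 \<mu> T \<and>
    algebraic_action F2 X \<tau> \<mu> T \<and>
    (\<forall>V \<sigma> \<rho>. sofic_approximation F2 V \<sigma> \<and> generating_pseudometric F2 \<tau> T \<rho> \<longrightarrow>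
       sofic_entropy F2 V \<sigma> \<tau> \<mu> T \<rho> = 0) \<and>
    (\<exists>P. generating_partition F2 \<mu> T P \<and> shannon_entropy \<mu> P < \<infinity>) \<and>
    (\<forall>P. generating_partition F2 \<mu> T P \<and> shannon_entropy \<mu> P < \<infinity> \<longrightarrow>
       f_invariant F2 (free_gens {gen_a, gen_b}) \<mu> T P = 0) \<and>
    rokhlin_entropy F2 \<mu> T = 0 \<and>
    (\<exists>(K :: real monoid) (\<tau>K :: real topology) (\<kappa> :: real measure) \<Phi>.
       compact_metrizable_group K \<tau>K \<and>
       sets \<kappa> = sets (borel_of \<tau>K) \<and> nontrivial_base \<kappa> \<and>
       factor_map F2 \<mu> T (bernoulli_measure F2 \<kappa>) (bernoulli_shift F2 \<kappa>) \<Phi> \<and>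
       two_to_one \<mu> (bernoulli_measure F2 \<kappa>) \<Phi> \<and>
       \<Phi> \<in> hom X (product_group (carrier F2) (\<lambda>_. K)) \<and>
       continuous_map \<tau> (product_topology (\<lambda>_. \<tau>K) (carrier F2)) \<Phi>)"
proof -
  have sofic: "sofic_entropy F2 V \<sigma> (coin_top cosets) mu shift \<rho> = 0"
    if "sofic_approximation F2 V \<sigma> \<and> generating_pseudometric F2 (coin_top cosets) shift \<rho>" for V \<sigma> \<rho>
  proof -
    interpret sofic_shift V \<sigma> \<rho> by unfold_locales (use that in blast)+
    show ?thesis by (rule sofic_entropy_shift)
  qed
  show ?thesis
    apply (intro exI[of _ "Z2_power cosets"] exI[of _ "coin_top cosets"] exI[of _ mu] exI[of _ shift] conjI)
             apply (rule pmp_shift ergodic_shift essentially_free_shift algebraic_shift)+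
        apply (intro allI impI, erule sofic)
       apply (rule finite_entropy_generator)
      apply (intro allI impI, elim conjE, erule (1) f_invariant_shift)
     apply (rule rokhlin_entropy_shift)
    apply (intro exI[of _ Z2] exI[of _ "discrete_topology {0, 1}"] exI[of _ two] exI[of _ edge_sum] conjI
        compact_metrizable_group_Z2 sets_two_borel nontrivial_two factor_map_edge_sum two_to_one_edge_sum
        edge_sum_hom[unfolded Z2_power_def[of "carrier F2"]] edge_sum_continuous[unfolded coin_top_def[of "carrier F2"]])
    done
qed

end
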